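(* Let $n \geq 2$ and $p_n := \max\{1,\,(n-1)(n-2)\}$. Let $\Sigma \subset \mathbb{S}^{n-1}$ be a domain with nonempty boundary in $\mathbb{S}^{n-1}$, and let $\Omega \subset \mathbb{R}^n$ be the cone over $\Sigma$. Suppose that there exists a function $u : \Omega \rightarrow \mathbb{R}$ that satisfies: (i) $u$ is homogeneous of degree $\alpha$ for some $\alpha \in (0,1)$; (ii) $u \in W^{2,p}_{loc}(\Omega) \cap W^{1,\infty}((\Omega \cap B_2)\setminus B_1)$ for some $p > p_n$ (with $p = p_n$ also allowed if $n \leq 3$); (iii) $u > 0$ in $\Omega$ and $u = 0$ on $\partial\Omega$; (iv) either $\det D^2u$ or $-\det D^2u$ is locally strictly positive in $\Omega$. Then $\mathbb{R}^n \setminus \Omega$ is a convex cone, and $\Sigma$ contains a closed hemisphere of $\mathbb{S}^{n-1}$.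
   Context: A domain is a nonempty connected open set. The cone over $\Sigma$ is $\Omega = \{r\omega : r > 0,\ \omega \in \Sigma\}$. $B_r$ denotes the ball of radius $r$ centered at the origin in $\mathbb{R}^n$. A function $u$ on $\Omega$ is homogeneous of degree $\alpha$ if $u(tx) = t^\alpha u(x)$ for all $t > 0$ and $x \in \Omega$. $D^2u$ is the (weak) Hessian of $u$, defined almost everywhere. The function $u$ is identified with its continuous representative (it is locally Lipschitz by (i) and (ii)), and "$u = 0$ on $\partial\Omega$" means that $u$ extends continuously to $\overline{\Omega}$ with value $0$ on $\partial\Omega$. A measurable function $h$ is locally strictly positive in an open set if on every compact subset $C$ of that set there is a constant $c_C > 0$ (which may depend on $C$) such that $h \geq c_C$ almost everywhere on $C$. *)

theory Defs
  imports "HOL-Analysis.Analysis"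
begin

definition cone_over :: "(real ^ 'n) set \<Rightarrow> (real ^ 'n) set" where
  "cone_over S = {r *\<^sub>R \<omega> | r \<omega>. r > 0 \<and> \<omega> \<in> S}"

text \<open>A list \<open>[i\<^sub>1, \<dots>, i\<^sub>k]\<close> of coordinate indices plays the role of a multi-index and stands for
  \<open>\<partial>\<^bsub>i\<^sub>1\<^esub> \<dots> \<partial>\<^bsub>i\<^sub>k\<^esub>\<close>.  The value of \<open>partial_deriv\<close> is unspecified at points where the function
  is not differentiable; it is only ever applied to smooth functions.\<close>

definition partial_deriv :: "'n \<Rightarrow> (real ^ 'n \<Rightarrow> real) \<Rightarrow> real ^ 'n \<Rightarrow> real" where
  "partial_deriv i f x = frechet_derivative f (at x) (axis i 1)"

definition iter_partial :: "'n list \<Rightarrow> (real ^ 'n \<Rightarrow> real) \<Rightarrow> real ^ 'n \<Rightarrow> real" where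
  "iter_partial is f = foldr partial_deriv is f"

definition smooth :: "(real ^ 'n \<Rightarrow> real) \<Rightarrow> bool" where
  "smooth f \<longleftrightarrow> (\<forall>is x. iter_partial is f differentiable (at x))"

definition test_function :: "(real ^ 'n) set \<Rightarrow> (real ^ 'n \<Rightarrow> real) \<Rightarrow> bool" where
  "test_function U \<phi> \<longleftrightarrow>
     smooth \<phi> \<and> compact (closure {x. \<phi> x \<noteq> 0}) \<and> closure {x. \<phi> x \<noteq> 0} \<subseteq> U"

text \<open>Functions on an open set \<open>U\<close> are represented by total functions whose values outside
  \<open>U\<close> are irrelevant.\<close>

definition locally_integrable :: "(real ^ 'n) set \<Rightarrow> (real ^ 'n \<Rightarrow> real) \<Rightarrow> bool" where
  "locally_integrable U f \<longleftrightarrow> (\<forall>K. compact K \<and> K \<subseteq> U \<longrightarrow> set_integrable lebesgue K f)"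

definition has_weak_deriv ::
    "(real ^ 'n) set \<Rightarrow> 'n list \<Rightarrow> (real ^ 'n \<Rightarrow> real) \<Rightarrow> (real ^ 'n \<Rightarrow> real) \<Rightarrow> bool" where
  "has_weak_deriv U is f g \<longleftrightarrow>
     locally_integrable U f \<and> locally_integrable U g \<and>
     (\<forall>\<phi>. test_function U \<phi> \<longrightarrow>
        (LINT x:U|lebesgue. f x * iter_partial is \<phi> x)
          = (- 1) ^ length is * (LINT x:U|lebesgue. g x * \<phi> x))"

definition Lp_loc :: "real \<Rightarrow> (real ^ 'n) set \<Rightarrow> (real ^ 'n \<Rightarrow> real) set" where
  "Lp_loc p U = {f. \<forall>K. compact K \<and> K \<subseteq> U \<longrightarrow>
     set_borel_measurable lebesgue K f \<and> set_integrable lebesgue K (\<lambda>x. \<bar>f x\<bar> powr p)}"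

definition Linf :: "(real ^ 'n) set \<Rightarrow> (real ^ 'n \<Rightarrow> real) set" where
  "Linf U = {f. set_borel_measurable lebesgue U f \<and>
     (\<exists>C. AE x in lebesgue. x \<in> U \<longrightarrow> \<bar>f x\<bar> \<le> C)}"

definition sobolev_loc :: "nat \<Rightarrow> real \<Rightarrow> (real ^ 'n) set \<Rightarrow> (real ^ 'n \<Rightarrow> real) set" where
  "sobolev_loc k p U =
     {f. \<forall>is. length is \<le> k \<longrightarrow> (\<exists>g \<in> Lp_loc p U. has_weak_deriv U is f g)}"

definition sobolev_inf :: "nat \<Rightarrow> (real ^ 'n) set \<Rightarrow> (real ^ 'n \<Rightarrow> real) set" where
  "sobolev_inf k U =
     {f. \<forall>is. length is \<le> k \<longrightarrow> (\<exists>g \<in> Linf U. has_weak_deriv U is f g)}"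

text \<open>A weak Hessian is determined only up to a null set, hence a predicate on \<open>H\<close>.\<close>

definition has_weak_hessian ::
    "(real ^ 'n) set \<Rightarrow> (real ^ 'n \<Rightarrow> real) \<Rightarrow> (real ^ 'n \<Rightarrow> real ^ 'n ^ 'n) \<Rightarrow> bool" where
  "has_weak_hessian U f H \<longleftrightarrow> (\<forall>i j. has_weak_deriv U [i, j] f (\<lambda>x. H x $ i $ j))"

definition locally_strictly_positive :: "(real ^ 'n) set \<Rightarrow> (real ^ 'n \<Rightarrow> real) \<Rightarrow> bool" where
  "locally_strictly_positive U h \<longleftrightarrow>
     (\<forall>C. compact C \<and> C \<subseteq> U \<longrightarrow>
        set_borel_measurable lebesgue C h \<and>
        (\<exists>c>0. AE x in lebesgue. x \<in> C \<longrightarrow> c \<le> h x))"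

definition homogeneous_on :: "(real ^ 'n) set \<Rightarrow> real \<Rightarrow> (real ^ 'n \<Rightarrow> real) \<Rightarrow> bool" where
  "homogeneous_on U \<alpha> f \<longleftrightarrow> (\<forall>x\<in>U. \<forall>t>0. f (t *\<^sub>R x) = t powr \<alpha> * f x)"

definition vanishes_on_boundary :: "(real ^ 'n) set \<Rightarrow> (real ^ 'n \<Rightarrow> real) \<Rightarrow> bool" where
  "vanishes_on_boundary U f \<longleftrightarrow>
     (\<exists>v. continuous_on (closure U) v \<and> (\<forall>x\<in>U. v x = f x) \<and> (\<forall>x\<in>frontier U. v x = 0))"

definition closed_hemisphere :: "real ^ 'n \<Rightarrow> (real ^ 'n) set" where
  "closed_hemisphere e = {x \<in> sphere 0 1. 0 \<le> e \<bullet> x}"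

definition critical_exponent :: "nat \<Rightarrow> real" where
  "critical_exponent n = max 1 ((real n - 1) * (real n - 2))"

end

theory Submission
  imports Defs
begin

text \<open>
  Extended by \<open>0\<close>, the function \<open>w = u\<^sup>\<beta>\<close> with \<open>\<beta> = 1 / \<alpha>\<close> is homogeneous of degree one. The point is
  that \<open>w (x + e) \<le> w x\<close> for all \<open>e \<notin> \<Omega>\<close>. Let \<open>h \<ge> 0\<close> be the best constant in \<open>w (x + e) \<le> w x + h\<close> and suppose
  \<open>h > 0\<close>. Then \<open>Q = h - e \<bullet> \<nabla>w \<ge> 0\<close> is homogeneous of degree zero, and it obeys a strong maximum principle:
  near no point that is not parallel to \<open>e\<close> does it have essential infimum \<open>0\<close>. Indeed the Jacobian determinant of
  the map \<open>(Q, \<partial>\<^sub>j w (j \<noteq> k, l), x\<^sub>l)\<close> has a strict sign, because it is a multiple of \<open>det D\<^sup>2u\<close>, and it is a null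
  Lagrangian. Integrated against functions of \<open>Q\<close> and a cutoff it gives, with \<open>d = n - 2\<close>,
  \<open>|{Q < \<epsilon>}| = o(\<epsilon>\<^sup>d\<^sup>+\<^sup>1)\<close>. If \<open>Q\<close> came close to \<open>0\<close>, homogeneity would place a strip with \<open>Q < \<epsilon>\<close> near the point;
  with cutoffs supported on a fine grid of cells the same inequality forces small values of \<open>Q\<close> in many cells, and
  Morrey's inequality in the \<open>d\<close> directions transversal to the grid, with exponent \<open>d (d + 1)\<close>, then gives a lower
  bound of order \<open>\<epsilon>\<^sup>d\<^sup>+\<^sup>1\<close>, a contradiction. So \<open>h\<close> can be improved locally, hence globally by compactness.

  It follows that the complement of \<open>\<Omega>\<close> is a convex cone. It contains no line, since otherwise a directional derivative
  of \<open>u\<close> would vanish, and \<open>det D\<^sup>2u\<close> with it; separation from \<open>0\<close> then yields the hemisphere.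
\<close>

text \<open>\<open>w\<close> has degree one, so D^2 w annihilates the position vector and the
  gradient map of \<open>w\<close> has zero Jacobian. Putting Q and x_l in place of two of its
  components repairs this: the determinant becomes det D^2 u times a factor that vanishes only with
  (e_k x_l - e_l x_k) x_l, and at points not parallel to \<open>e\<close> suitable k and l exist.
  The exponent d (d + 1) enters twice. Young's inequality absorbs the cutoff term eps Y^d, where Y
  bounds the second derivatives, and leaves eps^(d+1) Y^(d(d+1)) on a shrinking set. In Morrey's
  inequality a scale s with s^d of order eps^(d+1) makes (s / eps)^(d(d+1)) of order eps^(d+1)
  again. So at this exponent the competing terms differ only by powers of an o(1) factor, and this
  factor decides. The obstacle is that Q is known only almost everywhere, so a cell cannot be
  inspected through single values of Q. Cells are tested on mollified approximants Qn instead. The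
  grid is refined after n is fixed, by uniform continuity of Qn; hence the count of unsuitable slabs
  has to hold for all grids at once.\<close>

abbreviation "Borel \<equiv> borel_measurable borel"

abbreviation "L1n f \<equiv> (\<integral>\<^sup>+x. ennreal \<bar>f x\<bar> \<partial>lborel)"

subsection \<open>Smooth cutoffs and product test functions\<close>

text \<open>The factor (1/t)^k closes the family under differentiation: the derivative of one member
  is a combination of two others. The member k = 0 is the usual smooth function exp(-1/t).\<close>

definition flat_exp :: "nat => real => real" where
 "flat_exp k t = (if t > 0 then (1 / t) ^ k * exp (- (1 / t)) else 0)"

lemma flat_exp_tendsto_0: "(flat_exp k \<longlongrightarrow> 0) (at 0)" proof -
 have l: "(flat_exp k \<longlongrightarrow> 0) (at_left 0)" by (rule tendsto_eventually) (auto simp: flat_exp_def eventually_at_filter)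
 have "((%s::real. s ^ k / exp s) \<longlongrightarrow> 0) at_top" by (rule tendsto_power_div_exp_0)
 moreover have "filterlim (%t::real. 1 / t) at_top (at_right 0)" by (simp add: filterlim_inverse_at_top_right divide_inverse)
 ultimately have "((%t::real. (1/t) ^ k / exp (1/t)) \<longlongrightarrow> 0) (at_right 0)" by (rule filterlim_compose)
 moreover have "\<forall>\<^sub>F t in at_right 0. (1/t) ^ k / exp (1/t) = flat_exp k t"
  by (auto simp: flat_exp_def eventually_at_filter exp_minus divide_inverse)
 ultimately have r: "(flat_exp k \<longlongrightarrow> 0) (at_right 0)" by (rule Lim_transform_eventually)
 show ?thesis using l r by (simp add: filterlim_split_at)
qed

text \<open>At 0 the difference quotient of \<open>flat_exp k\<close> is
  \<open>flat_exp (Suc k)\<close>, so the vanishing limits at 0 for all k settle the only delicate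
  point.\<close>

lemma DERIV_flat_exp:
 "DERIV (flat_exp k) t :> flat_exp (k + 2) t - of_nat k * flat_exp (k + 1) t" proof -
 consider "t > 0" | "t < 0" | "t = 0" by linarith
 thus ?thesis proof cases
  case 1
  have "((%t. (1 / t) ^ k * exp (- (1 / t))) has_real_derivative
   (flat_exp (k + 2) t - of_nat k * flat_exp (k + 1) t)) (at t)" proof -
   have "((%t. (1 / t) ^ k * exp (- (1 / t))) has_real_derivative
    (of_nat k * (1/t)^(k - 1) * (- 1 / t^2)) * exp (- (1/t)) + (1/t)^k * (exp (- (1/t)) * (1/t^2))) (at t)"
    using 1 by (auto intro!: derivative_eq_intros simp: power2_eq_square)
   moreover have "(of_nat k * (1/t)^(k - 1) * (- 1 / t^2)) * exp (- (1/t)) + (1/t)^k * (exp (- (1/t)) * (1/t^2))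
     = flat_exp (k + 2) t - of_nat k * flat_exp (k + 1) t" using 1 by (cases k) (auto simp: flat_exp_def field_simps power2_eq_square)
   ultimately show ?thesis by simp
  qed
  moreover
  have "\<forall>\<^sub>F x in nhds t. x > 0" using eventually_nhds_in_open[of "{0<..}" t] 1 by auto
  hence "\<forall>\<^sub>F x in nhds t. flat_exp k x = (1 / x) ^ k * exp (- (1 / x))" by eventually_elim (auto simp: flat_exp_def)
  ultimately show ?thesis using DERIV_cong_ev[OF refl _ refl, of "flat_exp k" "%t. (1 / t) ^ k * exp (- (1 / t))"] by blast
 next
  case 2
  have "\<forall>\<^sub>F x in nhds t. x < 0" using eventually_nhds_in_open[of "{..<0}" t] 2 by auto
  hence "\<forall>\<^sub>F x in nhds t. flat_exp k x = 0" by eventually_elim (auto simp: flat_exp_def)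
  thus ?thesis using 2 by (subst DERIV_cong_ev[OF refl _ refl, of _ "%t. 0"]) (auto simp: flat_exp_def)
 next
  case 3
  have "((%h. (flat_exp k (0 + h) - flat_exp k 0) / h) \<longlongrightarrow> 0) (at 0)"
  proof (rule Lim_transform_eventually[OF flat_exp_tendsto_0[of "Suc k"]])
   show "\<forall>\<^sub>F h in at 0. flat_exp (Suc k) h = (flat_exp k (0 + h) - flat_exp k 0) / h"
    by (auto simp: flat_exp_def eventually_at_filter)
  qed
  thus ?thesis using 3 by (simp add: DERIV_def flat_exp_def)
 qed
qed

text \<open>A stock of smooth functions of one variable closed under differentiation; products of them are the test functions.\<close>

inductive_set sm1 :: "(real => real) set" where
 const: "(%t. c) \<in> sm1"
| ident: "(%t. t) \<in> sm1"
| flat: "(%t. flat_exp k (a + c * t)) \<in> sm1"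
| add: "f \<in> sm1 ==> g \<in> sm1 ==> (%t. f t + g t) \<in> sm1"
| mult: "f \<in> sm1 ==> g \<in> sm1 ==> (%t. f t * g t) \<in> sm1"

lemma sm1_derivative:
 assumes "f \<in> sm1"
 shows "\<exists>g\<in>sm1. \<forall>t. DERIV f t :> g t" using assms proof induction
 case (const c)
 thus ?case by (intro bexI[of _ "%t. 0"]) (auto intro: sm1.const)
next
 case ident
 thus ?case by (intro bexI[of _ "%t. 1"]) (auto intro: sm1.const)
next
 case (flat k a c)
 have "((%t. flat_exp k (a + c * t)) has_real_derivative
   c * (flat_exp (k + 2) (a + c * t) + (- of_nat k) * flat_exp (k + 1) (a + c * t))) (at t)" for t proof -
  have "DERIV (%t. a + c * t) t :> c" by (auto intro!: derivative_eq_intros)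
  from DERIV_chain'[OF this DERIV_flat_exp[of k]]
  show ?thesis by (simp add: algebra_simps)
 qed
 thus ?case
  by (intro bexI[of _ "%t. c * (flat_exp (k + 2) (a + c * t) + (- of_nat k) * flat_exp (k + 1) (a + c * t))"] allI sm1.intros)
next
 case (add f g)
 then obtain f' g' where "f'\<in>sm1" "g'\<in>sm1" "\<forall>t. DERIV f t :> f' t"
  "\<forall>t. DERIV g t :> g' t" by blast
 thus ?case by (intro bexI[of _ "%t. f' t + g' t"]) (auto intro!: sm1.intros derivative_intros)
next
 case (mult f g)
 then obtain f' g' where *: "f'\<in>sm1" "g'\<in>sm1" "\<forall>t. DERIV f t :> f' t"
  "\<forall>t. DERIV g t :> g' t" by blast
 have "DERIV (%t. f t * g t) t :> f' t * g t + f t * g' t" for t using * by (auto intro!: derivative_eq_intros)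
 thus ?case using * mult by (intro bexI[of _ "%t. f' t * g t + f t * g' t"]) (auto intro!: sm1.intros)
qed

lemma sm1_deriv: "f \<in> sm1 ==> deriv f \<in> sm1"
 and sm1_DERIV: "f \<in> sm1 ==> DERIV f t :> deriv f t" proof -
 assume "f \<in> sm1"
 then obtain g where g: "g \<in> sm1" "\<forall>t. DERIV f t :> g t" using sm1_derivative by blast
 hence "deriv f = g" by (auto intro: DERIV_imp_deriv)
 thus "deriv f \<in> sm1" "DERIV f t :> deriv f t" using g by auto
qed

lemma sm1_continuous: "f \<in> sm1 ==> continuous_on A f" by (meson DERIV_isCont continuous_at_imp_continuous_on sm1_DERIV)

lemma sm1_affine: "f \<in> sm1 ==> (%t. f (a + c * t)) \<in> sm1" proof (induction rule: sm1.induct)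
 case (flat k a' c')
 have "(%t. flat_exp k ((a' + c' * a) + (c' * c) * t)) \<in> sm1" by (rule sm1.flat)
 thus ?case by (simp add: algebra_simps)
qed (auto intro!: sm1.intros)

text \<open>In a product of one-variable functions a partial derivative only replaces one factor by
  its derivative, so all iterated partial derivatives keep this form.\<close>

definition ptest :: "('n => real => real) => real ^ 'n => real" where
 "ptest f x = (\<Prod>i\<in>UNIV. f i (x $ i))"

lemma has_derivative_ptest:
 fixes f :: "'n::finite => real => real"
 assumes f: "!!i. f i \<in> sm1"
 shows "(ptest f has_derivative (%h. \<Sum>i\<in>UNIV. h $ i * ptest (f(i := deriv (f i))) x)) (at x)" proof -
 have 1: "((%x. f i (x $ i)) has_derivative (%h. h $ i * deriv (f i) (x $ i))) (at x)" for i
  using has_derivative_compose[OF bounded_linear_imp_has_derivative[OF bounded_linear_vec_nth[of i]]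
   sm1_DERIV[OF f[of i], unfolded has_field_derivative_def], of x UNIV] by (simp add: mult.commute)
 have "((%x. \<Prod>i\<in>UNIV. f i (x $ i)) has_derivative
   (%h. \<Sum>i\<in>UNIV. (h $ i * deriv (f i) (x $ i)) * (\<Prod>j\<in>UNIV - {i}. f j (x $ j)))) (at x)"
  by (rule has_derivative_prod) (rule 1)
 moreover have "(h $ i * deriv (f i) (x $ i)) * (\<Prod>j\<in>UNIV - {i}. f j (x $ j)) =
   h $ i * ptest (f(i := deriv (f i))) x" for h :: "real^'n" and i
  unfolding ptest_def by (subst (2) prod.remove[of _ i]) (auto intro!: prod.cong)
 ultimately show ?thesis by (simp add: ptest_def[abs_def])
qed

lemma partial_deriv_ptest:
 fixes f :: "'n::finite => real => real"
 assumes f: "!!i. f i \<in> sm1"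
 shows "partial_deriv i (ptest f) = ptest (f(i := deriv (f i)))"
proof
 fix x
 have "frechet_derivative (ptest f) (at x) = (%h. \<Sum>i\<in>UNIV. h $ i * ptest (f(i := deriv (f i))) x)"
  using frechet_derivative_at[OF has_derivative_ptest[of f, OF f]] by metis
 thus "partial_deriv i (ptest f) x = ptest (f(i := deriv (f i))) x"
  by (simp add: partial_deriv_def axis_def if_distrib[of "%c. c * _"] cong: if_cong)
qed

lemma iter_partial_ptest:
 fixes f :: "'n::finite => real => real"
 assumes f: "!!i. f i \<in> sm1"
 shows "\<exists>g. (\<forall>i. g i \<in> sm1) \<and> iter_partial is (ptest f) = ptest g" proof (induction "is")
 case Nil
 thus ?case using assms by (auto simp: iter_partial_def)
next
 case (Cons a "is")
 then obtain g where g: "\<forall>i. g i \<in> sm1" "iter_partial is (ptest f) = ptest g" by auto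
 hence "iter_partial (a # is) (ptest f) = ptest (g(a := deriv (g a)))"
  using partial_deriv_ptest[of g a] by (simp add: iter_partial_def)
 moreover have "\<forall>i. (g(a := deriv (g a))) i \<in> sm1" using g sm1_deriv by auto
 ultimately show ?case by blast
qed

lemma smooth_ptest:
 fixes f :: "'n::finite => real => real"
 assumes f: "!!i. f i \<in> sm1"
 shows "smooth (ptest f)" unfolding smooth_def proof (intro allI)
 fix "is" :: "'n list" and x
 obtain g where "\<forall>i. g i \<in> sm1" "iter_partial is (ptest f) = ptest g" using iter_partial_ptest[of f "is", OF f] by blast
 thus "iter_partial is (ptest f) differentiable at x" using has_derivative_ptest[of g x] by (auto simp: differentiable_def)
qed

lemma iter_partial_1: "(!!i. f i \<in> sm1) ==> iter_partial [i] (ptest f) = ptest (f(i := deriv (f i)))"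
 by (simp add: iter_partial_def partial_deriv_ptest)

lemma iter_partial_2:
 fixes f :: "'n::finite => real => real"
 assumes f: "!!i. f i \<in> sm1"
 shows "iter_partial [i, j] (ptest f) =
   ptest ((f(j := deriv (f j)))(i := deriv ((f(j := deriv (f j))) i)))" proof -
 have "(f(j := deriv (f j))) m \<in> sm1" for m using f sm1_deriv by auto
 from partial_deriv_ptest[of "f(j := deriv (f j))", OF this, of i] partial_deriv_ptest[of f, OF f, of j]
 show ?thesis by (simp add: iter_partial_def)
qed

lemma continuous_on_ptest:
 fixes f :: "'n::finite => real => real"
 assumes f: "!!i. f i \<in> sm1"
 shows "continuous_on A (ptest f)" proof (rule continuous_at_imp_continuous_on, rule ballI)
 fix x
 show "isCont (ptest f) x" by (rule has_derivative_continuous[OF has_derivative_ptest[of f, OF f]])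
qed

lemma test_function_ptest:
 fixes f :: "'n::finite => real => real"
 assumes f: "!!i. f i \<in> sm1" and "!!i t. t \<notin> {a $ i .. b $ i} ==> f i t = 0" and "cbox a b \<subseteq> U"
 shows "test_function U (ptest f)" proof -
 have sub: "{x. ptest f x ~= 0} \<subseteq> cbox a b"
 proof
  fix x assume "x \<in> {x. ptest f x ~= 0}"
  hence "f i (x $ i) ~= 0" for i by (auto simp: ptest_def)
  hence "x $ i \<in> {a $ i .. b $ i}" for i using assms(2) by blast
  thus "x \<in> cbox a b" by (auto simp: mem_box_cart)
 qed
 hence "closure {x. ptest f x ~= 0} \<subseteq> cbox a b" by (rule closure_minimal) (rule closed_cbox)
 moreover from this have "compact (closure {x. ptest f x ~= 0})"
  using compact_Int_closed[OF compact_cbox[of a b] closed_closure[of "{x. ptest f x ~= 0}"]] by (simp add: Int_absorb1)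
 ultimately show ?thesis
  using assms(3) smooth_ptest[of f, OF assms(1)] unfolding test_function_def by (intro conjI) (assumption, assumption, rule order_trans)
qed

definition bump :: "real => real" where
 "bump t = flat_exp 0 (1 + t) * flat_exp 0 (1 - t)"

definition dbump :: "nat => real => real" where "dbump k = (deriv ^^ k) bump"

lemma bump_sm1: "bump \<in> sm1" proof -
 have "(%t. flat_exp 0 (1 + 1 * t) * flat_exp 0 (1 + (-1) * t)) \<in> sm1" by (intro sm1.intros)
 thus ?thesis by (simp add: bump_def[abs_def])
qed

lemma dbump_0: "dbump 0 = bump" and dbump_Suc: "dbump (Suc k) = deriv (dbump k)" by (auto simp: dbump_def)

lemma dbump_sm1: "dbump k \<in> sm1" by (induction k) (auto simp: dbump_0 dbump_Suc bump_sm1 sm1_deriv)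

lemma DERIV_dbump: "DERIV (dbump k) t :> dbump (Suc k) t" using sm1_DERIV[OF dbump_sm1[of k]] by (simp add: dbump_Suc)

lemma bump_nonneg: "bump t \<ge> 0" by (auto simp: bump_def flat_exp_def)

lemma bump_pos: "\<bar>t\<bar> < 1 ==> bump t > 0" by (auto simp: bump_def flat_exp_def)

lemma dbump_eq_0: "\<bar>t\<bar> > 1 ==> dbump k t = 0" proof (induction k arbitrary: t)
 case 0
 thus ?case by (auto simp: dbump_0 bump_def flat_exp_def)
next
 case (Suc k)
 have "\<forall>\<^sub>F s in nhds t. \<bar>s\<bar> > 1" proof -
  have "open {s::real. \<bar>s\<bar> > 1}" by (intro open_Collect_less continuous_intros)
  thus ?thesis using eventually_nhds_in_open[of "{s. \<bar>s\<bar> > 1}" t] Suc.prems by simp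
 qed
 hence "\<forall>\<^sub>F s in nhds t. dbump k s = 0" by eventually_elim (rule Suc.IH)
 hence "DERIV (dbump k) t :> 0" by (subst DERIV_cong_ev[OF refl _ refl, of _ "%t. 0"]) auto
 thus ?case by (simp add: dbump_Suc DERIV_imp_deriv)
qed

lemma dbump_bounded: "\<exists>C. \<forall>t. \<bar>dbump k t\<bar> <= C" proof -
 have "compact (dbump k ` {-1..1})" by (intro compact_continuous_image sm1_continuous dbump_sm1 compact_Icc)
 then obtain C where C: "\<forall>y\<in>dbump k ` {-1..1}. norm y <= C" using compact_imp_bounded bounded_iff by metis
 have "\<bar>dbump k t\<bar> <= max C 0" for t proof (cases "\<bar>t\<bar> <= 1")
  case True
  hence "t \<in> {-1..1}" by auto
  hence "\<bar>dbump k t\<bar> <= C" using C by fastforce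
  thus ?thesis by linarith
 next
  case False
  thus ?thesis using dbump_eq_0[of t k] by auto
 qed
 thus ?thesis by blast
qed

text \<open>The mean value inequality bounds the difference quotients by \<open>w\<close>, so
  dominated convergence applies along every sequence tending to 0.\<close>

lemma has_real_derivative_integral:
 fixes k k' :: "'a => real => real"
 assumes d: "0 < \<delta>"
  and der: "!!z t. \<bar>t - t0\<bar> < \<delta> ==> DERIV (k z) t :> k' z t"
  and int: "!!t. \<bar>t - t0\<bar> < \<delta> ==> integrable M (%z. k z t)"
  and w: "integrable M w"
  and bd: "!!z t. \<bar>t - t0\<bar> < \<delta> ==> \<bar>k' z t\<bar> <= w z"
 shows "DERIV (%t. \<integral>z. k z t \<partial>M) t0 :> (\<integral>z. k' z t0 \<partial>M)"
 unfolding DERIV_def proof (subst tendsto_at_iff_sequentially, intro allI impI)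
 fix X :: "nat => real" assume X: "\<forall>i. X i \<in> UNIV - {0}" "X \<longlonglongrightarrow> 0"
 hence "\<forall>\<^sub>F n in sequentially. \<bar>X n\<bar> < \<delta>" using d tendsto_rabs_zero order_tendstoD(2) by blast
 then obtain n0 where n0: "!!n. n \<ge> n0 ==> \<bar>X n\<bar> < \<delta>" by (auto simp: eventually_sequentially)
 let ?X = "%n. X (n + n0)"
 have X': "?X \<longlonglongrightarrow> 0" using X(2) by (rule LIMSEQ_ignore_initial_segment)
 have lim: "(%n. (k z (t0 + ?X n) - k z t0) / ?X n) \<longlonglongrightarrow> k' z t0" for z proof -
  have "((%h. (k z (t0 + h) - k z t0) / h) \<longlongrightarrow> k' z t0) (at 0)" using der[of t0 z] d by (simp add: DERIV_def)
  thus ?thesis unfolding tendsto_at_iff_sequentially using X(1) X' by (auto simp: comp_def)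
 qed
 have "(%n. \<integral>z. (k z (t0 + ?X n) - k z t0) / ?X n \<partial>M) \<longlonglongrightarrow> (\<integral>z. k' z t0 \<partial>M)"
 proof (rule integral_dominated_convergence[OF _ _ w])
  have m: "(%z. (k z (t0 + ?X n) - k z t0) / ?X n) \<in> borel_measurable M" for n
   using int[of "t0 + ?X n"] int[of t0] n0[of "n + n0"] d by (intro borel_measurable_divide borel_measurable_diff) auto
  thus "(%z. (k z (t0 + ?X n) - k z t0) / ?X n) \<in> borel_measurable M" for n .
  show "(%z. k' z t0) \<in> borel_measurable M" by (rule borel_measurable_LIMSEQ_real[OF lim m])
  show "AE z in M. (%n. (k z (t0 + ?X n) - k z t0) / ?X n) \<longlonglongrightarrow> k' z t0" using lim by simp
  show "AE z in M. norm ((k z (t0 + ?X n) - k z t0) / ?X n) <= w z" for n proof (rule AE_I2)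
   fix z
   have h: "\<bar>?X n\<bar> < \<delta>" "?X n ~= 0" using n0[of "n + n0"] X(1) by auto
   have "\<bar>k z (t0 + ?X n) - k z t0\<bar> <= w z * \<bar>(t0 + ?X n) - t0\<bar>"
   proof (rule field_differentiable_bound[where S="ball t0 \<delta>" and f'="k' z", simplified real_norm_def])
    show "convex (ball t0 \<delta>)" by simp
    show "!!s. s \<in> ball t0 \<delta> ==> (k z has_field_derivative k' z s) (at s within ball t0 \<delta>)"
     using der by (auto simp: dist_real_def abs_minus_commute intro: has_field_derivative_at_within)
    show "!!s. s \<in> ball t0 \<delta> ==> \<bar>k' z s\<bar> <= w z"
     using bd by (auto simp: dist_real_def abs_minus_commute)
    show "t0 + ?X n \<in> ball t0 \<delta>" "t0 \<in> ball t0 \<delta>" using h d by (auto simp: dist_real_def)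
   qed
   thus "norm ((k z (t0 + ?X n) - k z t0) / ?X n) <= w z" using h by (simp add: field_simps)
  qed
 qed
 moreover have "(\<integral>z. (k z (t0 + ?X n) - k z t0) / ?X n \<partial>M) =
   ((\<integral>z. k z (t0 + ?X n) \<partial>M) - (\<integral>z. k z t0 \<partial>M)) / ?X n" for n
  using int[of "t0 + ?X n"] int[of t0] n0[of "n + n0"] d by simp
 ultimately have "(%n. ((\<integral>z. k z (t0 + ?X n) \<partial>M) - (\<integral>z. k z t0 \<partial>M)) / ?X n) \<longlonglongrightarrow> (\<integral>z. k' z t0 \<partial>M)"
  by (simp only:)
 hence "(%n. ((\<integral>z. k z (t0 + X n) \<partial>M) - (\<integral>z. k z t0 \<partial>M)) / X n) \<longlonglongrightarrow> (\<integral>z. k' z t0 \<partial>M)"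
  by (rule LIMSEQ_offset)
 thus "((%h. ((\<integral>z. k z (t0 + h) \<partial>M) - (\<integral>z. k z t0 \<partial>M)) / h) \<circ> X) \<longlonglongrightarrow> (\<integral>z. k' z t0 \<partial>M)"
  by (simp add: comp_def)
qed

subsection \<open>Mollification\<close>

text \<open>The normalising constant depends on the dimension alone, hence the \<open>itself\<close>
  argument.\<close>

definition kmass :: "(real ^ 'n::finite) itself => real" where
 "kmass _ = (LBINT x. (\<Prod>i\<in>UNIV. bump ((x :: real ^ 'n) $ i)))"

text \<open>\<open>ker N \<kappa>\<close> is the derivative of multi-index \<open>\<kappa>\<close> of the mollifier of width \<open>1 / N\<close>.\<close>

definition ker :: "real => ('n::finite => nat) => real ^ 'n => real" where
 "ker N \<kappa> y = N ^ CARD('n) / kmass TYPE(real ^ 'n) * (\<Prod>i\<in>UNIV. N ^ \<kappa> i * dbump (\<kappa> i) (N * y $ i))"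

definition mol :: "real => ('n::finite => nat) => (real ^ 'n => real) => real ^ 'n => real" where
 "mol N \<kappa> f x = (LBINT z. (f z * ker N \<kappa> (x - z)))"

abbreviation "ker0 N \<equiv> ker N (%_. 0)"

abbreviation "mol0 N \<equiv> mol N (%_. 0)"

abbreviation "mol1 N i \<equiv> mol N ((%_. 0)(i := Suc ((%_. 0) i)))"

text \<open>Balls of the maximum norm fit the product kernel: its support at width 1/N is such a
  cube, and membership is checked coordinate by coordinate.\<close>

definition qcube :: "real ^ 'n => real => (real ^ 'n) set" where
 "qcube x r = {z. \<forall>i. \<bar>z $ i - x $ i\<bar> <= r}"

lemma qcube_eq_cbox: "qcube (x :: real ^ 'n::finite) r = cbox (x - (\<chi> i. r)) (x + (\<chi> i. r))"
 by (auto simp: qcube_def mem_box_cart abs_le_iff algebra_simps)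

lemma compact_qcube [simp]: "compact (qcube (x :: real ^ 'n::finite) r)" by (simp add: qcube_eq_cbox compact_cbox)

lemma qcube_self: "0 <= r ==> x \<in> qcube x r" by (simp add: qcube_def)

lemma qcube_borel [measurable]: "qcube (x :: real ^ 'n::finite) r \<in> sets borel" by (simp add: qcube_eq_cbox)

lemma emeasure_qcube: "emeasure lborel (qcube (x :: real ^ 'n::finite) r) < \<infinity>" "emeasure lborel (qcube x r) < top"
 using emeasure_bounded_finite[of "qcube x r"] compact_imp_bounded[OF compact_qcube[of x r]] by (auto simp: less_top)

lemma dbump_continuous: "continuous_on A (dbump k)" by (rule sm1_continuous[OF dbump_sm1])

lemma dbump_measurable [measurable]: "dbump k \<in> Borel" by (rule borel_measurable_continuous_onI[OF dbump_continuous])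

lemma ker_measurable [measurable]: "ker N \<kappa> \<in> Borel" unfolding ker_def[abs_def] by measurable

lemma ker_continuous: "continuous_on A (ker N \<kappa> :: real ^ 'n::finite => real)" proof -
 have "continuous_on A (%y :: real ^ 'n. dbump (\<kappa> i) (N * y $ i))" for i
  by (rule continuous_on_compose2[OF dbump_continuous[of UNIV]]) (auto intro!: continuous_intros)
 thus ?thesis unfolding ker_def[abs_def] by (intro continuous_on_mult continuous_on_const continuous_on_prod)
qed

lemma ker_bounded: "\<exists>C. \<forall>y :: real ^ 'n::finite. \<bar>ker N \<kappa> y\<bar> <= C" proof -
 have "\<forall>i. \<exists>C. \<forall>t. \<bar>N ^ \<kappa> i * dbump (\<kappa> i) t\<bar> <= C" using dbump_bounded by (force simp: abs_mult intro: mult_left_mono)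
 then obtain C where C: "!!i t. \<bar>N ^ \<kappa> i * dbump (\<kappa> i) t\<bar> <= C i" by metis
 have "\<bar>ker N \<kappa> y\<bar> <= \<bar>N ^ CARD('n) / kmass TYPE(real ^ 'n)\<bar> * (\<Prod>i\<in>UNIV. C i)" for y :: "real^'n"
  unfolding ker_def abs_mult[of _ "prod _ _"] abs_prod by (intro mult_left_mono prod_mono) (auto simp: C)
 thus ?thesis by blast
qed

lemma ker_eq_0: "N > 0 ==> \<bar>y $ i\<bar> > 1 / N ==> ker N \<kappa> y = 0" proof -
 assume N: "N > 0" "\<bar>y $ i\<bar> > 1 / N"
 hence "\<bar>N * y $ i\<bar> > 1" by (simp add: abs_mult field_simps)
 hence "dbump (\<kappa> i) (N * y $ i) = 0" by (rule dbump_eq_0)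
 thus ?thesis by (auto simp: ker_def)
qed

lemma ker_eq_0_qcube: "N > 0 ==> z \<notin> qcube x (1 / N) ==> ker N \<kappa> (x - z) = 0" proof -
 assume "N > 0" "z \<notin> qcube x (1 / N)"
 then obtain i where "\<bar>(x - z) $ i\<bar> > 1 / N" by (auto simp: qcube_def not_le abs_minus_commute)
 thus ?thesis using \<open>N > 0\<close> by (intro ker_eq_0)
qed

lemma integrable_cont_compact:
 fixes f :: "real ^ 'n::finite => real"
 assumes "continuous_on UNIV f" "!!x. x \<notin> K ==> f x = 0" "compact K"
 shows "integrable lborel f" proof -
 have "integrable lborel (%x. indicator K x *\<^sub>R f x)"
  by (rule borel_integrable_compact[OF assms(3) continuous_on_subset[OF assms(1)]]) simp
 moreover have "(%x. indicator K x *\<^sub>R f x) = f" using assms(2) by (auto simp: indicator_def fun_eq_iff)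
 ultimately show ?thesis by simp
qed

text \<open>A vanishing integral would make the nonempty open set where \<open>f\<close> is positive
  negligible.\<close>

lemma integral_pos_cont:
 fixes f :: "real ^ 'n::finite => real"
 assumes c: "continuous_on UNIV f" and i: "integrable lborel f" and nn: "!!x. f x \<ge> 0" and p: "f x0 > 0"
 shows "(LBINT x. f x) > 0" proof -
 have "(LBINT x. f x) ~= 0"
 proof
  assume "(LBINT x. f x) = 0"
  hence "AE x in lborel. f x = 0" using integral_nonneg_eq_0_iff_AE[OF i] nn by simp
  moreover have o: "open {x. f x > 0}" by (rule open_Collect_less[OF continuous_on_const c])
  moreover have "AE x in lborel. \<not> 0 < f x" using \<open>AE x in lborel. f x = 0\<close> by eventually_elim simp
  hence "{x. f x > 0} \<in> null_sets lborel" using emeasure_eq_0_AE[of "%x. 0 < f x" lborel] o by auto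
  hence "negligible {x. f x > 0}" by (simp add: negligible_iff_null_sets null_sets_completionI)
  thus False using o open_not_negligible p by auto
 qed
 moreover have "(LBINT x. f x) \<ge> 0" using nn by simp
 ultimately show ?thesis by linarith
qed

lemma kmass_pos: "kmass TYPE(real ^ 'n::finite) > 0" unfolding kmass_def proof (rule integral_pos_cont[where ?x0.0=0])
 show c: "continuous_on UNIV (%x :: real ^ 'n. \<Prod>i\<in>UNIV. bump (x $ i))" proof (rule continuous_on_prod)
  show "continuous_on UNIV (%x :: real ^ 'n. bump (x $ i))" for i
   by (rule continuous_on_compose2[OF dbump_continuous[of UNIV 0, unfolded dbump_0]]) (auto intro!: continuous_intros)
 qed
 show "integrable lborel (%x :: real ^ 'n. \<Prod>i\<in>UNIV. bump (x $ i))"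
 proof (rule integrable_cont_compact[OF c _ compact_qcube[of 0 1]])
  fix x :: "real^'n" assume "x \<notin> qcube 0 1"
  then obtain i where "\<bar>x $ i\<bar> > 1" by (auto simp: qcube_def not_le)
  thus "(\<Prod>i\<in>UNIV. bump (x $ i)) = 0" using dbump_eq_0[of _ 0] by (auto simp: dbump_0)
 qed
 show "!!x :: real ^ 'n. 0 <= (\<Prod>i\<in>UNIV. bump (x $ i))" by (intro prod_nonneg) (auto simp: bump_nonneg)
 show "0 < (\<Prod>i\<in>UNIV. bump ((0 :: real ^ 'n) $ i))" by (intro prod_pos) (auto simp: bump_pos)
qed

lemma ker_integrable: "N > 0 ==> integrable lborel (%z :: real ^ 'n::finite. ker N \<kappa> (x - z))"
proof (rule integrable_cont_compact[OF _ _ compact_qcube[of x "1/N"]])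
 show "continuous_on UNIV (%z. ker N \<kappa> (x - z))"
  by (rule continuous_on_compose2[OF ker_continuous[of UNIV]]) (auto intro!: continuous_intros)
qed (auto intro: ker_eq_0_qcube)

lemma ker_nonneg: "N > 0 ==> ker0 N (y :: real ^ 'n::finite) \<ge> 0"
 unfolding ker_def using kmass_pos[where 'n='n]
 by (intro mult_nonneg_nonneg prod_nonneg divide_nonneg_pos) (auto simp: dbump_0 bump_nonneg)

lemma lborel_integral_affine:
 fixes f :: "real ^ 'n::finite => real"
 assumes [measurable]: "f \<in> Borel" and c: "c ~= 0"
 shows "(LBINT x. f (t + c *\<^sub>R x)) = (LBINT x. f x) / \<bar>c\<bar> ^ CARD('n)" proof -
 show ?thesis using c by (subst lborel_affine[OF c, of t])
    (simp add: integral_density integral_distr integral_real_density)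
qed

lemma nn_integral_lborel_affine:
 fixes f :: "real ^ 'n::finite => ennreal"
 assumes [measurable]: "f \<in> Borel" and c: "c ~= 0"
 shows "(\<integral>\<^sup>+x. f x \<partial>lborel) = ennreal (\<bar>c\<bar> ^ CARD('n)) * (\<integral>\<^sup>+x. f (t + c *\<^sub>R x) \<partial>lborel)"
 by (subst lborel_affine[OF c, of t])
   (simp add: nn_integral_density nn_integral_distr nn_integral_cmult ennreal_power)

lemma integrable_lborel_affine:
 fixes f :: "real ^ 'n::finite => real"
 assumes f: "integrable lborel f" and c: "c ~= 0"
 shows "integrable lborel (%x. f (t + c *\<^sub>R x))" proof -
 have [measurable]: "f \<in> Borel" using f by auto
 have "(\<integral>\<^sup>+x. ennreal (norm (f x)) \<partial>lborel) = ennreal (\<bar>c\<bar> ^ CARD('n)) * (\<integral>\<^sup>+x. ennreal (norm (f (t + c *\<^sub>R x))) \<partial>lborel)"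
  by (rule nn_integral_lborel_affine[OF _ c]) measurable
 moreover have "(\<integral>\<^sup>+x. ennreal (norm (f x)) \<partial>lborel) < \<infinity>" using f by (simp add: integrable_iff_bounded)
 ultimately have "(\<integral>\<^sup>+x. ennreal (norm (f (t + c *\<^sub>R x))) \<partial>lborel) < \<infinity>"
  using c by (auto simp: ennreal_mult_less_top)
 thus ?thesis by (simp add: integrable_iff_bounded)
qed

lemma ker_integral: "N > 0 ==> (LBINT z. ker0 N (x - z :: real ^ 'n::finite)) = 1" proof -
 assume N: "N > 0"
 let ?g = "%y :: real ^ 'n. \<Prod>i\<in>UNIV. bump (y $ i)"
 have [measurable]: "bump \<in> Borel" using dbump_measurable[of 0] by (simp add: dbump_0)
 have e: "ker0 N (x - z) = N ^ CARD('n) / kmass TYPE(real ^ 'n) * ?g ((N *\<^sub>R x) + (- N) *\<^sub>R z)" for z :: "real^'n"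
  by (simp add: ker_def dbump_0 algebra_simps)
 have "(LBINT z. ker0 N (x - z)) = N ^ CARD('n) / kmass TYPE(real ^ 'n) * (LBINT z. ?g ((N *\<^sub>R x) + (- N) *\<^sub>R z))"
  unfolding e by simp
 also have "(LBINT z. ?g ((N *\<^sub>R x) + (- N) *\<^sub>R z)) = kmass TYPE(real ^ 'n) / \<bar>-N\<bar> ^ CARD('n)"
  unfolding kmass_def by (rule lborel_integral_affine) (use N in auto)
 finally show ?thesis using N kmass_pos[where 'n='n] by simp
qed

lemma mol_integrable:
 fixes f :: "real ^ 'n::finite => real"
 assumes "integrable lborel f"
 shows "integrable lborel (%z. f z * ker N \<kappa> (x - z))" proof -
 obtain C where C: "!!y :: real^'n. \<bar>ker N \<kappa> y\<bar> <= C" using ker_bounded by blast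
 have [measurable]: "f \<in> Borel" using assms by auto
 show ?thesis by (rule Bochner_Integration.integrable_bound[OF integrable_mult_left[OF assms, of C]])
    (auto simp: abs_mult intro!: mult_left_mono order_trans[OF C])
qed

lemma mol_continuous:
 fixes f :: "real ^ 'n::finite => real"
 assumes f: "integrable lborel f"
 shows "continuous_on A (mol N \<kappa> f)" proof (rule continuous_on_subset[of UNIV])
 obtain C where C: "!!y :: real^'n. \<bar>ker N \<kappa> y\<bar> <= C" using ker_bounded by blast
 have [measurable]: "f \<in> Borel" using f by auto
 show "continuous_on UNIV (mol N \<kappa> f)" unfolding continuous_on_sequentially comp_def mol_def
 proof (intro allI ballI impI, elim conjE)
  fix X :: "nat => real ^ 'n" and x assume X: "X \<longlonglongrightarrow> x"
  show "(%n. \<integral>z. f z * ker N \<kappa> (X n - z) \<partial>lborel) \<longlonglongrightarrow> (LBINT z. (f z * ker N \<kappa> (x - z)))"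
  proof (rule integral_dominated_convergence[OF _ _ integrable_norm[OF integrable_mult_left[OF f, of C]]])
   show "AE z in lborel. (%n. f z * ker N \<kappa> (X n - z)) \<longlonglongrightarrow> f z * ker N \<kappa> (x - z)"
   proof (rule AE_I2, rule tendsto_mult[OF tendsto_const])
    fix z
    have "(%n. X n - z) \<longlonglongrightarrow> x - z" by (intro tendsto_diff X tendsto_const)
    thus "(%n. ker N \<kappa> (X n - z)) \<longlonglongrightarrow> ker N \<kappa> (x - z)"
     by (rule continuous_on_tendsto_compose[OF ker_continuous[of UNIV]]) auto
   qed
   show "AE z in lborel. norm (f z * ker N \<kappa> (X n - z)) <= norm (f z * C)" for n
    by (auto simp: abs_mult intro!: mult_left_mono order_trans[OF C])
  qed auto
 qed
qed auto

lemma DERIV_ker: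
 "DERIV (%t. ker N \<kappa> (y + t *\<^sub>R axis i 1)) t :> ker N (\<kappa>(i := Suc (\<kappa> i))) (y + t *\<^sub>R axis i 1)"
proof -
 let ?c = "N ^ CARD('a) / kmass TYPE(real ^ 'a)"
 let ?g = "%j z. N ^ \<kappa> j * dbump (\<kappa> j) (N * z)"
 have sm: "?g j \<in> sm1" for j
  using sm1.mult[OF sm1.const[of "N ^ \<kappa> j"] sm1_affine[OF dbump_sm1[of "\<kappa> j"], of 0 N]] by simp
 have dg: "deriv (?g j) z = N ^ Suc (\<kappa> j) * dbump (Suc (\<kappa> j)) (N * z)" for j z proof -
  have "DERIV (%z. N * z) z :> N" by (auto intro!: derivative_eq_intros)
  from DERIV_chain'[OF this DERIV_dbump]
  have "DERIV (?g j) z :> N ^ \<kappa> j * (N * dbump (Suc (\<kappa> j)) (N * z))"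
   by (intro DERIV_cmult) (simp add: mult.commute)
  thus ?thesis by (simp add: DERIV_imp_deriv)
 qed
 have k: "ker N \<kappa> y = ?c * ptest ?g y" for y by (simp add: ker_def ptest_def)
 have k': "ker N (\<kappa>(i := Suc (\<kappa> i))) y = ?c * ptest (?g(i := deriv (?g i))) y" for y unfolding ker_def ptest_def
  by (intro arg_cong2[of _ _ _ _ "(*)"] prod.cong refl) (auto simp: dg)
 have "((%t. y + t *\<^sub>R axis i 1) has_derivative (%h. h *\<^sub>R axis i 1)) (at t)"
  by (auto intro!: derivative_eq_intros)
 from has_derivative_compose[OF this has_derivative_ptest[of ?g, OF sm]]
 have "((%t. ptest ?g (y + t *\<^sub>R axis i 1)) has_derivative
  (%h. \<Sum>j\<in>UNIV. (h *\<^sub>R axis i 1) $ j * ptest (?g(j := deriv (?g j))) (y + t *\<^sub>R axis i 1))) (at t)" .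
 moreover have "(%h. \<Sum>j\<in>UNIV. (h *\<^sub>R axis i 1) $ j * ptest (?g(j := deriv (?g j))) (y + t *\<^sub>R axis i 1))
  = (*) (ptest (?g(i := deriv (?g i))) (y + t *\<^sub>R axis i 1))"
  by (auto simp: axis_def fun_eq_iff if_distrib[of "%c. _ * c"] if_distrib[of "%c. c * _"] cong: if_cong)
 ultimately have "((%t. ptest ?g (y + t *\<^sub>R axis i 1)) has_real_derivative
   ptest (?g(i := deriv (?g i))) (y + t *\<^sub>R axis i 1)) (at t)" by (simp add: has_field_derivative_def)
 thus ?thesis unfolding k k' by (rule DERIV_cmult)
qed

text \<open>The derivative falls on the kernel; the differentiated kernel is bounded, so a multiple
  of |f| is the integrable majorant.\<close>

lemma DERIV_mol:
 fixes f :: "real ^ 'n::finite => real"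
 assumes f: "integrable lborel f"
 shows "DERIV (%t. mol N \<kappa> f (x + t *\<^sub>R axis i 1)) t0 :> mol N (\<kappa>(i := Suc (\<kappa> i))) f (x + t0 *\<^sub>R axis i 1)"
proof -
 obtain C where C: "!!y :: real^'n. \<bar>ker N (\<kappa>(i := Suc (\<kappa> i))) y\<bar> <= C" using ker_bounded by blast
 have e: "x + t *\<^sub>R axis i 1 - z = (x - z) + t *\<^sub>R axis i 1" for t and z :: "real^'n" by simp
 show ?thesis unfolding mol_def proof (rule has_real_derivative_integral[of 1])
  show "((%t. f z * ker N \<kappa> (x + t *\<^sub>R axis i 1 - z)) has_real_derivative
    f z * ker N (\<kappa>(i := Suc (\<kappa> i))) (x + t *\<^sub>R axis i 1 - z)) (at t)" for z t
   unfolding e by (intro DERIV_cmult DERIV_ker)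
  show "integrable lborel (%z. \<bar>f z * C\<bar>)" using f by auto
  show "\<bar>f z * ker N (\<kappa>(i := Suc (\<kappa> i))) (x + t *\<^sub>R axis i 1 - z)\<bar> <= \<bar>f z * C\<bar>" for z t
   by (auto simp: abs_mult intro!: mult_left_mono order_trans[OF C])
 qed (auto intro: mol_integrable[OF f])
qed

lemma mol_mono_AE:
 fixes f g :: "real ^ 'n::finite => real"
 assumes "integrable lborel f" "integrable lborel g" "N > 0" and "AE z\<in>qcube x (1/N) in lborel. f z <= g z"
 shows "mol0 N f x <= mol0 N g x" unfolding mol_def
proof (rule integral_mono_AE[OF mol_integrable mol_integrable])
 show "AE z in lborel. f z * ker0 N (x - z) <= g z * ker0 N (x - z)" using assms(4) proof eventually_elim
  case (elim z)
  thus ?case using assms(3) ker_nonneg[of N "x - z"] ker_eq_0_qcube[of N z x]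
   by (cases "z \<in> qcube x (1/N)") (auto intro: mult_right_mono)
 qed
qed (use assms in auto)

text \<open>The kernel has mass 1 and is supported in the cube. The comparison function is the
  constant cut off to that cube, which makes it integrable without changing its average.\<close>

lemma mol_bounds_const:
 fixes f :: "real ^ 'n::finite => real"
 assumes f: "integrable lborel f" and N: "N > 0"
 shows "(AE z\<in>qcube x (1/N) in lborel. f z <= c) ==> mol0 N f x <= c"
  and "(AE z\<in>qcube x (1/N) in lborel. c <= f z) ==> c <= mol0 N f x" proof -
 let ?h = "%z. indicator (qcube x (1/N)) z * c :: real"
 have h: "integrable lborel ?h" by (intro integrable_mult_left integrable_real_indicator) (auto simp: emeasure_qcube)
 have "mol0 N ?h x = (LBINT z. c * ker0 N (x - z))"
  unfolding mol_def using ker_eq_0_qcube[OF N] by (intro Bochner_Integration.integral_cong) (auto simp: indicator_def)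
 also have "... = c" using ker_integral[OF N, of x] by simp
 finally have c: "mol0 N ?h x = c" .
 show "(AE z\<in>qcube x (1/N) in lborel. f z <= c) ==> mol0 N f x <= c"
  using mol_mono_AE[OF f h N, of x] c by (auto simp: indicator_def elim: eventually_mono)
 show "(AE z\<in>qcube x (1/N) in lborel. c <= f z) ==> c <= mol0 N f x"
  using mol_mono_AE[OF h f N, of x] c by (auto simp: indicator_def elim: eventually_mono)
qed

lemma mol_diff:
 fixes f g :: "real ^ 'n::finite => real"
 assumes "integrable lborel f" "integrable lborel g"
 shows "mol N \<kappa> (%x. f x - g x) x = mol N \<kappa> f x - mol N \<kappa> g x" unfolding mol_def left_diff_distrib
 by (rule Bochner_Integration.integral_diff) (intro mol_integrable assms)+

lemma mol_add:
 fixes f g :: "real ^ 'n::finite => real"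
 assumes "integrable lborel f" "integrable lborel g"
 shows "mol N \<kappa> (%x. f x + g x) x = mol N \<kappa> f x + mol N \<kappa> g x" unfolding mol_def distrib_right
 by (rule Bochner_Integration.integral_add) (intro mol_integrable assms)+

lemma mol_measurable [measurable]:
 fixes f :: "real ^ 'n::finite => real"
 assumes "integrable lborel f"
 shows "mol N \<kappa> f \<in> Borel" by (rule borel_measurable_continuous_onI[OF mol_continuous[OF assms]])

lemma nn_integral_ker_second: "N > 0 ==> (\<integral>\<^sup>+x. ennreal (ker0 N (x - z :: real ^ 'n::finite)) \<partial>lborel) = 1"
proof -
 assume N: "N > 0"
 have "(\<integral>\<^sup>+x. ennreal (ker0 N (x - z)) \<partial>lborel) = (\<integral>\<^sup>+x. ennreal (ker0 N (z + (-1) *\<^sub>R x - z :: real ^ 'n)) \<partial>lborel)"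
  by (subst nn_integral_lborel_affine[of _ "-1" "z"]) (auto)
 also have "... = (\<integral>\<^sup>+x. ennreal (ker0 N (0 - x :: real ^ 'n)) \<partial>lborel)" by simp
 also have "... = ennreal (LBINT x. ker0 N (0 - x :: real^'n))"
  by (rule nn_integral_eq_integral[OF ker_integrable[OF N]]) (auto intro: ker_nonneg N)
 also have "... = 1" using ker_integral[OF N, of 0] by simp
 finally show ?thesis .
qed

text \<open>Tonelli's theorem, with the kernel having mass 1 also as a function of its first
  variable.\<close>

lemma mol_L1_contract:
 fixes f :: "real ^ 'n::finite => real"
 assumes f: "integrable lborel f" and N: "N > 0"
 shows "(L1n (%x. mol0 N f x)) <= (L1n (%x. f x))"
proof -
 have [measurable]: "f \<in> Borel" using f by auto
 have kn: "!!y :: real ^ 'n. 0 <= ker0 N y" by (rule ker_nonneg[OF N])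
 have "(L1n (%x. mol0 N f x)) <= (\<integral>\<^sup>+x. (\<integral>\<^sup>+z. ennreal (\<bar>f z\<bar> * ker0 N (x - z)) \<partial>lborel) \<partial>lborel)"
 proof (rule nn_integral_mono)
  fix x
  have "ennreal \<bar>mol0 N f x\<bar> <= (\<integral>\<^sup>+z. ennreal (norm (f z * ker0 N (x - z))) \<partial>lborel)"
   unfolding mol_def using integral_norm_bound_ennreal[OF mol_integrable[OF f]] by simp
  thus "ennreal \<bar>mol0 N f x\<bar> <= (\<integral>\<^sup>+z. ennreal (\<bar>f z\<bar> * ker0 N (x - z)) \<partial>lborel)"
   using kn by (simp add: abs_mult)
 qed
 also have "... = (\<integral>\<^sup>+z. (\<integral>\<^sup>+x. ennreal (\<bar>f z\<bar> * ker0 N (x - z)) \<partial>lborel) \<partial>lborel)"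
  by (rule lborel_pair.Fubini') measurable
 also have "... = (L1n (%z. f z))" proof (rule nn_integral_cong)
  fix z
  have "(\<integral>\<^sup>+x. ennreal (\<bar>f z\<bar> * ker0 N (x - z)) \<partial>lborel) = (\<integral>\<^sup>+x. ennreal \<bar>f z\<bar> * ennreal (ker0 N (x - z)) \<partial>lborel)"
   using kn by (simp add: ennreal_mult)
  also have "... = ennreal \<bar>f z\<bar> * (\<integral>\<^sup>+x. ennreal (ker0 N (x - z)) \<partial>lborel)"
   by (rule nn_integral_cmult) measurable
  finally show "(\<integral>\<^sup>+x. ennreal (\<bar>f z\<bar> * ker0 N (x - z)) \<partial>lborel) = ennreal \<bar>f z\<bar>"
   using nn_integral_ker_second[OF N, of z] by simp
 qed
 finally show ?thesis .
qed

lemma norm_le_qcube: "z \<in> qcube x r ==> norm (z - x :: real ^ 'n::finite) <= real CARD('n) * r" proof -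
 assume "z \<in> qcube x r"
 hence "norm (z - x) <= (\<Sum>i\<in>(UNIV::'n set). r)" by (intro order_trans[OF norm_le_l1_cart] sum_mono) (auto simp: qcube_def)
 thus ?thesis by simp
qed

lemma exists_qcube:
 fixes x0 :: "real ^ 'n::finite"
 assumes "open V" "x0 \<in> V"
 shows "\<exists>R>0. qcube x0 R \<subseteq> V" proof -
 obtain e where e: "e > 0" "ball x0 e \<subseteq> V" using assms open_contains_ball by blast
 define R where "R = e / (2 * real CARD('n))"
 have "qcube x0 R \<subseteq> ball x0 e"
 proof
  fix x assume "x \<in> qcube x0 R"
  hence "norm (x - x0) <= real CARD('n) * R" by (rule norm_le_qcube)
  also have "... < e" using e by (simp add: R_def)
  finally show "x \<in> ball x0 e" by (simp add: dist_norm norm_minus_commute)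
 qed
 moreover have "R > 0" using e by (simp add: R_def)
 ultimately show ?thesis using e(2) by blast
qed

text \<open>Pointwise convergence is evident only inside the open set, where the averages are
  eventually equal to 1. The mass outside is controlled by the total mass, which mollification does
  not increase.\<close>

lemma mol_open_L1:
 fixes V :: "(real ^ 'n::finite) set"
 assumes V: "open V" "emeasure lborel V < \<infinity>" and e: "0 < (e::real)"
 shows "\<exists>N0>0. \<forall>N\<ge>N0. (L1n (%x. mol0 N (indicator V) x - indicator V x)) < ennreal e"
proof -
 let ?f = "indicator V :: real ^ 'n => real"
 define a where "a = (%N. mol0 N ?f)"
 have [measurable]: "V \<in> sets borel" using V by auto
 have f: "integrable lborel ?f" using V by (intro integrable_real_indicator) auto
 have am [measurable]: "a N \<in> Borel" for N unfolding a_def by (rule mol_measurable[OF f])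
 have a01: "0 <= a N x" "a N x <= 1" if "0 < N" for N x
  unfolding a_def by (rule mol_bounds_const[OF f that]; simp)+
 have "((%N. LBINT x. a N x * ?f x) \<longlongrightarrow> (LBINT x. ?f x)) at_top"
 proof (rule integral_dominated_convergence_at_top[where w="?f"])
  show "\<forall>\<^sub>F N in at_top. AE x in lborel. norm (a N x * ?f x) <= ?f x"
   using eventually_gt_at_top[of 0] by eventually_elim (use a01 in \<open>auto simp: indicator_def\<close>)
  show "AE x in lborel. ((%N. a N x * ?f x) \<longlongrightarrow> ?f x) at_top" proof (rule AE_I2)
   fix x
   show "((%N. a N x * ?f x) \<longlongrightarrow> ?f x) at_top" proof (cases "x \<in> V")
    case True
    then obtain s where s: "s > 0" "qcube x s \<subseteq> V" using exists_qcube[OF V(1)] by blast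
    have "\<forall>\<^sub>F N in at_top. a N x * ?f x = ?f x" using eventually_ge_at_top[of "1 / s"]
    proof eventually_elim
     case (elim N)
     hence N: "0 < N" "1 / N <= s" using s(1) less_le_trans[of 0 "1 / s" N] by (auto simp: field_simps)
     have "1 <= a N x" unfolding a_def
      by (rule mol_bounds_const(2)[OF f N(1)]) (use s(2) N(2) in \<open>auto simp: qcube_def subset_iff indicator_def intro!: AE_I2 intro: order_trans\<close>)
     thus ?case using a01(2)[OF N(1), of x] by simp
    qed
    thus ?thesis by (rule tendsto_eventually)
   qed simp
  qed
 qed (use f in auto)
 hence "\<forall>\<^sub>F N in at_top. (LBINT x. ?f x) - e / 2 < (LBINT x. a N x * ?f x)" by (rule order_tendstoD(1)) (use e in simp)
 then obtain N1 where N1: "!!N. N \<ge> N1 ==> (LBINT x. ?f x) - e / 2 < (LBINT x. a N x * ?f x)" by (auto simp: eventually_at_top_linorder)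
 show ?thesis proof (intro exI[of _ "max 1 N1"] conjI allI impI)
  fix N assume N: "max 1 N1 <= N"
  hence N0: "0 < N" by simp
  have ai: "integrable lborel (a N)" unfolding integrable_iff_bounded
   using le_less_trans[OF mol_L1_contract[OF f N0]] f[unfolded integrable_iff_bounded] mol_measurable[OF f] by (simp add: a_def)
  have fi: "integrable lborel (%x. a N x * ?f x)"
   by (rule Bochner_Integration.integrable_bound[OF f]) (use a01[OF N0] in \<open>auto simp: indicator_def\<close>)
  have "ennreal (LBINT x. a N x) = (L1n (%x. a N x))"
   using nn_integral_eq_integral[OF ai] a01[OF N0] by simp
  also have "... <= (L1n (%x. ?f x))" unfolding a_def by (rule mol_L1_contract[OF f N0])
  also have "... = ennreal (LBINT x. ?f x)" using nn_integral_eq_integral[OF f] by simp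
  finally have le: "(LBINT x. a N x) <= (LBINT x. ?f x)" by (subst (asm) ennreal_le_iff) auto
  \<comment> \<open>Since \<open>?f\<close> takes only the values 0 and 1 and \<open>a N\<close>
    lies between them, |a - f| = a + f - 2 a f pointwise.\<close>
  have "(L1n (%x. a N x - ?f x)) = (\<integral>\<^sup>+x. ennreal (a N x + ?f x - 2 * (a N x * ?f x)) \<partial>lborel)"
   using a01[OF N0] by (intro nn_integral_cong arg_cong[where f=ennreal]) (auto simp: indicator_def)
  also have "... = ennreal (LBINT x. a N x + ?f x - 2 * (a N x * ?f x))"
   using a01[OF N0] by (intro nn_integral_eq_integral Bochner_Integration.integrable_diff Bochner_Integration.integrable_add integrable_mult_right ai f fi AE_I2) (auto simp: indicator_def)
  also have "(LBINT x. a N x + ?f x - 2 * (a N x * ?f x)) = (LBINT x. a N x) + (LBINT x. ?f x) - 2 * (LBINT x. a N x * ?f x)"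
   using ai f fi by (simp del: integral_indicator)
  also have "ennreal ... < ennreal e" using N1[of N] N le e by (intro ennreal_lessI) auto
  finally show "(L1n (%x. mol0 N ?f x - ?f x)) < ennreal e" by (simp add: a_def)
 qed simp
qed

text \<open>The contraction property transfers the closeness of \<open>f\<close> and
  \<open>g\<close> to their mollifications; each of three errors gets a third of
  \<open>e\<close>.\<close>

lemma mol_L1_approx:
 fixes f g :: "real ^ 'n::finite => real"
 assumes f: "integrable lborel f" and g: "integrable lborel g" and e: "0 < (e::real)" and N: "0 < N"
  and fg: "(L1n (%x. f x - g x)) < ennreal (e / 3)"
  and mg: "(L1n (%x. mol0 N g x - g x)) < ennreal (e / 3)"
 shows "(L1n (%x. mol0 N f x - f x)) < e" proof -
 have [measurable]: "f \<in> Borel" "g \<in> Borel"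
  "mol0 N f \<in> Borel" "mol0 N g \<in> Borel" using f g by auto
 have 1: "(L1n (%x. mol0 N f x - mol0 N g x)) < ennreal (e/3)"
  using mol_L1_contract[of "%x. f x - g x", OF _ N] f g fg by (simp add: mol_diff)
 have "(L1n (%x. mol0 N f x - f x)) <=
  (\<integral>\<^sup>+x. ennreal \<bar>mol0 N f x - mol0 N g x\<bar> + ennreal \<bar>mol0 N g x - g x\<bar> + ennreal \<bar>f x - g x\<bar> \<partial>lborel)"
  by (intro nn_integral_mono) (auto simp: ennreal_plus[symmetric] simp del: ennreal_plus intro!: ennreal_leI)
 also have "... = (L1n (%x. mol0 N f x - mol0 N g x)) + (L1n (%x. mol0 N g x - g x))
   + (L1n (%x. f x - g x))" by (simp add: nn_integral_add)
 also have "... < ennreal (e/3) + ennreal (e/3) + ennreal (e/3)" using 1 mg fg by (intro add_strict_mono)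
 also have "... = e" using e by (simp add: ennreal_plus[symmetric] del: ennreal_plus)
 finally show ?thesis .
qed

text \<open>Outer regularity reduces indicators of Borel sets to open sets; sums split the error,
  and limits of simple functions follow from the L1 contraction.\<close>

lemma mol_L1_convergence:
 fixes f :: "real ^ 'n::finite => real"
 assumes "integrable lborel f" "0 < (e::real)"
 shows "\<exists>N0>0. \<forall>N\<ge>N0. (L1n (%x. mol0 N f x - f x)) < e" using assms
proof (induction arbitrary: e rule: integrable_induct)
 case (base A c)
 define \<delta> where "\<delta> = e / (3 * (\<bar>c\<bar> + 1))"
 have de: "0 < \<delta>" "\<bar>c\<bar> * \<delta> < e / 3" using base(3) by (auto simp: \<delta>_def field_simps)
 hence cd: "ennreal \<bar>c\<bar> * ennreal \<delta> < ennreal (e / 3)" using base(3) by (simp add: ennreal_mult'[symmetric] ennreal_lessI)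
 have [measurable]: "A \<in> sets borel" using base by simp
 obtain V where V: "open V" "A \<subseteq> V" "emeasure lborel (V - A) < ennreal \<delta>" using outer_regular_lborel[of A \<delta>] de by auto
 have [measurable]: "V \<in> sets borel" using V by auto
 have "emeasure lborel V <= emeasure lborel A + emeasure lborel (V - A)"
  using V(2) emeasure_subadditive[of A lborel "V - A"] by (simp add: Un_absorb1)
 also have "... < \<infinity>" using base V(3) by (simp add: ennreal_add_less_top less_trans[OF _ ennreal_less_top])
 finally have Vf: "emeasure lborel V < \<infinity>" .
 obtain N0 where N0: "N0 > 0" "!!N. N \<ge> N0 ==> (L1n (%x. mol0 N (indicator V) x - indicator V x)) < ennreal \<delta>"
  using mol_open_L1[OF V(1) Vf de(1)] by blast
 have iV: "integrable lborel (indicator V :: real ^ 'n => real)" using Vf by (intro integrable_real_indicator) auto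
 show ?case proof (intro exI[of _ N0] conjI allI impI N0(1))
  fix N assume N: "N0 <= N"
  show "(L1n (%x. mol0 N (%x. indicator A x *\<^sub>R c) x - indicator A x *\<^sub>R c)) < ennreal e"
  proof (rule mol_L1_approx[where g="%x. c * indicator V x"])
   have "(L1n (%x. indicator A x *\<^sub>R c - c * indicator V x)) = (\<integral>\<^sup>+x. ennreal \<bar>c\<bar> * indicator (V - A) x \<partial>lborel)"
    using V(2) by (intro nn_integral_cong) (auto simp: indicator_def)
   also have "... <= ennreal \<bar>c\<bar> * ennreal \<delta>" using V(3) by (subst nn_integral_cmult_indicator) (auto intro: mult_left_mono)
   finally show "(L1n (%x. indicator A x *\<^sub>R c - c * indicator V x)) < ennreal (e / 3)" using cd by (rule le_less_trans)
   have "mol0 N (%x. c * indicator V x) x = c * mol0 N (indicator V) x" for x by (simp add: mol_def mult.assoc)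
   hence "(L1n (%x. mol0 N (%x. c * indicator V x) x - c * indicator V x)) =
     (\<integral>\<^sup>+x. ennreal \<bar>c\<bar> * ennreal \<bar>mol0 N (indicator V) x - indicator V x\<bar> \<partial>lborel)"
    by (simp add: ennreal_mult'[symmetric] abs_mult[symmetric] right_diff_distrib)
   also have "... = ennreal \<bar>c\<bar> * (L1n (%x. mol0 N (indicator V) x - indicator V x))"
    by (rule nn_integral_cmult) (use mol_measurable[OF iV] in measurable)
   also have "... <= ennreal \<bar>c\<bar> * ennreal \<delta>" using N0(2)[OF N] by (intro mult_left_mono) auto
   finally show "(L1n (%x. mol0 N (%x. c * indicator V x) x - c * indicator V x)) < ennreal (e / 3)"
    using cd by (rule le_less_trans)
  qed (use base iV N N0 in auto)
 qed
next
 case (add f g)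
 obtain N1 N2 where N1: "N1 > 0" "!!N. N \<ge> N1 ==> (L1n (%x. mol0 N f x - f x)) < ennreal (e/2)"
  and N2: "N2 > 0" "!!N. N \<ge> N2 ==> (L1n (%x. mol0 N g x - g x)) < ennreal (e/2)"
  using add(3)[of "e/2"] add(4)[of "e/2"] add(5) by auto
 have [measurable]: "f \<in> Borel" "g \<in> Borel" using add by auto
 note [measurable] = mol_measurable[OF add(1)] mol_measurable[OF add(2)]
 show ?case proof (intro exI[of _ "max N1 N2"] conjI allI impI)
  fix N assume N: "max N1 N2 <= N"
  have "(L1n (%x. mol0 N (%x. f x + g x) x - (f x + g x)))
   <= (\<integral>\<^sup>+x. ennreal \<bar>mol0 N f x - f x\<bar> + ennreal \<bar>mol0 N g x - g x\<bar> \<partial>lborel)" unfolding mol_add[OF add(1,2)]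
   by (intro nn_integral_mono) (auto simp: ennreal_plus[symmetric] simp del: ennreal_plus intro!: ennreal_leI)
  also have "... = (L1n (%x. mol0 N f x - f x)) + (L1n (%x. mol0 N g x - g x))"
   by (rule nn_integral_add) measurable
  also have "... < ennreal (e/2) + ennreal (e/2)" using N1(2)[of N] N2(2)[of N] N by (intro add_strict_mono) auto
  also have "... = e" using add(5) by (simp add: ennreal_plus[symmetric] del: ennreal_plus)
  finally show "(L1n (%x. mol0 N (%x. f x + g x) x - (f x + g x))) < ennreal e" .
 qed (use N1 in simp)
next
 case (lim f s)
 have [measurable]: "f \<in> Borel" "!!i. s i \<in> Borel" using lim by auto
 have "(%i. \<integral>\<^sup>+x. ennreal (norm (f x - s i x)) \<partial>lborel) \<longlonglongrightarrow> 0"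
 proof (rule nn_integral_dominated_convergence_norm[where w="%x. 2 * norm (f x)"])
  show "(\<integral>\<^sup>+x. ennreal (2 * norm (f x)) \<partial>lborel) < \<infinity>"
   using integrable_mult_right[OF integrable_norm[OF lim(4)], of 2] unfolding integrable_iff_bounded by simp
 qed (use lim in auto)
 hence "\<forall>\<^sub>F i in sequentially. (\<integral>\<^sup>+x. ennreal (norm (f x - s i x)) \<partial>lborel) < ennreal (e/3)"
  using lim.prems by (intro order_tendstoD(2)) auto
 then obtain i where i: "(L1n (%x. f x - s i x)) < ennreal (e/3)"
  by (auto simp: eventually_sequentially)
 thus ?case using lim(5)[of "e/3" i] lim.prems mol_L1_approx[OF lim(4) lim(1) lim.prems _ i] by (meson less_le_trans zero_less_divide_iff zero_less_numeral)
qed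

text \<open>Tangent line at \<open>m\<close> of the convex function a^p; it is the pointwise form of
  Jensen's inequality below.\<close>

lemma power_tangent:
 fixes a m :: real
 assumes "a \<ge> 0" "m \<ge> 0"
 shows "m ^ p + of_nat p * m ^ (p - 1) * (a - m) <= a ^ p" proof (induction p)
 case (Suc p)
 show ?case proof (cases p)
  case 0
  thus ?thesis by simp
 next
  case (Suc q)
  have "m ^ Suc p + of_nat (Suc p) * m ^ p * (a - m) <= a * (m ^ p + of_nat p * m ^ (p - 1) * (a - m))" proof -
   have "a * (m ^ p + of_nat p * m ^ (p - 1) * (a - m)) - (m ^ Suc p + of_nat (Suc p) * m ^ p * (a - m))
     = of_nat p * m ^ (p - 1) * (a - m)^2" using Suc by (simp add: algebra_simps power2_eq_square)
   moreover have "... \<ge> 0" using assms by simp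
   ultimately show ?thesis by linarith
  qed
  also have "... <= a * a ^ p" using Suc.IH assms by (intro mult_left_mono) auto
  finally show ?thesis by simp
 qed
qed simp

text \<open>The kernel is a probability density, and the tangent line is taken at the mean
  \<open>m\<close> of |f|, where its linear term integrates to zero.\<close>

lemma mol_jensen:
 fixes f :: "real ^ 'n::finite => real"
 assumes f: "integrable lborel f" and fp: "integrable lborel (%z. \<bar>f z\<bar> ^ p)" and N: "N > 0"
 shows "\<bar>mol0 N f x\<bar> ^ p <= mol0 N (%z. \<bar>f z\<bar> ^ p) x" proof -
 let ?k = "%z. ker0 N (x - z)"
 have kn: "!!y :: real ^ 'n. 0 <= ker0 N y" by (rule ker_nonneg[OF N])
 have fa: "integrable lborel (%z. \<bar>f z\<bar>)" using f by auto
 define m where "m = (LBINT z. (\<bar>f z\<bar> * ?k z))"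
 have m0: "m \<ge> 0" unfolding m_def using kn by (intro integral_nonneg_AE AE_I2) auto
 have "\<bar>mol0 N f x\<bar> <= (LBINT z. (\<bar>f z * ?k z\<bar>))" unfolding mol_def by (rule integral_abs_bound)
 also have "... = m" unfolding m_def using kn by (simp add: abs_mult)
 finally have "\<bar>mol0 N f x\<bar> ^ p <= m ^ p" by (intro power_mono) auto
 also have "m ^ p = (LBINT z. (m ^ p - of_nat p * m ^ (p - 1) * m) * ?k z + of_nat p * m ^ (p - 1) * (\<bar>f z\<bar> * ?k z))"
  by (subst Bochner_Integration.integral_add)
    (use ker_integrable[OF N] mol_integrable[OF fa] ker_integral[OF N, of x] in \<open>auto simp: m_def[symmetric]\<close>)
 also have "... <= mol0 N (%z. \<bar>f z\<bar> ^ p) x" unfolding mol_def proof (rule integral_mono)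
  show "integrable lborel (%z. (m ^ p - of_nat p * m ^ (p - 1) * m) * ?k z + of_nat p * m ^ (p - 1) * (\<bar>f z\<bar> * ?k z))"
   using ker_integrable[OF N] mol_integrable[OF fa] by (intro Bochner_Integration.integrable_add integrable_mult_right) auto
  show "integrable lborel (%z. \<bar>f z\<bar> ^ p * ?k z)" by (rule mol_integrable[OF fp])
  fix z
  have "(m ^ p - of_nat p * m ^ (p - 1) * m) * ?k z + of_nat p * m ^ (p - 1) * (\<bar>f z\<bar> * ?k z) =
   (m ^ p + of_nat p * m ^ (p - 1) * (\<bar>f z\<bar> - m)) * ?k z" by (simp add: algebra_simps)
  also have "... <= \<bar>f z\<bar> ^ p * ?k z" using power_tangent[of "\<bar>f z\<bar>" m p] m0 kn by (intro mult_right_mono) auto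
  finally show "(m ^ p - of_nat p * m ^ (p - 1) * m) * ?k z + of_nat p * m ^ (p - 1) * (\<bar>f z\<bar> * ?k z) <= \<bar>f z\<bar> ^ p * ?k z" .
 qed
 finally show ?thesis .
qed

subsection \<open>Weak derivatives\<close>

text \<open>The support condition is imposed factor by factor, so that it survives replacing one
  factor by its derivative.\<close>

definition box_test :: "(real ^ 'n::finite) set => ('n => real => real) => bool" where
 "box_test U h \<longleftrightarrow> (\<forall>j. h j \<in> sm1) \<and>
   (\<exists>a b. cbox a b \<subseteq> U \<and> (\<forall>i t. t \<notin> {a $ i .. b $ i} --> h i t = 0))"

text \<open>Test functions are restricted to products. These include the mollifying kernels, which
  suffice to identify locally integrable functions almost everywhere.\<close>

definition wder :: "(real ^ 'n::finite) set => 'n => (real ^ 'n => real) => (real ^ 'n => real) => bool" where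
 "wder U i f g \<longleftrightarrow> (\<forall>h. box_test U h -->
   (LBINT x. f x * ptest (h(i := deriv (h i))) x) = - (LBINT x. g x * ptest h x))"

text \<open>Borel measurability on the whole space is built in, so that every integral can be taken
  over \<open>lborel\<close> and Fubini and affine substitutions apply directly.\<close>

definition loc_int :: "(real ^ 'n::finite) set => (real ^ 'n => real) => bool" where
 "loc_int U f \<longleftrightarrow> f \<in> Borel \<and> (\<forall>K. compact K \<and> K \<subseteq> U --> integrable lborel (%x. indicator K x * f x))"

lemma deriv_zero_outside:
 fixes f :: "real => real"
 assumes "!!t. t \<notin> {a..b} ==> f t = 0" "t \<notin> {a..b}"
 shows "deriv f t = 0" proof -
 have "\<forall>\<^sub>F s in nhds t. s \<in> - {a..b}" using assms(2) by (intro eventually_nhds_in_open) auto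
 hence "\<forall>\<^sub>F s in nhds t. f s = 0" by eventually_elim (auto intro!: assms(1))
 hence "DERIV f t :> 0" by (subst DERIV_cong_ev[OF refl _ refl, of _ "%t. 0"]) auto
 thus ?thesis by (rule DERIV_imp_deriv)
qed

lemma box_test_deriv: "box_test U h ==> box_test U (h(i := deriv (h i)))" unfolding box_test_def
proof (elim conjE exE, intro conjI allI)
 fix a b j assume h: "\<forall>j. h j \<in> sm1" "cbox a b \<subseteq> U" "\<forall>i t. t \<notin> {a $ i..b $ i} --> h i t = 0"
 show "(h(i := deriv (h i))) j \<in> sm1" using h(1) sm1_deriv by auto
 have "\<forall>k t. t \<notin> {a $ k..b $ k} --> (h(i := deriv (h i))) k t = 0" proof (intro allI impI)
  fix k t assume "t \<notin> {a $ k..b $ k}"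
  thus "(h(i := deriv (h i))) k t = 0" using h(3) deriv_zero_outside[of "a $ i" "b $ i" "h i" t] by (cases "k = i") auto
 qed
 thus "\<exists>a b. cbox a b \<subseteq> U \<and> (\<forall>k t. t \<notin> {a $ k..b $ k} --> (h(i := deriv (h i))) k t = 0)"
  using h(2) by blast
qed

text \<open>Euler's identity is tested with x_j times a test function; this product has to be
  admissible again.\<close>

lemma box_test_ident: "box_test U h ==> box_test U (h(i := %t. t * h i t))" unfolding box_test_def
proof (elim conjE exE, intro conjI allI)
 fix a b j assume h: "\<forall>j. h j \<in> sm1" "cbox a b \<subseteq> U" "\<forall>i t. t \<notin> {a $ i..b $ i} --> h i t = 0"
 show "(h(i := %t. t * h i t)) j \<in> sm1" using h(1) sm1.mult[OF sm1.ident] by auto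
 show "\<exists>a b. cbox a b \<subseteq> U \<and> (\<forall>k t. t \<notin> {a $ k..b $ k} --> (h(i := %t. t * h i t)) k t = 0)"
  using h(2,3) by (intro exI[of _ a] exI[of _ b]) auto
qed

lemma box_test_support:
 assumes "box_test U h"
 obtains K where "compact K" "K \<subseteq> U" "!!x. x \<notin> K ==> ptest h x = 0"
  "!!i x. x \<notin> K ==> ptest (h(i := deriv (h i))) x = 0" "!!V. K \<subseteq> V ==> box_test V h"
proof -
 obtain a b where ab: "cbox a b \<subseteq> U" "!!i t. t \<notin> {a $ i .. b $ i} ==> h i t = 0"
  using assms by (auto simp: box_test_def)
 have sm: "!!j. h j \<in> sm1" using assms by (simp add: box_test_def)
 have z: "ptest h' x = 0" if "x \<notin> cbox a b" "!!i t. t \<notin> {a $ i .. b $ i} ==> h' i t = 0" for x h' proof -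
  obtain i where "x $ i \<notin> {a $ i .. b $ i}" using \<open>x \<notin> cbox a b\<close> by (auto simp: mem_box_cart)
  hence "h' i (x $ i) = 0" by (rule that(2))
  thus ?thesis unfolding ptest_def by (intro prod_zero) auto
 qed
 show thesis proof (rule that[of "cbox a b"])
  fix i x assume "x \<notin> cbox a b"
  thus "ptest (h(i := deriv (h i))) x = 0" using ab(2) deriv_zero_outside[of "a $ i" "b $ i" "h i"] by (intro z) auto
 next
  fix V assume "cbox a b \<subseteq> V"
  thus "box_test V h" using ab(2) sm unfolding box_test_def by blast
 qed (use ab z in \<open>auto simp: compact_cbox\<close>)
qed

lemma ptest_borel [measurable]: "(!!i. h i \<in> sm1) ==> ptest h \<in> Borel"
 by (rule borel_measurable_continuous_onI[OF continuous_on_ptest[of h]])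

lemma box_test_bounded:
 assumes "box_test U h"
 shows "\<exists>C. \<forall>x. \<bar>ptest h x\<bar> <= C" proof -
 obtain K where K: "compact K" "!!x. x \<notin> K ==> ptest h x = 0" using box_test_support[OF assms] by metis
 have sm: "h i \<in> sm1" for i using assms by (simp add: box_test_def)
 have "compact (ptest h ` K)" by (rule compact_continuous_image[OF continuous_on_ptest[of h, OF sm] K(1)])
 then obtain C where C: "\<forall>y\<in>ptest h ` K. norm y <= C" using compact_imp_bounded bounded_iff by metis
 have "\<bar>ptest h x\<bar> <= max C 0" for x proof (cases "x \<in> K")
  case True
  thus ?thesis using C by auto
 next
  case False
  thus ?thesis using K(2) by simp
 qed
 thus ?thesis by blast
qed

lemma loc_int_test:
 assumes f: "loc_int U f" and h: "box_test U h"
 shows "integrable lborel (%x. f x * ptest h x)" proof -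
 obtain K where K: "compact K" "K \<subseteq> U" "!!x. x \<notin> K ==> ptest h x = 0" using box_test_support[OF h] by metis
 obtain C where C: "!!x. \<bar>ptest h x\<bar> <= C" using box_test_bounded[OF h] by blast
 have sm: "h i \<in> sm1" for i using h by (simp add: box_test_def)
 have [measurable]: "f \<in> Borel" "ptest h \<in> Borel"
  using f ptest_borel[of h, OF sm] by (auto simp: loc_int_def)
 have i: "integrable lborel (%x. indicator K x * f x)" using f K by (simp add: loc_int_def)
 show ?thesis proof (rule Bochner_Integration.integrable_bound[OF integrable_mult_left[OF i, of C]])
  show "AE x in lborel. norm (f x * ptest h x) <= norm (indicator K x * f x * C)" proof (rule AE_I2)
   fix x
   show "norm (f x * ptest h x) <= norm (indicator K x * f x * C)"
    using K(3)[of x] C[of x] by (cases "x \<in> K") (auto simp: abs_mult intro!: mult_left_mono)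
  qed
 qed measurable
qed

lemma iter_partial_ptest_box:
 fixes h :: "'n::finite => real => real"
 assumes "box_test U h"
 shows "\<exists>g. box_test U g \<and> iter_partial is (ptest h) = ptest g" proof (induction "is")
 case Nil
 thus ?case using assms by (auto simp: iter_partial_def)
next
 case (Cons a "is")
 then obtain g where g: "box_test U g" "iter_partial is (ptest h) = ptest g" by auto
 hence "g i \<in> sm1" for i by (simp add: box_test_def)
 thus ?case using partial_deriv_ptest[of g a] g(2) box_test_deriv[OF g(1)] by (auto simp: iter_partial_def)
qed

lemma box_test_test_function: "box_test U h ==> test_function U (ptest h)"
 unfolding box_test_def using test_function_ptest by blast

text \<open>Cutting off along a compact exhaustion shows that the function extended by 0 is Lebesgue
  measurable, and such a function agrees almost everywhere with a Borel one.\<close>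

lemma borel_rep:
 fixes f :: "real ^ 'n::finite => real"
 assumes "open U" "locally_integrable U f"
 shows "\<exists>f'. loc_int U f' \<and> (AE x\<in>U in lborel. f x = f' x)" proof -
 obtain C where C: "!!n. compact (C n)" "!!n. C n \<subseteq> U" "!!n::nat. C n \<subseteq> interior (C (Suc n))" "\<Union>(range C) = U"
  using open_Union_compact_subsets[OF assms(1)] by metis
 have mono: "C n \<subseteq> C m" if "n <= m" for n m
  using that by (rule lift_Suc_mono_le[of C, rotated]) (meson C(3) interior_subset order_trans)
 have "(%x. indicator U x *\<^sub>R f x) \<in> borel_measurable lebesgue" proof (rule borel_measurable_LIMSEQ_real)
  show "(%x. indicator (C n) x *\<^sub>R f x) \<in> borel_measurable lebesgue" for n
   using assms(2) C(1,2)[of n] unfolding locally_integrable_def set_integrable_def by auto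
  fix x
  show "(%n. indicator (C n) x *\<^sub>R f x) \<longlonglongrightarrow> indicator U x *\<^sub>R f x" proof (cases "x \<in> U")
   case True
   then obtain n where n: "x \<in> C n" using C(4) by blast
   have "\<forall>\<^sub>F m in sequentially. indicator (C m) x *\<^sub>R f x = indicator U x *\<^sub>R f x"
    using eventually_ge_at_top[of n] by eventually_elim (use mono n True in \<open>auto simp: indicator_def\<close>)
   thus ?thesis by (rule tendsto_eventually)
  next
   case False
   hence "indicator (C m) x *\<^sub>R f x = indicator U x *\<^sub>R f x" for m using C(2) by (auto simp: indicator_def)
   thus ?thesis by (simp only: tendsto_const)
  qed
 qed
 then obtain f' where f': "f' \<in> borel_measurable lborel" "AE x in lborel. indicator U x *\<^sub>R f x = f' x"
  using completion_ex_borel_measurable_real by blast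
 have ae: "AE x\<in>U in lborel. f x = f' x" using f'(2) by eventually_elim auto
 have "loc_int U f'" unfolding loc_int_def proof (intro conjI allI impI, use f' in simp)
  fix K assume K: "compact K \<and> K \<subseteq> U"
  hence [measurable]: "K \<in> sets borel" by (simp add: compact_imp_closed)
  have [measurable]: "f' \<in> Borel" using f' by simp
  have "integrable lebesgue (%x. indicator K x *\<^sub>R f x)"
   using assms(2) K unfolding locally_integrable_def set_integrable_def by blast
  moreover have "AE x in lebesgue. indicator K x *\<^sub>R f x = indicator K x * f' x"
   using AE_completion[OF ae] by eventually_elim (use K in \<open>auto simp: indicator_def\<close>)
  ultimately have "integrable lebesgue (%x. indicator K x * f' x)"
   by (subst integrable_cong_AE[of _ _ "%x. indicator K x *\<^sub>R f x"]) (auto elim: eventually_mono intro: measurable_completion)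
  thus "integrable lborel (%x. indicator K x * f' x)" by (subst (asm) integrable_completion) auto
 qed
 thus ?thesis using ae by blast
qed

text \<open>Bridge from weak derivatives with respect to \<open>lebesgue\<close>, as in the
  statement, to Borel representatives integrated over \<open>lborel\<close>.\<close>

lemma weak_deriv_lborel:
 fixes f :: "real ^ 'n::finite => real"
 assumes w: "has_weak_deriv U is f g" and f': "loc_int U f'" "AE x\<in>U in lborel. f x = f' x"
  and g': "loc_int U g'" "AE x\<in>U in lborel. g x = g' x" and h: "box_test U h" and U: "open U"
 shows "(LBINT x. f' x * iter_partial is (ptest h) x) = (- 1) ^ length is * (LBINT x. g' x * ptest h x)" proof -
 have conv: "(LINT x:U|lebesgue. k x * ptest h' x) = (LBINT x. k' x * ptest h' x)"
  if k: "loc_int U k'" "AE x\<in>U in lborel. k x = k' x" and h': "box_test U h'" and lk: "locally_integrable U k" for k k' h' proof -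
  obtain K where K: "compact K" "K \<subseteq> U" "!!x. x \<notin> K ==> ptest h' x = 0" using box_test_support[OF h'] by metis
  have sm: "h' i \<in> sm1" for i using h' by (simp add: box_test_def)
  have [measurable]: "k' \<in> Borel" "ptest h' \<in> Borel"
   using k ptest_borel[of h', OF sm] by (auto simp: loc_int_def)
  have ae: "AE x in lebesgue. indicator U x *\<^sub>R (k x * ptest h' x) = k' x * ptest h' x"
   using AE_completion[OF k(2)] by eventually_elim (use K in \<open>auto simp: indicator_def\<close>)
  have m': "(%x. k' x * ptest h' x) \<in> borel_measurable lebesgue" by (intro measurable_completion) measurable
  have "(LINT x:U|lebesgue. k x * ptest h' x) = (\<integral>x. k' x * ptest h' x \<partial>lebesgue)" unfolding set_lebesgue_integral_def
  proof (rule integral_cong_AE[OF _ m' ae])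
   have "AE x in lebesgue. k' x * ptest h' x = indicator U x *\<^sub>R (k x * ptest h' x)" using ae by eventually_elim (rule sym)
   thus "(%x. indicator U x *\<^sub>R (k x * ptest h' x)) \<in> borel_measurable lebesgue"
    by (rule borel_measurable_AE[OF m'])
  qed
  also have "... = (LBINT x. k' x * ptest h' x)" by (rule integral_completion) measurable
  finally show ?thesis .
 qed
 obtain g0 where g0: "box_test U g0" "iter_partial is (ptest h) = ptest g0" using iter_partial_ptest_box[OF h] by blast
 have li: "locally_integrable U f" "locally_integrable U g" using w by (auto simp: has_weak_deriv_def)
 have "(LINT x:U|lebesgue. f x * iter_partial is (ptest h) x) = (- 1) ^ length is * (LINT x:U|lebesgue. g x * ptest h x)"
  using w box_test_test_function[OF h] by (simp add: has_weak_deriv_def)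
 thus ?thesis unfolding g0(2) conv[OF f' g0(1) li(1)] conv[OF g' h li(2)] .
qed

lemma kernel_box_test:
 fixes x :: "real ^ 'n::finite"
 assumes N: "N > 0" and sub: "qcube x (1/N) \<subseteq> U"
 shows "box_test U (%j z. dbump (\<kappa> j) (N * (x $ j - z)))" unfolding box_test_def proof (intro conjI allI)
 fix j
 show "(%z. dbump (\<kappa> j) (N * (x $ j - z))) \<in> sm1"
  using sm1_affine[OF dbump_sm1[of "\<kappa> j"], of "N * x $ j" "- N"] by (simp add: algebra_simps)
next
 show "\<exists>a b. cbox a b \<subseteq> U \<and> (\<forall>i t. t \<notin> {a $ i..b $ i} --> dbump (\<kappa> i) (N * (x $ i - t)) = 0)"
 proof (intro exI conjI allI impI)
  show "cbox (x - (\<chi> i. 1/N)) (x + (\<chi> i. 1/N)) \<subseteq> U" using sub by (simp add: qcube_eq_cbox)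
  fix i t assume "t \<notin> {(x - (\<chi> i. 1 / N)) $ i..(x + (\<chi> i. 1 / N)) $ i}"
  hence "\<bar>x $ i - t\<bar> > 1 / N" by auto
  hence "1 < N * \<bar>x $ i - t\<bar>" using N by (simp add: field_simps)
  hence "\<bar>N * (x $ i - t)\<bar> > 1" using N by (simp only: abs_mult abs_of_pos)
  thus "dbump (\<kappa> i) (N * (x $ i - t)) = 0" by (rule dbump_eq_0)
 qed
qed

lemma ker_ptest:
 "ker N \<kappa> (x - z) = N ^ CARD('n::finite) / kmass TYPE(real ^ 'n) * (\<Prod>i\<in>UNIV. N ^ \<kappa> i) *
   ptest (%j z. dbump (\<kappa> j) (N * (x $ j - z))) (z :: real ^ 'n)" by (simp add: ker_def ptest_def prod.distrib)

text \<open>As a function of z the kernel at x - z is a product test function. Differentiating it in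
  z instead of x changes the sign, which cancels the sign in the definition of a weak
  derivative.\<close>

lemma mol_wder:
 fixes f g :: "real ^ 'n::finite => real"
 assumes w: "wder U i f g" and N: "N > 0" and sub: "qcube x (1/N) \<subseteq> K" "K \<subseteq> U"
 shows "mol N (\<kappa>(i := Suc (\<kappa> i))) (%z. indicator K z * f z) x = mol N \<kappa> (%z. indicator K z * g z) x"
proof -
 define c where "c = N ^ CARD('n) / kmass TYPE(real ^ 'n) * (\<Prod>i\<in>UNIV. N ^ \<kappa> i)"
 define h where "h = (%j z. dbump (\<kappa> j) (N * (x $ j - z)))"
 have bt: "box_test U h" unfolding h_def by (rule kernel_box_test[OF N]) (use sub in blast)
 have dh: "deriv (h i) z = - N * dbump (Suc (\<kappa> i)) (N * (x $ i - z))" for z proof -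
  have "DERIV (%z. N * (x $ i - z)) z :> (- N)" by (auto intro!: derivative_eq_intros)
  from DERIV_chain'[OF this DERIV_dbump] have "DERIV (h i) z :> dbump (Suc (\<kappa> i)) (N * (x $ i - z)) * - N"
   unfolding h_def .
  thus ?thesis by (simp add: DERIV_imp_deriv mult.commute)
 qed
 have "ptest (h(i := deriv (h i))) z = - N * ptest (%j z. dbump ((\<kappa>(i := Suc (\<kappa> i))) j) (N * (x $ j - z))) z" for z
 proof -
  have "ptest (h(i := deriv (h i))) z = deriv (h i) (z $ i) * (\<Prod>j\<in>UNIV - {i}. h j (z $ j))"
   unfolding ptest_def by (subst prod.remove[of _ i]) (auto intro!: prod.cong)
  moreover have "ptest (%j z. dbump ((\<kappa>(i := Suc (\<kappa> i))) j) (N * (x $ j - z))) z =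
    dbump (Suc (\<kappa> i)) (N * (x $ i - z $ i)) * (\<Prod>j\<in>UNIV - {i}. h j (z $ j))"
   unfolding ptest_def h_def by (subst prod.remove[of _ i]) (auto intro!: prod.cong)
  ultimately show ?thesis by (simp add: dh)
 qed
 moreover have "(\<Prod>j\<in>UNIV. N ^ (\<kappa>(i := Suc (\<kappa> i))) j) = N * (\<Prod>j\<in>UNIV. N ^ \<kappa> j)"
  by (subst (1 2) prod.remove[of _ i]) (auto intro!: prod.cong)
 ultimately have k1: "ker N (\<kappa>(i := Suc (\<kappa> i))) (x - z) = - c * ptest (h(i := deriv (h i))) z" for z
  by (simp add: ker_ptest c_def)
 have k0: "ker N \<kappa> (x - z) = c * ptest h z" for z by (simp add: ker_ptest c_def h_def)
 have "mol N (\<kappa>(i := Suc (\<kappa> i))) (%z. indicator K z * f z) x = (LBINT z. f z * ker N (\<kappa>(i := Suc (\<kappa> i))) (x - z))"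
  unfolding mol_def using ker_eq_0_qcube[OF N, of _ x] sub by (intro Bochner_Integration.integral_cong) (auto simp: indicator_def)
 also have "... = c * (LBINT z. g z * ptest h z)" using w bt unfolding k1 wder_def by (simp add: algebra_simps)
 also have "... = (LBINT z. (g z * ker N \<kappa> (x - z)))"
  unfolding k0 by (subst integral_mult_right_zero[symmetric]) (simp add: algebra_simps)
 also have "... = mol N \<kappa> (%z. indicator K z * g z) x"
  unfolding mol_def using ker_eq_0_qcube[OF N, of _ x] sub by (intro Bochner_Integration.integral_cong) (auto simp: indicator_def)
 finally show ?thesis .
qed

lemma compact_enlarge:
 fixes K :: "(real ^ 'n::finite) set"
 assumes "compact K" "open U" "K \<subseteq> U"
 obtains \<delta> K' where "\<delta> > 0" "compact K'" "K' \<subseteq> U" "!!x. x \<in> K ==> qcube x \<delta> \<subseteq> K'"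
proof (cases "K = {}")
 case True
 thus thesis using that[of 1 "{}"] by auto
next
 case False
 obtain e where e: "e > 0" "(\<Union>x\<in>K. cball x e) \<subseteq> U"
  using compact_subset_open_imp_cball_epsilon_subset[OF assms(1,2,3)] by blast
 let ?K' = "{x + y |x y. x \<in> K \<and> y \<in> cball 0 e}"
 show thesis proof (rule that[of "e / real CARD('n)" ?K'])
  show "0 < e / real CARD('n)" using e by simp
  show "compact ?K'" by (rule compact_sums[OF assms(1) compact_cball])
  show "?K' \<subseteq> U" using e(2) by (force simp: dist_norm)
  fix x assume x: "x \<in> K"
  show "qcube x (e / real CARD('n)) \<subseteq> ?K'"
  proof
   fix z assume "z \<in> qcube x (e / real CARD('n))"
   thus "z \<in> ?K'" using norm_le_qcube[of z x "e / real CARD('n)"] x by force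
  qed
 qed
qed

lemma open_AE_compacts:
 fixes U :: "(real ^ 'n::finite) set"
 assumes "open U" "!!K. compact K ==> K \<subseteq> U ==> AE x\<in>K in lborel. P x"
 shows "AE x\<in>U in lborel. P x" proof -
 obtain C where C: "!!n. compact (C n)" "!!n. C n \<subseteq> U" "\<Union>(range (C :: nat => _)) = U"
  using open_Union_compact_subsets[OF assms(1)] by metis
 have "AE x in lborel. \<forall>n. x \<in> C n --> P x" unfolding AE_all_countable using assms(2) C by blast
 thus ?thesis by eventually_elim (use C(3) in blast)
qed

lemma qcube_mono: "r <= s ==> qcube x r \<subseteq> qcube x s" by (auto simp: qcube_def intro: order_trans)

text \<open>The mollifications are nonnegative on a compact set once the kernel is narrow, and they
  converge to \<open>f\<close> in L1; so the negative part of \<open>f\<close> has integral at most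
  every positive number there.\<close>

lemma fundamental_lemma:
 fixes f :: "real ^ 'n::finite => real"
 assumes U: "open U" and f: "loc_int U f"
  and pos: "!!x N. N > 0 ==> qcube x (1/N) \<subseteq> U ==> 0 <= (LBINT z. f z * ker0 N (x - z))"
 shows "AE x\<in>U in lborel. 0 <= f x" proof (rule open_AE_compacts[OF U])
 fix K assume K: "compact K" "K \<subseteq> U"
 obtain \<delta> K' where K': "\<delta> > 0" "compact K'" "K' \<subseteq> U" "!!x. x \<in> K ==> qcube x \<delta> \<subseteq> K'"
  using compact_enlarge[OF K(1) U K(2)] by blast
 have [measurable]: "K \<in> sets borel" "K' \<in> sets borel" "f \<in> Borel"
  using K K' f by (auto simp: compact_imp_closed loc_int_def)
 define F where "F = (%z. indicator K' z * f z)"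
 have F: "integrable lborel F" unfolding F_def using f K' by (simp add: loc_int_def)
 have [measurable]: "F \<in> Borel" using F by auto
 have KK': "x \<in> K'" if "x \<in> K" for x using K'(4)[OF that] K'(1) qcube_self[of \<delta> x] by auto
 have main: "(\<integral>\<^sup>+x. ennreal (- f x) * indicator K x \<partial>lborel) <= ennreal e" if e: "e > 0" for e proof -
  obtain N0 where N0: "N0 > 0" "!!N. N \<ge> N0 ==> (L1n (%x. mol0 N F x - F x)) < ennreal e"
   using mol_L1_convergence[OF F e] by blast
  define N where "N = max N0 (1 / \<delta>)"
  have N: "N \<ge> N0" "N > 0" "1 / N <= \<delta>" using N0(1) K'(1) by (auto simp: N_def field_simps max_def)
  have "(\<integral>\<^sup>+x. ennreal (- f x) * indicator K x \<partial>lborel) <= (L1n (%x. mol0 N F x - F x))"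
  proof (rule nn_integral_mono)
   fix x
   show "ennreal (- f x) * indicator K x <= ennreal \<bar>mol0 N F x - F x\<bar>" proof (cases "x \<in> K")
    case True
    have sub: "qcube x (1/N) \<subseteq> K'" using K'(4)[OF True] qcube_mono[OF N(3), of x] by blast
    have "mol0 N F x = (LBINT z. f z * ker0 N (x - z))"
     unfolding mol_def F_def using ker_eq_0_qcube[OF N(2), of _ x] sub
     by (intro Bochner_Integration.integral_cong) (auto simp: indicator_def)
    also have "... \<ge> 0" by (rule pos[OF N(2)]) (use sub K' in blast)
    finally have "0 <= mol0 N F x" .
    moreover have "F x = f x" using KK'[OF True] by (simp add: F_def)
    ultimately have "- f x <= \<bar>mol0 N F x - F x\<bar>" by linarith
    thus ?thesis using True by (simp add: ennreal_leI)
   qed simp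
  qed
  thus ?thesis using N0(2)[OF N(1)] by simp
 qed
 have "(\<integral>\<^sup>+x. ennreal (- f x) * indicator K x \<partial>lborel) <= 0"
  by (rule ennreal_le_epsilon) (simp only: add_0 main)
 hence "(\<integral>\<^sup>+x. ennreal (- f x) * indicator K x \<partial>lborel) = 0" by (simp only: le_zero_eq)
 hence "AE x in lborel. ennreal (- f x) * indicator K x = 0" proof (subst (asm) nn_integral_0_iff_AE)
  show "(%x. ennreal (- f x) * indicator K x) \<in> borel_measurable lborel" by measurable
 qed
 thus "AE x\<in>K in lborel. 0 <= f x" proof eventually_elim
  case (elim x)
  show ?case using elim ennreal_eq_0_iff[of "- f x"] by auto
 qed
qed

lemma fundamental_lemma_eq:
 fixes f g :: "real ^ 'n::finite => real"
 assumes U: "open U" and f: "loc_int U f" and g: "loc_int U g"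
  and eq: "!!h. box_test U h ==> (LBINT z. f z * ptest h z) = (LBINT z. g z * ptest h z)"
 shows "AE x\<in>U in lborel. f x = g x" proof -
 have li: "loc_int U (%x. f x - g x)" "loc_int U (%x. g x - f x)" using f g by (auto simp: loc_int_def right_diff_distrib)
 have k: "(LBINT z. f z * ker0 N (x - z)) = (LBINT z. g z * ker0 N (x - z)) \<and>
   integrable lborel (%z. f z * ker0 N (x - z)) \<and> integrable lborel (%z. g z * ker0 N (x - z))"
  if "N > 0" "qcube x (1/N) \<subseteq> U" for N x proof -
  define h where "h = (%(j::'n) z. dbump 0 (N * (x $ j - z)))"
  have bt: "box_test U h" unfolding h_def by (rule kernel_box_test[OF that, of "%_. 0"])
  have e: "(k :: real ^ 'n => real) z * ker0 N (x - z) = N ^ CARD('n) / kmass TYPE(real ^ 'n) * (k z * ptest h z)" for k z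
   by (simp add: ker_ptest h_def)
  show ?thesis unfolding e using eq[OF bt] loc_int_test[OF f bt] loc_int_test[OF g bt] by simp
 qed
 have "AE x\<in>U in lborel. 0 <= f x - g x"
  by (rule fundamental_lemma[OF U li(1)]) (use k in \<open>simp add: left_diff_distrib\<close>)
 moreover have "AE x\<in>U in lborel. 0 <= g x - f x"
  by (rule fundamental_lemma[OF U li(2)]) (use k in \<open>simp add: left_diff_distrib\<close>)
 ultimately show ?thesis by eventually_elim auto
qed

lemma box_test_scale:
 assumes h: "box_test V h" and t: "t > 0" and V: "!!x. x \<in> V ==> t *\<^sub>R x \<in> U"
 shows "box_test U (%j s. h j (s / t))" proof -
 obtain a b where ab: "!!j. h j \<in> sm1" "cbox a b \<subseteq> V" "!!i s. s \<notin> {a $ i .. b $ i} ==> h i s = 0"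
  using h by (auto simp: box_test_def)
 show ?thesis unfolding box_test_def proof (intro conjI allI)
  show "(%s. h j (s / t)) \<in> sm1" for j using sm1_affine[OF ab(1)[of j], of 0 "1/t"] by simp
  have 1: "cbox (t *\<^sub>R a) (t *\<^sub>R b) \<subseteq> U"
  proof
   fix z assume "z \<in> cbox (t *\<^sub>R a) (t *\<^sub>R b)"
   hence "(1 / t) *\<^sub>R z \<in> cbox a b" using t by (auto simp: mem_box_cart field_simps)
   hence "t *\<^sub>R ((1 / t) *\<^sub>R z) \<in> U" using ab(2) by (intro V) auto
   thus "z \<in> U" using t by simp
  qed
  have 2: "h i (s / t) = 0" if "s \<notin> {(t *\<^sub>R a) $ i..(t *\<^sub>R b) $ i}" for i s proof -
   have "s / t \<notin> {a $ i .. b $ i}" using t that by (auto simp: field_simps)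
   thus "h i (s / t) = 0" by (rule ab(3))
  qed
  show "\<exists>a b. cbox a b \<subseteq> U \<and> (\<forall>i s. s \<notin> {a $ i..b $ i} --> h i (s / t) = 0)"
   using 1 2 by blast
 qed
qed

lemma loc_int_cmult: "loc_int U f ==> V \<subseteq> U ==> loc_int V (%x. c * f x)" unfolding loc_int_def
proof (elim conjE, intro conjI allI impI)
 fix K assume *: "\<forall>K. compact K \<and> K \<subseteq> U --> integrable lborel (%x. indicat_real K x * f x)" "V \<subseteq> U" "compact K \<and> K \<subseteq> V"
 hence "integrable lborel (%x. indicat_real K x * f x)" by blast
 thus "integrable lborel (%x. indicat_real K x * (c * f x))" by (simp add: mult.left_commute)
qed measurable

lemma ptest_scale: "ptest (%j s. h j (s / t)) z = ptest h ((1 / t) *\<^sub>R z)" by (simp add: ptest_def)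

lemma deriv_scale:
 assumes "f \<in> sm1" "t > 0"
 shows "deriv (%s. f (s / t)) = (%s. (1 / t) * deriv f (s / t))"
proof
 fix s
 have "DERIV (%s. s / t) s :> 1/t" using assms(2) by (auto intro!: derivative_eq_intros)
 from DERIV_chain'[OF this sm1_DERIV[OF assms(1)]] have "DERIV (%s. f (s / t)) s :> deriv f (s/t) * (1/t)" .
 thus "deriv (%s. f (s / t)) s = (1 / t) * deriv f (s / t)" by (simp add: DERIV_imp_deriv)
qed

subsection \<open>Homogeneity and Euler's identity\<close>

text \<open>The exceptional null set may depend on t. Both x and t x are required to lie in
  \<open>U\<close>, so that the notion passes to subsets that are not cones.\<close>

definition hom_AE :: "(real ^ 'n::finite) set => real => (real ^ 'n => real) => bool" where
 "hom_AE U \<gamma> f \<longleftrightarrow> (\<forall>t>0. AE x in lborel. x \<in> U \<and> t *\<^sub>R x \<in> U --> f (t *\<^sub>R x) = t powr \<gamma> * f x)"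

lemma loc_int_borel: "loc_int U f ==> f \<in> Borel" by (simp add: loc_int_def)

lemma box_test_sm1: "box_test U h ==> h j \<in> sm1" by (simp add: box_test_def)

lemma hom_AE_integral:
 fixes f :: "real ^ 'n::finite => real"
 assumes f: "loc_int U f" and hom: "hom_AE U \<gamma> f" and t: "t > 0"
  and h: "box_test V h" and V: "V \<subseteq> U" "!!x. x \<in> V ==> t *\<^sub>R x \<in> U"
 shows "(LBINT z. f z * ptest h ((1/t) *\<^sub>R z)) = t ^ CARD('n) * t powr \<gamma> * (LBINT x. f x * ptest h x)" proof -
 obtain K where K: "compact K" "K \<subseteq> V" "!!x. x \<notin> K ==> ptest h x = 0" using box_test_support[OF h] by metis
 note [measurable] = loc_int_borel[OF f] ptest_borel[of h, OF box_test_sm1[OF h]]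
 have "(LBINT x. f (0 + t *\<^sub>R x) * ptest h ((1/t) *\<^sub>R (0 + t *\<^sub>R x))) = (LBINT z. f z * ptest h ((1/t) *\<^sub>R z)) / \<bar>t\<bar> ^ CARD('n)"
  by (rule lborel_integral_affine) (use t in auto)
 moreover have "(LBINT x. f (0 + t *\<^sub>R x) * ptest h ((1/t) *\<^sub>R (0 + t *\<^sub>R x))) = (LBINT x. (t powr \<gamma> * (f x * ptest h x)))"
 proof (rule integral_cong_AE)
  have "AE x in lborel. x \<in> U \<and> t *\<^sub>R x \<in> U --> f (t *\<^sub>R x) = t powr \<gamma> * f x"
   using hom t by (simp add: hom_AE_def)
  thus "AE x in lborel. f (0 + t *\<^sub>R x) * ptest h ((1/t) *\<^sub>R (0 + t *\<^sub>R x)) = t powr \<gamma> * (f x * ptest h x)"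
  proof eventually_elim
   case (elim x)
   show ?case using elim K V t K(3) by (auto simp: subset_iff)
  qed
 qed measurable
 moreover have "(LBINT x. (t powr \<gamma> * (f x * ptest h x))) = t powr \<gamma> * (LBINT x. f x * ptest h x)"
  by (rule integral_mult_right_zero)
 ultimately have "(LBINT z. f z * ptest h ((1/t) *\<^sub>R z)) / \<bar>t\<bar> ^ CARD('n) = t powr \<gamma> * (LBINT x. f x * ptest h x)"
  by (simp only:)
 thus ?thesis using t by (simp only: field_simps abs_of_pos) (simp add: field_simps)
qed

text \<open>A change of variables moves the dilation onto the test function, and differentiating the
  dilated test function produces the extra factor 1/t.\<close>

lemma hom_AE_deriv:
 fixes f g :: "real ^ 'n::finite => real"
 assumes U: "open U" and f: "loc_int U f" and g: "loc_int U g" and w: "wder U i f g" and hom: "hom_AE U \<gamma> f"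
 shows "hom_AE U (\<gamma> - 1) g" unfolding hom_AE_def proof (intro allI impI)
 fix t :: real assume t: "t > 0"
 note [measurable] = loc_int_borel[OF f] loc_int_borel[OF g]
 define V where "V = U \<inter> (%x. t *\<^sub>R x) -` U"
 have V: "open V" unfolding V_def by (intro open_Int U open_vimage continuous_intros)
 have VU: "V \<subseteq> U" "!!x. x \<in> V ==> t *\<^sub>R x \<in> U" by (auto simp: V_def)
 have l1: "loc_int V (%x. g (t *\<^sub>R x))" unfolding loc_int_def proof (intro conjI allI impI)
  fix K assume K: "compact K \<and> K \<subseteq> V"
  let ?K = "(%x. t *\<^sub>R x) ` K"
  have "compact ?K" "?K \<subseteq> U" using K VU by (auto intro: compact_scaling)
  hence "integrable lborel (%x. indicator ?K x * g x)" using g by (simp add: loc_int_def)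
  hence "integrable lborel (%x. indicator ?K (0 + t *\<^sub>R x) * g (0 + t *\<^sub>R x))"
   by (rule integrable_lborel_affine) (use t in simp)
  moreover have "indicator ?K (0 + t *\<^sub>R x) = (indicator K x :: real)" for x using t by (auto simp: indicator_def)
  ultimately show "integrable lborel (%x. indicator K x * g (t *\<^sub>R x))" by simp
 qed measurable
 have l2: "loc_int V (%x. t powr (\<gamma> - 1) * g x)" by (rule loc_int_cmult[OF g VU(1)])
 have "AE x\<in>V in lborel. g (t *\<^sub>R x) = t powr (\<gamma> - 1) * g x" proof (rule fundamental_lemma_eq[OF V l1 l2])
  fix h assume h: "box_test V h"
  note [measurable] = ptest_borel[of h, OF box_test_sm1[OF h]]
  let ?h = "%j s. h j (s / t)"
  have bt: "box_test U ?h" by (rule box_test_scale[OF h t VU(2)])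
  have "(LBINT x. g (0 + t *\<^sub>R x) * ptest h ((1/t) *\<^sub>R (0 + t *\<^sub>R x))) = (LBINT z. g z * ptest h ((1/t) *\<^sub>R z)) / \<bar>t\<bar> ^ CARD('n)"
   by (rule lborel_integral_affine) (use t in auto)
  hence 1: "(LBINT x. g (t *\<^sub>R x) * ptest h x) = (LBINT z. g z * ptest ?h z) / t ^ CARD('n)" using t by (simp add: ptest_scale)
  have pe: "ptest (?h(i := deriv (?h i))) z = (1/t) * ptest (h(i := deriv (h i))) ((1/t) *\<^sub>R z)" for z
   unfolding ptest_def deriv_scale[OF box_test_sm1[OF h] t] by (subst (1 2) prod.remove[of _ i]) (auto intro!: prod.cong)
  have "(LBINT z. g z * ptest ?h z) = - (LBINT z. f z * ((1/t) * ptest (h(i := deriv (h i))) ((1/t) *\<^sub>R z)))"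
   using w[unfolded wder_def, rule_format, OF bt] unfolding pe by linarith
  also have "... = - (1/t) * (LBINT z. f z * ptest (h(i := deriv (h i))) ((1/t) *\<^sub>R z))"
   by (subst integral_mult_right_zero[symmetric]) (simp add: algebra_simps)
  also have "... = - (1/t) * (t ^ CARD('n) * t powr \<gamma> * (LBINT x. f x * ptest (h(i := deriv (h i))) x))"
   by (subst hom_AE_integral[OF f hom t box_test_deriv[OF h] VU]) auto
  also have "(LBINT x. f x * ptest (h(i := deriv (h i))) x) = - (LBINT x. g x * ptest h x)" proof -
   show ?thesis using h VU w unfolding box_test_def wder_def by blast
  qed
  finally have "(LBINT z. g z * ptest ?h z) = t ^ CARD('n) * (t powr (\<gamma> - 1) * (LBINT x. g x * ptest h x))"
   using t by (simp add: powr_diff field_simps)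
  hence "(LBINT x. g (t *\<^sub>R x) * ptest h x) = t powr (\<gamma> - 1) * (LBINT x. g x * ptest h x)" using t by (simp add: 1)
  also have "... = (LBINT x. t powr (\<gamma> - 1) * g x * ptest h x)"
   by (subst integral_mult_right_zero[symmetric]) (simp add: algebra_simps)
  finally show "(LBINT x. g (t *\<^sub>R x) * ptest h x) = (LBINT x. t powr (\<gamma> - 1) * g x * ptest h x)" .
 qed
 thus "AE x in lborel. x \<in> U \<and> t *\<^sub>R x \<in> U --> g (t *\<^sub>R x) = t powr (\<gamma> - 1) * g x"
  by eventually_elim (simp add: V_def)
qed

text \<open>By homogeneity s^n times the integral of f(z) \<phi>(s z) equals s^(-\<gamma>) times the
  integral of f \<phi> for s near 1. Euler's identity, in weak form, is the equality of the
  derivatives at s = 1.\<close>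

lemma euler_weak:
 fixes f :: "real ^ 'n::finite => real"
 assumes U: "open U" and f: "loc_int U f" and g: "!!j. loc_int U (g j)" and w: "!!j. wder U j f (g j)"
  and hom: "hom_AE U \<gamma> f"
 shows "AE x\<in>U in lborel. (\<Sum>j\<in>UNIV. x $ j * g j x) = \<gamma> * f x" proof (rule fundamental_lemma_eq[OF U])
 have comp_bd: "\<exists>R. \<forall>z\<in>K. norm z <= R" if "compact K" for K :: "(real^'n) set"
  using compact_imp_bounded[OF that] by (simp add: bounded_iff)
 have gj: "loc_int U (%x. x $ j * g j x)" for j unfolding loc_int_def proof (intro conjI allI impI)
  show "(%x. x $ j * g j x) \<in> Borel" using loc_int_borel[OF g[of j]] by measurable
  fix K assume K: "compact K \<and> K \<subseteq> U"
  then obtain R where R: "!!z. z \<in> K ==> norm z <= R" using comp_bd by blast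
  have [measurable]: "K \<in> sets borel" "g j \<in> Borel" using K loc_int_borel[OF g[of j]] by (auto simp: compact_imp_closed)
  have i: "integrable lborel (%x. indicator K x * g j x)" using g[of j] K by (simp add: loc_int_def)
  show "integrable lborel (%x. indicator K x * (x $ j * g j x))"
  proof (rule Bochner_Integration.integrable_bound[OF integrable_mult_right[OF i, of R]])
   show "AE x in lborel. norm (indicator K x * (x $ j * g j x)) <= norm (R * (indicator K x * g j x))" proof (rule AE_I2)
    fix x
    show "norm (indicator K x * (x $ j * g j x)) <= norm (R * (indicator K x * g j x))"
     using R[of x] component_le_norm_cart[of x j] by (cases "x \<in> K") (auto simp: abs_mult intro!: mult_right_mono)
   qed
  qed measurable
 qed
 have sum_li: "loc_int U (%x. \<Sum>j\<in>A. x $ j * g j x)" if "finite A" for A using that proof induction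
  case empty
  thus ?case by (simp add: loc_int_def)
 next
  case (insert a A)
  thus ?case using gj[of a] by (auto simp: loc_int_def distrib_left)
 qed
 show "loc_int U (%x. \<Sum>j\<in>UNIV. x $ j * g j x)" by (rule sum_li) simp
 show "loc_int U (%x. \<gamma> * f x)" using f by (auto simp: loc_int_def mult.left_commute)
 fix h assume h: "box_test U h"
 let ?\<phi> = "ptest h" and ?d = "%j. ptest (h(j := deriv (h j)))"
 note sm = box_test_sm1[OF h]
 note bd = box_test_deriv[OF h]
 note [measurable] = loc_int_borel[OF f] ptest_borel[of h, OF sm]
 have [measurable]: "?d j \<in> Borel" for j by (rule ptest_borel[OF box_test_sm1[OF bd]])
 obtain K where K: "compact K" "K \<subseteq> U" "!!x. x \<notin> K ==> ?\<phi> x = 0" "!!j x. x \<notin> K ==> ?d j x = 0"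
  and KV: "!!V. K \<subseteq> V ==> box_test V h" using box_test_support[OF h] by metis
 obtain \<delta>1 K2 where d1: "\<delta>1 > 0" and K2: "compact K2" and K2U: "K2 \<subseteq> U" and enl: "!!x. x \<in> K ==> qcube x \<delta>1 \<subseteq> K2"
  using compact_enlarge[OF K(1) U K(2)] by blast
 obtain R0 where R0: "!!z. z \<in> K ==> norm z <= R0" using comp_bd[OF K(1)] by blast
 define R where "R = max R0 1"
 have R: "!!z. z \<in> K ==> norm z <= R" "R \<ge> 1" using R0 by (force simp: R_def)+
 \<comment> \<open>If s z lies in the support and |s - 1| < \<open>\<delta>\<close>, then z is
   within \<open>\<delta>1\<close> of s z in every coordinate and hence stays in
   \<open>K2\<close>.\<close>
 define \<delta> where "\<delta> = min (1/2) (\<delta>1 / (2 * R))"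
 have \<delta>: "\<delta> > 0" "\<delta> <= 1/2" "2 * \<delta> * R <= \<delta>1" using d1 R by (auto simp: \<delta>_def min_def field_simps)
 have supp: "z \<in> K2" if "s *\<^sub>R z \<in> K" "\<bar>s - 1\<bar> < \<delta>" for s z proof -
  have s: "s > 1/2" using that \<delta> by auto
  have "\<bar>z $ i - (s *\<^sub>R z) $ i\<bar> <= \<delta>1" for i proof -
   have "\<bar>z $ i - (s *\<^sub>R z) $ i\<bar> = \<bar>s - 1\<bar> * \<bar>z $ i\<bar>" by (simp add: abs_mult[symmetric] algebra_simps abs_minus_commute)
   also have "\<bar>z $ i\<bar> <= 2 * \<bar>(s *\<^sub>R z) $ i\<bar>" using s mult_right_mono[of 1 "2 * s" "\<bar>z $ i\<bar>"] by (simp add: abs_mult)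
   also have "\<bar>s - 1\<bar> * (2 * \<bar>(s *\<^sub>R z) $ i\<bar>) <= \<delta> * (2 * R)"
    using that(2) order_trans[OF component_le_norm_cart R(1)[OF that(1)]] \<delta>(1) by (intro mult_mono) auto
   finally show ?thesis using \<delta>(3) by (simp add: mult_left_mono)
  qed
  thus ?thesis using enl[OF that(1)] by (auto simp: qcube_def)
 qed
 obtain C0 where C0: "!!x. \<bar>?\<phi> x\<bar> <= C0" using box_test_bounded[OF h] by blast
 have "\<forall>j. \<exists>C. \<forall>x. \<bar>?d j x\<bar> <= C" using box_test_bounded[OF bd] by blast
 then obtain Cd where Cd: "!!j x. \<bar>?d j x\<bar> <= Cd j" by metis
 obtain R2 where R2: "!!z. z \<in> K2 ==> norm z <= R2" using comp_bd[OF K2] by blast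
 let ?n = "real CARD('n)"
 define k where "k = (%z s. f z * (s ^ CARD('n) * ?\<phi> (s *\<^sub>R z)))"
 define k' where "k' = (%z s. f z * (?n * s ^ (CARD('n) - 1) * ?\<phi> (s *\<^sub>R z) + s ^ CARD('n) * (\<Sum>j\<in>UNIV. z $ j * ?d j (s *\<^sub>R z))))"
 have [measurable]: "K2 \<in> sets borel" using K2 by (simp add: compact_imp_closed)
 have fK2: "integrable lborel (%z. indicator K2 z * f z)" using f K2 K2U by (simp add: loc_int_def)
 have kint: "integrable lborel (%z. k z s)" and kval: "(LBINT z. k z s) = s powr (- \<gamma>) * (LBINT x. (f x * ?\<phi> x))"
  if that': "\<bar>s - 1\<bar> < \<delta>" for s proof -
  have s: "s > 0" using that' \<delta> by auto
  let ?V = "U \<inter> (%x. (1/s) *\<^sub>R x) -` U"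
  have "(1/s) *\<^sub>R x \<in> U" if x: "x \<in> K" for x proof -
   have "s *\<^sub>R ((1/s) *\<^sub>R x) \<in> K" using s x by simp
   from supp[OF this that'] show "(1/s) *\<^sub>R x \<in> U" using K2U by blast
  qed
  hence hV: "box_test ?V h" using K(2) by (intro KV) auto
  have "1 / s > 0" using s by simp
  from hom_AE_integral[OF f hom this hV]
  have "(LBINT z. (f z * ?\<phi> (s *\<^sub>R z))) = (1/s) ^ CARD('n) * (1/s) powr \<gamma> * (LBINT x. (f x * ?\<phi> x))"
   using s by auto
  moreover have "(LBINT z. k z s) = s ^ CARD('n) * (LBINT z. (f z * ?\<phi> (s *\<^sub>R z)))"
   unfolding k_def by (subst integral_mult_right_zero[symmetric]) (simp add: algebra_simps)
  ultimately show "(LBINT z. k z s) = s powr (- \<gamma>) * (LBINT x. (f x * ?\<phi> x))"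
   using s by (simp add: powr_divide powr_minus field_simps)
  show "integrable lborel (%z. k z s)"
  proof (rule Bochner_Integration.integrable_bound[OF integrable_mult_right[OF fK2, of "s ^ CARD('n) * C0"]])
   show "(%z. k z s) \<in> borel_measurable lborel" unfolding k_def by measurable
   show "AE z in lborel. norm (k z s) <= norm (s ^ CARD('n) * C0 * (indicator K2 z * f z))" proof (rule AE_I2)
    fix z
    show "norm (k z s) <= norm (s ^ CARD('n) * C0 * (indicator K2 z * f z))" proof (cases "s *\<^sub>R z \<in> K")
     case True
     hence "z \<in> K2" using supp that' by blast
     moreover have "\<bar>f z\<bar> * (s ^ CARD('n) * \<bar>?\<phi> (s *\<^sub>R z)\<bar>) <= \<bar>f z\<bar> * (s ^ CARD('n) * \<bar>C0\<bar>)"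
      using C0[of "s *\<^sub>R z"] s by (intro mult_left_mono) auto
     ultimately show ?thesis using s by (simp add: k_def abs_mult mult.commute mult.left_commute)
    next
     case False
     thus ?thesis using K(3) by (simp add: k_def)
    qed
   qed
  qed
 qed
 have der: "DERIV (k z) s :> k' z s" for z s proof -
  have "((%s. s *\<^sub>R z) has_derivative (%h. h *\<^sub>R z)) (at s)" by (auto intro!: derivative_eq_intros)
  from has_derivative_compose[OF this has_derivative_ptest[of h, OF sm]]
  have "((%s. ?\<phi> (s *\<^sub>R z)) has_derivative (%c. \<Sum>j\<in>UNIV. (c *\<^sub>R z) $ j * ?d j (s *\<^sub>R z))) (at s)" .
  moreover have "(%c. \<Sum>j\<in>UNIV. (c *\<^sub>R z) $ j * ?d j (s *\<^sub>R z)) = (*) (\<Sum>j\<in>UNIV. z $ j * ?d j (s *\<^sub>R z))"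
   by (auto simp: fun_eq_iff sum_distrib_right sum_distrib_left mult_ac)
  ultimately have 1: "DERIV (%s. ?\<phi> (s *\<^sub>R z)) s :> (\<Sum>j\<in>UNIV. z $ j * ?d j (s *\<^sub>R z))"
   by (simp add: has_field_derivative_def)
  have 2: "DERIV (%s. s ^ CARD('n)) s :> ?n * s ^ (CARD('n) - 1)" by (auto intro!: derivative_eq_intros)
  show ?thesis unfolding k_def k'_def using DERIV_cmult[OF DERIV_mult[OF 2 1], of "f z"] by (simp add: algebra_simps)
 qed
 have bdk': "\<bar>k' z s\<bar> <= \<bar>(?n * 2 ^ (CARD('n) - 1) * \<bar>C0\<bar> + 2 ^ CARD('n) * (\<Sum>j\<in>UNIV. \<bar>R2\<bar> * \<bar>Cd j\<bar>)) * (indicator K2 z * f z)\<bar>"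
  (is "_ <= \<bar>?W * _\<bar>") if that': "\<bar>s - 1\<bar> < \<delta>" for s z proof (cases "s *\<^sub>R z \<in> K")
  case True
  have s: "0 <= s" "s <= 2" using that' \<delta> by auto
  have z: "z \<in> K2" using supp True that' by blast
  have "\<bar>?n * s ^ (CARD('n) - 1) * ?\<phi> (s *\<^sub>R z)\<bar> <= ?n * 2 ^ (CARD('n) - 1) * \<bar>C0\<bar>"
   unfolding abs_mult using s C0[of "s *\<^sub>R z"] by (intro mult_mono power_mono) (auto simp: power_mono)
  moreover have "\<bar>s ^ CARD('n) * (\<Sum>j\<in>UNIV. z $ j * ?d j (s *\<^sub>R z))\<bar> <= 2 ^ CARD('n) * (\<Sum>j\<in>UNIV. \<bar>R2\<bar> * \<bar>Cd j\<bar>)"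
   unfolding abs_mult proof (intro mult_mono)
   show "\<bar>s ^ CARD('n)\<bar> <= 2 ^ CARD('n)" using s by (simp add: power_mono)
   have "\<bar>z $ j * ?d j (s *\<^sub>R z)\<bar> <= \<bar>R2\<bar> * \<bar>Cd j\<bar>" for j
    unfolding abs_mult using R2[OF z] component_le_norm_cart[of z j] Cd[of j "s *\<^sub>R z"] by (intro mult_mono) auto
   thus "\<bar>\<Sum>j\<in>UNIV. z $ j * ?d j (s *\<^sub>R z)\<bar> <= (\<Sum>j\<in>UNIV. \<bar>R2\<bar> * \<bar>Cd j\<bar>)"
    by (intro order_trans[OF sum_abs] sum_mono)
  qed auto
  ultimately have "\<bar>?n * s ^ (CARD('n) - 1) * ?\<phi> (s *\<^sub>R z) + s ^ CARD('n) * (\<Sum>j\<in>UNIV. z $ j * ?d j (s *\<^sub>R z))\<bar> <= ?W"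
   by (intro order_trans[OF abs_triangle_ineq] add_mono)
  hence "\<bar>f z\<bar> * \<bar>?n * s ^ (CARD('n) - 1) * ?\<phi> (s *\<^sub>R z) + s ^ CARD('n) * (\<Sum>j\<in>UNIV. z $ j * ?d j (s *\<^sub>R z))\<bar> <= \<bar>f z\<bar> * \<bar>?W\<bar>"
   by (intro mult_left_mono) auto
  thus ?thesis using z by (simp add: k'_def abs_mult mult.commute)
 next
  case False
  thus ?thesis using K(3,4) by (simp add: k'_def)
 qed
 have "DERIV (%s. \<integral>z. k z s \<partial>lborel) 1 :> (LBINT z. k' z 1)"
 proof (rule has_real_derivative_integral[OF \<delta>(1)])
  show "integrable lborel (%z. \<bar>(?n * 2 ^ (CARD('n) - 1) * \<bar>C0\<bar> + 2 ^ CARD('n) * (\<Sum>j\<in>UNIV. \<bar>R2\<bar> * \<bar>Cd j\<bar>)) * (indicator K2 z * f z)\<bar>)"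
   by (intro integrable_abs integrable_mult_right fK2)
 qed (use der kint bdk' in auto)
 moreover have "DERIV (%s. \<integral>z. k z s \<partial>lborel) 1 :> (- \<gamma> * (LBINT x. (f x * ?\<phi> x)))"
 proof -
  have "\<forall>\<^sub>F s in nhds 1. s \<in> ball 1 \<delta>" using \<delta>(1) by (intro eventually_nhds_in_open) auto
  hence ev: "\<forall>\<^sub>F s in nhds 1. (LBINT z. k z s) = s powr (- \<gamma>) * (LBINT x. (f x * ?\<phi> x))"
   by eventually_elim (auto intro!: kval simp: dist_real_def abs_minus_commute)
  have dd: "DERIV (%s. s powr (- \<gamma>) * (LBINT x. (f x * ?\<phi> x))) 1 :> (- \<gamma> * (LBINT x. (f x * ?\<phi> x)))"
   by (auto intro!: derivative_eq_intros)
  show ?thesis by (rule iffD2[OF DERIV_cong_ev[OF refl ev refl] dd])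
 qed
 ultimately have key: "(LBINT z. k' z 1) = - \<gamma> * (LBINT x. (f x * ?\<phi> x))" by (rule DERIV_unique)
 \<comment> \<open>Testing with z_j \<phi> gives \<phi> + z_j d_j \<phi> on the other side; the sum
   over j is exactly the derivative of s^n \<phi>(s z) at s = 1.\<close>
 have gphi: "(LBINT z. g j z * (z $ j * ?\<phi> z)) = - (LBINT z. f z * (?\<phi> z + z $ j * ?d j z))
    \<and> integrable lborel (%z. g j z * (z $ j * ?\<phi> z)) \<and> integrable lborel (%z. f z * (?\<phi> z + z $ j * ?d j z))" for j
 proof -
  let ?h = "h(j := %t. t * h j t)"
  have bt: "box_test U ?h" by (rule box_test_ident[OF h])
  have p1: "ptest ?h z = z $ j * ?\<phi> z" for z unfolding ptest_def by (subst (1 2) prod.remove[of _ j]) (auto intro!: prod.cong)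
  have "deriv (?h j) t = h j t + t * deriv (h j) t" for t proof -
   show ?thesis using DERIV_mult[OF DERIV_ident sm1_DERIV[OF sm[of j]], of t] by (simp add: DERIV_imp_deriv)
  qed
  hence p2: "ptest (?h(j := deriv (?h j))) z = ?\<phi> z + z $ j * ?d j z" for z
   unfolding ptest_def by (subst (1 2 3) prod.remove[of _ j]) (auto simp: algebra_simps intro!: prod.cong)
  have "(LBINT z. f z * (?\<phi> z + z $ j * ?d j z)) = - (LBINT z. g j z * (z $ j * ?\<phi> z))"
   using w[of j, unfolded wder_def, rule_format, OF bt] unfolding p1 p2 .
  moreover note loc_int_test[OF g[of j] bt, unfolded p1]
  moreover note loc_int_test[OF f box_test_deriv[OF bt, of j], unfolded p2]
  ultimately show ?thesis by (intro conjI) linarith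
 qed
 have "(LBINT z. ((\<Sum>j\<in>UNIV. z $ j * g j z) * ?\<phi> z)) = (LBINT z. (\<Sum>j\<in>UNIV. g j z * (z $ j * ?\<phi> z)))"
  by (simp add: sum_distrib_left sum_distrib_right mult_ac)
 also have "... = (\<Sum>j\<in>UNIV. - (LBINT z. f z * (?\<phi> z + z $ j * ?d j z)))"
  by (subst Bochner_Integration.integral_sum) (use gphi in auto)
 also have "... = - (LBINT z. (\<Sum>j\<in>UNIV. f z * (?\<phi> z + z $ j * ?d j z)))"
  by (subst Bochner_Integration.integral_sum) (use gphi in \<open>auto simp: sum_negf\<close>)
 also have "(%z. \<Sum>j\<in>UNIV. f z * (?\<phi> z + z $ j * ?d j z)) = (%z. k' z 1)"
  by (auto simp: k'_def fun_eq_iff sum.distrib sum_distrib_left[symmetric])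
 also have "- (LBINT z. k' z 1) = (LBINT z. (\<gamma> * f z * ?\<phi> z))" unfolding key by (simp add: mult.assoc)
 finally show "(LBINT z. ((\<Sum>j\<in>UNIV. z $ j * g j z) * ?\<phi> z)) = (LBINT z. (\<gamma> * f z * ?\<phi> z))" .
qed

subsection \<open>Smooth approximants with an integrable majorant\<close>

definition inc :: "('n => nat) => 'n => 'n => nat" where
 "inc \<kappa> i = \<kappa>(i := Suc (\<kappa> i))"

lemma inc_commute: "inc (inc \<kappa> i) j = inc (inc \<kappa> j) i" by (auto simp: inc_def fun_eq_iff)

definition icube :: "real ^ 'n => real => (real ^ 'n) set" where
 "icube x r = {z. \<forall>i. \<bar>z $ i - x $ i\<bar> < r}"

lemma open_icube: "open (icube (x :: real ^ 'n::finite) r)" proof -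
 have "icube x r = (\<Inter>i\<in>UNIV. {z. \<bar>z $ i - x $ i\<bar> < r})" by (auto simp: icube_def)
 thus ?thesis by (auto intro!: open_INT open_Collect_less continuous_intros)
qed

lemma icube_borel [measurable]: "icube (x :: real ^ 'n::finite) r \<in> sets borel"
 using borel_open[OF open_icube] .

text \<open>Errors with L1 norms below 2^-n have an integrable sum. This sum dominates each of them,
  and its almost sure finiteness forces them to tend to 0.\<close>

lemma summable_L1_subsequence:
 fixes E :: "real => 'a => real"
 assumes E: "!!N. N \<ge> N1 ==> E N \<in> borel_measurable M" and nn: "!!N x. E N x \<ge> 0"
  and lim: "!!e. e > 0 ==> \<exists>N0. \<forall>N\<ge>N0. (\<integral>\<^sup>+x. ennreal (E N x) \<partial>M) < ennreal e"
 obtains s :: "nat => real" and Z where "!!n. s n \<ge> N1" "integrable M Z" "AE x in M. (%n. E (s n) x) \<longlonglongrightarrow> 0"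
  "AE x in M. \<forall>n. E (s n) x <= Z x" "!!x. Z x \<ge> 0" proof -
 have "\<exists>N\<ge>N1. (\<integral>\<^sup>+x. ennreal (E N x) \<partial>M) < ennreal ((1/2)^n)" for n :: nat proof -
  obtain N0 where "\<forall>N\<ge>N0. (\<integral>\<^sup>+x. ennreal (E N x) \<partial>M) < ennreal ((1/2)^n)" using lim[of "(1/2)^n"] by auto
  thus ?thesis by (intro exI[of _ "max N0 N1"]) auto
 qed
 then obtain s where s: "!!n. s n \<ge> N1" "!!n::nat. (\<integral>\<^sup>+x. ennreal (E (s n) x) \<partial>M) < ennreal ((1/2)^n)" by metis
 have [measurable]: "E (s n) \<in> borel_measurable M" for n using E s(1) by blast
 define T where "T = (%x. \<Sum>n. ennreal (E (s n) x))"
 have T_meas [measurable]: "T \<in> borel_measurable M" unfolding T_def by measurable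
 have "(\<integral>\<^sup>+x. T x \<partial>M) = (\<Sum>n. \<integral>\<^sup>+x. ennreal (E (s n) x) \<partial>M)"
  unfolding T_def by (rule nn_integral_suminf) measurable
 also have "... <= (\<Sum>n. ennreal ((1/2)^n))" by (intro suminf_le) (use s(2) in \<open>auto intro: less_imp_le\<close>)
 also have "... = ennreal (\<Sum>n. (1/2)^n)" by (rule suminf_ennreal2) (auto simp: summable_geometric)
 also have "... < \<infinity>" by simp
 finally have fin: "(\<integral>\<^sup>+x. T x \<partial>M) < \<infinity>" .
 hence aefin: "AE x in M. T x ~= \<infinity>" by (intro nn_integral_noteq_infinite) auto
 define Z where "Z = (%x. enn2real (T x))"
 have "integrable M Z" proof (rule integrableI_bounded)
  show "Z \<in> borel_measurable M" unfolding Z_def by measurable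
  have "(\<integral>\<^sup>+x. ennreal (norm (Z x)) \<partial>M) <= (\<integral>\<^sup>+x. T x \<partial>M)"
   unfolding Z_def by (intro nn_integral_mono) (auto simp: ennreal_enn2real_if)
  thus "(\<integral>\<^sup>+x. ennreal (norm (Z x)) \<partial>M) < \<infinity>" using fin by simp
 qed
 moreover have "AE x in M. (%n. E (s n) x) \<longlonglongrightarrow> 0 \<and> (\<forall>n. E (s n) x <= Z x)" using aefin
 proof eventually_elim
  case (elim x)
  have sm: "summable (%n. E (s n) x)" using elim nn by (intro summable_suminf_not_top) (auto simp: T_def)
  have "T x = ennreal (\<Sum>n. E (s n) x)" unfolding T_def by (rule suminf_ennreal2[OF nn sm])
  hence Zx: "Z x = (\<Sum>n. E (s n) x)" unfolding Z_def by (simp only: enn2real_ennreal[OF suminf_nonneg[OF sm nn]])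
  have "sum (%n. E (s n) x) {n} <= (\<Sum>n. E (s n) x)" for n by (rule sum_le_suminf[OF sm]) (auto intro: nn)
  hence "\<forall>n. E (s n) x <= Z x" unfolding Zx by simp
  thus ?case using summable_LIMSEQ_zero[OF sm] by blast
 qed
 hence "AE x in M. (%n. E (s n) x) \<longlonglongrightarrow> 0" "AE x in M. \<forall>n. E (s n) x <= Z x"
  by (eventually_elim, simp)+
 moreover have "Z x \<ge> 0" for x by (simp add: Z_def)
 ultimately show thesis using that s(1) by blast
qed

text \<open>Adding the errors of all members of \<open>F\<close> produces one subsequence and one
  majorant that serve for every member.\<close>

lemma mollified_family:
 fixes F :: "(real ^ 'n::finite => real) set"
 assumes F: "finite F" "!!f. f \<in> F ==> integrable lborel f"
 obtains s :: "nat => real" and Z where "!!n. s n \<ge> N1" "integrable lborel Z" "!!x. Z x \<ge> 0"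
  "!!f. f \<in> F ==> AE x in lborel. (%n. mol0 (s n) f x) \<longlonglongrightarrow> f x"
  "AE x in lborel. \<forall>n. \<forall>f\<in>F. \<bar>mol0 (s n) f x - f x\<bar> <= Z x" proof -
 define E where "E = (%N x. \<Sum>f\<in>F. \<bar>mol0 N f x - f x\<bar>)"
 have m: "(%x. \<bar>mol0 N f x - f x\<bar>) \<in> borel_measurable lborel" if "f \<in> F" for f N
  using mol_measurable[OF F(2)[OF that], of N "%_. 0"] F(2)[OF that] by auto
 have le: "\<bar>mol0 N f x - f x\<bar> <= E N x" if "f \<in> F" for f N x
  unfolding E_def by (rule member_le_sum[OF that]) (use F in auto)
 obtain s Z where s: "!!n. s n \<ge> N1" "integrable lborel Z" "AE x in lborel. (%n. E (s n) x) \<longlonglongrightarrow> 0"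
  "AE x in lborel. \<forall>n. E (s n) x <= Z x" "!!x. Z x \<ge> 0"
 proof (rule summable_L1_subsequence[of N1 E lborel])
  show "E N \<in> borel_measurable lborel" for N unfolding E_def by (intro borel_measurable_sum m)
  show "0 <= E N x" for N x by (simp add: E_def sum_nonneg)
  fix e :: real assume e: "0 < e"
  define \<delta> where "\<delta> = e / (real (card F) + 1)"
  have de: "0 < \<delta>" "real (card F) * \<delta> < e" using e by (auto simp: \<delta>_def field_simps)
  have "\<forall>f\<in>F. \<exists>N0. \<forall>N\<ge>N0. (L1n (%x. mol0 N f x - f x)) < ennreal \<delta>"
   using mol_L1_convergence[OF F(2) de(1)] by blast
  then obtain N0 where N0: "!!f N. f \<in> F ==> N0 f <= N ==> (L1n (%x. mol0 N f x - f x)) < ennreal \<delta>"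
   unfolding bchoice_iff by blast
  have "(\<integral>\<^sup>+x. ennreal (E N x) \<partial>lborel) < ennreal e" if N: "Max (insert 1 (N0 ` F)) <= N" for N proof -
   have "(\<integral>\<^sup>+x. ennreal (E N x) \<partial>lborel) = (\<integral>\<^sup>+x. (\<Sum>f\<in>F. ennreal \<bar>mol0 N f x - f x\<bar>) \<partial>lborel)"
    unfolding E_def by (simp add: sum_ennreal)
   also have "... = (\<Sum>f\<in>F. \<integral>\<^sup>+x. ennreal \<bar>mol0 N f x - f x\<bar> \<partial>lborel)"
    by (intro nn_integral_sum measurable_compose[OF m measurable_ennreal])
   also have "... <= (\<Sum>f\<in>F. ennreal \<delta>)" using N0[of _ N] N F(1) by (intro sum_mono) (auto intro: less_imp_le)
   also have "... = ennreal (real (card F) * \<delta>)" using de by (simp add: ennreal_mult ennreal_of_nat_eq_real_of_nat)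
   also have "... < ennreal e" by (rule ennreal_lessI[OF e de(2)])
   finally show ?thesis .
  qed
  thus "\<exists>N0. \<forall>N\<ge>N0. (\<integral>\<^sup>+x. ennreal (E N x) \<partial>lborel) < ennreal e" by blast
 qed blast
 show thesis proof (rule that[OF s(1,2,5)])
  show "AE x in lborel. \<forall>n. \<forall>f\<in>F. \<bar>mol0 (s n) f x - f x\<bar> <= Z x"
   using s(4) by eventually_elim (blast intro: order_trans[OF le])
  show "AE x in lborel. (%n. mol0 (s n) f x) \<longlonglongrightarrow> f x" if "f \<in> F" for f using s(3)
  proof eventually_elim
   case (elim x)
   have "(%n. mol0 (s n) f x - f x) \<longlonglongrightarrow> 0" by (rule Lim_null_comparison[OF _ elim]) (use le[OF that] in auto)
   thus ?case by (rule LIM_zero_cancel)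
  qed
 qed
qed

text \<open>Jensen's inequality bounds the p-th power of a mollified second derivative by the
  mollification of the p-th power, which converges in L1; so one integrable \<open>Z\<close> serves
  for all n. Third derivatives are supplied because the null Lagrangian identity differentiates rows
  of second derivatives.\<close>

lemma mollified_sequence:
 fixes x0 :: "real ^ 'n::finite" and u :: "real ^ 'n => real"
 assumes R: "R > 0" and p: "0 < p" and sub: "qcube x0 (2 * R) \<subseteq> U"
  and u: "loc_int U u" and D: "!!i. loc_int U (D i)" and H: "!!i j. loc_int U (H i j)"
  and Hp: "!!i j. loc_int U (%x. \<bar>H i j x\<bar> ^ p)"
  and wu: "!!i. wder U i u (D i)" and wD: "!!i j. wder U j (D i) (H i j)"
  and bu: "AE x\<in>U in lborel. m0 <= u x \<and> u x <= M0"
  and bD: "!!i. AE x\<in>U in lborel. \<bar>D i x\<bar> <= L"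
 obtains un :: "nat => real ^ 'n => real" and un1 un2 un3 and Z
 where
  "!!n x i. DERIV (%t. un n (x + t *\<^sub>R axis i 1)) 0 :> un1 n i x"
  "!!n x i j. DERIV (%t. un1 n i (x + t *\<^sub>R axis j 1)) 0 :> un2 n i j x"
  "!!n x i j k. DERIV (%t. un2 n i j (x + t *\<^sub>R axis k 1)) 0 :> un3 n i j k x"
  "!!n i j. un2 n i j = un2 n j i" "!!n i j k. un3 n i j k = un3 n i k j"
  "!!n. continuous_on UNIV (un n)" "!!n i. continuous_on UNIV (un1 n i)"
  "!!n i j. continuous_on UNIV (un2 n i j)" "!!n i j k. continuous_on UNIV (un3 n i j k)"
  "!!n x. x \<in> qcube x0 R ==> m0 <= un n x \<and> un n x <= M0"
  "!!n i x. x \<in> qcube x0 R ==> \<bar>un1 n i x\<bar> <= L"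
  "AE x\<in>qcube x0 R in lborel. (%n. un n x) \<longlonglongrightarrow> u x"
  "!!i. AE x\<in>qcube x0 R in lborel. (%n. un1 n i x) \<longlonglongrightarrow> D i x"
  "!!i j. AE x\<in>qcube x0 R in lborel. (%n. un2 n i j x) \<longlonglongrightarrow> H i j x"
  "integrable lborel Z" "!!x. Z x \<ge> 0"
  "AE x\<in>qcube x0 R in lborel. (\<forall>n i j. \<bar>un2 n i j x\<bar> ^ p <= Z x)" proof -
 let ?K = "qcube x0 (2 * R)"
 have K: "compact ?K" by simp
 define c where "c = (%f z. indicator ?K z * f z :: real)"
 have ci: "integrable lborel (c f)" if "loc_int U f" for f using that sub K unfolding c_def loc_int_def by blast
 note iu = ci[OF u] and iD = ci[OF D] and iH = ci[OF H] and iHp = ci[OF Hp]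
 have cp: "(%z. \<bar>c (H i j) z\<bar> ^ p) = c (%x. \<bar>H i j x\<bar> ^ p)" for i j
  using p by (auto simp: c_def indicator_def fun_eq_iff)
 define F where "F = {c u} \<union> range (%i. c (D i)) \<union> range (%(i, j). c (H i j)) \<union> range (%(i, j). c (%x. \<bar>H i j x\<bar> ^ p))"
 have F: "finite F" "!!f. f \<in> F ==> integrable lborel f" "c u \<in> F" "!!i. c (D i) \<in> F" "!!i j. c (H i j) \<in> F" "!!i j. c (%x. \<bar>H i j x\<bar> ^ p) \<in> F"
  using iu iD iH iHp by (auto simp: F_def)
 obtain s :: "nat => real" and Z0 where s: "!!n. s n \<ge> 1 / R" and Z0: "integrable lborel Z0" "!!x. Z0 x \<ge> 0"
  and conv: "!!f. f \<in> F ==> AE x in lborel. (%n. mol0 (s n) f x) \<longlonglongrightarrow> f x"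
  and Z0b: "AE x in lborel. \<forall>n. \<forall>f\<in>F. \<bar>mol0 (s n) f x - f x\<bar> <= Z0 x"
  by (rule mollified_family[OF F(1), of "1 / R"], erule F(2), rule that)
 have sp: "s n > 0" and sR: "1 / s n <= R" for n proof -
  have "0 < 1 / R" using R by simp
  thus "s n > 0" using s[of n] by linarith
  thus "1 / s n <= R" using s[of n] R by (simp add: field_simps)
 qed
 have qs: "qcube x (1 / s n) \<subseteq> ?K" if "x \<in> qcube x0 R" for x n
 proof
  fix z assume z: "z \<in> qcube x (1 / s n)"
  show "z \<in> ?K" unfolding qcube_def proof (intro CollectI allI)
   fix i
   have "\<bar>z $ i - x $ i\<bar> <= R" using z sR[of n] by (auto simp: qcube_def intro: order_trans)
   moreover have "\<bar>x $ i - x0 $ i\<bar> <= R" using that by (auto simp: qcube_def)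
   ultimately show "\<bar>z $ i - x0 $ i\<bar> <= 2 * R" by linarith
  qed
 qed
 define un where "un = (%n. mol0 (s n) (c u))"
 define un1 where "un1 = (%n i. mol (s n) (inc (%_. 0) i) (c u))"
 define un2 where "un2 = (%n i j. mol (s n) (inc (inc (%_. 0) i) j) (c u))"
 define un3 where "un3 = (%n i j k. mol (s n) (inc (inc (inc (%_. 0) i) j) k) (c u))"
 \<comment> \<open>On the inner cube the kernel stays inside the cube of radius 2 R, so derivatives
   of the kernel may be exchanged for weak derivatives of \<open>u\<close>.\<close>
 have e1: "un1 n i x = mol0 (s n) (c (D i)) x" if "x \<in> qcube x0 R" for n i x
  unfolding un1_def inc_def c_def by (rule mol_wder[OF wu sp qs[OF that] sub])
 have e2: "un2 n i j x = mol0 (s n) (c (H i j)) x" if "x \<in> qcube x0 R" for n i j x proof -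
  have "un2 n i j x = mol (s n) (inc (inc (%_. 0) j) i) (c u) x" unfolding un2_def by (subst inc_commute) simp
  also have "... = mol (s n) (inc (%_. 0) j) (c (D i)) x"
   unfolding inc_def[of "inc _ _"] c_def by (rule mol_wder[OF wu sp qs[OF that] sub])
  also have "... = mol0 (s n) (c (H i j)) x" unfolding inc_def c_def by (rule mol_wder[OF wD sp qs[OF that] sub])
  finally show ?thesis .
 qed
 have R2: "qcube x0 R \<subseteq> ?K" using R by (intro qcube_mono) simp
 have der: "DERIV (%t. mol N \<kappa> (c u) (x + t *\<^sub>R axis i 1)) 0 :> mol N (inc \<kappa> i) (c u) x" for N \<kappa> x i
  using DERIV_mol[OF iu, of N \<kappa> x i 0] by (simp add: inc_def)
 define Z where "Z = (%x. Z0 x + (\<Sum>ij\<in>UNIV. c (%x. \<bar>H (fst ij) (snd ij) x\<bar> ^ p) x))"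
 show thesis proof (rule that[of un un1 un2 un3 Z])
  show "DERIV (%t. un n (x + t *\<^sub>R axis i 1)) 0 :> un1 n i x" for n x i
   unfolding un_def un1_def by (rule der)
  show "DERIV (%t. un1 n i (x + t *\<^sub>R axis j 1)) 0 :> un2 n i j x" for n x i j
   unfolding un2_def un1_def by (rule der)
  show "DERIV (%t. un2 n i j (x + t *\<^sub>R axis k 1)) 0 :> un3 n i j k x" for n x i j k
   unfolding un2_def un3_def by (rule der)
  show "un2 n i j = un2 n j i" for n i j unfolding un2_def by (subst inc_commute) simp
  show "un3 n i j k = un3 n i k j" for n i j k unfolding un3_def by (subst inc_commute[of "inc _ i"]) simp
  show "continuous_on UNIV (un n)" for n unfolding un_def by (rule mol_continuous[OF iu])
  show "continuous_on UNIV (un1 n i)" for n i unfolding un1_def by (rule mol_continuous[OF iu])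
  show "continuous_on UNIV (un2 n i j)" for n i j unfolding un2_def by (rule mol_continuous[OF iu])
  show "continuous_on UNIV (un3 n i j k)" for n i j k unfolding un3_def by (rule mol_continuous[OF iu])
  show "m0 <= un n x \<and> un n x <= M0" if x: "x \<in> qcube x0 R" for n x proof -
   have "AE z\<in>qcube x (1 / s n) in lborel. m0 <= c u z \<and> c u z <= M0"
    using bu by eventually_elim (use qs[OF x, of n] sub in \<open>auto simp: c_def\<close>)
   hence "AE z\<in>qcube x (1 / s n) in lborel. m0 <= c u z" "AE z\<in>qcube x (1 / s n) in lborel. c u z <= M0"
    by (eventually_elim, simp)+
   thus ?thesis unfolding un_def using mol_bounds_const[OF iu sp[of n], of x] by blast
  qed
  show "\<bar>un1 n i x\<bar> <= L" if x: "x \<in> qcube x0 R" for n i x proof -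
   have "AE z\<in>qcube x (1 / s n) in lborel. - L <= c (D i) z \<and> c (D i) z <= L"
    using bD[of i] by eventually_elim (use qs[OF x, of n] sub in \<open>auto simp: c_def abs_le_iff\<close>)
   hence "AE z\<in>qcube x (1 / s n) in lborel. - L <= c (D i) z" "AE z\<in>qcube x (1 / s n) in lborel. c (D i) z <= L"
    by (eventually_elim, simp)+
   thus ?thesis using mol_bounds_const[OF iD sp[of n], of x] unfolding e1[OF x] by force
  qed
  show "AE x\<in>qcube x0 R in lborel. (%n. un n x) \<longlonglongrightarrow> u x"
   using conv[OF F(3)] unfolding un_def by eventually_elim (use R2 in \<open>auto simp: c_def indicator_def\<close>)
  show "AE x\<in>qcube x0 R in lborel. (%n. un1 n i x) \<longlonglongrightarrow> D i x" for i using conv[OF F(4), of i]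
  proof eventually_elim
   case (elim x)
   show ?case
   proof
    assume x: "x \<in> qcube x0 R"
    thus "(%n. un1 n i x) \<longlonglongrightarrow> D i x" using R2 elim unfolding e1[OF x] by (auto simp: c_def)
   qed
  qed
  show "AE x\<in>qcube x0 R in lborel. (%n. un2 n i j x) \<longlonglongrightarrow> H i j x" for i j
   using conv[OF F(5), of i j] proof eventually_elim
   case (elim x)
   show ?case
   proof
    assume x: "x \<in> qcube x0 R"
    thus "(%n. un2 n i j x) \<longlonglongrightarrow> H i j x" using R2 elim unfolding e2[OF x] by (auto simp: c_def)
   qed
  qed
  have cnn: "c (%x. \<bar>H i j x\<bar> ^ p) x \<ge> 0" for i j x by (simp add: c_def)
  show "integrable lborel Z" unfolding Z_def 
   by (intro Bochner_Integration.integrable_add Z0(1) Bochner_Integration.integrable_sum iHp)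
  show "Z x \<ge> 0" for x unfolding Z_def using Z0(2) cnn by (intro add_nonneg_nonneg sum_nonneg) auto
  show "AE x\<in>qcube x0 R in lborel. (\<forall>n i j. \<bar>un2 n i j x\<bar> ^ p <= Z x)" using Z0b proof eventually_elim
   case (elim x)
   show ?case proof (intro impI allI)
    fix n i j assume x: "x \<in> qcube x0 R"
    have "c (%x. \<bar>H i j x\<bar> ^ p) x <= (\<Sum>ij\<in>UNIV. c (%x. \<bar>H (fst ij) (snd ij) x\<bar> ^ p) x)"
     using member_le_sum[of "(i,j)" UNIV "%ij. c (%x. \<bar>H (fst ij) (snd ij) x\<bar> ^ p) x"] cnn by auto
    moreover have "\<bar>un2 n i j x\<bar> ^ p <= mol0 (s n) (c (%x. \<bar>H i j x\<bar> ^ p)) x"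
     unfolding e2[OF x] cp[symmetric] by (rule mol_jensen[OF iH _ sp]) (use cp iHp in simp)
    moreover have "\<bar>mol0 (s n) (c (%x. \<bar>H i j x\<bar> ^ p)) x - c (%x. \<bar>H i j x\<bar> ^ p) x\<bar> <= Z0 x" using elim F(6) by blast
    ultimately show "\<bar>un2 n i j x\<bar> ^ p <= Z x" unfolding Z_def by linarith
   qed
  qed
 qed
qed

subsection \<open>Null Lagrangians\<close>

definition has_partial :: "(real ^ 'n::finite => real) => real => 'n => real ^ 'n => bool" where
 "has_partial f d i x \<longleftrightarrow> DERIV (%t. f (x + t *\<^sub>R axis i 1)) 0 :> d"

lemma has_partial_at:
 assumes "has_partial f d i (x + s *\<^sub>R axis i 1)"
 shows "DERIV (%t. f (x + t *\<^sub>R axis i 1)) s :> d" proof -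
 show ?thesis using assms DERIV_shift[where f="%t. f (x + t *\<^sub>R axis i 1)" and z=s and x=0] by (simp add: has_partial_def algebra_simps)
qed

lemma has_partial_mult:
 "has_partial f f' i x ==> has_partial g g' i x ==> has_partial (%x. f x * g x) (f' * g x + f x * g') i x"
 unfolding has_partial_def by (drule (1) DERIV_mult) (simp add: algebra_simps)

lemma has_partial_cong:
 assumes "open U" "x \<in> U" "!!y. y \<in> U ==> f y = g y" "has_partial g d i x"
 shows "has_partial f d i x" proof -
 have "((%t::real. x + t *\<^sub>R axis i 1) \<longlongrightarrow> x + 0 *\<^sub>R axis i 1) (nhds 0)"
  by (intro tendsto_intros filterlim_ident)
 hence "\<forall>\<^sub>F t in nhds 0. x + t *\<^sub>R axis i 1 \<in> U" using assms(1,2) by (intro topological_tendstoD) auto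
 hence "\<forall>\<^sub>F t in nhds 0. f (x + t *\<^sub>R axis i 1) = g (x + t *\<^sub>R axis i 1)" by eventually_elim (rule assms(3))
 thus ?thesis using assms(4) unfolding has_partial_def by (subst DERIV_cong_ev[OF refl _ refl])
qed

lemma has_partial_prod:
 assumes "finite A" "!!a. a \<in> A ==> has_partial (f a) (f' a) i x"
 shows "has_partial (%x. \<Prod>a\<in>A. f a x) (\<Sum>a\<in>A. f' a * (\<Prod>b\<in>A - {a}. f b x)) i x" using assms
proof (induction)
 case empty
 thus ?case by (simp add: has_partial_def)
next
 case (insert a A)
 have "has_partial (%x. f a x * (\<Prod>a\<in>A. f a x)) (f' a * (\<Prod>a\<in>A. f a x) + f a x * (\<Sum>a\<in>A. f' a * (\<Prod>b\<in>A - {a}. f b x))) i x"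
  using insert by (intro has_partial_mult) auto
 moreover have "f a x * (\<Sum>a\<in>A. f' a * (\<Prod>b\<in>A - {a}. f b x)) = (\<Sum>c\<in>A. f' c * (\<Prod>b\<in>insert a A - {c}. f b x))"
  unfolding sum_distrib_left proof (rule sum.cong[OF refl])
  fix c assume "c \<in> A"
  hence "insert a A - {c} = insert a (A - {c})" "a \<notin> A - {c}" using insert by auto
  thus "f a x * (f' c * (\<Prod>b\<in>A - {c}. f b x)) = f' c * (\<Prod>b\<in>insert a A - {c}. f b x)" using insert(1) by simp
 qed
 moreover have "insert a A - {a} = A" using insert by auto
 ultimately show ?case using insert by simp
qed

lemma continuous_zero_extension:
 fixes f :: "real ^ 'n::finite => real"
 assumes "open U" "compact C" "C \<subseteq> U" "continuous_on U f" "!!x. x \<in> U ==> x \<notin> C ==> f x = 0"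
 shows "continuous_on UNIV (%x. if x \<in> U then f x else 0)" proof -
 have "continuous_on (U \<union> - C) (%x. if x \<in> U then f x else 0)" proof (rule continuous_on_open_Un)
  show "continuous_on U (%x. if x \<in> U then f x else 0)" using assms(4) by (rule continuous_on_eq) auto
  show "continuous_on (- C) (%x. if x \<in> U then f x else 0)"
   by (rule continuous_on_eq[of _ "%_. 0"]) (use assms(5) in auto)
 qed (use assms in \<open>auto simp: compact_imp_closed open_Compl\<close>)
 moreover have "U \<union> - C = UNIV" using assms by auto
 ultimately show ?thesis by simp
qed

text \<open>Translation along the axis leaves the integral of \<open>F\<close> unchanged;
  differentiating this constant under the integral sign gives the claim.\<close>

lemma integral_partial_zero:
 fixes F G :: "real ^ 'n::finite => real"
 assumes F: "continuous_on UNIV F" and G: "continuous_on UNIV G" and C: "compact C"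
  and F0: "!!x. x \<notin> C ==> F x = 0" and G0: "!!x. x \<notin> C ==> G x = 0"
  and der: "!!x. has_partial F (G x) i x"
 shows "(LBINT x. G x) = 0" proof -
 have iF: "integrable lborel F" by (rule integrable_cont_compact[OF F F0 C])
 have "compact (G ` C)" by (rule compact_continuous_image[OF continuous_on_subset[OF G] C]) simp
 then obtain B where B: "\<forall>y\<in>G ` C. norm y <= B" using compact_imp_bounded bounded_iff by metis
 have GB: "\<bar>G x\<bar> <= \<bar>B\<bar>" for x proof (cases "x \<in> C")
  case True
  thus ?thesis using B by auto
 qed (simp add: G0)
 let ?C = "{x + y | x y. x \<in> C \<and> y \<in> cball 0 1}"
 have C': "compact ?C" by (rule compact_sums[OF C compact_cball])
 hence C'm: "?C \<in> sets borel" by (simp add: compact_imp_closed)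
 have "DERIV (%t. \<integral>x. F (x + t *\<^sub>R axis i 1) \<partial>lborel) 0 :> (LBINT x. G (x + 0 *\<^sub>R axis i 1))"
 proof (rule has_real_derivative_integral[of 1])
  show "DERIV (%t. F (x + t *\<^sub>R axis i 1)) t :> G (x + t *\<^sub>R axis i 1)" for x t
   by (rule has_partial_at[OF der])
  show "integrable lborel (%x. F (x + t *\<^sub>R axis i 1))" for t
   using integrable_lborel_affine[OF iF, of 1 "t *\<^sub>R axis i 1"] by (simp add: add.commute)
  show "integrable lborel (%x. indicator ?C x * \<bar>B\<bar>)"
   using emeasure_bounded_finite[OF compact_imp_bounded[OF C']] C'm by (intro integrable_mult_left integrable_real_indicator) auto
  show "\<bar>G (x + t *\<^sub>R axis i 1)\<bar> <= indicator ?C x * \<bar>B\<bar>" if "\<bar>t - 0\<bar> < 1" for x t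
  proof (cases "x + t *\<^sub>R axis i 1 \<in> C")
   case True
   have "x \<in> ?C" using that True by (intro CollectI exI[of _ "x + t *\<^sub>R axis i 1"] exI[of _ "- (t *\<^sub>R axis i 1)"]) auto
   thus ?thesis using GB by simp
  qed (simp add: G0)
 qed simp
 moreover have "(LBINT x. F (x + t *\<^sub>R axis i 1)) = (LBINT x. F x)" for t proof -
  have "(LBINT x. F (t *\<^sub>R axis i 1 + 1 *\<^sub>R x)) = (LBINT x. F x) / \<bar>1\<bar> ^ CARD('n)"
   by (rule lborel_integral_affine) (use iF in auto)
  thus ?thesis by (simp add: add.commute)
 qed
 ultimately have "DERIV (%t::real. \<integral>x. F x \<partial>lborel) 0 :> (LBINT x. G x)" by simp
 from DERIV_unique[OF this DERIV_const] show ?thesis .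
qed

text \<open>Composition with the transposition of k and j is a bijection of the permutations that
  reverses the sign and preserves the summand.\<close>

lemma sum_sign_transpose_zero:
 fixes T :: "('n::finite => 'n) => real"
 assumes kj: "k ~= j" and T: "!!\<pi>. T (\<pi> \<circ> Transposition.transpose k j) = T \<pi>"
 shows "(\<Sum>\<pi> | \<pi> permutes UNIV. of_int (sign \<pi>) * T \<pi>) = 0" proof -
 have bij: "bij_betw (%\<pi>. \<pi> \<circ> Transposition.transpose k j) {\<pi>. \<pi> permutes (UNIV::'n set)} {\<pi>. \<pi> permutes UNIV}"
  by (rule bij_betw_byWitness[where f'="%\<pi>. \<pi> \<circ> Transposition.transpose k j"])
    (auto simp: comp_assoc intro!: permutes_compose permutes_swap_id)
 have "(\<Sum>\<pi> | \<pi> permutes (UNIV::'n set). of_int (sign \<pi>) * T \<pi>) =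
  (\<Sum>\<pi> | \<pi> permutes (UNIV::'n set). of_int (sign (\<pi> \<circ> Transposition.transpose k j)) * T (\<pi> \<circ> Transposition.transpose k j))"
  using sum.reindex_bij_betw[OF bij, of "%\<pi>. of_int (sign \<pi>) * T \<pi>"] by simp
 also have "... = (\<Sum>\<pi> | \<pi> permutes (UNIV::'n set). - (of_int (sign \<pi>) * T \<pi>))" proof (rule sum.cong[OF refl])
  fix \<pi> :: "'n => 'n" assume "\<pi> \<in> {\<pi>. \<pi> permutes UNIV}"
  hence "permutation \<pi>" using permutation_permutes[of \<pi>] by (auto intro: exI[of _ UNIV])
  thus "of_int (sign (\<pi> \<circ> Transposition.transpose k j)) * T (\<pi> \<circ> Transposition.transpose k j) = - (of_int (sign \<pi>) * T \<pi>)" by (simp add: T sign_compose permutation_swap_id sign_swap_id kj)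
 qed
 finally show ?thesis by (simp add: sum_negf)
qed

text \<open>In the permutation expansion the derivative is moved off \<Psi>. Every term that arises
  contains a second derivative with the two indices \<open>\<pi> j\<close> and
  \<open>\<pi> k\<close>, and its symmetry makes the terms cancel in pairs.\<close>

lemma null_lagrangian:
 fixes \<Psi> :: "real ^ 'n::finite => real"
 assumes U: "open U" "compact C" "C \<subseteq> U"
  and P: "!!j m i x. j ~= k ==> x \<in> U ==> has_partial (DP j m) (DDP j m i x) i x"
  and sym: "!!j m i x. j ~= k ==> x \<in> U ==> DDP j m i x = DDP j i m x"
  and cP: "!!j m. j ~= k ==> continuous_on U (DP j m)" "!!j m i. j ~= k ==> continuous_on U (DDP j m i)"
  and Psi: "!!i x. x \<in> U ==> has_partial \<Psi> (d\<Psi> i x) i x"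
  and cPsi: "continuous_on U \<Psi>" "!!i. continuous_on U (d\<Psi> i)"
  and zero: "!!x. x \<in> U ==> x \<notin> C ==> \<Psi> x = 0" "!!i x. x \<in> U ==> x \<notin> C ==> d\<Psi> i x = 0"
 shows "(LBINT x. indicator U x * det (\<chi> a b. if a = k then d\<Psi> b x else DP a b x)) = 0" proof -
 define R where "R = (%\<pi> x. \<Prod>a\<in>UNIV - {k}. DP a (\<pi> a) x)"
 define T where "T = (%j \<pi> x. DDP j (\<pi> j) (\<pi> k) x * (\<Prod>a\<in>UNIV - {k} - {j}. DP a (\<pi> a) x))"
 have T_sym: "T j (\<pi> \<circ> Transposition.transpose k j) x = T j \<pi> x" if "j ~= k" "x \<in> U" for j \<pi> x proof -
  show ?thesis using sym[OF that, of "\<pi> k" "\<pi> j"] by (simp add: T_def)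
 qed
 have cR: "continuous_on U (R \<pi>)" for \<pi> unfolding R_def by (intro continuous_on_prod cP) auto
 have cT: "continuous_on U (T j \<pi>)" if "j ~= k" for j \<pi> unfolding T_def using that by (intro continuous_on_mult continuous_on_prod cP) auto
 have dR: "has_partial (R \<pi>) (\<Sum>j\<in>UNIV - {k}. T j \<pi> x) (\<pi> k) x" if "x \<in> U" for \<pi> x
  unfolding R_def T_def by (rule has_partial_prod) (use P that in auto)
 have int0: "integrable lborel (%x. indicator U x * f x)" if "continuous_on U f" "!!x. x \<in> U ==> x \<notin> C ==> f x = 0" for f :: "real ^ 'n => real"
 proof -
  have eq: "(%x. indicator U x * f x) = (%x. if x \<in> U then f x else 0)" by (auto simp: indicator_def fun_eq_iff)
  show ?thesis unfolding eq by (rule integrable_cont_compact[OF continuous_zero_extension[OF U that] _ U(2)]) (use that in auto)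
 qed
 \<comment> \<open>The product of \<Psi> with the entries of the other rows has compact support; its
   partial derivative in the direction \<open>\<pi> k\<close> integrates to zero.\<close>
 have ibp: "(LBINT x. indicator U x * (d\<Psi> (\<pi> k) x * R \<pi> x)) = - (LBINT x. indicator U x * (\<Psi> x * (\<Sum>j\<in>UNIV - {k}. T j \<pi> x)))" for \<pi>
 proof -
  let ?F = "%x. if x \<in> U then \<Psi> x * R \<pi> x else 0"
  let ?g = "%x. d\<Psi> (\<pi> k) x * R \<pi> x + \<Psi> x * (\<Sum>j\<in>UNIV - {k}. T j \<pi> x)"
  let ?G = "%x. if x \<in> U then ?g x else 0"
  have cS: "continuous_on U (%x. \<Sum>j\<in>UNIV - {k}. T j \<pi> x)" by (intro continuous_on_sum cT) auto
  have "(LBINT x. ?G x) = 0" proof (rule integral_partial_zero[of ?F ?G C "\<pi> k"])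
   show "continuous_on UNIV ?F"
    by (rule continuous_zero_extension[OF U]) (use zero in \<open>auto intro!: continuous_on_mult cPsi cR\<close>)
   show "continuous_on UNIV ?G"
    by (rule continuous_zero_extension[OF U]) (use zero in \<open>auto intro!: continuous_on_mult continuous_on_add cPsi cR cS\<close>)
   show "compact C" by (rule U)
   show "x \<notin> C ==> ?F x = 0" "x \<notin> C ==> ?G x = 0" for x using zero by auto
   show "has_partial ?F (?G x) (\<pi> k) x" for x proof (cases "x \<in> U")
    case True
    have "has_partial (%x. \<Psi> x * R \<pi> x) (?g x) (\<pi> k) x" by (intro has_partial_mult Psi dR True)
    thus ?thesis using True by (intro has_partial_cong[OF U(1) True, of ?F "%x. \<Psi> x * R \<pi> x"]) auto
   next
    case False
    hence "x \<in> - C" using U by auto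
    moreover have "open (- C)" using U by (simp add: compact_imp_closed open_Compl)
    moreover have "?F y = 0" if "y \<in> - C" for y using that zero by auto
    moreover have "has_partial (%_. 0) (?G x) (\<pi> k) x" using False by (simp add: has_partial_def)
    ultimately show ?thesis by (intro has_partial_cong[of "- C" x ?F "%_. 0"]) auto
   qed
  qed
  moreover have "?G = (%x. indicator U x * (d\<Psi> (\<pi> k) x * R \<pi> x) + indicator U x * (\<Psi> x * (\<Sum>j\<in>UNIV - {k}. T j \<pi> x)))"
   by (auto simp: indicator_def)
  moreover have "(LBINT x. indicator U x * (d\<Psi> (\<pi> k) x * R \<pi> x) + indicator U x * (\<Psi> x * (\<Sum>j\<in>UNIV - {k}. T j \<pi> x)))
   = (LBINT x. indicator U x * (d\<Psi> (\<pi> k) x * R \<pi> x)) + (LBINT x. indicator U x * (\<Psi> x * (\<Sum>j\<in>UNIV - {k}. T j \<pi> x)))"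
   by (rule Bochner_Integration.integral_add; rule int0) (use zero in \<open>auto intro!: continuous_on_mult cPsi cR cS\<close>)
  ultimately show ?thesis by simp
 qed
 have detexp: "det (\<chi> a b. if a = k then d\<Psi> b x else DP a b x) = (\<Sum>\<pi> | \<pi> permutes UNIV. of_int (sign \<pi>) * (d\<Psi> (\<pi> k) x * R \<pi> x))" for x
  unfolding det_def R_def by (intro sum.cong refl arg_cong2[of _ _ _ _ "(*)"], subst prod.remove[of _ k]) (auto intro!: prod.cong)
 have int1: "integrable lborel (%x. indicator U x * (d\<Psi> (\<pi> k) x * R \<pi> x))" for \<pi>
  by (rule int0) (use zero in \<open>auto intro!: continuous_on_mult cPsi cR\<close>)
 have int2: "integrable lborel (%x. indicator U x * (\<Psi> x * (\<Sum>j\<in>UNIV - {k}. T j \<pi> x)))" for \<pi>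
  by (rule int0) (use zero in \<open>auto intro!: continuous_on_mult continuous_on_sum cPsi cT\<close>)
 have "(LBINT x. indicator U x * det (\<chi> a b. if a = k then d\<Psi> b x else DP a b x))
  = (LBINT x. (\<Sum>\<pi> | \<pi> permutes UNIV. of_int (sign \<pi>) * (indicator U x * (d\<Psi> (\<pi> k) x * R \<pi> x))))"
  unfolding detexp by (simp add: sum_distrib_left mult_ac)
 also have "... = (\<Sum>\<pi> | \<pi> permutes UNIV. of_int (sign \<pi>) * (LBINT x. indicator U x * (d\<Psi> (\<pi> k) x * R \<pi> x)))"
  by (subst Bochner_Integration.integral_sum) (auto intro!: integrable_mult_right int1)
 also have "... = - (\<Sum>\<pi> | \<pi> permutes UNIV. of_int (sign \<pi>) * (LBINT x. indicator U x * (\<Psi> x * (\<Sum>j\<in>UNIV - {k}. T j \<pi> x))))"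
  unfolding ibp by (simp add: sum_negf)
 also have "(\<Sum>\<pi> | \<pi> permutes UNIV. of_int (sign \<pi>) * (LBINT x. indicator U x * (\<Psi> x * (\<Sum>j\<in>UNIV - {k}. T j \<pi> x))))
  = (LBINT x. (\<Sum>\<pi> | \<pi> permutes UNIV. of_int (sign \<pi>) * (indicator U x * (\<Psi> x * (\<Sum>j\<in>UNIV - {k}. T j \<pi> x)))))"
  by (subst Bochner_Integration.integral_sum) (auto intro!: integrable_mult_right int2)
 also have "(%x. \<Sum>\<pi> | \<pi> permutes UNIV. of_int (sign \<pi>) * (indicator U x * (\<Psi> x * (\<Sum>j\<in>UNIV - {k}. T j \<pi> x)))) = (%x. 0)"
 proof
  fix x
  show "(\<Sum>\<pi> | \<pi> permutes UNIV. of_int (sign \<pi>) * (indicator U x * (\<Psi> x * (\<Sum>j\<in>UNIV - {k}. T j \<pi> x)))) = 0"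
  proof (cases "x \<in> U")
   case True
   have "(\<Sum>\<pi> | \<pi> permutes UNIV. of_int (sign \<pi>) * (indicator U x * (\<Psi> x * (\<Sum>j\<in>UNIV - {k}. T j \<pi> x))))
    = (\<Sum>\<pi> | \<pi> permutes UNIV. \<Sum>j\<in>UNIV - {k}. \<Psi> x * (of_int (sign \<pi>) * T j \<pi> x))"
    using True by (simp add: sum_distrib_left mult_ac)
   also have "... = (\<Sum>j\<in>UNIV - {k}. \<Psi> x * (\<Sum>\<pi> | \<pi> permutes UNIV. of_int (sign \<pi>) * T j \<pi> x))"
    by (subst sum.swap) (simp add: sum_distrib_left)
   also have "... = 0" proof (rule sum.neutral, rule ballI)
    fix j assume "j \<in> UNIV - {k}"
    hence "(\<Sum>\<pi> | \<pi> permutes UNIV. of_int (sign \<pi>) * T j \<pi> x) = 0"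
     by (intro sum_sign_transpose_zero[of k j "%\<pi>. T j \<pi> x"]) (use T_sym True in auto)
    thus "\<Psi> x * (\<Sum>\<pi> | \<pi> permutes UNIV. of_int (sign \<pi>) * T j \<pi> x) = 0" by simp
   qed
   finally show ?thesis .
  qed simp
 qed
 finally show ?thesis by simp
qed

text \<open>Jacobian determinant of a map whose component k has gradient \<open>v\<close>, whose
  component l is the coordinate x_l, and whose remaining components have the gradients
  \<open>P a\<close>.\<close>

definition jdet :: "'n::finite => 'n => ('n => real) => ('n => 'n => real) => real" where
 "jdet k l v P = det (\<chi> a b. if a = k then v b else if a = l then (if b = l then 1 else 0) else P a b)"

lemma jdet_expand:
 fixes k l :: "'n::finite"
 shows "jdet k l v P = (\<Sum>\<pi> | \<pi> permutes (UNIV :: 'n set). of_int (sign \<pi>) *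
  (v (\<pi> k) * (\<Prod>a\<in>UNIV - {k}. if a = l then (if \<pi> a = l then 1 else 0) else P a (\<pi> a))))" unfolding jdet_def det_def
 by (intro sum.cong refl arg_cong2[of _ _ _ _ "(*)"], subst prod.remove[of _ k]) (auto intro!: prod.cong)

lemma jdet_add: "jdet k l (%b. v b + w b) P = jdet k l v P + jdet k l w P"
 unfolding jdet_expand by (simp add: sum.distrib algebra_simps)

lemma jdet_scale: "jdet k l (%b. t * v b) P = t * jdet k l v P" unfolding jdet_expand by (simp add: sum_distrib_left algebra_simps)

text \<open>Rows k and l are then multiples of the same unit vector.\<close>

lemma jdet_axis:
 assumes "k ~= l"
 shows "jdet k l (%b. if b = l then t else 0) P = 0" unfolding jdet_expand proof (rule sum.neutral, rule ballI)
 fix \<pi> :: "'a => 'a" assume p: "\<pi> \<in> {\<pi>. \<pi> permutes UNIV}"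
 show "of_int (sign \<pi>) * ((if \<pi> k = l then t else 0) * (\<Prod>a\<in>UNIV - {k}. if a = l then (if \<pi> a = l then 1 else 0) else P a (\<pi> a))) = 0"
 proof (cases "\<pi> k = l")
  case True
  hence "\<pi> l ~= l" using p assms by (metis mem_Collect_eq permutes_inj inj_eq)
  thus ?thesis using assms by auto
 qed simp
qed

text \<open>Each of the n! products takes one entry of \<open>v\<close>, one entry 0 or 1 from row
  l, and n - 2 entries of \<open>P\<close>; this is the source of the power d of the majorant
  \<open>Y\<close>.\<close>

lemma jdet_bound:
 fixes k l :: "'n::finite"
 assumes kl: "k ~= l" and Y: "0 <= Y" "!!a b. a ~= k ==> a ~= l ==> \<bar>P a b\<bar> <= Y"
 shows "\<bar>jdet k l v P\<bar> <= fact CARD('n) * ((\<Sum>b\<in>UNIV. \<bar>v b\<bar>) * Y ^ (CARD('n) - 2))" proof -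
 have "\<bar>jdet k l v P\<bar> <= (\<Sum>\<pi> | \<pi> permutes (UNIV :: 'n set). (\<Sum>b\<in>UNIV. \<bar>v b\<bar>) * Y ^ (CARD('n) - 2))"
  unfolding jdet_expand proof (intro order_trans[OF sum_abs] sum_mono)
  fix \<pi> :: "'n => 'n"
  have s: "\<bar>of_int (sign \<pi>) :: real\<bar> = 1" by (simp add: sign_def)
  have "\<bar>\<Prod>a\<in>UNIV - {k}. if a = l then (if \<pi> a = l then 1 else 0) else P a (\<pi> a)\<bar>
   <= (\<Prod>a\<in>UNIV - {k}. if a = l then 1 else Y)" unfolding abs_prod using Y by (intro prod_mono) auto
  also have "... = (\<Prod>a\<in>UNIV - {k} - {l}. Y)" using kl by (subst prod.remove[of _ l]) auto
  also have "... = Y ^ (CARD('n) - 2)" proof -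
   have "card (UNIV - {k} - {l}) = CARD('n) - 2" using kl by (simp add: card_Diff_singleton_if)
   thus ?thesis by simp
  qed
  finally have "\<bar>v (\<pi> k)\<bar> * \<bar>\<Prod>a\<in>UNIV - {k}. if a = l then (if \<pi> a = l then 1 else 0) else P a (\<pi> a)\<bar>
    <= (\<Sum>b\<in>UNIV. \<bar>v b\<bar>) * Y ^ (CARD('n) - 2)"
   by (intro mult_mono member_le_sum[of _ _ "%b. \<bar>v b\<bar>"]) (auto intro: sum_nonneg)
  thus "\<bar>of_int (sign \<pi>) * (v (\<pi> k) * (\<Prod>a\<in>UNIV - {k}. if a = l then (if \<pi> a = l then 1 else 0) else P a (\<pi> a)))\<bar>
   <= (\<Sum>b\<in>UNIV. \<bar>v b\<bar>) * Y ^ (CARD('n) - 2)" by (simp only: abs_mult s mult_1)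
 qed
 also have "... = fact CARD('n) * ((\<Sum>b\<in>UNIV. \<bar>v b\<bar>) * Y ^ (CARD('n) - 2))" by (simp add: card_permutations[OF refl])
 finally show ?thesis .
qed

lemma jdet_tendsto:
 assumes "!!b. (%n. v n b) \<longlonglongrightarrow> v' b" "!!a b. a ~= k ==> a ~= l ==> (%n. P n a b) \<longlonglongrightarrow> P' a b"
 shows "(%n. jdet k l (v n) (P n)) \<longlonglongrightarrow> jdet k l v' P'" unfolding jdet_expand
proof (intro tendsto_sum tendsto_mult tendsto_const assms(1) tendsto_prod)
 fix a and \<pi> :: "'a => 'a"
 assume "a \<in> UNIV - {k}"
 thus "(%n. if a = l then (if \<pi> a = l then 1 else 0) else P n a (\<pi> a)) \<longlonglongrightarrow> (if a = l then (if \<pi> a = l then 1 else 0) else P' a (\<pi> a))"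
  using assms(2)[of a "\<pi> a"] by (cases "a = l") auto
qed

lemma jdet_measurable:
 assumes "!!b. (%x. v x b) \<in> borel_measurable M" "!!a b. a ~= k ==> a ~= l ==> (%x. P x a b) \<in> borel_measurable M"
 shows "(%x. jdet k l (v x) (P x)) \<in> borel_measurable M" unfolding jdet_expand
proof (intro borel_measurable_sum borel_measurable_times borel_measurable_const assms(1) borel_measurable_prod)
 fix a and \<pi> :: "'a => 'a"
 assume "a \<in> UNIV - {k}"
 thus "(%x. if a = l then (if \<pi> a = l then 1 else 0) else P x a (\<pi> a)) \<in> borel_measurable M"
  using assms(2)[of a "\<pi> a"] by (cases "a = l") auto
qed

text \<open>The squared positive part is C^1, as required of the first row of the null Lagrangian,
  and its derivative is the truncation that acts as a weight.\<close>

definition pos2 :: "real => real" where "pos2 t = (max 0 t)\<^sup>2"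

lemma DERIV_pos2: "DERIV pos2 t :> 2 * max 0 t" proof -
 consider "t > 0" | "t < 0" | "t = 0" by linarith
 thus ?thesis proof cases
  case 1
  have "\<forall>\<^sub>F s in nhds t. s \<in> {0<..}" using 1 by (intro eventually_nhds_in_open) auto
  hence ev: "\<forall>\<^sub>F s in nhds t. pos2 s = s\<^sup>2" by eventually_elim (simp add: pos2_def)
  have "DERIV (%s::real. s\<^sup>2) t :> 2 * max 0 t" using 1 by (auto intro!: derivative_eq_intros)
  thus ?thesis by (rule iffD2[OF DERIV_cong_ev[OF refl ev refl]])
 next
  case 2
  have "\<forall>\<^sub>F s in nhds t. s \<in> {..<0}" using 2 by (intro eventually_nhds_in_open) auto
  hence ev: "\<forall>\<^sub>F s in nhds t. pos2 s = 0" by eventually_elim (simp add: pos2_def)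
  have "DERIV (%s::real. 0) t :> 2 * max 0 t" using 2 by auto
  thus ?thesis by (rule iffD2[OF DERIV_cong_ev[OF refl ev refl]])
 next
  case 3
  have "((%h::real. max 0 h) \<longlongrightarrow> max 0 0) (at 0)" by (intro tendsto_intros)
  hence "((%h::real. max 0 h) \<longlongrightarrow> 0) (at 0)" by simp
  moreover have "\<forall>\<^sub>F h in at 0. max 0 h = (pos2 (0 + h) - pos2 0) / h"
   by (auto simp: pos2_def eventually_at_filter max_def power2_eq_square)
  ultimately have "((%h. (pos2 (0 + h) - pos2 0) / h) \<longlongrightarrow> 0) (at 0)" by (rule Lim_transform_eventually)
  thus ?thesis using 3 by (simp add: DERIV_def)
 qed
qed

lemma pos2_nonneg: "pos2 t \<ge> 0" by (simp add: pos2_def)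

lemma continuous_on_pos2: "continuous_on A f ==> continuous_on A (%x. pos2 (f x))"
 unfolding pos2_def by (intro continuous_intros)

lemma has_partial_coord:
 fixes f :: "real => real"
 assumes "DERIV f (x $ i) :> f'"
 shows "has_partial (%x. f (x $ i)) (if b = i then f' else 0) b x" proof (cases "b = i")
 case True
 have "DERIV (%t. x $ i + t) 0 :> 1" by (auto intro!: derivative_eq_intros)
 from DERIV_chain'[OF this, of f f'] assms have "DERIV (%t. f (x $ i + t)) 0 :> f'" by simp
 thus ?thesis using True by (simp add: has_partial_def)
next
 case False
 thus ?thesis using False by (simp add: has_partial_def axis_def)
qed

lemma has_partial_sum:
 "(!!a. a \<in> A ==> has_partial (f a) (f' a) i x) ==> has_partial (%x. \<Sum>a\<in>A. f a x) (\<Sum>a\<in>A. f' a) i x"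
 unfolding has_partial_def by (rule DERIV_sum)

lemma has_partial_diff:
 "has_partial f f' i x ==> has_partial g g' i x ==> has_partial (%x. f x - g x) (f' - g') i x"
 unfolding has_partial_def by (rule DERIV_diff)

lemma has_partial_const: "has_partial (%x. c) 0 i x" by (simp add: has_partial_def)

lemma has_partial_chain:
 "DERIV g (f x) :> g' ==> has_partial f f' i x ==> has_partial (%x. g (f x)) (g' * f') i x"
 unfolding has_partial_def using DERIV_chain'[of "%t. f (x + t *\<^sub>R axis i 1)" f' 0 UNIV g g'] by (simp add: mult.commute)

text \<open>\<open>q\<close> and \<open>pd\<close> play the roles of \<open>\<nabla>Q\<close> and \<open>D\<^sup>2w\<close>; \<open>Qn\<close> and \<open>dP\<close> are smooth approximants dominated by
  \<open>Y\<close>.\<close>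

locale jacobian_setup =
 fixes x0 :: "real ^ 'n::finite" and R :: real and k l :: 'n
  and Q :: "real ^ 'n => real" and q :: "'n => real ^ 'n => real" and pd :: "'n => 'n => real ^ 'n => real"
  and Qn :: "nat => real ^ 'n => real" and dQ :: "nat => 'n => real ^ 'n => real"
  and dP :: "nat => 'n => 'n => real ^ 'n => real" and ddP :: "nat => 'n => 'n => 'n => real ^ 'n => real"
  and M c \<sigma> :: real and Y :: "real ^ 'n => real" and d pe :: nat
 assumes kl: "k ~= l" and R_pos: "R > 0"
  and d_def: "d = CARD('n) - 2" and pe_def: "pe = max 1 (d * (d + 1))"
  and dQn: "!!n i x. x \<in> icube x0 R ==> has_partial (Qn n) (dQ n i x) i x"
  and ddPn: "!!n j m i x. x \<in> icube x0 R ==> has_partial (dP n j m) (ddP n j m i x) i x"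
  and sym: "!!n j m i x. x \<in> icube x0 R ==> ddP n j m i x = ddP n j i m x"
  and cont: "!!n. continuous_on (icube x0 R) (Qn n)" "!!n i. continuous_on (icube x0 R) (dQ n i)"
   "!!n j i. continuous_on (icube x0 R) (dP n j i)" "!!n j i m. continuous_on (icube x0 R) (ddP n j i m)"
  and Q_bound: "!!n x. x \<in> icube x0 R ==> \<bar>Qn n x\<bar> <= M"
  and meas: "Q \<in> Borel" "!!i. q i \<in> Borel" "!!j i. pd j i \<in> Borel"
   "Y \<in> Borel"
  and Y_ge_1: "!!x. 1 <= Y x" and Y_int: "integrable lborel (%x. indicator (icube x0 R) x * Y x ^ pe)"
  and dom: "AE x\<in>icube x0 R in lborel. (\<forall>n i. \<bar>dQ n i x\<bar> <= Y x)"
   "AE x\<in>icube x0 R in lborel. (\<forall>n j i. \<bar>dP n j i x\<bar> <= Y x)"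
  and lims: "AE x\<in>icube x0 R in lborel. (%n. Qn n x) \<longlonglongrightarrow> Q x"
   "AE x\<in>icube x0 R in lborel. (\<forall>i. (%n. dQ n i x) \<longlonglongrightarrow> q i x)"
   "AE x\<in>icube x0 R in lborel. (\<forall>j i. (%n. dP n j i x) \<longlonglongrightarrow> pd j i x)"
  and Q_nonneg: "AE x\<in>icube x0 R in lborel. 0 <= Q x"
  and c_pos: "c > 0" and sigma: "\<bar>\<sigma>\<bar> = 1"
  and jac: "AE x\<in>icube x0 R in lborel. c <= \<sigma> * jdet k l (%b. q b x) (%a b. pd a b x)"
begin

abbreviation "U \<equiv> icube x0 R"

lemma U_open: "open U" by (rule open_icube)

lemma U_meas [measurable]: "U \<in> sets borel" by (rule icube_borel)

lemma Y_pow: "a <= pe ==> Y x ^ a <= Y x ^ pe" using Y_ge_1 by (intro power_increasing) auto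

lemma d1_le_pe: "d + 1 <= pe" unfolding pe_def by (cases d) auto

lemma cont_indicator: "continuous_on U f ==> (%x. indicator U x * f x) \<in> Borel" for f :: "real ^ 'n => real"
 using borel_measurable_continuous_on_indicator[of U f] U_meas by (simp add: scaleR_conv_of_real)

text \<open>Coordinate l is left out of the sum because a separate cutoff in x_l localises that
  direction.\<close>

definition \<theta> :: "real => ('n => real => real) => real ^ 'n => real" where
 "\<theta> eps \<psi> x = max 0 (eps - (\<Sum>i\<in>UNIV - {l}. \<psi> i (x $ i)) - Q x) / eps"

lemma theta_nonneg: "0 < eps ==> 0 <= \<theta> eps \<psi> x" by (simp add: \<theta>_def)

lemma theta_le_1: "0 < eps ==> (!!i t. 0 <= \<psi> i t) ==> 0 <= Q x ==> \<theta> eps \<psi> x <= 1"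
 using sum_nonneg[of "UNIV - {l}" "%i. \<psi> i (x $ i)"] by (auto simp: \<theta>_def)

lemma interval_bound:
 fixes f :: "real => real"
 assumes "continuous_on UNIV f"
 shows "\<exists>B\<ge>0. \<forall>t. \<bar>t - a\<bar> <= s --> \<bar>f t\<bar> <= B" proof -
 have "compact (f ` {a - s .. a + s})" by (rule compact_continuous_image[OF continuous_on_subset[OF assms]]) auto
 then obtain B where "\<forall>y\<in>f ` {a - s .. a + s}. norm y <= B" using compact_imp_bounded bounded_iff by metis
 hence "\<bar>f t\<bar> <= \<bar>B\<bar>" if "\<bar>t - a\<bar> <= s" for t proof -
  have "norm (f t) <= B" using that \<open>\<forall>y\<in>f ` {a - s..a + s}. norm y <= B\<close> by force
  thus ?thesis by simp
 qed
 thus ?thesis by (intro exI[of _ "\<bar>B\<bar>"]) auto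
qed

text \<open>The integrand is the limit of Jacobians whose first row is the gradient of \<open>h \<sigma>\<^sup>2 / (2 \<epsilon>)\<close> with
  \<open>\<sigma> = (\<epsilon> - \<Sum> \<psi>\<^sub>i - Q)\<^sup>+\<close>; the derivative of \<open>h\<close> drops out since row \<open>l\<close> is a unit vector.\<close>

lemma identity_limit:
 assumes e: "0 < eps" and r: "0 < r" "r < r'" "r' < R"
  and psi: "!!i t. DERIV (\<psi> i) t :> \<psi>' i t" "!!i. continuous_on UNIV (\<psi>' i)" "!!i t. 0 <= \<psi> i t"
   "!!i t. r' <= \<bar>t - x0 $ i\<bar> ==> eps + M <= \<psi> i t"
  and chi: "!!t. DERIV h t :> h' t" "continuous_on UNIV h'" "!!t. r <= \<bar>t - x0 $ l\<bar> ==> h t = 0"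
 shows "(LBINT x. indicator U x * (h (x $ l) * \<theta> eps \<psi> x * (jdet k l (%b. \<psi>' b (x $ b)) (%a b. pd a b x) + jdet k l (%b. q b x) (%a b. pd a b x)))) = 0"
proof -
 have cpsi: "continuous_on A (\<psi> i)" and cchi: "continuous_on A h" for A i
  using psi(1) chi(1) by (auto intro!: continuous_at_imp_continuous_on DERIV_isCont)
 have ccoord: "continuous_on A (%x :: real^'n. f (x $ i))" if "continuous_on UNIV f" for f :: "real => real" and A i
  by (rule continuous_on_compose2[OF that]) (auto intro!: continuous_intros)
 have chi''0: "h' t = 0" if "r < \<bar>t - x0 $ l\<bar>" for t proof -
  have "open {s. r < \<bar>s - x0 $ l\<bar>}" by (intro open_Collect_less continuous_intros)
  hence "\<forall>\<^sub>F s in nhds t. s \<in> {s. r < \<bar>s - x0 $ l\<bar>}" using that by (intro eventually_nhds_in_open) auto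
  hence ev: "\<forall>\<^sub>F s in nhds t. h s = 0" by eventually_elim (auto intro: chi(3))
  have "DERIV h t :> 0" by (rule iffD2[OF DERIV_cong_ev[OF refl ev refl]]) simp
  thus ?thesis using DERIV_unique chi(1) by blast
 qed
 define s where "s = (%n x. eps - (\<Sum>i\<in>UNIV - {l}. \<psi> i (x $ i)) - Qn n x)"
 define th where "th = (%n x. max 0 (s n x) / eps)"
 define g where "g = (%n b x. (if b = l then 0 else \<psi>' b (x $ b)) + dQ n b x)"
 define \<Psi> where "\<Psi> = (%n x. h (x $ l) * (pos2 (s n x) / (2 * eps)))"
 define dPsi where "dPsi = (%n b x. (if b = l then h' (x $ l) else 0) * (pos2 (s n x) / (2 * eps)) + h (x $ l) * (th n x * - g n b x))"
 define DP where "DP = (%n j i x. if j = l then (if i = l then 1 else 0) else dP n j i x)"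
 define DDP where "DDP = (%n j m i x. if j = l then 0 else ddP n j m i x)"
 have cs: "continuous_on U (s n)" for n
  unfolding s_def by (intro continuous_on_diff continuous_on_const continuous_on_sum ccoord cpsi cont)
 have cth: "continuous_on U (th n)" for n unfolding th_def using e cs by (intro continuous_intros) auto
 have cg: "continuous_on U (g n b)" for n b unfolding g_def by (cases "b = l") (auto intro!: continuous_on_add ccoord psi cont)
 \<comment> \<open>In the directions other than l the support is compact because \<psi>_i exceeds
   \<open>eps + M\<close> beyond r', which outweighs every value of \<open>Qn\<close>.\<close>
 have big: "s n x <= 0" if "x \<in> U" "i ~= l" "r' <= \<bar>x $ i - x0 $ i\<bar>" for n x i proof -
  have "\<psi> i (x $ i) <= (\<Sum>i\<in>UNIV - {l}. \<psi> i (x $ i))" using that psi(3) by (intro member_le_sum) auto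
  thus ?thesis using psi(4)[OF that(3)] Q_bound[OF that(1), of n] by (auto simp: s_def)
 qed
 have zero: "h (x $ l) = 0 \<and> h' (x $ l) = 0 \<or> s n x <= 0" if x: "x \<in> U" "x \<notin> qcube x0 r'" for n x proof -
  obtain i where i: "r' < \<bar>x $ i - x0 $ i\<bar>" using x(2) by (auto simp: qcube_def not_le)
  show ?thesis proof (cases "i = l")
   case True
   thus ?thesis using i r chi(3)[of "x $ l"] chi''0[of "x $ l"] by auto
  next
   case False
   thus ?thesis using big[OF x(1) False, of n] i by auto
  qed
 qed
 have nl: "(LBINT x. indicator U x * det (\<chi> a b. if a = k then dPsi n b x else DP n a b x)) = 0" for n
 proof (rule null_lagrangian[of U "qcube x0 r'" k "DP n" "DDP n" "\<Psi> n"])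
  show "qcube x0 r' \<subseteq> U" using r by (auto simp: qcube_def icube_def intro: le_less_trans)
  show "has_partial (DP n j m) (DDP n j m i x) i x" if "x \<in> U" for j m i x
   using ddPn[OF that, of n j m i] by (cases "j = l") (auto simp: DP_def DDP_def has_partial_const)
  show "DDP n j m i x = DDP n j i m x" if "x \<in> U" for j m i x using sym[OF that, of n j m i] by (auto simp: DDP_def)
  show "continuous_on U (DP n j m)" for j m using cont(3) by (cases "j = l") (auto simp: DP_def intro: continuous_on_const)
  show "continuous_on U (DDP n j m i)" for j m i using cont(4) by (cases "j = l") (auto simp: DDP_def intro: continuous_on_const)
  show "has_partial (\<Psi> n) (dPsi n b x) b x" if x: "x \<in> U" for b x proof -
   have "has_partial (s n) (0 - (\<Sum>i\<in>UNIV - {l}. if b = i then \<psi>' i (x $ i) else 0) - dQ n b x) b x"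
    unfolding s_def by (intro has_partial_diff has_partial_const has_partial_sum has_partial_coord psi dQn x)
   moreover have "(\<Sum>i\<in>UNIV - {l}. if b = i then \<psi>' i (x $ i) else 0) = (if b = l then 0 else \<psi>' b (x $ b))"
    by (simp add: sum.delta)
   ultimately have ps: "has_partial (s n) (- g n b x) b x" by (simp add: g_def)
   have "DERIV (%t. pos2 t / (2 * eps)) t :> max 0 t / eps" for t
    using DERIV_cdivide[OF DERIV_pos2[of t], of "2 * eps"] by simp
   from has_partial_chain[OF this ps] have "has_partial (%x. pos2 (s n x) / (2 * eps)) (th n x * - g n b x) b x"
    by (simp add: th_def)
   from has_partial_mult[OF has_partial_coord[where f=h and x=x and i=l and b=b, OF chi(1)] this]
   show ?thesis by (simp add: \<Psi>_def dPsi_def)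
  qed
  show "continuous_on U (\<Psi> n)"
   unfolding \<Psi>_def by (intro continuous_on_mult continuous_on_divide ccoord cchi continuous_on_pos2 cs continuous_on_const) (use e in auto)
  have "continuous_on U (%x. if b = l then h' (x $ l) else 0)" for b
   using ccoord[OF chi(2)] by (cases "b = l") (auto intro: continuous_on_const)
  note cb = this
  have c1: "continuous_on U (%x. pos2 (s n x) / (2 * eps))"
   by (intro continuous_on_divide continuous_on_pos2 cs continuous_on_const) (use e in auto)
  have c2: "continuous_on U (%x. th n x * - g n b x)" for b by (intro continuous_on_mult continuous_on_minus cth cg)
  show "continuous_on U (dPsi n b)" for b unfolding dPsi_def
   by (rule continuous_on_add[OF continuous_on_mult[OF cb c1] continuous_on_mult[OF ccoord[OF cchi] c2]])
  show "\<Psi> n x = 0" if "x \<in> U" "x \<notin> qcube x0 r'" for x using zero[OF that, of n] by (auto simp: \<Psi>_def pos2_def)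
  show "dPsi n b x = 0" if "x \<in> U" "x \<notin> qcube x0 r'" for b x using zero[OF that, of n] by (auto simp: dPsi_def pos2_def th_def)
 qed (auto intro: U_open)
 define J where "J = (%n x. jdet k l (%b. \<psi>' b (x $ b)) (%a b. dP n a b x) + jdet k l (%b. dQ n b x) (%a b. dP n a b x))"
 have detJ: "det (\<chi> a b. if a = k then dPsi n b x else DP n a b x) = - (h (x $ l) * th n x * J n x)" for n x proof -
  let ?P = "%a b. dP n a b x"
  \<comment> \<open>Everything in column l that is not part of \<psi>' + dQ. Since \<open>g\<close>
    omits \<psi>' in column l, that term is added back here; the whole contribution is a multiple of
    a unit vector, which \<open>jdet_axis\<close> removes.\<close>
  let ?t = "h' (x $ l) * (pos2 (s n x) / (2 * eps)) + h (x $ l) * th n x * \<psi>' l (x $ l)"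
  have 1: "det (\<chi> a b. if a = k then dPsi n b x else DP n a b x) = jdet k l (%b. dPsi n b x) ?P"
   unfolding jdet_def DP_def by (intro arg_cong[where f=det]) (auto simp: vec_eq_iff)
  have 2: "(%b. dPsi n b x) = (%b. (if b = l then ?t else 0) + (- (h (x $ l) * th n x)) * (\<psi>' b (x $ b) + dQ n b x))" by (auto simp: dPsi_def g_def algebra_simps)
  show ?thesis unfolding 2 jdet_add jdet_axis[OF kl] jdet_scale J_def 1 by simp
 qed
 have nl2: "(LBINT x. indicator U x * (h (x $ l) * th n x * J n x)) = 0" for n proof -
  show ?thesis using nl[of n] unfolding detJ by simp
 qed
 obtain Bc where Bc: "Bc \<ge> 0" "!!t. \<bar>t - x0 $ l\<bar> <= R ==> \<bar>h t\<bar> <= Bc" using interval_bound[OF cchi, of "x0 $ l" R] by blast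
 have "\<forall>i. \<exists>B\<ge>0. \<forall>t. \<bar>t - x0 $ i\<bar> <= R --> \<bar>\<psi>' i t\<bar> <= B" using interval_bound[OF psi(2)] by blast
 then obtain Bp where Bp: "!!i. Bp i \<ge> 0" "!!i t. \<bar>t - x0 $ i\<bar> <= R ==> \<bar>\<psi>' i t\<bar> <= Bp i" by metis
 \<comment> \<open>The determinants are bounded by multiples of Y^d and Y^(d+1), and d + 1 <=
   \<open>pe\<close>, so Y^pe is a majorant for every n.\<close>
 define W where "W = (%x. Bc * ((eps + \<bar>M\<bar>) / eps) * (fact CARD('n) * ((\<Sum>i\<in>UNIV. Bp i) + real CARD('n))) * (indicator U x * Y x ^ pe))"
 define F where "F = (%n x. indicator U x * (h (x $ l) * th n x * J n x))"
 define Finf where "Finf = (%x. indicator U x * (h (x $ l) * \<theta> eps \<psi> x * (jdet k l (%b. \<psi>' b (x $ b)) (%a b. pd a b x) + jdet k l (%b. q b x) (%a b. pd a b x))))"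
 have "(%n. \<integral>x. F n x \<partial>lborel) \<longlonglongrightarrow> (LBINT x. Finf x)"
 proof (rule integral_dominated_convergence[where w=W])
  have [measurable]: "\<psi> i \<in> Borel" "h \<in> Borel" "\<psi>' i \<in> Borel" for i
   by (auto intro!: borel_measurable_continuous_onI cpsi cchi psi)
  note [measurable] = meas
  have [measurable]: "(%x. jdet k l (%b. \<psi>' b (x $ b)) (%a b. pd a b x)) \<in> Borel"
   "(%x. jdet k l (%b. q b x) (%a b. pd a b x)) \<in> Borel"
   by (rule jdet_measurable; measurable)+
  have [measurable]: "\<theta> eps \<psi> \<in> Borel" unfolding \<theta>_def by measurable
  show "Finf \<in> borel_measurable lborel" unfolding Finf_def by measurable
  show "F n \<in> borel_measurable lborel" for n proof -
   have cj: "continuous_on U (%x. jdet k l (v x) (P x))" if "!!b. continuous_on U (%x. v x b)" "!!a b. continuous_on U (%x. P x a b)"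
    for v :: "real ^ 'n => 'n => real" and P unfolding jdet_expand
   proof (intro continuous_on_sum continuous_on_mult continuous_on_const that continuous_on_prod)
    fix a and \<pi> :: "'n => 'n"
    show "continuous_on U (%x. if a = l then (if \<pi> a = l then 1 else 0) else P x a (\<pi> a))"
     using that(2)[of a "\<pi> a"] by (cases "a = l") (auto intro: continuous_on_const)
   qed
   have "continuous_on U (J n)" unfolding J_def by (rule continuous_on_add[OF cj cj]) (rule ccoord[OF psi(2)] cont)+
   hence "continuous_on U (%x. h (x $ l) * th n x * J n x)" by (intro continuous_on_mult ccoord cchi cth)
   thus ?thesis unfolding F_def using cont_indicator by simp
  qed
  show "integrable lborel W" unfolding W_def by (rule integrable_mult_right[OF Y_int])
  show "AE x in lborel. (%n. F n x) \<longlonglongrightarrow> Finf x" using lims proof eventually_elim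
   case (elim x)
   show ?case proof (cases "x \<in> U")
    case True
    have "(%n. th n x) \<longlonglongrightarrow> \<theta> eps \<psi> x" unfolding th_def \<theta>_def s_def
     using elim True e by (intro tendsto_intros) auto
    moreover have "(%n. J n x) \<longlonglongrightarrow> jdet k l (%b. \<psi>' b (x $ b)) (%a b. pd a b x) + jdet k l (%b. q b x) (%a b. pd a b x)"
     unfolding J_def using elim True by (intro tendsto_add jdet_tendsto) auto
    ultimately show ?thesis unfolding F_def Finf_def by (intro tendsto_mult tendsto_const)
   qed (simp add: F_def Finf_def)
  qed
  show "AE x in lborel. norm (F n x) <= W x" for n using dom proof eventually_elim
   case (elim x)
   show ?case proof (cases "x \<in> U")
    case True
    have co: "\<bar>x $ i - x0 $ i\<bar> <= R" for i using True by (auto simp: icube_def intro: less_imp_le)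
    have th: "\<bar>th n x\<bar> <= (eps + \<bar>M\<bar>) / eps" using sum_nonneg[of "UNIV - {l}" "%i. \<psi> i (x $ i)"] psi(3) Q_bound[OF True, of n] e by (simp add: th_def divide_right_mono s_def)
    have Yn: "0 <= Y x" using Y_ge_1[of x] by linarith
    have "\<bar>jdet k l (%b. \<psi>' b (x $ b)) (%a b. dP n a b x)\<bar> <= fact CARD('n) * ((\<Sum>b\<in>UNIV. \<bar>\<psi>' b (x $ b)\<bar>) * Y x ^ d)"
     unfolding d_def using elim True by (intro jdet_bound[OF kl Yn]) auto
    also have "... <= fact CARD('n) * ((\<Sum>b\<in>UNIV. Bp b) * Y x ^ pe)"
     using Bp co Yn d1_le_pe by (intro mult_left_mono mult_mono sum_mono Y_pow) (auto intro: sum_nonneg)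
    finally have j1: "\<bar>jdet k l (%b. \<psi>' b (x $ b)) (%a b. dP n a b x)\<bar> <= fact CARD('n) * ((\<Sum>b\<in>UNIV. Bp b) * Y x ^ pe)" .
    have "\<bar>jdet k l (%b. dQ n b x) (%a b. dP n a b x)\<bar> <= fact CARD('n) * ((\<Sum>b\<in>UNIV. \<bar>dQ n b x\<bar>) * Y x ^ d)"
     unfolding d_def using elim True by (intro jdet_bound[OF kl Yn]) auto
    also have "... <= fact CARD('n) * ((\<Sum>b\<in>(UNIV::'n set). Y x) * Y x ^ d)"
     using elim True Yn by (intro mult_left_mono mult_right_mono sum_mono) auto
    also have "... = fact CARD('n) * (real CARD('n) * Y x ^ (d + 1))" by simp
    also have "... <= fact CARD('n) * (real CARD('n) * Y x ^ pe)" by (intro mult_left_mono Y_pow d1_le_pe) auto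
    finally have "\<bar>J n x\<bar> <= fact CARD('n) * ((\<Sum>b\<in>UNIV. Bp b) * Y x ^ pe) + fact CARD('n) * (real CARD('n) * Y x ^ pe)"
     unfolding J_def using j1 by (intro order_trans[OF abs_triangle_ineq] add_mono)
    hence J: "\<bar>J n x\<bar> <= (fact CARD('n) * ((\<Sum>i\<in>UNIV. Bp i) + real CARD('n))) * Y x ^ pe"
     by (simp add: algebra_simps)
    have "\<bar>h (x $ l) * th n x * J n x\<bar> <= Bc * ((eps + \<bar>M\<bar>) / eps) * ((fact CARD('n) * ((\<Sum>i\<in>UNIV. Bp i) + real CARD('n))) * Y x ^ pe)"
     unfolding abs_mult using Bc co th J e by (intro mult_mono) auto
    thus ?thesis using True by (simp add: F_def W_def mult.assoc)
   qed (simp add: F_def W_def)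
  qed
 qed
 hence "(%n. 0) \<longlonglongrightarrow> (LBINT x. Finf x)" unfolding F_def nl2 .
 from LIMSEQ_unique[OF this tendsto_const] show ?thesis by (simp add: Finf_def)
qed

end

section \<open>The integral inequality for general cutoffs\<close>

context jacobian_setup
begin

lemma meas_theta:
 assumes "!!i. \<psi> i \<in> Borel"
 shows "\<theta> eps \<psi> \<in> Borel" proof -
 note [measurable] = assms meas
 show ?thesis unfolding \<theta>_def by measurable
qed

lemma jdet_meas:
 assumes "!!b. (%x. v x b) \<in> Borel"
 shows "(%x. jdet k l (v x) (%a b. pd a b x)) \<in> Borel"
 by (rule jdet_measurable) (use assms meas in auto)

lemma pd_bound: "AE x\<in>U in lborel. (\<forall>j i. \<bar>pd j i x\<bar> <= Y x)" using lims(3) dom(2) proof eventually_elim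
 case (elim x)
 show ?case proof (intro impI allI)
  fix j i assume "x \<in> U"
  thus "\<bar>pd j i x\<bar> <= Y x" using elim by (intro LIMSEQ_le_const2[OF tendsto_rabs[of "%n. dP n j i x"]]) auto
 qed
qed

lemma q_bound: "AE x\<in>U in lborel. (\<forall>i. \<bar>q i x\<bar> <= Y x)" using lims(2) dom(1) proof eventually_elim
 case (elim x)
 show ?case proof (intro impI allI)
  fix i assume "x \<in> U"
  thus "\<bar>q i x\<bar> <= Y x" using elim by (intro LIMSEQ_le_const2[OF tendsto_rabs[of "%n. dQ n i x"]]) auto
 qed
qed

lemma U_AE_int:
 assumes f: "f \<in> Borel" "AE x\<in>U in lborel. \<bar>f x\<bar> <= B * Y x ^ pe"
 shows "integrable lborel (%x. indicator U x * f x)"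
proof (rule Bochner_Integration.integrable_bound[OF integrable_mult_right[OF Y_int, of B]])
 note [measurable] = f(1)
 show "(%x. indicator U x * f x) \<in> borel_measurable lborel" by measurable
 show "AE x in lborel. norm (indicator U x * f x) <= norm (B * (indicator U x * Y x ^ pe))" using f(2) proof eventually_elim
  case (elim x)
  thus ?case by (cases "x \<in> U") (auto simp: abs_le_iff)
 qed
qed

text \<open>The identity equates the weighted Jacobian of Q with minus that of the cutoffs. After
  the sign \<sigma> the first is at least c times the weight, while the second is bounded entry by
  entry. The majorant \<open>g\<close> is left open so that the place where the cutoffs vary can be
  exploited.\<close>

lemma main_inequality:
 assumes e: "0 < eps" and r: "0 < r" "r < r'" "r' < R"
  and phi: "!!i t. DERIV (\<phi> i) t :> \<phi>' i t" "!!i. continuous_on UNIV (\<phi>' i)"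
   "!!i t. 0 <= \<phi> i t" "!!i t. r' <= \<bar>t - x0 $ i\<bar> ==> eps + M <= \<phi> i t"
  and h: "!!t. DERIV h t :> h' t" "continuous_on UNIV h'" "!!t. 0 <= h t"
   "!!t. r <= \<bar>t - x0 $ l\<bar> ==> h t = 0"
  and w_def: "w = (%x. h (x $ l) * \<theta> eps \<phi> x)"
  and bnd: "g \<in> Borel"
   "AE x\<in>U in lborel. w x * (fact CARD('n) * ((\<Sum>i\<in>UNIV. \<bar>\<phi>' i (x $ i)\<bar>) * Y x ^ d)) <= g x"
   "AE x\<in>U in lborel. \<bar>g x\<bar> <= B * Y x ^ pe"
 shows "c * (LBINT x. indicator U x * w x) <= (LBINT x. indicator U x * g x)"
  and "integrable lborel (%x. indicator U x * w x)" proof -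
 have ch: "continuous_on A h" for A using h(1) by (auto intro!: continuous_at_imp_continuous_on DERIV_isCont)
 have cphi0: "continuous_on A (\<phi> i)" for A i using phi(1) by (auto intro!: continuous_at_imp_continuous_on DERIV_isCont)
 note [measurable] = meas bnd(1) borel_measurable_continuous_onI[OF ch] borel_measurable_continuous_onI[OF phi(2)]
 have [measurable]: "\<theta> eps \<phi> \<in> Borel"
  by (rule meas_theta) (rule borel_measurable_continuous_onI[OF cphi0])
 let ?jp = "%x. jdet k l (%b. \<phi>' b (x $ b)) (%a b. pd a b x)" and ?jq = "%x. jdet k l (%b. q b x) (%a b. pd a b x)"
 have [measurable]: "?jq \<in> Borel" "?jp \<in> Borel" by (rule jdet_meas; measurable)+
 have id: "(LBINT x. indicator U x * (w x * (?jp x + ?jq x))) = 0" unfolding w_def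
  by (rule identity_limit[OF e r phi h(1,2,4)])
 obtain Bc where Bc: "Bc \<ge> 0" "!!t. \<bar>t - x0 $ l\<bar> <= R ==> \<bar>h t\<bar> <= Bc" using interval_bound[OF ch, of "x0 $ l" R] by blast
 have "\<forall>i. \<exists>B\<ge>0. \<forall>t. \<bar>t - x0 $ i\<bar> <= R --> \<bar>\<phi>' i t\<bar> <= B" using interval_bound[OF phi(2)] by blast
 then obtain Bp where Bp: "!!i. Bp i \<ge> 0" "!!i t. \<bar>t - x0 $ i\<bar> <= R ==> \<bar>\<phi>' i t\<bar> <= Bp i" by metis
 have Yn: "0 <= Y x" for x using Y_ge_1[of x] by linarith
 have co: "\<bar>x $ i - x0 $ i\<bar> <= R" if "x \<in> U" for x i using that by (auto simp: icube_def intro: less_imp_le)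
 have w0: "0 <= w x" for x using h(3) theta_nonneg[OF e] by (simp add: w_def)
 have I: "integrable lborel (%x. indicator U x * (w x * f x))"
  if f [measurable]: "f \<in> Borel" and b: "AE x\<in>U in lborel. \<bar>f x\<bar> <= b * Y x ^ pe" for f b
 proof (rule U_AE_int[where B="Bc * b"])
  show "AE x\<in>U in lborel. \<bar>w x * f x\<bar> <= Bc * b * Y x ^ pe" using Q_nonneg b proof eventually_elim
   case (elim x)
   show ?case
   proof
    assume x: "x \<in> U"
    hence "\<bar>w x\<bar> * \<bar>f x\<bar> <= (Bc * 1) * (b * Y x ^ pe)" unfolding w_def abs_mult
     using Bc co[OF x] elim theta_le_1[OF e phi(3)] theta_nonneg[OF e] by (intro mult_mono) auto
    thus "\<bar>w x * f x\<bar> <= Bc * b * Y x ^ pe" by (simp add: abs_mult)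
   qed
  qed
 qed (simp add: w_def, measurable)
 have i1: "integrable lborel (%x. indicator U x * w x)"
  using I[of "%_. 1" 1] Y_ge_1 by (simp add: one_le_power)
 have bp: "AE x\<in>U in lborel. \<bar>?jp x\<bar> <= fact CARD('n) * ((\<Sum>b\<in>UNIV. \<bar>\<phi>' b (x $ b)\<bar>) * Y x ^ d)"
  using pd_bound by eventually_elim (intro impI, unfold d_def, rule jdet_bound[OF kl Yn], auto)
 have i2: "integrable lborel (%x. indicator U x * (w x * ?jp x))"
 proof (rule I[where b="fact CARD('n) * (\<Sum>b\<in>UNIV. Bp b)"])
  show "AE x\<in>U in lborel. \<bar>?jp x\<bar> <= fact CARD('n) * (\<Sum>b\<in>UNIV. Bp b) * Y x ^ pe" using bp
  proof eventually_elim
   case (elim x)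
   have "fact CARD('n) * ((\<Sum>b\<in>UNIV. \<bar>\<phi>' b (x $ b)\<bar>) * Y x ^ d) <= fact CARD('n) * ((\<Sum>b\<in>UNIV. Bp b) * Y x ^ pe)" if "x \<in> U"
    using Bp co[OF that] Yn d1_le_pe by (intro mult_left_mono mult_mono sum_mono Y_pow) (auto intro: sum_nonneg)
   thus ?case using elim unfolding mult.assoc by (blast intro: order_trans)
  qed
 qed measurable
 have i3: "integrable lborel (%x. indicator U x * (w x * ?jq x))"
 proof (rule I[where b="fact CARD('n) * real CARD('n)"])
  show "AE x\<in>U in lborel. \<bar>?jq x\<bar> <= fact CARD('n) * real CARD('n) * Y x ^ pe" using pd_bound q_bound
  proof eventually_elim
   case (elim x)
   show ?case
   proof
    assume x: "x \<in> U"
    have "\<bar>?jq x\<bar> <= fact CARD('n) * ((\<Sum>b\<in>UNIV. \<bar>q b x\<bar>) * Y x ^ d)" unfolding d_def by (rule jdet_bound[OF kl Yn]) (use elim x in auto)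
    also have "... <= fact CARD('n) * ((\<Sum>b\<in>(UNIV::'n set). Y x) * Y x ^ d)"
     using elim x Yn by (intro mult_left_mono mult_right_mono sum_mono) auto
    also have "... = fact CARD('n) * (real CARD('n) * Y x ^ (d + 1))" by simp
    also have "... <= fact CARD('n) * (real CARD('n) * Y x ^ pe)" by (intro mult_left_mono Y_pow d1_le_pe) auto
    finally show "\<bar>?jq x\<bar> <= fact CARD('n) * real CARD('n) * Y x ^ pe" by (simp add: mult.assoc)
   qed
  qed
 qed measurable
 have "0 = (LBINT x. indicator U x * (w x * ?jp x) + indicator U x * (w x * ?jq x))" using id by (simp add: algebra_simps)
 also have "... = (LBINT x. indicator U x * (w x * ?jp x)) + (LBINT x. indicator U x * (w x * ?jq x))"
  by (rule Bochner_Integration.integral_add[OF i2 i3])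
 finally have eq: "(LBINT x. indicator U x * (w x * ?jq x)) = - (LBINT x. indicator U x * (w x * ?jp x))" by linarith
 have "c * (LBINT x. indicator U x * w x) = (LBINT x. c * (indicator U x * w x))" by simp
 also have "... <= (LBINT x. \<sigma> * (indicator U x * (w x * ?jq x)))"
 proof (rule integral_mono_AE[OF integrable_mult_right[OF i1] integrable_mult_right[OF i3]])
  show "AE x in lborel. c * (indicator U x * w x) <= \<sigma> * (indicator U x * (w x * ?jq x))" using jac proof eventually_elim
   case (elim x)
   thus ?case using mult_left_mono[OF _ w0[of x], of c "\<sigma> * ?jq x"] by (cases "x \<in> U") (auto simp: mult_ac)
  qed
 qed
 also have "... = (LBINT x. - \<sigma> * (indicator U x * (w x * ?jp x)))" unfolding integral_mult_right_zero eq by simp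
 also have "... <= (LBINT x. indicator U x * g x)" proof (rule integral_mono_AE[OF integrable_mult_right[OF i2] U_AE_int[OF bnd(1,3)]])
  show "AE x in lborel. - \<sigma> * (indicator U x * (w x * ?jp x)) <= indicator U x * g x" using bp bnd(2) proof eventually_elim
   case (elim x)
   show ?case proof (cases "x \<in> U")
    case True
    have "- \<sigma> * (w x * ?jp x) <= \<bar>\<sigma> * (w x * ?jp x)\<bar>" by linarith
    also have "... = w x * \<bar>?jp x\<bar>" using w0 sigma abs_mult[of \<sigma>] abs_mult[of "w x" "?jp x"] by (simp only: abs_of_nonneg mult_1)
    also have "... <= w x * (fact CARD('n) * ((\<Sum>b\<in>UNIV. \<bar>\<phi>' b (x $ b)\<bar>) * Y x ^ d))"
     using elim True w0 by (intro mult_left_mono) auto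
    also have "... <= g x" using elim True by blast
    finally show ?thesis using True by simp
   qed simp
  qed
 qed
 finally show "c * (LBINT x. indicator U x * w x) <= (LBINT x. indicator U x * g x)" .
 show "integrable lborel (%x. indicator U x * w x)" by (rule i1)
qed

end

subsection \<open>Sublevel sets of the first component\<close>

lemma mult_rearrange: "a * b * e * f = a * f * b * (e :: real)" by simp

text \<open>Above c/2 the factor 2 a / c is at least 1, so its d-th power may be inserted. The part
  c/2 will be absorbed into the left side.\<close>

lemma young_power:
 fixes a c :: real
 assumes "0 <= a" "0 < c"
 shows "a <= c / 2 + (if c / 2 < a then a ^ (d + 1) * (2 / c) ^ d else 0)" proof (cases "a <= c / 2")
 case False
 hence "1 <= (a * (2 / c)) ^ d" using assms by (intro one_le_power) (simp add: field_simps)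
 hence "a * 1 <= a * (a * (2 / c)) ^ d" using assms by (intro mult_left_mono) auto
 hence "a <= a ^ (d + 1) * (2 / c) ^ d" by (simp only: power_mult_distrib mult_1_right power_Suc Suc_eq_plus1[symmetric] mult.assoc)
 hence "a <= c / 2 + a ^ (d + 1) * (2 / c) ^ d" using assms by linarith
 thus ?thesis using False by (simp only: not_le if_True)
qed simp

lemma sum_at_most_one:
 fixes f :: "'a => real"
 assumes "finite A" "0 <= C" "!!a. a \<in> A ==> f a <= C" "!!a b. a \<in> A ==> b \<in> A ==> f a ~= 0 ==> f b ~= 0 ==> a = b"
 shows "sum f A <= C" proof (cases "\<exists>a\<in>A. f a ~= 0")
 case True
 then obtain a where a: "a \<in> A" "f a ~= 0" by blast
 have "sum f A = sum f {a}" proof (rule sum.mono_neutral_right[OF assms(1)])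
  show "\<forall>i\<in>A - {a}. f i = 0" using assms(4)[OF _ a(1) _ a(2)] by blast
 qed (use a in simp)
 thus ?thesis using assms(3)[OF a(1)] by simp
next
 case False
 hence "sum f A = 0" by (intro sum.neutral) blast
 thus ?thesis using assms(2) by simp
qed

lemma grid_disjoint:
 fixes e y :: real
 assumes "0 < e" "real s * e <= y" "y < (real s + 1) * e" "real s' * e <= y" "y < (real s' + 1) * e"
 shows "s = s'" proof -
 have "s <= s'" if "real s * e <= y" "y < (real s' + 1) * e" for s s' :: nat proof -
  have "real s * e < (real s' + 1) * e" using that by linarith
  hence "real s < real s' + 1" using assms(1) by (simp only: mult_less_cancel_right_pos)
  thus ?thesis by linarith
 qed
 thus ?thesis using assms by (meson order_antisym)
qed

text \<open>A piecewise quadratic \<open>C\<^sup>1\<close> step from \<open>0\<close> to \<open>1\<close>.\<close>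

definition hp :: "real => real" where
 "hp y = 2 * pos2 y - 4 * pos2 (y - 1/2) + 2 * pos2 (y - 1)"

definition hp' :: "real => real" where
 "hp' y = 4 * max 0 y - 8 * max 0 (y - 1/2) + 4 * max 0 (y - 1)"

lemma DERIV_hp: "DERIV hp y :> hp' y" proof -
 have *: "DERIV (%y. pos2 (y - a)) y :> 2 * max 0 (y - a)" for a proof -
  have "DERIV (%y. y - a) y :> 1" by (auto intro!: derivative_eq_intros)
  from DERIV_chain'[OF this DERIV_pos2] show ?thesis by simp
 qed
 show ?thesis unfolding hp_def hp'_def
  using DERIV_add[OF DERIV_diff[OF DERIV_cmult[OF DERIV_pos2, of 2] DERIV_cmult[OF *[of "1/2"], of 4]] DERIV_cmult[OF *[of 1], of 2]] by simp
qed

lemma hp_nonneg: "0 <= hp y" proof -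
 consider "y <= 0" | "0 < y" "y <= 1/2" | "1/2 < y" "y <= 1" | "1 < y" by linarith
 thus ?thesis proof cases
  case 3
  hence "0 <= 1 - 2 * (1 - y)\<^sup>2" using power_mono[of "1 - y" "1/2" 2] by (simp add: power2_eq_square)
  thus ?thesis using 3 by (simp add: hp_def pos2_def power2_eq_square algebra_simps)
 qed (simp_all add: hp_def pos2_def power2_eq_square algebra_simps)
qed

lemma hp_1: "1 <= y ==> hp y = 1" by (simp add: hp_def pos2_def power2_eq_square algebra_simps)

lemma hp_0: "y <= 0 ==> hp y = 0" by (simp add: hp_def pos2_def)

lemma hp'_nz: "hp' y ~= 0 ==> 0 < y \<and> y < 1" by (auto simp: hp'_def max_def split: if_splits)

lemma hp'_bound: "\<bar>hp' y\<bar> <= 2" by (auto simp: hp'_def max_def split: if_splits)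

lemma continuous_on_hp': "continuous_on A f ==> continuous_on A (%x. hp' (f x))"
 unfolding hp'_def by (intro continuous_intros)

text \<open>The end points a and b stay free because the lower bound obtained from homogeneity is
  linear in b - a and is applied to thin slabs.\<close>

definition strip :: "(real ^ 'n::finite => real) => real ^ 'n => 'n => real => real => real => real => (real ^ 'n) set" where
 "strip Q x0 l r eps a b = {x. a <= x $ l \<and> x $ l <= b \<and> Q x < eps \<and> (\<forall>j. j ~= l --> \<bar>x $ j - x0 $ j\<bar> <= r / 2)}"

lemma strip_borel:
 assumes [measurable]: "Q \<in> Borel"
 shows "strip Q x0 l r eps a b \<in> sets borel" proof -
 have "strip Q x0 l r eps a b = {x \<in> space borel. a <= x $ l} \<inter> {x \<in> space borel. x $ l <= b} \<inter> {x \<in> space borel. Q x < eps} \<inter>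
  (\<Inter>j\<in>UNIV. {x \<in> space borel. j ~= l --> \<bar>x $ j - x0 $ j\<bar> <= r / 2})" by (auto simp: strip_def)
 moreover have "(\<Inter>j\<in>UNIV. {x \<in> space borel. j ~= l --> \<bar>x $ j - x0 $ j\<bar> <= r / 2}) \<in> sets borel"
  by (intro sets.finite_INT) auto
 ultimately show ?thesis by simp
qed

lemma strip_subset:
 assumes "0 < r" "x0 $ l - r <= a" "b <= x0 $ l + r"
 shows "strip Q x0 l r eps a b \<subseteq> qcube x0 r"
proof
 fix x assume x: "x \<in> strip Q x0 l r eps a b"
 have "\<bar>x $ j - x0 $ j\<bar> <= r" for j proof (cases "j = l")
  case True
  have "\<bar>x $ l - x0 $ l\<bar> <= r" using x assms by (auto simp: strip_def)
  thus ?thesis using True by simp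
 next
  case False
  hence "\<bar>x $ j - x0 $ j\<bar> <= r / 2" using x by (auto simp: strip_def)
  thus ?thesis using assms(1) by linarith
 qed
 thus "x \<in> qcube x0 r" by (simp add: qcube_def)
qed

section \<open>Staircase cutoffs on a grid of cells\<close>

context jacobian_setup
begin

definition sub :: "real => real => (real ^ 'n) set" where
 "sub r eps = {x \<in> icube x0 r. Q x < eps}"

text \<open>The range from r/2 to r of the distance to x0_i, on the side chosen by the sign
  \<kappa>, is cut into m equal intervals; s < m is the number of the interval.\<close>

definition cellA :: "real => nat => 'n => real => nat => real ^ 'n => bool" where
 "cellA r m i \<kappa> s x \<longleftrightarrow> real s * (r / (2 * real m)) <= \<kappa> * (x $ i - x0 $ i) - r / 2 \<and>
   \<kappa> * (x $ i - x0 $ i) - r / 2 < (real s + 1) * (r / (2 * real m))"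

lemma sub_meas [measurable]: "sub r eps \<in> sets borel" proof -
 note [measurable] = meas(1)
 have "sub r eps = icube x0 r \<inter> {x \<in> space borel. Q x < eps}" by (auto simp: sub_def)
 thus ?thesis by simp
qed

lemma cube_subset_U: "r <= R ==> icube x0 r \<subseteq> U" by (auto simp: icube_def intro: less_le_trans)

lemma qcube_subset_U: "r < R ==> qcube x0 r \<subseteq> U"
 by (auto simp: icube_def qcube_def intro: le_less_trans)

lemma cube_finite: "emeasure lborel (icube x0 r) < \<infinity>" proof -
 have "icube x0 r \<subseteq> qcube x0 r" by (auto simp: icube_def qcube_def intro: less_imp_le)
 hence "emeasure lborel (icube x0 r) <= emeasure lborel (qcube x0 r)" by (intro emeasure_mono) auto
 thus ?thesis using emeasure_qcube(1)[of x0 r] by (rule le_less_trans)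
qed

lemma sub_finite: "emeasure lborel (sub r eps) < \<infinity>" proof -
 have "sub r eps \<subseteq> icube x0 r" by (auto simp: sub_def)
 hence "emeasure lborel (sub r eps) <= emeasure lborel (icube x0 r)" by (intro emeasure_mono) auto
 thus ?thesis using cube_finite by (rule le_less_trans)
qed

lemma Y_pow_nonneg: "0 <= Y x ^ a" using Y_ge_1[of x] by (intro zero_le_power) linarith

lemma weight_bound:
 assumes "0 <= w" "w <= 1" "0 <= K"
 shows "\<bar>w * (K * Y x ^ d)\<bar> <= K * Y x ^ pe" proof -
 have "Y x ^ d <= Y x ^ pe" using d1_le_pe by (intro Y_pow) simp
 hence "K * Y x ^ d <= K * Y x ^ pe" using assms(3) by (rule mult_left_mono)
 moreover have "0 <= K * Y x ^ d" using assms(3) Y_pow_nonneg by (rule mult_nonneg_nonneg)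
 ultimately have "w * (K * Y x ^ d) <= 1 * (K * Y x ^ pe)" using mult_mono[OF assms(2) \<open>K * Y x ^ d <= K * Y x ^ pe\<close>] by simp
 moreover have "0 <= w * (K * Y x ^ d)" using assms(1) \<open>0 <= K * Y x ^ d\<close> by (rule mult_nonneg_nonneg)
 ultimately show ?thesis by linarith
qed

text \<open>The factorial comes from \<open>jdet_bound\<close>; 8 / r times \<open>eps\<close> is
  the slope of the staircase below, summed over the n coordinates.\<close>

definition Kc :: "real => real" where "Kc r = fact CARD('n) * (real CARD('n) * (8 / r))"

text \<open>The set where the cutoff term cannot be absorbed into half of the lower bound c of the
  Jacobian.\<close>

definition large :: "real => real => (real ^ 'n) set" where "large r eps = {x \<in> U. c / 2 < Kc r * eps * Y x ^ d}"

definition D :: "real => real => real" where "D r eps = (LBINT x. indicator (large r eps) x * Y x ^ pe)"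

text \<open>What \<open>young_power\<close> leaves for a = Kc eps Y^d after the powers of eps and Y
  have been split off.\<close>

definition Ac :: "real => real" where "Ac r = Kc r ^ (d + 1) * (2 / c) ^ d"

lemma large_meas [measurable]: "large r eps \<in> sets borel" proof -
 note [measurable] = meas(4)
 have "large r eps = U \<inter> {x \<in> space borel. c / 2 < Kc r * eps * Y x ^ d}" by (auto simp: large_def)
 thus ?thesis by simp
qed

lemma Y_sub_int:
 assumes [measurable]: "B \<in> sets borel" and B: "B \<subseteq> U"
 shows "integrable lborel (%x. indicator B x * Y x ^ pe)"
proof (rule Bochner_Integration.integrable_bound[OF Y_int])
 note [measurable] = meas(4)
 show "(%x. indicator B x * Y x ^ pe) \<in> borel_measurable lborel" by measurable
 show "AE x in lborel. norm (indicator B x * Y x ^ pe) <= norm (indicator U x * Y x ^ pe)"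
  using B by (intro AE_I2) (auto simp: indicator_def)
qed

lemma Kc_pos: "0 < r ==> 0 < Kc r" by (simp add: Kc_def)

lemma Ac_pos: "0 < r ==> 0 < Ac r" using Kc_pos c_pos by (simp add: Ac_def)

text \<open>The power d + 1 produced by \<open>young_power\<close> turns Y^d into Y^(d(d+1)); this
  dictates the integrability exponent \<open>pe\<close>.\<close>

lemma Y_pow_d1: "(Y x ^ d) ^ (d + 1) <= Y x ^ pe" proof -
 have "d * (d + 1) <= pe" by (simp add: pe_def)
 thus ?thesis unfolding power_mult[symmetric] by (rule Y_pow)
qed

text \<open>The cutoffs are staircases that rise only in the cells of \<open>NG\<close>, so the
  error term lives where Q < eps inside those cells, that is, in \<open>E\<close>. Half of the m
  cells suffice because each step is twice as high as an even distribution would require. The factor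
  c/8 is c/2, left after absorption, times the lower bound 1/4 of the weight on the strip.\<close>

lemma cell_cutoff:
 assumes r: "0 < r" "r < R" and e: "0 < eps" and eta: "0 < \<eta>" "x0 $ l - r <= a" "a + \<eta> <= x0 $ l + r" and m: "0 < m"
  and NG: "!!i \<kappa>. NG i \<kappa> \<subseteq> {..<m :: nat}" "!!i \<kappa>. i ~= l ==> \<kappa> \<in> {1, -1} ==> m <= 2 * card (NG i \<kappa>)"
  and E [measurable]: "E \<in> sets borel"
  and NE: "!!i \<kappa> s x. i ~= l ==> \<kappa> \<in> {1, -1} ==> s \<in> NG i \<kappa> ==> cellA r m i \<kappa> s x ==> a <= x $ l ==> x $ l < a + \<eta> ==>
   Q x < eps ==> x \<in> qcube x0 r ==> x \<in> E"
 shows "c / 8 * measure lborel (strip Q x0 l r (eps / 2) (a + \<eta> / 4) (a + 3 * \<eta> / 4))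
  <= Ac r * eps ^ (d + 1) * (LBINT x. indicator (E \<inter> large r eps) x * Y x ^ pe)" proof -
 have m': "0 < real m" using m by simp
 define C where "C = Kc r * eps"
 have C0: "0 < C" using Kc_pos e r by (simp add: C_def)
 define \<delta> where "\<delta> = r / (2 * real m)"
 have de: "0 < \<delta>" using r m by (simp add: \<delta>_def)
 have fin: "finite (NG i \<kappa>)" for i \<kappa> using NG(1) by (rule finite_subset) simp
 define \<Gamma> where "\<Gamma> = (%i. Sigma {1, -1 :: real} (NG i))"
 have finA: "finite (\<Gamma> i)" for i by (simp add: \<Gamma>_def fin)
 \<comment> \<open>At least m/2 steps of this height add up to \<open>eps\<close>.\<close>
 define z where "z = 2 * eps / real m"
 have z0: "0 < z" using e m by (simp add: z_def)
 define arg where "arg = (%i p (\<tau> :: real). (fst p * (\<tau> - x0 $ i) - r / 2 - real (snd p) * \<delta>) / \<delta>)"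
 define \<psi> where "\<psi> = (%i \<tau>. \<Sum>p\<in>\<Gamma> i. z * hp (arg i p \<tau>))"
 define \<psi>' where "\<psi>' = (%i \<tau>. \<Sum>p\<in>\<Gamma> i. z * (hp' (arg i p \<tau>) * (fst p / \<delta>)))"
 define r' where "r' = (r + R) / 2"
 have r': "r < r'" "r' < R" using r by (auto simp: r'_def)
 \<comment> \<open>Makes the quadratic ramp between r and r' reach \<open>eps + |M|\<close> at
   distance r'.\<close>
 define G where "G = (eps + \<bar>M\<bar>) / (r' - r)\<^sup>2"
 have G: "G > 0" using e r' by (auto simp: G_def)
 \<comment> \<open>\<theta> does not see the function with index l; a constant meets the growth
   condition that is imposed on all indices alike.\<close>
 define \<phi> where "\<phi> = (%i t. if i = l then eps + \<bar>M\<bar> else \<psi> i t + G * (pos2 (t - x0 $ i - r) + pos2 (x0 $ i - t - r)))"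
 define \<phi>' where "\<phi>' = (%i t. if i = l then 0 else \<psi>' i t + G * (2 * max 0 (t - x0 $ i - r) - 2 * max 0 (x0 $ i - t - r)))"
 define y where "y = (%\<tau>. (\<tau> - a) / \<eta>)"
 \<comment> \<open>The square of the parabola 4 y (1 - y), cut off at 0: it is C^1, lies between 0
   and 1, is supported on the slab and is at least 9/16 on its middle half.\<close>
 define h where "h = (%\<tau>. pos2 (4 * (y \<tau> * (1 - y \<tau>))))"
 define h' where "h' = (%\<tau>. 2 * max 0 (4 * (y \<tau> * (1 - y \<tau>))) * (4 * ((1 / \<eta>) * (1 - y \<tau>) + (0 - 1 / \<eta>) * y \<tau>)))"
 define w where "w = (%x. h (x $ l) * \<theta> eps \<phi> x)"
 define g where "g = (%x. w x * indicator E x * (C * Y x ^ d))"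
 have psi0: "0 <= \<psi> i \<tau>" for i \<tau> unfolding \<psi>_def using z0 by (intro sum_nonneg mult_nonneg_nonneg hp_nonneg) auto
 have dpsi: "DERIV (\<psi> i) \<tau> :> \<psi>' i \<tau>" for i \<tau> proof -
  have "DERIV (arg i p) \<tau> :> fst p / \<delta>" for p
   unfolding arg_def using de by (auto intro!: derivative_eq_intros)
  from DERIV_chain'[OF this DERIV_hp] have "DERIV (%\<tau>. hp (arg i p \<tau>)) \<tau> :> hp' (arg i p \<tau>) * (fst p / \<delta>)" for p
   by simp
  thus ?thesis unfolding \<psi>_def \<psi>'_def by (intro DERIV_sum DERIV_cmult)
 qed
 have cpsi: "continuous_on UNIV (\<psi>' i)" for i unfolding \<psi>'_def arg_def
  using de by (intro continuous_on_sum continuous_on_mult continuous_on_const continuous_on_hp' continuous_intros) auto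
 \<comment> \<open>At distance r from x0_i every selected step on that side has been climbed
   completely.\<close>
 have psibig: "eps <= \<psi> i \<tau>" if i: "i ~= l" and far: "r <= \<bar>\<tau> - x0 $ i\<bar>" for i \<tau> proof -
  obtain \<kappa> :: real where s: "\<kappa> \<in> {1, -1}" "r <= \<kappa> * (\<tau> - x0 $ i)"
   using far that[of 1] that[of "-1"] by (cases "\<tau> - x0 $ i \<ge> 0") auto
  have c: "real m <= 2 * real (card (NG i \<kappa>))" using NG(2)[OF i s(1)] by linarith
  have one: "hp (arg i (\<kappa>, s) \<tau>) = 1" if "s \<in> NG i \<kappa>" for s proof (rule hp_1)
   have "real s + 1 <= real m" using that NG(1)[of i \<kappa>] by auto
   hence "(real s + 1) * \<delta> <= real m * \<delta>" using de by (simp only: mult_le_cancel_right_pos)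
   moreover have "real m * \<delta> = r / 2" using m by (simp add: \<delta>_def)
   ultimately have "\<delta> <= \<kappa> * (\<tau> - x0 $ i) - r / 2 - real s * \<delta>" using s(2) by (simp add: algebra_simps)
   thus "1 <= arg i (\<kappa>, s) \<tau>" using de by (simp add: arg_def)
  qed
  have "eps = z * (real m / 2)" using m by (simp add: z_def)
  also have "... <= z * real (card (NG i \<kappa>))" by (rule mult_left_mono) (use c z0 in auto)
  also have "... = (\<Sum>s\<in>NG i \<kappa>. z * hp (arg i (\<kappa>, s) \<tau>))" using one by simp
  also have "... = (\<Sum>p\<in>Pair \<kappa> ` NG i \<kappa>. z * hp (arg i p \<tau>))" by (subst sum.reindex) (auto simp: inj_on_def)
  also have "... <= \<psi> i \<tau>" unfolding \<psi>_def
   using s(1) finA z0 by (intro sum_mono2 mult_nonneg_nonneg hp_nonneg) (auto simp: \<Gamma>_def)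
  finally show ?thesis .
 qed
 have cell: "cellA r m i (fst p) (snd p) x" if "hp' (arg i p (x $ i)) ~= 0" for i p x proof -
  from hp'_nz[OF that] have "0 < arg i p (x $ i) * \<delta>" "arg i p (x $ i) * \<delta> < 1 * \<delta>" using de by (auto intro: mult_strict_right_mono)
  moreover have "arg i p (x $ i) * \<delta> = fst p * (x $ i - x0 $ i) - r / 2 - real (snd p) * \<delta>" using de by (simp add: arg_def)
  ultimately show ?thesis unfolding cellA_def \<delta>_def[symmetric] by (simp add: algebra_simps)
 qed
 have psi'b: "\<bar>\<psi>' i (x $ i)\<bar> <= 8 / r * eps" for i x proof -
  let ?f = "%p. z * (hp' (arg i p (x $ i)) * (fst p / \<delta>))"
  have "\<bar>\<psi>' i (x $ i)\<bar> <= (\<Sum>p\<in>\<Gamma> i. \<bar>?f p\<bar>)" unfolding \<psi>'_def by (rule sum_abs)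
  \<comment> \<open>At a given point at most one step is rising: the side fixes the sign, and the
    cell fixes the number.\<close>
  also have "... <= z * (2 * (1 / \<delta>))" proof (rule sum_at_most_one[OF finA])
   show "0 <= z * (2 * (1 / \<delta>))" using z0 de by simp
   fix p assume p: "p \<in> \<Gamma> i"
   hence "\<bar>fst p / \<delta>\<bar> = 1 / \<delta>" using de by (auto simp: \<Gamma>_def)
   thus "\<bar>?f p\<bar> <= z * (2 * (1 / \<delta>))"
    unfolding abs_mult using z0 de hp'_bound[of "arg i p (x $ i)"] by (intro mult_mono) auto
  next
   fix p p' assume p: "p \<in> \<Gamma> i" "p' \<in> \<Gamma> i" and nz: "\<bar>?f p\<bar> ~= 0" "\<bar>?f p'\<bar> ~= 0"
   have 1: "cellA r m i (fst p) (snd p) x" and 2: "cellA r m i (fst p') (snd p') x" by (rule cell; use nz in auto)+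
   have pos: "0 < \<kappa> * (x $ i - x0 $ i)" if "cellA r m i \<kappa> s x" for \<kappa> s proof -
    have "0 <= real s * \<delta>" using de by simp
    thus ?thesis using that r unfolding cellA_def \<delta>_def[symmetric] by linarith
   qed
   have f: "fst p = fst p'" using pos[OF 1] pos[OF 2] p by (auto simp: \<Gamma>_def)
   hence "snd p = snd p'"
    using grid_disjoint[OF de, of "snd p" "fst p * (x $ i - x0 $ i) - r / 2" "snd p'"] 1 2 unfolding cellA_def \<delta>_def[symmetric] by simp
   with f show "p = p'" by (rule prod_eqI)
  qed
  also have "... = 8 / r * eps" using m r by (simp add: z_def \<delta>_def field_simps)
  finally show ?thesis .
 qed
 have dphi: "DERIV (\<phi> i) t :> \<phi>' i t" for i t proof (cases "i = l")
  case True
  thus ?thesis by (auto simp: \<phi>_def \<phi>'_def)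
 next
  case False
  have "DERIV (%t. t - x0 $ i - r) t :> 1" by (auto intro!: derivative_eq_intros)
  from DERIV_chain'[OF this DERIV_pos2] have 1: "DERIV (%t. pos2 (t - x0 $ i - r)) t :> 2 * max 0 (t - x0 $ i - r)" by simp
  have "DERIV (%t. x0 $ i - t - r) t :> (-1)" by (auto intro!: derivative_eq_intros)
  from DERIV_chain'[OF this DERIV_pos2] have 2: "DERIV (%t. pos2 (x0 $ i - t - r)) t :> (- (2 * max 0 (x0 $ i - t - r)))" by simp
  have "\<phi> i = (%t. \<psi> i t + G * (pos2 (t - x0 $ i - r) + pos2 (x0 $ i - t - r)))" using False by (auto simp: \<phi>_def)
  thus ?thesis using DERIV_add[OF dpsi DERIV_cmult[OF DERIV_add[OF 1 2], of G]] False by (simp add: \<phi>'_def)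
 qed
 have cphi: "continuous_on UNIV (\<phi>' i)" for i using cpsi[of i] by (cases "i = l") (auto simp: \<phi>'_def intro!: continuous_intros)
 have phi0: "0 <= \<phi> i t" for i t using psi0[of i t] G e by (auto simp: \<phi>_def pos2_nonneg)
 have phibig: "eps + M <= \<phi> i t" if "r' <= \<bar>t - x0 $ i\<bar>" for i t proof (cases "i = l")
  case True
  thus ?thesis by (simp add: \<phi>_def)
 next
  case False
  have "(r' - r)\<^sup>2 <= pos2 (t - x0 $ i - r) + pos2 (x0 $ i - t - r)" proof (cases "t - x0 $ i \<ge> 0")
   case True
   hence "(r' - r)\<^sup>2 <= pos2 (t - x0 $ i - r)" unfolding pos2_def using that r' by (intro power_mono) auto
   thus ?thesis using pos2_nonneg[of "x0 $ i - t - r"] by linarith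
  next
   case F: False
   hence "(r' - r)\<^sup>2 <= pos2 (x0 $ i - t - r)" unfolding pos2_def using that r' by (intro power_mono) auto
   thus ?thesis using pos2_nonneg[of "t - x0 $ i - r"] by linarith
  qed
  hence "G * (r' - r)\<^sup>2 <= G * (pos2 (t - x0 $ i - r) + pos2 (x0 $ i - t - r))" using G by (intro mult_left_mono) auto
  moreover have "G * (r' - r)\<^sup>2 = eps + \<bar>M\<bar>" using r' by (simp add: G_def)
  ultimately show ?thesis using psi0[of i t] False by (simp add: \<phi>_def)
 qed
 have near: "\<phi> i t = \<psi> i t" "\<phi>' i t = \<psi>' i t" if "i ~= l" "\<bar>t - x0 $ i\<bar> <= r" for i t proof -
  have "max 0 (t - x0 $ i - r) = 0" "max 0 (x0 $ i - t - r) = 0" using that(2) by auto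
  thus "\<phi> i t = \<psi> i t" "\<phi>' i t = \<psi>' i t" using that(1) by (simp_all add: \<phi>_def \<phi>'_def pos2_def)
 qed
 have dh: "DERIV h \<tau> :> h' \<tau>" for \<tau> proof -
  have dy: "DERIV y \<tau> :> 1 / \<eta>" unfolding y_def using eta by (auto intro!: derivative_eq_intros)
  have "DERIV (%\<tau>. 1 - y \<tau>) \<tau> :> 0 - 1 / \<eta>" by (intro DERIV_diff dy DERIV_const)
  from DERIV_cmult[OF DERIV_mult[OF dy this], of 4]
  have "DERIV (%\<tau>. 4 * (y \<tau> * (1 - y \<tau>))) \<tau> :> 4 * ((1 / \<eta>) * (1 - y \<tau>) + (0 - 1 / \<eta>) * y \<tau>)" .
  from DERIV_chain'[OF this DERIV_pos2] show ?thesis unfolding h_def h'_def by simp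
 qed
 have ch': "continuous_on UNIV h'" unfolding h'_def y_def using eta by (intro continuous_intros) auto
 have h0: "0 <= h \<tau>" for \<tau> by (simp add: h_def pos2_nonneg)
 have hB: "a < \<tau> \<and> \<tau> < a + \<eta>" if "h \<tau> ~= 0" for \<tau> proof -
  have "\<not> 0 < t ==> pos2 (4 * t) = 0" for t by (simp add: pos2_def max_absorb1)
  hence "0 < y \<tau> * (1 - y \<tau>)" using that unfolding h_def by blast
  hence "0 < y \<tau>" "y \<tau> < 1" by (auto simp: zero_less_mult_iff)
  thus ?thesis using eta(1) by (auto simp: y_def field_simps)
 qed
 have hz: "h \<tau> = 0" if "r <= \<bar>\<tau> - x0 $ l\<bar>" for \<tau> using hB[of \<tau>] that eta by linarith
 have h1: "h \<tau> <= 1" for \<tau> proof -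
  have "0 <= (2 * y \<tau> - 1)\<^sup>2" by simp
  hence "4 * (y \<tau> * (1 - y \<tau>)) <= 1" by (simp add: power2_eq_square algebra_simps)
  thus ?thesis unfolding h_def pos2_def by (intro power_le_one) auto
 qed
 have w01: "0 <= w x" "w x <= 1" if "0 <= Q x" for x
  using h0 theta_nonneg[OF e] mult_mono[OF h1 theta_le_1[OF e phi0 that]] by (auto simp: w_def)
 have [measurable]: "\<phi> i \<in> Borel" "h \<in> Borel" for i
  using dphi dh by (auto intro!: borel_measurable_continuous_onI continuous_at_imp_continuous_on DERIV_isCont)
 note [measurable] = meas
 have [measurable]: "\<theta> eps \<phi> \<in> Borel" by (rule meas_theta) measurable
 have gm [measurable]: "g \<in> Borel" unfolding g_def w_def by measurable
 have supp: "x \<in> qcube x0 r \<and> Q x < eps" if w: "w x ~= 0" "0 <= Q x" for x proof -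
  have s: "(\<Sum>i\<in>UNIV - {l}. \<phi> i (x $ i)) + Q x < eps" using w by (auto simp: w_def \<theta>_def max_def split: if_splits)
  have sn: "0 <= (\<Sum>i\<in>UNIV - {l}. \<phi> i (x $ i))" using phi0 by (intro sum_nonneg)
  have "\<bar>x $ i - x0 $ i\<bar> <= r" for i proof (rule ccontr)
   assume *: "\<not> ?thesis"
   hence i: "i ~= l" using hz[of "x $ l"] w by (auto simp: w_def)
   hence "eps <= \<psi> i (x $ i)" using * by (intro psibig) auto
   also have "... <= \<phi> i (x $ i)" using i G by (simp add: \<phi>_def pos2_nonneg)
   also have "... <= (\<Sum>i\<in>UNIV - {l}. \<phi> i (x $ i))" using i phi0 by (intro member_le_sum) auto
   finally show False using s w by linarith
  qed
  thus ?thesis using s sn by (auto simp: qcube_def)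
 qed
 have bound1: "AE x\<in>U in lborel. w x * (fact CARD('n) * ((\<Sum>i\<in>UNIV. \<bar>\<phi>' i (x $ i)\<bar>) * Y x ^ d)) <= g x"
  using Q_nonneg proof eventually_elim
  case (elim x)
  let ?S = "\<Sum>i\<in>UNIV. \<bar>\<phi>' i (x $ i)\<bar>"
  show ?case
  proof
   assume "x \<in> U"
   hence Q0: "0 <= Q x" using elim by blast
   show "w x * (fact CARD('n) * (?S * Y x ^ d)) <= g x" proof (cases "w x ~= 0 \<and> ?S ~= 0")
    case True
    hence xs: "x \<in> qcube x0 r" "Q x < eps" using supp[OF _ Q0] by auto
    hence np: "\<phi>' i (x $ i) = (if i = l then 0 else \<psi>' i (x $ i))" for i
     using near(2)[of i "x $ i"] by (auto simp: \<phi>'_def qcube_def)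
    obtain i where "\<phi>' i (x $ i) ~= 0" using True sum.neutral[of UNIV "%i. \<bar>\<phi>' i (x $ i)\<bar>"] by fastforce
    hence i: "i ~= l" "\<psi>' i (x $ i) ~= 0" using np[of i] by (auto split: if_splits)
    then obtain p where p: "p \<in> \<Gamma> i" "hp' (arg i p (x $ i)) ~= 0"
     unfolding \<psi>'_def using sum.neutral[of "\<Gamma> i" "%p. z * (hp' (arg i p (x $ i)) * (fst p / \<delta>))"] by fastforce
    have "a <= x $ l" "x $ l < a + \<eta>" using hB[of "x $ l"] True by (auto simp: w_def)
    hence xE: "x \<in> E" using xs p(1) by (intro NE[OF i(1) _ _ cell[OF p(2)]]) (auto simp: \<Gamma>_def)
    have "?S <= (\<Sum>i\<in>(UNIV :: 'n set). 8 / r * eps)" unfolding np using psi'b e r by (intro sum_mono) auto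
    hence "?S <= real CARD('n) * (8 / r) * eps" by simp
    hence "fact CARD('n) * (?S * Y x ^ d) <= fact CARD('n) * (real CARD('n) * (8 / r) * eps * Y x ^ d)"
     by (intro mult_left_mono mult_right_mono Y_pow_nonneg fact_ge_zero)
    also have "... = C * Y x ^ d" by (simp add: C_def Kc_def mult_ac)
    finally show ?thesis using w01[OF Q0] xE by (simp add: g_def mult_left_mono)
   next
    case False
    hence eq: "w x * (fact CARD('n) * (?S * Y x ^ d)) = 0" by auto
    show ?thesis unfolding eq g_def using C0 w01[OF Q0] by (intro mult_nonneg_nonneg Y_pow_nonneg) auto
   qed
  qed
 qed
 have bound2: "AE x\<in>U in lborel. \<bar>g x\<bar> <= C * Y x ^ pe" using Q_nonneg proof eventually_elim
  case (elim x)
  show ?case unfolding g_def using C0 w01[of x] elim by (intro impI weight_bound) (auto simp: indicator_def)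
 qed
 have MI: "c * (LBINT x. indicator U x * w x) <= (LBINT x. indicator U x * g x)" "integrable lborel (%x. indicator U x * w x)"
  using main_inequality[OF e r(1) r' dphi cphi phi0 phibig dh ch' h0 hz w_def gm bound1 bound2] by blast+
 define S where "S = strip Q x0 l r (eps / 2) (a + \<eta> / 4) (a + 3 * \<eta> / 4)"
 have Sm: "S \<in> sets borel" unfolding S_def by (rule strip_borel[OF meas(1)])
 have SU: "S \<subseteq> U" unfolding S_def by (rule order_trans[OF strip_subset[OF r(1)] qcube_subset_U[OF r(2)]]) (use eta in linarith)+
 have Sfin: "emeasure lborel S < \<infinity>" using emeasure_mono[OF SU, of lborel] cube_finite[of R] by (auto simp: le_less_trans)
 have "measure lborel S / 4 = (LBINT x. indicator S x / 4)" by simp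
 \<comment> \<open>On the strip all staircases are still at level 0, so \<theta> >= 1/2 there;
   together with h >= 1/2 this gives w >= 1/4.\<close>
 also have "... <= (LBINT x. indicator U x * w x)" proof (rule integral_mono[OF _ MI(2)])
  show "integrable lborel (%x. indicator S x / 4 :: real)"
   using Sfin Sm by (intro integrable_divide_zero integrable_real_indicator) auto
  fix x
  show "indicator S x / 4 <= indicator U x * w x" proof (cases "x \<in> S")
   case True
   have "\<psi> i (x $ i) = 0" if "i ~= l" for i unfolding \<psi>_def proof (rule sum.neutral, rule ballI)
    fix p assume "p \<in> \<Gamma> i"
    hence "fst p * (x $ i - x0 $ i) <= \<bar>x $ i - x0 $ i\<bar>" by (auto simp: \<Gamma>_def)
    also have "... <= r / 2" using True that by (auto simp: S_def strip_def)
    finally have "fst p * (x $ i - x0 $ i) - r / 2 - real (snd p) * \<delta> <= 0"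
     using mult_nonneg_nonneg[OF of_nat_0_le_iff less_imp_le[OF de], of "snd p"] by linarith
    hence "arg i p (x $ i) <= 0" using de unfolding arg_def by (simp add: divide_le_0_iff)
    thus "z * hp (arg i p (x $ i)) = 0" by (simp add: hp_0)
   qed
   hence "\<phi> i (x $ i) = 0" if "i ~= l" for i using near(1)[OF that, of "x $ i"] True that r by (auto simp: S_def strip_def)
   hence th: "1 / 2 <= \<theta> eps \<phi> x" using True e by (simp add: \<theta>_def S_def strip_def field_simps)
   have yb: "1/4 <= y (x $ l)" "y (x $ l) <= 3/4" using True eta(1) by (auto simp: S_def strip_def y_def field_simps)
   have "0 <= (y (x $ l) - 1/4) * (3/4 - y (x $ l))" using yb by (intro mult_nonneg_nonneg) auto
   hence "3/4 <= max 0 (4 * (y (x $ l) * (1 - y (x $ l))))" by (simp add: algebra_simps max.coboundedI2)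
   hence "(3/4)\<^sup>2 <= h (x $ l)" unfolding h_def pos2_def by (rule power_mono) simp
   hence hh: "1 / 2 <= h (x $ l)" by (simp add: power2_eq_square)
   have "(1 / 2) * (1 / 2) <= w x" unfolding w_def by (rule mult_mono[OF hh th]) (use hh in auto)
   thus ?thesis using True SU by auto
  next
   case False
   thus ?thesis using h0 theta_nonneg[OF e] by (simp add: w_def)
  qed
 qed
 finally have low: "measure lborel S / 4 <= (LBINT x. indicator U x * w x)" .
 let ?F = "E \<inter> large r eps" and ?A = "Ac r * eps ^ (d + 1)"
 have FU: "?F \<subseteq> U" by (auto simp: large_def)
 have A0: "0 <= ?A" using Ac_pos[OF r(1)] e by simp
 have "c * (LBINT x. indicator U x * w x) <= (LBINT x. indicator U x * g x)" by (rule MI(1))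
 also have "... <= (LBINT x. (c / 2) * (indicator U x * w x) + ?A * (indicator ?F x * Y x ^ pe))" proof (rule integral_mono_AE)
  show "AE x in lborel. indicator U x * g x <= (c / 2) * (indicator U x * w x) + ?A * (indicator ?F x * Y x ^ pe)"
   using Q_nonneg proof eventually_elim
   case (elim x)
   show ?case proof (cases "x \<in> U \<and> x \<in> E")
    case True
    hence wx: "0 <= w x" "w x <= 1" using elim w01 by auto
    \<comment> \<open>Half of c is set aside for absorption; the excess is confined to
      \<open>large\<close> and carries the powers eps^(d+1) and Y^pe.\<close>
    have "C * Y x ^ d <= c / 2 + (if c / 2 < C * Y x ^ d then (C * Y x ^ d) ^ (d + 1) * (2 / c) ^ d else 0)"
     using C0 c_pos by (intro young_power mult_nonneg_nonneg Y_pow_nonneg) auto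
    also have "(C * Y x ^ d) ^ (d + 1) * (2 / c) ^ d = ?A * (Y x ^ d) ^ (d + 1)"
     unfolding power_mult_distrib C_def Ac_def by (rule mult_rearrange)
    also have "(if c / 2 < C * Y x ^ d then ?A * (Y x ^ d) ^ (d + 1) else 0) <= ?A * (indicator ?F x * Y x ^ pe)"
     using True mult_left_mono[OF Y_pow_d1 A0] by (auto simp: large_def C_def)
    finally have "w x * (C * Y x ^ d) <= w x * (c / 2 + ?A * (indicator ?F x * Y x ^ pe))" using wx by (intro mult_left_mono) auto
    also have "... <= c / 2 * w x + 1 * (?A * (indicator ?F x * Y x ^ pe))"
     unfolding distrib_left by (intro add_mono mult_right_mono mult_nonneg_nonneg A0 Y_pow_nonneg wx) auto
    finally show ?thesis using True by (simp add: g_def)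
   next
    case False
    thus ?thesis using A0 c_pos elim w01[of x] by (auto simp: g_def large_def indicator_def)
   qed
  qed
 qed (intro Bochner_Integration.integrable_add integrable_mult_right MI(2) Y_sub_int FU U_AE_int[OF gm bound2]; measurable)+
 also have "... = (c / 2) * (LBINT x. indicator U x * w x) + ?A * (LBINT x. indicator ?F x * Y x ^ pe)"
  by (subst Bochner_Integration.integral_add) (auto intro!: integrable_mult_right MI(2) Y_sub_int FU)
 finally have "(c / 2) * (LBINT x. indicator U x * w x) <= ?A * (LBINT x. indicator ?F x * Y x ^ pe)" by linarith
 moreover have "(c / 2) * (measure lborel S / 4) <= (c / 2) * (LBINT x. indicator U x * w x)"
  by (rule mult_left_mono[OF low]) (use c_pos in simp)
 ultimately show ?thesis unfolding S_def by simp
qed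

text \<open>A single cell per side and no restriction on where the cutoff varies: m = 1 and E =
  UNIV. The two end points of the strip delimit the middle half of the slab of radius r.\<close>

lemma sublevel_bound:
 assumes r: "0 < r" "r < R" and e: "0 < eps"
 shows "measure lborel (sub (r / 2) (eps / 2)) <= 8 / c * Ac r * eps ^ (d + 1) * D r eps" proof -
 let ?S = "strip Q x0 l r (eps / 2) (x0 $ l - r + 2 * r / 4) (x0 $ l - r + 3 * (2 * r) / 4)"
 have "sub (r / 2) (eps / 2) \<subseteq> ?S"
 proof
  fix x assume "x \<in> sub (r / 2) (eps / 2)"
  hence x: "\<bar>x $ j - x0 $ j\<bar> < r / 2" "Q x < eps / 2" for j by (auto simp: sub_def icube_def)
  show "x \<in> ?S" using x(2) x(1)[of l] less_imp_le[OF x(1)] unfolding strip_def abs_less_iff by auto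
 qed
 moreover have "?S \<in> fmeasurable lborel"
  by (rule fmeasurableI2[OF _ strip_subset]) (use r strip_borel[OF meas(1)] emeasure_qcube(1)[of x0 r] in \<open>auto simp: fmeasurable_def\<close>)
 ultimately have "measure lborel (sub (r / 2) (eps / 2)) <= measure lborel ?S" by (intro measure_mono_fmeasurable) auto
 also have "c / 8 * measure lborel ?S <= Ac r * eps ^ (d + 1) * (LBINT x. indicator (UNIV \<inter> large r eps) x * Y x ^ pe)"
  by (rule cell_cutoff[where m=1 and NG="%i \<kappa>. {0}"]) (use r e in auto)
 hence "measure lborel ?S <= 8 / c * Ac r * eps ^ (d + 1) * D r eps" using c_pos by (simp add: D_def field_simps)
 finally show ?thesis .
qed

text \<open>Each point leaves \<open>large\<close> once eps is small, and Y^pe dominates. This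
  factor turns the sublevel bound from O(eps^(d+1)) into o(eps^(d+1)).\<close>

lemma D_tendsto_0:
 assumes r: "0 < r" and e: "0 < e"
 shows "\<exists>eps>0. eps <= 1 \<and> D r eps < e" proof -
 note [measurable] = meas
 have "(%n. D r (1 / real (Suc n))) \<longlonglongrightarrow> (\<integral>x. 0 \<partial>(lborel :: (real^'n) measure))" unfolding D_def
 proof (rule integral_dominated_convergence[OF _ _ Y_int])
  show "(%x. indicator (large r (1 / real (Suc n))) x * Y x ^ pe) \<in> borel_measurable lborel" for n by measurable
  show "AE x in lborel. (%n. indicator (large r (1 / real (Suc n))) x * Y x ^ pe) \<longlonglongrightarrow> 0"
  proof (rule AE_I2)
   fix x
   have "(%n. Kc r * (1 / real (Suc n)) * Y x ^ d) \<longlonglongrightarrow> Kc r * 0 * Y x ^ d" by (intro tendsto_intros LIMSEQ_Suc[OF lim_1_over_n])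
   hence "\<forall>\<^sub>F n in sequentially. Kc r * (1 / real (Suc n)) * Y x ^ d < c / 2" by (rule order_tendstoD(2)) (use c_pos in simp)
   hence "\<forall>\<^sub>F n in sequentially. indicator (large r (1 / real (Suc n))) x * Y x ^ pe = 0" by eventually_elim (auto simp: large_def)
   thus "(%n. indicator (large r (1 / real (Suc n))) x * Y x ^ pe) \<longlonglongrightarrow> 0" by (rule tendsto_eventually)
  qed
  show "AE x in lborel. norm (indicator (large r (1 / real (Suc n))) x * Y x ^ pe) <= indicator U x * Y x ^ pe" for n
   using Y_pow_nonneg by (intro AE_I2) (auto simp: indicator_def large_def)
 qed simp
 hence "(%n. D r (1 / real (Suc n))) \<longlonglongrightarrow> 0" by simp
 hence "\<forall>\<^sub>F n in sequentially. D r (1 / real (Suc n)) < e" using e by (rule order_tendstoD(2))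
 then obtain n where n: "D r (1 / real (Suc n)) < e" by (auto simp: eventually_sequentially)
 thus ?thesis by (intro exI[of _ "1 / real (Suc n)"]) simp
qed

end

subsection \<open>Morrey's inequality on a cell\<close>

text \<open>Coordinates are changed one at a time, by induction on the set S of those already moved;
  each move costs at most e' times the norm of the increment.\<close>

lemma partials_has_derivative:
 fixes f :: "real ^ 'n::finite => real"
 assumes U: "open U" "x \<in> U" and p: "!!y i. y \<in> U ==> has_partial f (d i y) i y"
  and c: "!!i. continuous_on U (d i)"
 shows "(f has_derivative (%h. \<Sum>i\<in>UNIV. d i x * h $ i)) (at x)" unfolding has_derivative_at_alt
proof (intro conjI allI impI)
 show "bounded_linear (%h. \<Sum>i\<in>UNIV. d i x * h $ i)"
  by (intro bounded_linear_sum bounded_linear_const_mult bounded_linear_vec_nth)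
 fix e :: real assume e: "e > 0"
 define e' where "e' = e / real CARD('n)"
 have e': "e' > 0" using e by (simp add: e'_def)
 have "\<exists>r>0. \<forall>y. norm (y - x) < r --> y \<in> U \<and> \<bar>d i y - d i x\<bar> <= e'" for i proof -
  have "isCont (d i) x" using c U by (simp add: continuous_on_eq_continuous_at)
  hence "\<forall>\<^sub>F y in nhds x. dist (d i y) (d i x) < e'"
   using e' by (intro tendstoD) (simp add: isCont_def tendsto_at_iff_tendsto_nhds)
  moreover have "\<forall>\<^sub>F y in nhds x. y \<in> U" using U by (rule eventually_nhds_in_open)
  ultimately have "\<forall>\<^sub>F y in nhds x. y \<in> U \<and> \<bar>d i y - d i x\<bar> <= e'"
   by eventually_elim (auto simp: dist_real_def)
  thus ?thesis by (auto simp: eventually_nhds_metric dist_norm)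
 qed
 then obtain r where r: "!!i. r i > 0" "!!i y. norm (y - x) < r i ==> y \<in> U \<and> \<bar>d i y - d i x\<bar> <= e'" by metis
 show "\<exists>r>0. \<forall>y. norm (y - x) < r --> norm (f y - f x - (\<Sum>i\<in>UNIV. d i x * (y - x) $ i)) <= e * norm (y - x)"
 proof (intro exI[of _ "Min (range r)"] conjI allI impI)
  show "0 < Min (range r)" using r(1) by simp
  fix y assume y: "norm (y - x) < Min (range r)"
  define h where "h = y - x"
  define hS where "hS = (%S. (\<chi> i. if i \<in> S then h $ i else 0))"
  have near: "z \<in> U \<and> \<bar>d i z - d i x\<bar> <= e'" if "norm (z - x) <= norm h" for z i proof (rule r(2))
   have "Min (range r) <= r i" by simp
   thus "norm (z - x) < r i" using that y unfolding h_def by linarith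
  qed
  have "\<bar>f (x + hS S) - f x - (\<Sum>i\<in>S. d i x * h $ i)\<bar> <= e' * real (card S) * norm h" for S
  proof (induction S rule: finite_induct[OF finite])
   case 1
   have "hS {} = 0" by (simp add: hS_def vec_eq_iff)
   thus ?case by simp
  next
   case (2 a S)
   define G where "G = (%t. f (x + hS S + t *\<^sub>R axis a 1) - d a x * t)"
   define T where "T = {- \<bar>h $ a\<bar> .. \<bar>h $ a\<bar>}"
   have nn: "norm (x + hS S + t *\<^sub>R axis a 1 - x) <= norm h" if "t \<in> T" for t
    by (rule norm_le_componentwise_cart) (use that 2(2) in \<open>auto simp: hS_def axis_def T_def\<close>)
   have "norm (G (h $ a) - G 0) <= e' * norm (h $ a - 0)" proof (rule field_differentiable_bound[of T])
    show "convex T" by (simp add: T_def)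
    fix t assume t: "t \<in> T"
    have "DERIV (%t. f (x + hS S + t *\<^sub>R axis a 1)) t :> d a (x + hS S + t *\<^sub>R axis a 1)"
     using near[OF nn[OF t], of a] by (intro has_partial_at p) simp
    from DERIV_diff[OF this DERIV_cmult[OF DERIV_ident, of "d a x"]]
    have "DERIV G t :> d a (x + hS S + t *\<^sub>R axis a 1) - d a x" by (simp add: G_def)
    thus "(G has_real_derivative d a (x + hS S + t *\<^sub>R axis a 1) - d a x) (at t within T)"
     by (rule has_field_derivative_at_within)
    show "norm (d a (x + hS S + t *\<^sub>R axis a 1) - d a x) <= e'" using near[OF nn[OF t], of a] by simp
   qed (auto simp: T_def)
   moreover have "x + hS S + (h $ a) *\<^sub>R axis a 1 = x + hS (insert a S)" using 2(2) by (auto simp: hS_def vec_eq_iff axis_def)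
   ultimately have 1: "\<bar>f (x + hS (insert a S)) - d a x * h $ a - f (x + hS S)\<bar> <= e' * \<bar>h $ a\<bar>"
    by (simp add: G_def)
   have "e' * \<bar>h $ a\<bar> <= e' * norm h" using e' component_le_norm_cart[of h a] by simp
   with 1 2 show ?case by (simp add: algebra_simps)
  qed
  from this[of UNIV] have "\<bar>f (x + hS UNIV) - f x - (\<Sum>i\<in>UNIV. d i x * h $ i)\<bar> <= e * norm h" by (simp add: e'_def)
  moreover have "x + hS UNIV = y" by (simp add: hS_def h_def vec_eq_iff)
  ultimately show "norm (f y - f x - (\<Sum>i\<in>UNIV. d i x * (y - x) $ i)) <= e * norm (y - x)" by (simp add: h_def)
 qed
qed

lemma ftc_nn_bound:
 fixes F f :: "real => real"
 assumes "a <= b" "!!t. a <= t ==> t <= b ==> DERIV F t :> f t" "continuous_on {a..b} f"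
 shows "ennreal \<bar>F b - F a\<bar> <= (\<integral>\<^sup>+t. ennreal (indicator {a..b} t * \<bar>f t\<bar>) \<partial>lborel)"
proof -
 have d: "(F has_vector_derivative f t) (at t within {a..b})" if "a <= t" "t <= b" for t
  by (rule has_vector_derivative_at_within[OF iffD1[OF has_real_derivative_iff_has_vector_derivative assms(2)[OF that]]])
 have i: "has_bochner_integral lborel (%t. indicator {a..b} t *\<^sub>R f t) (F b - F a)"
  by (rule has_bochner_integral_FTC_Icc[OF assms(1) d assms(3)])
 have "ennreal (norm (F b - F a)) <= (\<integral>\<^sup>+t. ennreal (norm (indicator {a..b} t *\<^sub>R f t)) \<partial>lborel)"
  using integral_norm_bound_ennreal[OF conjunct1[OF i[unfolded has_bochner_integral_iff]]]
  unfolding conjunct2[OF i[unfolded has_bochner_integral_iff]] .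
 also have "... = (\<integral>\<^sup>+t. ennreal (indicator {a..b} t * \<bar>f t\<bar>) \<partial>lborel)"
  by (intro nn_integral_cong) (auto simp: indicator_def)
 finally show ?thesis by simp
qed

text \<open>The quadratic parameter \<open>s\<^sup>2\<close> makes the weight in the Morrey estimate bounded as soon as \<open>P \<ge> 2 card J\<close>.\<close>

definition shrink :: "'n set => real ^ 'n => real => real ^ 'n => real ^ 'n" where
 "shrink J z s x = (\<chi> j. if j \<in> J then z $ j + s\<^sup>2 * (x $ j - z $ j) else x $ j)"

lemma continuous_shrink: "continuous_on A (%(s, x). shrink J (z :: real ^ 'n::finite) s x)" proof -
 have "(%(s, x). shrink J z s x) = (%p. \<chi> j. if j \<in> J then z $ j + (fst p)\<^sup>2 * (snd p $ j - z $ j) else snd p $ j)"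
  by (simp add: shrink_def fun_eq_iff split_beta)
 moreover have "continuous_on A (%p. if j \<in> J then z $ j + (fst p)\<^sup>2 * (snd p $ j - z $ j) else (snd p :: real ^ 'n) $ j)" for j
  by (cases "j \<in> J") (auto intro!: continuous_intros)
 ultimately show ?thesis by (simp only: continuous_on_vec_lambda)
qed

text \<open>The map is affine and diagonal; it scales card J coordinates by s^2 each.\<close>

lemma nn_integral_shrink:
 fixes f :: "real ^ 'n::finite => ennreal"
 assumes s: "s > 0" and f: "f \<in> Borel"
 shows "(\<integral>\<^sup>+x. f x \<partial>lborel) = ennreal (s ^ (2 * card J)) * (\<integral>\<^sup>+x. f (shrink J z s x) \<partial>lborel)"
proof -
 define c where "c = (%b :: real ^ 'n. if b \<in> (%j. axis j 1) ` J then s\<^sup>2 else 1)"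
 define t where "t = shrink J z s 0"
 have ax: "c (axis j 1) = (if j \<in> J then s\<^sup>2 else 1)" for j by (auto simp: c_def axis_eq_axis)
 have B: "(Basis :: (real ^ 'n) set) = (%j. axis j 1) ` UNIV" by (auto simp: Basis_vec_def)
 have inj: "inj (%j. axis j 1 :: real ^ 'n)" by (auto simp: inj_on_def axis_eq_axis)
 have T: "t + (\<Sum>b\<in>Basis. (c b * (x \<bullet> b)) *\<^sub>R b) = shrink J z s x" for x proof -
  have "(\<Sum>b\<in>Basis. (c b * (x \<bullet> b)) *\<^sub>R b) = (\<Sum>j\<in>UNIV. (c (axis j 1) * x $ j) *\<^sub>R axis j 1)"
   unfolding B by (subst sum.reindex[OF inj]) (simp add: inner_axis)
  also have "... = (\<chi> j. c (axis j 1) * x $ j)"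
   by (simp add: vec_eq_iff axis_def if_distrib[where f="%x. _ * x"] cong: if_cong)
  finally show ?thesis by (simp add: t_def shrink_def ax vec_eq_iff algebra_simps)
 qed
 have P: "(\<Prod>b\<in>Basis. \<bar>c b\<bar>) = s ^ (2 * card J)" proof -
  have "(\<Prod>b\<in>Basis. \<bar>c b\<bar>) = (\<Prod>j\<in>UNIV. if j \<in> J then s\<^sup>2 else 1)"
   unfolding B by (subst prod.reindex[OF inj]) (simp add: ax if_distrib[where f=abs] cong: if_cong)
  also have "... = (\<Prod>j\<in>J. s\<^sup>2)" by (simp add: prod.If_cases)
  finally show ?thesis by (simp add: power_mult)
 qed
 have c0: "c b ~= 0" for b using s by (simp add: c_def)
 have m: "(%x. t + (\<Sum>b\<in>Basis. (c b * (x \<bullet> b)) *\<^sub>R b)) \<in> Borel" by measurable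
 have "(\<integral>\<^sup>+x. f x \<partial>lborel) = (\<integral>\<^sup>+x. f x \<partial>density (distr lborel borel (%x. t + (\<Sum>b\<in>Basis. (c b * (x \<bullet> b)) *\<^sub>R b))) (%_. \<Prod>b\<in>Basis. \<bar>c b\<bar>))"
  by (rule arg_cong[where f="%M. nn_integral M f", OF lborel_affine_euclidean[where c=c and t=t, OF c0]])
 also have "... = ennreal (s ^ (2 * card J)) * (\<integral>\<^sup>+x. f (shrink J z s x) \<partial>lborel)"
  using f m by (simp add: nn_integral_density nn_integral_distr nn_integral_cmult T P)
 finally show ?thesis .
qed

text \<open>A substitute for Hoelder's inequality with a free threshold \<open>m\<close>, which is
  tuned to the size of eps later.\<close>

lemma power_young: "0 <= y ==> 0 < m ==> 1 <= p ==> y <= m + m * (y / m) ^ p" for y m :: real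
proof (cases "y <= m")
 case False
 assume *: "0 <= y" "0 < m" "1 <= p"
 hence "1 <= y / m" using False by simp
 hence "m * (y / m) <= m * (y / m) ^ p" using self_le_power[of "y / m" p] * * by (intro mult_left_mono) auto
 thus ?thesis using * by simp
qed (simp add: add_increasing2)

text \<open>\<open>q\<close> is integrated along the path \<open>shrink\<close>, whose speed is 2 s
  (x - z) on J. Raising s |d_j q| to the power P yields a weight s^P, which compensates the Jacobian
  s^(2 card J) of the path map, so the integral over x is bounded uniformly in s.\<close>

lemma morrey_cell:
 fixes q :: "real ^ 'n::finite => real"
 assumes U: "open U" and pq: "!!y i. y \<in> U ==> has_partial q (d i y) i y" and c: "!!i. continuous_on U (d i)"
  and B: "B \<in> sets borel" "emeasure lborel B < \<infinity>" "B \<subseteq> U"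
  and star: "!!x s. x \<in> B ==> 0 <= s ==> s <= 1 ==> shrink J z s x \<in> B"
  and rho: "0 <= \<rho>" "!!x j. x \<in> B ==> j \<in> J ==> \<bar>x $ j - z $ j\<bar> <= \<rho>"
  and P: "1 <= P" "2 * card J <= P" and m: "0 < m"
  and int: "!!j. integrable lborel (%x. indicator B x * \<bar>d j x\<bar> ^ P)"
 shows "(\<integral>\<^sup>+x. ennreal (indicator B x * \<bar>q x - q (shrink J z 0 x)\<bar>) \<partial>lborel)
  <= ennreal (\<Sum>j\<in>J. 2 * \<rho> * m * measure lborel B + 2 * \<rho> * m * (1 / m) ^ P * (LBINT x. (indicator B x * \<bar>d j x\<bar> ^ P)))"
proof -
 define h where "h = (%j x. ennreal (indicator B x * \<bar>d j x\<bar> ^ P))"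
 define K where "K = 2 * \<rho> * m * (1 / m) ^ P"
 have K: "0 <= K" using rho m by (simp add: K_def)
 have L: "0 <= 2 * \<rho> * m" using rho m by simp
 have hm [measurable]: "h j \<in> Borel" for j
  unfolding h_def using borel_measurable_integrable[OF int[of j]] by (intro measurable_compose[OF _ measurable_ennreal]) simp
 define H where "H = (%s x. indicator {0..1} s * (\<Sum>j\<in>J. ennreal (2 * \<rho> * m) * indicator B x + ennreal K * (ennreal (s ^ P) * h j (shrink J z s x))))"
 have pt: "ennreal (indicator B x * \<bar>q x - q (shrink J z 0 x)\<bar>) <= (\<integral>\<^sup>+s. H s x \<partial>lborel)" for x
 proof (cases "x \<in> B")
  case x: True
  define w where "w = (\<chi> j. if j \<in> J then x $ j - z $ j else 0)"
  define f where "f = (%s. \<Sum>j\<in>UNIV. d j (shrink J z s x) * ((2 * s) *\<^sub>R w) $ j)"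
  have sh: "shrink J z s x = shrink J z 0 x + s\<^sup>2 *\<^sub>R w" for s by (simp add: shrink_def w_def vec_eq_iff)
  have sB: "shrink J z s x \<in> U" if "0 <= s" "s <= 1" for s using star[OF x that] B by blast
  have "((%s. shrink J z 0 x + s\<^sup>2 *\<^sub>R w) has_vector_derivative (2 * s) *\<^sub>R w) (at s)" for s
   by (auto intro!: derivative_eq_intros)
  hence dsh: "((%s. shrink J z s x) has_vector_derivative (2 * s) *\<^sub>R w) (at s)" for s by (simp only: sh[symmetric])
  have der: "DERIV (%s. q (shrink J z s x)) s :> f s" if "0 <= s" "s <= 1" for s proof -
   have "(q has_derivative (%h. \<Sum>i\<in>UNIV. d i (shrink J z s x) * h $ i)) (at (shrink J z s x))"
    by (rule partials_has_derivative[OF U sB[OF that] pq c])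
   hence "(q has_derivative (%h. \<Sum>i\<in>UNIV. d i (shrink J z s x) * h $ i)) (at (shrink J z s x) within range (%s. shrink J z s x))"
    by (rule has_derivative_at_withinI)
   from vector_derivative_diff_chain_within[OF dsh this]
   show ?thesis unfolding has_real_derivative_iff_has_vector_derivative f_def o_def .
  qed
  have csh: "continuous_on {0..1} (%s. shrink J z s x)"
   by (rule continuous_on_vector_derivative[OF has_vector_derivative_at_within[OF dsh]])
  have cf: "continuous_on {0..1} f" unfolding f_def by (intro continuous_intros continuous_on_compose2[OF c csh]) (use sB in auto)
  have "ennreal \<bar>q (shrink J z 1 x) - q (shrink J z 0 x)\<bar> <= (\<integral>\<^sup>+s. ennreal (indicator {0..1} s * \<bar>f s\<bar>) \<partial>lborel)"
   by (rule ftc_nn_bound[OF _ der cf]) auto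
  also have "... <= (\<integral>\<^sup>+s. H s x \<partial>lborel)" proof (rule nn_integral_mono)
   fix s :: real
   show "ennreal (indicator {0..1} s * \<bar>f s\<bar>) <= H s x" proof (cases "s \<in> {0..1}")
    case s: True
    have "\<bar>f s\<bar> <= (\<Sum>j\<in>UNIV. \<bar>d j (shrink J z s x) * ((2 * s) *\<^sub>R w) $ j\<bar>)" unfolding f_def by (rule sum_abs)
    also have "... = (\<Sum>j\<in>J. \<bar>d j (shrink J z s x) * ((2 * s) *\<^sub>R w) $ j\<bar>)"
     by (rule sum.mono_neutral_right) (auto simp: w_def)
    also have "... <= (\<Sum>j\<in>J. 2 * \<rho> * m + K * (s ^ P * \<bar>d j (shrink J z s x)\<bar> ^ P))" proof (rule sum_mono)
     fix j assume j: "j \<in> J"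
     let ?a = "\<bar>d j (shrink J z s x)\<bar>"
     have sa: "0 <= s * ?a" using s by simp
     have "\<bar>d j (shrink J z s x) * ((2 * s) *\<^sub>R w) $ j\<bar> = 2 * (s * ?a) * \<bar>x $ j - z $ j\<bar>"
      using s j by (simp add: w_def abs_mult)
     also have "... <= 2 * (s * ?a) * \<rho>" by (rule mult_left_mono[OF rho(2)[OF x j]]) (use sa in simp)
     also have "... = 2 * \<rho> * (s * ?a)" by simp
     also have "... <= 2 * \<rho> * (m + m * (s * ?a / m) ^ P)"
      by (rule mult_left_mono[OF power_young[OF sa m P(1)]]) (use rho in simp)
     also have "(s * ?a / m) ^ P = (1 / m) ^ P * (s ^ P * ?a ^ P)" by (simp add: power_divide power_mult_distrib)
     also have "2 * \<rho> * (m + m * ((1 / m) ^ P * (s ^ P * ?a ^ P))) = 2 * \<rho> * m + K * (s ^ P * ?a ^ P)"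
      unfolding K_def by (simp only: distrib_left mult.assoc)
     finally show "\<bar>d j (shrink J z s x) * ((2 * s) *\<^sub>R w) $ j\<bar> <= 2 * \<rho> * m + K * (s ^ P * ?a ^ P)" .
    qed
    finally have "ennreal \<bar>f s\<bar> <= ennreal (\<Sum>j\<in>J. 2 * \<rho> * m + K * (s ^ P * \<bar>d j (shrink J z s x)\<bar> ^ P))" by (rule ennreal_leI)
    also have "... = (\<Sum>j\<in>J. ennreal (2 * \<rho> * m + K * (s ^ P * \<bar>d j (shrink J z s x)\<bar> ^ P)))"
     using s by (intro sum_ennreal[symmetric] add_nonneg_nonneg L mult_nonneg_nonneg K zero_le_power) auto
    also have "... = (\<Sum>j\<in>J. ennreal (2 * \<rho> * m) + ennreal K * (ennreal (s ^ P) * ennreal (\<bar>d j (shrink J z s x)\<bar> ^ P)))"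
    proof (rule sum.cong[OF refl])
     fix j
     have "0 <= s ^ P * \<bar>d j (shrink J z s x)\<bar> ^ P" using s by simp
     thus "ennreal (2 * \<rho> * m + K * (s ^ P * \<bar>d j (shrink J z s x)\<bar> ^ P)) = ennreal (2 * \<rho> * m) + ennreal K * (ennreal (s ^ P) * ennreal (\<bar>d j (shrink J z s x)\<bar> ^ P))"
      using K L s by (subst ennreal_plus) (simp_all add: ennreal_mult)
    qed
    also have "... = H s x" using s x star[OF x, of s] by (simp add: H_def h_def)
    finally show ?thesis using s by simp
   qed (simp add: H_def)
  qed
  finally show ?thesis using x by (simp add: shrink_def cong: if_cong)
 qed (simp add: H_def)
 have mprod: "(%p. shrink J z (fst p) (snd p)) \<in> borel_measurable (borel \<Otimes>\<^sub>M borel)"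
  using borel_measurable_continuous_onI[OF continuous_shrink[of UNIV J z]] by (simp add: borel_prod case_prod_unfold)
 have m1: "(%p. h j (shrink J z (fst p) (snd p))) \<in> borel_measurable (lborel \<Otimes>\<^sub>M lborel)" for j
  using measurable_compose[OF mprod hm[of j]] by (simp cong: measurable_cong_sets sets_pair_measure_cong)
 have m2: "(%p. indicator B (snd p) :: ennreal) \<in> borel_measurable (lborel \<Otimes>\<^sub>M lborel)" using B(1) by measurable
 have Hm: "case_prod (%x s. H s x) \<in> borel_measurable (lborel \<Otimes>\<^sub>M lborel)" proof -
  note [measurable] = m1 m2
  have "(%p. H (fst p) (snd p)) \<in> borel_measurable (lborel \<Otimes>\<^sub>M lborel)" unfolding H_def by measurable
  from measurable_compose[OF measurable_pair_swap' this] show ?thesis by (simp add: case_prod_unfold)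
 qed
 have inner: "(\<integral>\<^sup>+x. H s x \<partial>lborel) <= indicator {0..1} s * ennreal (\<Sum>j\<in>J. 2 * \<rho> * m * measure lborel B + K * (LBINT x. (indicator B x * \<bar>d j x\<bar> ^ P)))" for s
 proof (cases "s \<in> {0..1}")
  case s: True
  have ms: "shrink J z s \<in> Borel"
   by (rule borel_measurable_continuous_onI) (rule continuous_on_compose2[OF continuous_shrink[of UNIV J z], of _ "%x. (s, x)", simplified], intro continuous_intros)
  have mh [measurable]: "(%x. h j (shrink J z s x)) \<in> Borel" for j by (rule measurable_compose[OF ms hm])
  have [measurable]: "B \<in> sets borel" by (rule B(1))
  \<comment> \<open>For s <= 1 and P >= 2 card J the weight is at most the Jacobian; at s = 0 the
    left side vanishes because P >= 1.\<close>
  have sc: "ennreal (s ^ P) * (\<integral>\<^sup>+x. h j (shrink J z s x) \<partial>lborel) <= (\<integral>\<^sup>+x. h j x \<partial>lborel)" for j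
  proof (cases "s = 0")
   case True
   thus ?thesis using P(1) by (cases P) auto
  next
   case False
   hence "s > 0" using s by simp
   have "s ^ P <= s ^ (2 * card J)" using s P by (intro power_decreasing) auto
   hence "ennreal (s ^ P) * (\<integral>\<^sup>+x. h j (shrink J z s x) \<partial>lborel) <= ennreal (s ^ (2 * card J)) * (\<integral>\<^sup>+x. h j (shrink J z s x) \<partial>lborel)"
    by (intro mult_right_mono ennreal_leI) auto
   also have "... = (\<integral>\<^sup>+x. h j x \<partial>lborel)" by (rule nn_integral_shrink[OF \<open>s > 0\<close> hm, symmetric])
   finally show ?thesis .
  qed
  have hi: "(\<integral>\<^sup>+x. h j x \<partial>lborel) = ennreal (LBINT x. (indicator B x * \<bar>d j x\<bar> ^ P))" for j
   unfolding h_def by (rule nn_integral_eq_integral[OF int]) auto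
  have eB: "emeasure lborel B = ennreal (measure lborel B)" using B(2) by (intro emeasure_eq_ennreal_measure) auto
  have "(\<integral>\<^sup>+x. H s x \<partial>lborel) = (\<Sum>j\<in>J. ennreal (2 * \<rho> * m) * emeasure lborel B + ennreal K * (ennreal (s ^ P) * (\<integral>\<^sup>+x. h j (shrink J z s x) \<partial>lborel)))"
   using s by (simp add: H_def nn_integral_sum nn_integral_add nn_integral_cmult)
  also have "... <= (\<Sum>j\<in>J. ennreal (2 * \<rho> * m) * emeasure lborel B + ennreal K * (\<integral>\<^sup>+x. h j x \<partial>lborel))"
   by (intro sum_mono add_left_mono mult_left_mono sc) auto
  also have "... = (\<Sum>j\<in>J. ennreal (2 * \<rho> * m * measure lborel B + K * (LBINT x. (indicator B x * \<bar>d j x\<bar> ^ P))))"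
  proof (rule sum.cong[OF refl])
   fix j
   have "0 <= (LBINT x. (indicator B x * \<bar>d j x\<bar> ^ P))" by (rule Bochner_Integration.integral_nonneg) auto
   thus "ennreal (2 * \<rho> * m) * emeasure lborel B + ennreal K * (\<integral>\<^sup>+x. h j x \<partial>lborel) = ennreal (2 * \<rho> * m * measure lborel B + K * (LBINT x. (indicator B x * \<bar>d j x\<bar> ^ P)))"
    unfolding hi eB using K L by (subst ennreal_plus) (simp_all add: ennreal_mult)
  qed
  also have "... = ennreal (\<Sum>j\<in>J. 2 * \<rho> * m * measure lborel B + K * (LBINT x. (indicator B x * \<bar>d j x\<bar> ^ P)))"
   by (intro sum_ennreal add_nonneg_nonneg mult_nonneg_nonneg[OF L] mult_nonneg_nonneg[OF K] Bochner_Integration.integral_nonneg) auto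
  finally show ?thesis using s by simp
 qed (simp add: H_def)
 let ?R = "ennreal (\<Sum>j\<in>J. 2 * \<rho> * m * measure lborel B + K * (LBINT x. (indicator B x * \<bar>d j x\<bar> ^ P)))"
 have "(\<integral>\<^sup>+x. ennreal (indicator B x * \<bar>q x - q (shrink J z 0 x)\<bar>) \<partial>lborel) <= (\<integral>\<^sup>+x. \<integral>\<^sup>+s. H s x \<partial>lborel \<partial>lborel)"
  by (intro nn_integral_mono pt)
 also have "... = (\<integral>\<^sup>+s. \<integral>\<^sup>+x. H s x \<partial>lborel \<partial>lborel)"
  by (rule lborel_pair.Fubini'[OF Hm, symmetric])
 also have "... <= (\<integral>\<^sup>+s. indicator {0..1::real} s * ?R \<partial>lborel)" by (intro nn_integral_mono inner)
 also have "... = ?R" by (simp add: nn_integral_multc)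
 finally show ?thesis unfolding K_def .
qed

subsection \<open>Counting cells\<close>

lemma sum_integral_disjoint_le:
 fixes f :: "'a => real"
 assumes G: "finite G" and B: "!!p. p \<in> G ==> B p \<in> sets M" "!!p. p \<in> G ==> B p \<subseteq> C" and f: "!!x. 0 <= f x"
  and i: "integrable M (%x. indicator C x * f x)" and m: "f \<in> borel_measurable M"
  and disj: "!!p p' x. p \<in> G ==> p' \<in> G ==> x \<in> B p ==> x \<in> B p' ==> p = p'"
 shows "(\<Sum>p\<in>G. LINT x|M. indicator (B p) x * f x) <= (LINT x|M. indicator C x * f x)" proof -
 have fi: "integrable M (%x. indicator (B p) x * f x)" if "p \<in> G" for p proof (rule Bochner_Integration.integrable_bound[OF i])
  note [measurable] = B(1)[OF that] m
  show "(%x. indicator (B p) x * f x) \<in> borel_measurable M" by measurable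
  show "AE x in M. norm (indicator (B p) x * f x) <= norm (indicator C x * f x)"
   using B(2)[OF that] by (intro AE_I2) (auto simp: indicator_def)
 qed
 have "(\<Sum>p\<in>G. LINT x|M. indicator (B p) x * f x) = (LINT x|M. (\<Sum>p\<in>G. indicator (B p) x * f x))"
  by (rule Bochner_Integration.integral_sum[symmetric, OF fi])
 also have "... <= (LINT x|M. indicator C x * f x)" proof (rule integral_mono[OF Bochner_Integration.integrable_sum[OF fi] i])
  fix x
  show "(\<Sum>p\<in>G. indicator (B p) x * f x) <= indicator C x * f x" proof (rule sum_at_most_one[OF G])
   show "p = p'" if "p \<in> G" "p' \<in> G" "indicator (B p) x * f x ~= 0" "indicator (B p') x * f x ~= 0" for p p'
    using disj[OF that(1,2), of x] that(3,4) by (auto simp: indicator_def split: if_splits)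
  qed (use f[of x] B(2) in \<open>auto simp: indicator_def\<close>)
 qed
 finally show ?thesis .
qed

context jacobian_setup
begin

text \<open>The slab of half-width \<rho> around x0_l is cut into m equal slabs; t < m is the number
  of the slab.\<close>

definition cellB :: "real => nat => nat => real ^ 'n => bool" where
 "cellB \<rho> m t x \<longleftrightarrow> real t * (2 * \<rho> / real m) <= x $ l - x0 $ l + \<rho> \<and>
   x $ l - x0 $ l + \<rho> < (real t + 1) * (2 * \<rho> / real m)"

text \<open>Tested on the continuous \<open>Qn\<close>, since single values of Q carry no
  information.\<close>

definition good :: "real => real => real => nat => nat => 'n => real => nat => nat => bool" where
 "good r \<rho> eps n m i \<kappa> s t \<longleftrightarrow> (\<exists>x\<in>qcube x0 r. cellA r m i \<kappa> s x \<and> cellB \<rho> m t x \<and> Qn n x <= eps / 3)"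

text \<open>In such a slab every signed direction offers at least half of its cells for a staircase,
  which is what \<open>cell_cutoff\<close> asks of \<open>NG\<close>.\<close>

definition bad :: "real => real => real => nat => nat => nat => bool" where
 "bad r \<rho> eps n m t \<longleftrightarrow> (\<forall>i\<in>UNIV - {l}. \<forall>\<kappa>\<in>{1, -1}. m <= 2 * card {s. s < m \<and> \<not> good r \<rho> eps n m i \<kappa> s t})"

definition far :: "real => nat => (real ^ 'n) set" where
 "far eps n = {x \<in> U. eps < \<bar>Qn n x - Q x\<bar>}"

lemma far_meas [measurable]: "far eps n \<in> sets borel" proof -
 note [measurable] = meas(1) cont_indicator[OF cont(1)[of n]]
 have "far eps n = U \<inter> {x \<in> space borel. eps < \<bar>indicator U x * Qn n x - Q x\<bar>}" by (auto simp: far_def)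
 thus ?thesis by simp
qed

lemma cellB_meas: "{x. cellB \<rho> m t x} \<in> sets borel" proof -
 have "{x. cellB \<rho> m t x} = {x \<in> space borel. real t * (2 * \<rho> / real m) <= x $ l - x0 $ l + \<rho> \<and>
   x $ l - x0 $ l + \<rho> < (real t + 1) * (2 * \<rho> / real m)}" by (auto simp: cellB_def)
 thus ?thesis by simp
qed

text \<open>In a cell that is not good Qn > eps/3, while the cutoff only sees points with Q < eps/4.
  The gap eps/12 puts these points into \<open>far\<close>, whereas the lower bound
  \<open>rad\<close> keeps the left side of \<open>cell_cutoff\<close> positive.\<close>

lemma bad_strip:
 assumes r: "0 < r" "r < R" and rh: "0 < \<rho>" "\<rho> <= r" and e: "0 < eps" and t: "t < m"
  and rad: "!!a b. x0 $ l - \<rho> <= a ==> a <= b ==> b <= x0 $ l + \<rho> ==> c1 * (b - a) <= measure lborel (strip Q x0 l r (eps / 8) a b)"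
  and bad: "bad r \<rho> eps n m t"
 shows "c * c1 * \<rho> / (8 * real m) <= Ac r * (eps / 4) ^ (d + 1) * (LBINT x. indicator (far (eps / 12) n \<inter> {x. cellB \<rho> m t x}) x * Y x ^ pe)"
proof -
 have m: "0 < real m" using t by simp
 define \<eta> where "\<eta> = 2 * \<rho> / real m"
 have eta: "0 < \<eta>" using rh m by (simp add: \<eta>_def)
 have t0: "0 <= real t * \<eta>" using eta by simp
 have "(real t + 1) * \<eta> <= real m * \<eta>" using t eta by (intro mult_right_mono) auto
 hence t1: "real t * \<eta> + \<eta> <= 2 * \<rho>" using m by (simp add: \<eta>_def distrib_right add_divide_distrib)
 define a where "a = x0 $ l - \<rho> + real t * \<eta>"
 let ?E = "far (eps / 12) n \<inter> {x. cellB \<rho> m t x}"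
 note [measurable] = cellB_meas
 have EU: "?E \<subseteq> U" by (auto simp: far_def)
 have "c1 * ((a + 3 * \<eta> / 4) - (a + \<eta> / 4)) <= measure lborel (strip Q x0 l r (eps / 8) (a + \<eta> / 4) (a + 3 * \<eta> / 4))"
  by (rule rad) (use eta t0 t1 in \<open>auto simp: a_def\<close>)
 hence "c1 * (\<eta> / 2) <= measure lborel (strip Q x0 l r (eps / 4 / 2) (a + \<eta> / 4) (a + 3 * \<eta> / 4))" by simp
 hence "c / 8 * (c1 * (\<eta> / 2)) <= c / 8 * measure lborel (strip Q x0 l r (eps / 4 / 2) (a + \<eta> / 4) (a + 3 * \<eta> / 4))"
  using c_pos by (intro mult_left_mono) auto
 also have "... <= Ac r * (eps / 4) ^ (d + 1) * (LBINT x. indicator (?E \<inter> large r (eps / 4)) x * Y x ^ pe)"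
 proof (rule cell_cutoff[OF r _ eta, where NG="%i \<kappa>. {s. s < m \<and> \<not> good r \<rho> eps n m i \<kappa> s t}"])
  show "m <= 2 * card {s. s < m \<and> \<not> good r \<rho> eps n m i \<kappa> s t}" if "i ~= l" "\<kappa> \<in> {1, -1}" for i \<kappa>
   using bad that unfolding bad_def by blast
  fix i \<kappa> s x assume *: "s \<in> {s. s < m \<and> \<not> good r \<rho> eps n m i \<kappa> s t}" "cellA r m i \<kappa> s x" "a <= x $ l" "x $ l < a + \<eta>" "Q x < eps / 4" "x \<in> qcube x0 r"
  have cB: "cellB \<rho> m t x" using *(3,4) unfolding cellB_def \<eta>_def[symmetric] a_def by (simp add: distrib_right)
  hence "eps / 3 < Qn n x" using * unfolding good_def by (auto simp: not_le)
  thus "x \<in> ?E" using *(5,6) cB e qcube_subset_U[OF r(2)] by (auto simp: far_def)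
 qed (use e rh t t0 t1 in \<open>auto simp: a_def\<close>)
 also have "... <= Ac r * (eps / 4) ^ (d + 1) * (LBINT x. indicator ?E x * Y x ^ pe)"
  using EU Ac_pos[OF r(1)] e Y_pow_nonneg by (intro mult_left_mono integral_mono Y_sub_int) (auto simp: indicator_def)
 finally show ?thesis using m by (simp add: \<eta>_def mult_ac)
qed

lemma far_tendsto_0:
 assumes e: "0 < eps"
 shows "(%n. LBINT x. indicator (far eps n) x * Y x ^ pe) \<longlonglongrightarrow> 0" proof -
 note [measurable] = meas(4)
 have "(%n. LBINT x. indicator (far eps n) x * Y x ^ pe) \<longlonglongrightarrow> (\<integral>x. 0 \<partial>(lborel :: (real ^ 'n) measure))"
 proof (rule integral_dominated_convergence[OF _ _ Y_int])
  show "(%x. indicator (far eps n) x * Y x ^ pe) \<in> borel_measurable lborel" for n by measurable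
  show "AE x in lborel. (%n. indicator (far eps n) x * Y x ^ pe) \<longlonglongrightarrow> 0" using lims(1) proof eventually_elim
   case (elim x)
   have "\<forall>\<^sub>F n in sequentially. indicator (far eps n) x * Y x ^ pe = 0" proof (cases "x \<in> U")
    case True
    hence "(%n. Qn n x) \<longlonglongrightarrow> Q x" using elim by blast
    hence "\<forall>\<^sub>F n in sequentially. dist (Qn n x) (Q x) < eps" by (rule tendstoD) (use e in simp)
    thus ?thesis by eventually_elim (simp add: far_def dist_real_def)
   qed (simp add: far_def)
   thus ?case by (rule tendsto_eventually)
  qed
  show "AE x in lborel. norm (indicator (far eps n) x * Y x ^ pe) <= indicator U x * Y x ^ pe" for n
   using Y_pow_nonneg by (intro AE_I2) (auto simp: indicator_def far_def)
 qed simp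
 thus ?thesis by simp
qed

text \<open>Distinct slabs are disjoint, so the integrals over \<open>far\<close> add up to at most
  one integral, which tends to 0 as n grows. The threshold n0 does not depend on m; this matters
  because m is chosen after n.\<close>

lemma bad_count:
 assumes r: "0 < r" "r < R" and rh: "0 < \<rho>" "\<rho> <= r" and e: "0 < eps" and c1: "0 < c1"
  and rad: "!!a b. x0 $ l - \<rho> <= a ==> a <= b ==> b <= x0 $ l + \<rho> ==> c1 * (b - a) <= measure lborel (strip Q x0 l r (eps / 8) a b)"
 shows "\<exists>n0. \<forall>n\<ge>n0. \<forall>m\<ge>1. 2 * card {t. t < m \<and> bad r \<rho> eps n m t} <= m" proof -
 define C where "C = Ac r * (eps / 4) ^ (d + 1)"
 have C0: "0 < C" using e Ac_pos[OF r(1)] by (simp add: C_def)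
 define E where "E = (%n. LBINT x. indicator (far (eps / 12) n) x * Y x ^ pe)"
 note [measurable] = meas(4) cellB_meas
 have "E \<longlonglongrightarrow> 0" unfolding E_def by (rule far_tendsto_0) (use e in simp)
 moreover have "0 < c * c1 * \<rho> / (16 * C)" using c_pos c1 rh C0 by simp
 ultimately have "\<forall>\<^sub>F n in sequentially. E n < c * c1 * \<rho> / (16 * C)" by (rule order_tendstoD(2))
 then obtain n0 where n0: "!!n. n \<ge> n0 ==> E n < c * c1 * \<rho> / (16 * C)" by (auto simp: eventually_sequentially)
 show ?thesis proof (intro exI[of _ n0] allI impI)
  fix n m :: nat assume n: "n \<ge> n0" and m: "m \<ge> 1"
  let ?T = "{t. t < m \<and> bad r \<rho> eps n m t}"
  let ?a = "c * c1 * \<rho> / (8 * real m)" and ?B = "%t. far (eps / 12) n \<inter> {x. cellB \<rho> m t x}"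
  have eta: "0 < 2 * \<rho> / real m" using rh m by simp
  have "real (card ?T) * ?a = (\<Sum>t\<in>?T. ?a)" by simp
  also have "... <= (\<Sum>t\<in>?T. C * (LBINT x. indicator (?B t) x * Y x ^ pe))"
   unfolding C_def using bad_strip[OF r rh e _ rad] by (intro sum_mono) blast
  also have "... = C * (\<Sum>t\<in>?T. LBINT x. indicator (?B t) x * Y x ^ pe)" by (rule sum_distrib_left[symmetric])
  also have "(\<Sum>t\<in>?T. LBINT x. indicator (?B t) x * Y x ^ pe) <= E n" unfolding E_def proof (rule sum_integral_disjoint_le)
   show "t = s" if "x \<in> ?B t" "x \<in> ?B s" for t s x
    using that grid_disjoint[OF eta, of t "x $ l - x0 $ l + \<rho>" s] by (auto simp: cellB_def)
   show "integrable lborel (%x. indicator (far (eps / 12) n) x * Y x ^ pe)" by (rule Y_sub_int[OF far_meas]) (auto simp: far_def)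
  qed (use Y_pow_nonneg in \<open>auto intro: Y_pow_nonneg\<close>)
  also have "C * E n < C * (c * c1 * \<rho> / (16 * C))" by (rule mult_strict_left_mono[OF n0[OF n] C0])
  also have "... = (real m / 2) * ?a" using C0 m by simp
  finally have "real (card ?T) * ?a < (real m / 2) * ?a" using C0 by (simp add: mult_left_mono)
  moreover have "0 < ?a" using c_pos c1 rh m by simp
  ultimately have "real (card ?T) < real m / 2" by (simp only: mult_less_cancel_right_pos)
  thus "2 * card ?T <= m" by linarith
 qed
qed

text \<open>Pigeonhole: at least m/2 slabs are not bad, each of them has a signed direction with at
  least m/2 good cells, and there are 2 (n - 1) signed directions; hence the constant 8 n.\<close>

lemma many_good:
 assumes "1 <= m" "2 * card {t. t < m \<and> bad r \<rho> eps n m t} <= m"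
 shows "\<exists>i \<kappa>. i ~= l \<and> \<kappa> \<in> {1, -1} \<and>
  m * m <= 8 * CARD('n) * card {(s, t). s < m \<and> t < m \<and> good r \<rho> eps n m i \<kappa> s t}" proof (rule ccontr)
 define G where "G = (%i \<kappa>. {(s, t). s < m \<and> t < m \<and> good r \<rho> eps n m i \<kappa> s t})"
 define gd where "gd = (%i \<kappa> t. {s. s < m \<and> good r \<rho> eps n m i \<kappa> s t})"
 assume *: "\<not> ?thesis"
 have small: "8 * CARD('n) * card (G i \<kappa>) < m * m" if "i ~= l" "\<kappa> \<in> {1, -1}" for i \<kappa>
  using * that unfolding G_def by (meson not_le)
 have cG: "card (G i \<kappa>) = (\<Sum>t<m. card (gd i \<kappa> t))" for i \<kappa> proof -
  have "G i \<kappa> = prod.swap ` (SIGMA t:{..<m}. gd i \<kappa> t)" by (auto simp: G_def gd_def image_iff)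
  hence "card (G i \<kappa>) = card (SIGMA t:{..<m}. gd i \<kappa> t)" by (simp add: card_image)
  also have "... = (\<Sum>t<m. card (gd i \<kappa> t))" by (rule card_SigmaI) (auto simp: gd_def)
  finally show ?thesis .
 qed
 let ?I = "(UNIV - {l}) \<times> {1, -1 :: real}"
 have nb: "m <= 2 * (\<Sum>p\<in>?I. card (gd (fst p) (snd p) t))" if nbt: "t < m" "\<not> bad r \<rho> eps n m t" for t proof -
  obtain i \<kappa> where i: "i ~= l" "\<kappa> \<in> {1, -1}" "\<not> m <= 2 * card {s. s < m \<and> \<not> good r \<rho> eps n m i \<kappa> s t}"
   using nbt(2) unfolding bad_def by blast
  have "card (gd i \<kappa> t \<union> {s. s < m \<and> \<not> good r \<rho> eps n m i \<kappa> s t}) <= card (gd i \<kappa> t) + card {s. s < m \<and> \<not> good r \<rho> eps n m i \<kappa> s t}"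
   by (rule card_Un_le)
  moreover have "gd i \<kappa> t \<union> {s. s < m \<and> \<not> good r \<rho> eps n m i \<kappa> s t} = {..<m}" by (auto simp: gd_def)
  ultimately have "m <= 2 * card (gd i \<kappa> t)" using i(3) by simp
  moreover have "card (gd i \<kappa> t) <= (\<Sum>p\<in>?I. card (gd (fst p) (snd p) t))"
   using member_le_sum[of "(i, \<kappa>)" ?I "%p. card (gd (fst p) (snd p) t)"] i by simp
  ultimately show ?thesis by linarith
 qed
 let ?T = "{t. t < m \<and> \<not> bad r \<rho> eps n m t}"
 have "card (?T \<union> {t. t < m \<and> bad r \<rho> eps n m t}) <= card ?T + card {t. t < m \<and> bad r \<rho> eps n m t}" by (rule card_Un_le)
 moreover have "?T \<union> {t. t < m \<and> bad r \<rho> eps n m t} = {..<m}" by auto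
 ultimately have cT: "m <= 2 * card ?T" using assms(2) by simp
 hence "m * m <= (2 * card ?T) * m" by (rule mult_right_mono) simp
 also have "... = 2 * (\<Sum>t\<in>?T. m)" by simp
 also have "... <= 2 * (\<Sum>t\<in>?T. 2 * (\<Sum>p\<in>?I. card (gd (fst p) (snd p) t)))" by (intro mult_left_mono sum_mono nb) auto
 also have "... <= 2 * (\<Sum>t<m. 2 * (\<Sum>p\<in>?I. card (gd (fst p) (snd p) t)))" by (intro mult_left_mono sum_mono2) auto
 also have "... = 4 * (\<Sum>p\<in>?I. card (G (fst p) (snd p)))" unfolding cG sum_distrib_left[symmetric] by (subst sum.swap) simp
 finally have "2 * CARD('n) * (m * m) <= 2 * CARD('n) * (4 * (\<Sum>p\<in>?I. card (G (fst p) (snd p))))" by (rule mult_left_mono) simp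
 also have "... = (\<Sum>p\<in>?I. 8 * CARD('n) * card (G (fst p) (snd p)))" by (simp add: sum_distrib_left mult.assoc)
 also have "... < (\<Sum>p\<in>?I. m * m)" proof (rule sum_strict_mono)
  show "?I ~= {}" using kl by auto
  show "8 * CARD('n) * card (G (fst p) (snd p)) < m * m" if "p \<in> ?I" for p using that by (intro small) auto
 qed simp
 also have "... = 2 * (CARD('n) - 1) * (m * m)" proof -
  have "card ?I = 2 * (CARD('n) - 1)" by (simp add: card_cartesian_product card_Diff_singleton_if mult.commute)
  thus ?thesis by (simp only: sum_constant of_nat_id)
 qed
 also have "... <= 2 * CARD('n) * (m * m)" by (intro mult_right_mono mult_left_mono) auto
 finally show False by simp
qed

end

lemma quarter_split:
 fixes V L Z :: real
 assumes "4 * (V - L) <= V + Z" "0 <= Z" "0 <= L"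
 shows "V <= 2 * L + Z" using assms by simp

lemma measure_cart_box:
 fixes a b :: "real ^ 'n::finite"
 assumes "!!j. a $ j <= b $ j"
 shows "measure lborel (box a b) = (\<Prod>j\<in>UNIV. b $ j - a $ j)" proof -
 have B: "(Basis :: (real ^ 'n) set) = (%j. axis j 1) ` UNIV" by (auto simp: Basis_vec_def)
 have inj: "inj (%j. axis j 1 :: real ^ 'n)" by (auto simp: inj_on_def axis_eq_axis)
 have "measure lborel (box a b) = (\<Prod>e\<in>Basis. (b - a) \<bullet> e)"
  by (rule measure_lborel_box) (use assms in \<open>auto simp: B inner_axis\<close>)
 also have "... = (\<Prod>j\<in>UNIV. b $ j - a $ j)" unfolding B by (subst prod.reindex[OF inj]) (simp add: inner_axis)
 finally show ?thesis .
qed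

section \<open>From good cells to a lower bound for sublevel sets\<close>

context jacobian_setup
begin

lemma Qn_low_meas: "B \<in> sets borel ==> B \<subseteq> U ==> {x \<in> B. Qn n x < eps} \<in> sets borel" proof -
 assume B: "B \<in> sets borel" "B \<subseteq> U"
 note [measurable] = B(1) cont_indicator[OF cont(1)[of n]]
 have "{x \<in> B. Qn n x < eps} = B \<inter> {x \<in> space borel. indicator U x * Qn n x < eps}" using B(2) by auto
 thus ?thesis by simp
qed

text \<open>On the slice through z with the d coordinates of J frozen, Qn <= eps/3 + eps/6, since
  the slice lies in one cell. Morrey's inequality in the J directions limits how much of a box of
  half-width w around this slice can have Qn >= eps.\<close>

lemma cell_box:
 assumes r: "0 < r" "20 * r <= R" and rh: "0 < \<rho>" "\<rho> <= r" and e: "0 < eps" and w: "0 < w" "w <= r"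
  and i: "i ~= l" "\<kappa> \<in> {1, -1}" and st: "s < m" "t < m" and d: "0 < d"
  and uc: "!!x y. x \<in> qcube x0 (2 * r) ==> y \<in> qcube x0 (2 * r) ==> (!!j. \<bar>x $ j - y $ j\<bar> <= 2 * r / real m) ==> \<bar>Qn n x - Qn n y\<bar> <= eps / 6"
  and good: "good r \<rho> eps n m i \<kappa> s t"
 shows "\<exists>B. B \<in> sets borel \<and> B \<subseteq> {x. cellA r m i \<kappa> s x \<and> cellB \<rho> m t x} \<and> B \<subseteq> icube x0 (3 * r) \<and>
  (2 * w) ^ d * (r / (2 * real m) * (2 * \<rho> / real m)) <=
   2 * measure lborel {x \<in> B. Qn n x < eps} + (16 * w * real d / eps) ^ pe * (LBINT x. indicator B x * Y x ^ pe)"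
proof -
 have m: "0 < real m" using st by simp
 have m1: "1 <= real m" using st by simp
 define \<delta> where "\<delta> = r / (2 * real m)"
 have de: "0 < \<delta>" using r m by (simp add: \<delta>_def)
 define \<eta> where "\<eta> = 2 * \<rho> / real m"
 have eta: "0 < \<eta>" using rh m by (simp add: \<eta>_def)
 have de2: "\<delta> <= 2 * r / real m" using r m by (simp add: \<delta>_def field_simps)
 have eta2: "\<eta> <= 2 * r / real m" using rh m by (simp add: \<eta>_def divide_right_mono)
 obtain z where z: "z \<in> qcube x0 r" "cellA r m i \<kappa> s z" "cellB \<rho> m t z" "Qn n z <= eps / 3"
  using good unfolding good_def by blast
 define J where "J = UNIV - {i, l}"
 have cJ: "card J = d" using i by (simp add: J_def d_def card_Diff_subset)
 define B where "B = {x. cellA r m i \<kappa> s x \<and> cellB \<rho> m t x \<and> (\<forall>j\<in>J. \<bar>x $ j - z $ j\<bar> <= w)}"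
 have zb: "\<bar>z $ j - x0 $ j\<bar> <= r" for j using z(1) by (simp add: qcube_def)
 have sd: "(real s + 1) * \<delta> <= r / 2" proof -
  have "(real s + 1) * \<delta> <= real m * \<delta>" using st de by (intro mult_right_mono) auto
  also have "... = r / 2" using m by (simp add: \<delta>_def)
  finally show ?thesis .
 qed
 have td: "(real t + 1) * \<eta> <= 2 * \<rho>" proof -
  have "(real t + 1) * \<eta> <= real m * \<eta>" using st eta by (intro mult_right_mono) auto
  also have "... = 2 * \<rho>" using m by (simp add: \<eta>_def)
  finally show ?thesis .
 qed
 have s0: "0 <= real s * \<delta>" "0 <= real t * \<eta>" using de eta by auto
 have sd1: "(real s + 1) * \<delta> = real s * \<delta> + \<delta>" "(real t + 1) * \<eta> = real t * \<eta> + \<eta>" by (simp_all add: distrib_right)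
 have B2: "x \<in> qcube x0 (2 * r)" if x: "x \<in> B" for x proof -
  have "\<bar>x $ j - x0 $ j\<bar> <= 2 * r" for j proof -
   consider "j = i" | "j = l" | "j \<in> J" by (auto simp: J_def)
   thus ?thesis proof cases
    case 1
    have "real s * \<delta> <= \<kappa> * (x $ i - x0 $ i) - r / 2" "\<kappa> * (x $ i - x0 $ i) - r / 2 < (real s + 1) * \<delta>"
     using x by (auto simp: B_def cellA_def \<delta>_def)
    hence "\<bar>\<kappa> * (x $ i - x0 $ i)\<bar> <= 2 * r" using s0 sd r by linarith
    thus ?thesis using 1 i(2) by auto
   next
    case 2
    have "real t * \<eta> <= x $ l - x0 $ l + \<rho>" "x $ l - x0 $ l + \<rho> < (real t + 1) * \<eta>"
     using x by (auto simp: B_def cellB_def \<eta>_def)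
    hence "\<bar>x $ l - x0 $ l\<bar> <= 2 * r" using s0 td r rh by linarith
    thus ?thesis using 2 by simp
   next
    case 3
    hence "\<bar>x $ j - z $ j\<bar> <= w" using x by (auto simp: B_def)
    thus ?thesis using zb[of j] w by linarith
   qed
  qed
  thus ?thesis by (simp add: qcube_def)
 qed
 have qU: "qcube x0 (2 * r) \<subseteq> U" by (rule qcube_subset_U) (use r in linarith)
 have BU: "B \<subseteq> U" using B2 qU by blast
 have B3: "B \<subseteq> icube x0 (3 * r)"
 proof
  fix x assume "x \<in> B"
  hence "\<bar>x $ j - x0 $ j\<bar> <= 2 * r" for j using B2 by (auto simp: qcube_def)
  moreover have "2 * r < 3 * r" using r by simp
  ultimately show "x \<in> icube x0 (3 * r)" unfolding icube_def by (blast intro: le_less_trans)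
 qed
 have Bm [measurable]: "B \<in> sets borel" proof -
  have 1: "{x. cellA r m i \<kappa> s x} \<in> sets borel" proof -
   have "{x. cellA r m i \<kappa> s x} = {x \<in> space borel. real s * \<delta> <= \<kappa> * (x $ i - x0 $ i) - r / 2 \<and> \<kappa> * (x $ i - x0 $ i) - r / 2 < (real s + 1) * \<delta>}"
    by (auto simp: cellA_def \<delta>_def)
   thus ?thesis by simp
  qed
  have "B = {x. cellA r m i \<kappa> s x} \<inter> {x. cellB \<rho> m t x} \<inter> (\<Inter>j\<in>insert i J. {x \<in> space borel. j \<in> J --> \<bar>x $ j - z $ j\<bar> <= w})"
   by (auto simp: B_def)
  moreover have "(\<Inter>j\<in>insert i J. {x \<in> space borel. j \<in> J --> \<bar>x $ j - z $ j\<bar> <= w}) \<in> sets borel"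
   by (intro sets.finite_INT) auto
  ultimately show ?thesis using 1 cellB_meas[of \<rho> m t] by auto
 qed
 have Bfin: "emeasure lborel B < \<infinity>" using emeasure_mono[OF B3, of lborel] cube_finite[of "3 * r"] by (auto simp: le_less_trans)
 have star: "shrink J z s' x \<in> B" if "x \<in> B" "0 <= s'" "s' <= 1" for x s' proof -
  have "\<bar>s'\<^sup>2 * (x $ j - z $ j)\<bar> <= w" if j: "j \<in> J" for j proof -
   have "s'\<^sup>2 <= 1" using \<open>0 <= s'\<close> \<open>s' <= 1\<close> by (simp add: power_le_one)
   hence "s'\<^sup>2 * \<bar>x $ j - z $ j\<bar> <= 1 * \<bar>x $ j - z $ j\<bar>" by (rule mult_right_mono) simp
   also have "... <= w" using \<open>x \<in> B\<close> j by (auto simp: B_def)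
   finally show ?thesis by (simp add: abs_mult)
  qed
  moreover have "i \<notin> J" "l \<notin> J" by (auto simp: J_def)
  ultimately show ?thesis using \<open>x \<in> B\<close> by (auto simp: B_def shrink_def cellA_def cellB_def)
 qed
 have low: "Qn n (shrink J z 0 x) <= eps / 2" if x: "x \<in> B" for x proof -
  have "\<bar>Qn n (shrink J z 0 x) - Qn n z\<bar> <= eps / 6" proof (rule uc)
   show "shrink J z 0 x \<in> qcube x0 (2 * r)" using star[OF x, of 0] B2 by simp
   show "z \<in> qcube x0 (2 * r)" using z(1) r by (auto simp: qcube_def intro: order_trans)
   fix j
   consider "j = i" | "j = l" | "j \<in> J" by (auto simp: J_def)
   thus "\<bar>shrink J z 0 x $ j - z $ j\<bar> <= 2 * r / real m" proof cases
    case 1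
    have "real s * \<delta> <= \<kappa> * (x $ i - x0 $ i) - r / 2" "\<kappa> * (x $ i - x0 $ i) - r / 2 < real s * \<delta> + \<delta>"
     "real s * \<delta> <= \<kappa> * (z $ i - x0 $ i) - r / 2" "\<kappa> * (z $ i - x0 $ i) - r / 2 < real s * \<delta> + \<delta>"
     using x z(2) sd1 by (auto simp: B_def cellA_def \<delta>_def[symmetric])
    hence "\<bar>\<kappa> * (x $ i - x0 $ i) - \<kappa> * (z $ i - x0 $ i)\<bar> <= \<delta>" by linarith
    hence "\<bar>x $ i - z $ i\<bar> <= \<delta>" using i(2) by auto
    thus ?thesis using 1 de2 by (simp add: shrink_def J_def)
   next
    case 2
    have "real t * \<eta> <= x $ l - x0 $ l + \<rho>" "x $ l - x0 $ l + \<rho> < real t * \<eta> + \<eta>"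
     "real t * \<eta> <= z $ l - x0 $ l + \<rho>" "z $ l - x0 $ l + \<rho> < real t * \<eta> + \<eta>"
     using x z(3) sd1 by (auto simp: B_def cellB_def \<eta>_def[symmetric])
    hence "\<bar>x $ l - z $ l\<bar> <= \<eta>" by linarith
    thus ?thesis using 2 eta2 by (simp add: shrink_def J_def)
   next
    case 3
    thus ?thesis using r m by (simp add: shrink_def)
   qed
  qed
  thus ?thesis using z(4) by linarith
 qed
 define V where "V = measure lborel B"
 define GB where "GB = (LBINT x. indicator B x * Y x ^ pe)"
 \<comment> \<open>Chosen so that 2 w \<mu> d, the factor in Morrey's bound, equals eps/8.\<close>
 define \<mu> where "\<mu> = eps / (16 * w * real d)"
 have mu: "0 < \<mu>" using e w d by (simp add: \<mu>_def)
 note [measurable] = meas(4)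
 have GBi: "integrable lborel (%x. indicator B x * Y x ^ pe)" by (rule Y_sub_int[OF Bm BU])
 have bd: "AE x in lborel. \<bar>indicator B x * \<bar>dQ n j x\<bar> ^ pe\<bar> <= indicator B x * Y x ^ pe" for j using dom(1)
 proof eventually_elim
  case (elim x)
  show ?case proof (cases "x \<in> B")
   case True
   hence "\<bar>dQ n j x\<bar> <= Y x" using elim BU by blast
   hence "\<bar>dQ n j x\<bar> ^ pe <= Y x ^ pe" by (rule power_mono) simp
   thus ?thesis using True by simp
  qed simp
 qed
 have dQi: "integrable lborel (%x. indicator B x * \<bar>dQ n j x\<bar> ^ pe)" for j
 proof (rule Bochner_Integration.integrable_bound[OF GBi])
  have [measurable]: "(%x. indicator U x * dQ n j x) \<in> Borel" by (rule cont_indicator[OF cont(2)])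
  have "(%x. indicator B x * \<bar>dQ n j x\<bar> ^ pe) = (%x. indicator B x * \<bar>indicator U x * dQ n j x\<bar> ^ pe)"
   using BU by (auto simp: indicator_def fun_eq_iff)
  thus "(%x. indicator B x * \<bar>dQ n j x\<bar> ^ pe) \<in> borel_measurable lborel" by simp
  show "AE x in lborel. norm (indicator B x * \<bar>dQ n j x\<bar> ^ pe) <= norm (indicator B x * Y x ^ pe)"
   using bd[of j] by eventually_elim simp
 qed
 have dQl: "(LBINT x. (indicator B x * \<bar>dQ n j x\<bar> ^ pe)) <= GB" for j
  unfolding GB_def by (rule integral_mono_AE[OF dQi GBi]) (use bd[of j] in eventually_elim, simp)
 have GB0: "0 <= GB" unfolding GB_def by (intro Bochner_Integration.integral_nonneg mult_nonneg_nonneg Y_pow_nonneg) auto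
 have pe1: "1 <= pe" by (simp add: pe_def)
 have pe2: "2 * card J <= pe" proof -
  have "2 * d <= d * (d + 1)" using d by (cases d) auto
  thus ?thesis unfolding cJ pe_def by (rule max.coboundedI2)
 qed
 define F where "F = (\<integral>\<^sup>+x. ennreal (indicator B x * \<bar>Qn n x - Qn n (shrink J z 0 x)\<bar>) \<partial>lborel)"
 have "F <= ennreal (\<Sum>j\<in>J. 2 * w * \<mu> * measure lborel B + 2 * w * \<mu> * (1 / \<mu>) ^ pe * (LBINT x. (indicator B x * \<bar>dQ n j x\<bar> ^ pe)))"
  unfolding F_def
  by (rule morrey_cell[OF U_open dQn cont(2) Bm Bfin BU star _ _ pe1 pe2 mu dQi]) (use w in \<open>auto simp: B_def\<close>)
 also have "... <= ennreal (\<Sum>j\<in>J. 2 * w * \<mu> * V + 2 * w * \<mu> * (1 / \<mu>) ^ pe * GB)"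
 proof (rule ennreal_leI, rule sum_mono, unfold V_def, rule add_left_mono)
  fix j show "2 * w * \<mu> * (1 / \<mu>) ^ pe * (LBINT x. (indicator B x * \<bar>dQ n j x\<bar> ^ pe)) <= 2 * w * \<mu> * (1 / \<mu>) ^ pe * GB"
   by (rule mult_left_mono[OF dQl]) (use w mu in simp)
 qed
 also have "(\<Sum>j\<in>J. 2 * w * \<mu> * V + 2 * w * \<mu> * (1 / \<mu>) ^ pe * GB) = (2 * w * \<mu> * real d) * (V + (1 / \<mu>) ^ pe * GB)"
  by (simp add: cJ algebra_simps)
 also have "2 * w * \<mu> * real d = eps / 8" using w d by (simp add: \<mu>_def)
 finally have F1: "F <= ennreal (eps / 8 * (V + (1 / \<mu>) ^ pe * GB))" .
 define L where "L = {x \<in> B. Qn n x < eps}"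
 have Lm [measurable]: "L \<in> sets borel" unfolding L_def by (rule Qn_low_meas[OF Bm BU])
 \<comment> \<open>Chebyshev: outside \<open>L\<close> the value of \<open>Qn\<close> is at least
   eps, against at most eps/2 on the slice.\<close>
 have "ennreal (eps / 2 * (V - measure lborel L)) = ennreal (eps / 2) * emeasure lborel (B - L)" proof -
  have fB: "B \<in> fmeasurable lborel" using Bfin by (simp add: fmeasurable_def)
  have "V - measure lborel L = measure lborel (B - L)" unfolding V_def proof (rule measurable_measure_Diff[OF fB, symmetric])
   show "L \<in> sets lborel" using Lm by simp
   show "L \<subseteq> B" by (auto simp: L_def)
  qed
  moreover have "emeasure lborel (B - L) = ennreal (measure lborel (B - L))"
   using emeasure_mono[of "B - L" B lborel] Bfin by (intro emeasure_eq_ennreal_measure) (auto simp: top_unique)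
  ultimately show ?thesis using e by (simp only: ennreal_mult divide_nonneg_nonneg measure_nonneg less_imp_le zero_le_numeral)
 qed
 also have "... = (\<integral>\<^sup>+x. ennreal (eps / 2) * indicator (B - L) x \<partial>lborel)" by (rule nn_integral_cmult_indicator[symmetric]) simp
 also have "... <= F" unfolding F_def proof (rule nn_integral_mono)
  fix x
  show "ennreal (eps / 2) * indicator (B - L) x <= ennreal (indicator B x * \<bar>Qn n x - Qn n (shrink J z 0 x)\<bar>)"
  proof (cases "x \<in> B - L")
   case True
   hence "eps <= Qn n x" by (auto simp: L_def)
   moreover have "Qn n (shrink J z 0 x) <= eps / 2" using low[of x] True by blast
   ultimately have "eps / 2 <= \<bar>Qn n x - Qn n (shrink J z 0 x)\<bar>" by linarith
   thus ?thesis using True by (simp add: ennreal_leI)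
  qed simp
 qed
 also note F1
 finally have "eps / 2 * (V - measure lborel L) <= eps / 8 * (V + (1 / \<mu>) ^ pe * GB)"
  by (subst (asm) ennreal_le_iff) (use e GB0 mu in \<open>auto simp: V_def\<close>)
 moreover have "eps / 2 * (V - measure lborel L) = eps / 8 * (4 * (V - measure lborel L))" by (simp only: mult.assoc[symmetric] times_divide_eq_left)
 ultimately have "eps / 8 * (4 * (V - measure lborel L)) <= eps / 8 * (V + (1 / \<mu>) ^ pe * GB)" by (simp only:)
 hence "4 * (V - measure lborel L) <= V + (1 / \<mu>) ^ pe * GB" using e by (simp only: mult_le_cancel_left_pos divide_pos_pos zero_less_numeral)
 moreover have "0 <= (1 / \<mu>) ^ pe * GB" using mu GB0 by simp
 ultimately have VL: "V <= 2 * measure lborel L + (1 / \<mu>) ^ pe * GB" using measure_nonneg[of lborel L] by (rule quarter_split)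
 have mu1: "1 / \<mu> = 16 * w * real d / eps" by (simp add: \<mu>_def)
 have "(2 * w) ^ d * (\<delta> * \<eta>) <= V" proof -
  \<comment> \<open>Left end of the cell in coordinate i; for \<kappa> = -1 the cell is reflected,
    so its outer end comes first.\<close>
  define ai where "ai = x0 $ i + (if \<kappa> = 1 then r / 2 + real s * \<delta> else - (r / 2 + real s * \<delta> + \<delta>))"
  define a :: "real ^ 'n" where "a = (\<chi> j. if j = i then ai else if j = l then x0 $ l - \<rho> + real t * \<eta> else z $ j - w)"
  define b :: "real ^ 'n" where "b = (\<chi> j. if j = i then ai + \<delta> else if j = l then x0 $ l - \<rho> + real t * \<eta> + \<eta> else z $ j + w)"
  have bB: "box a b \<subseteq> B"
  proof
   fix x assume x: "x \<in> box a b"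
   have xj: "a $ j < x $ j \<and> x $ j < b $ j" for j using x by (simp add: mem_box_cart)
   have "cellA r m i \<kappa> s x"
    using xj[of i] i(2) unfolding cellA_def \<delta>_def[symmetric] by (auto simp: a_def b_def ai_def distrib_right)
   moreover have "cellB \<rho> m t x"
    using xj[of l] i(1) unfolding cellB_def \<eta>_def[symmetric] by (auto simp: a_def b_def distrib_right)
   moreover have "\<bar>x $ j - z $ j\<bar> <= w" if "j \<in> J" for j using xj[of j] that by (auto simp: a_def b_def J_def)
   ultimately show "x \<in> B" by (simp add: B_def)
  qed
  have "measure lborel (box a b) = (\<Prod>j\<in>UNIV. b $ j - a $ j)"
   by (rule measure_cart_box) (use de eta w in \<open>auto simp: a_def b_def\<close>)
  also have "... = (\<Prod>j\<in>UNIV. if j = i then \<delta> else if j = l then \<eta> else 2 * w)"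
   by (intro prod.cong) (auto simp: a_def b_def)
  also have "... = \<delta> * (\<eta> * (2 * w) ^ d)" proof -
   have J': "UNIV - {i} - {l} = J" by (auto simp: J_def)
   have "(\<Prod>j\<in>UNIV - {i} - {l}. if j = i then \<delta> else if j = l then \<eta> else 2 * w) = (\<Prod>j\<in>J. 2 * w)"
    unfolding J' by (intro prod.cong) (auto simp: J_def)
   thus ?thesis using i(1) by (subst prod.remove[of _ i], simp, simp, subst prod.remove[of _ l]) (auto simp: cJ)
  qed
  finally have "(2 * w) ^ d * (\<delta> * \<eta>) = measure lborel (box a b)" by (simp only: mult_ac)
  also have "... <= V" unfolding V_def
   by (rule measure_mono_fmeasurable[OF bB]) (use Bfin in \<open>auto simp: fmeasurable_def\<close>)
  finally show ?thesis .
 qed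
 also note VL
 finally have "(2 * w) ^ d * (r / (2 * real m) * (2 * \<rho> / real m)) <= 2 * measure lborel {x \<in> B. Qn n x < eps} + (16 * w * real d / eps) ^ pe * (LBINT x. indicator B x * Y x ^ pe)"
  unfolding mu1 L_def GB_def \<delta>_def \<eta>_def .
 moreover have "B \<subseteq> {x. cellA r m i \<kappa> s x \<and> cellB \<rho> m t x}" by (auto simp: B_def)
 ultimately show ?thesis using Bm B3 by blast
qed

text \<open>The grid is made so fine that \<open>Qn\<close> varies by at most eps/6 across a cell. A
  cell has area r \<rho> / m^2 in the directions i and l, and at least m^2 / (8 n) cells are good,
  so m cancels.\<close>

lemma sum_cells:
 assumes r: "0 < r" "20 * r <= R" and rh: "0 < \<rho>" "\<rho> <= r" and e: "0 < eps" and w: "0 < w" "w <= r" and d: "0 < d"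
  and bc: "!!m. 1 <= m ==> 2 * card {t. t < m \<and> bad r \<rho> eps n m t} <= m"
 shows "r * \<rho> / (8 * real CARD('n)) * (2 * w) ^ d <= 2 * measure lborel {x \<in> icube x0 (3 * r). Qn n x < eps}
  + (16 * w * real d / eps) ^ pe * (LBINT x. indicator U x * Y x ^ pe)" proof -
 have qU: "qcube x0 (2 * r) \<subseteq> U" by (rule qcube_subset_U) (use r in linarith)
 have "uniformly_continuous_on (qcube x0 (2 * r)) (Qn n)"
  by (rule compact_uniformly_continuous[OF continuous_on_subset[OF cont(1) qU]]) simp
 then obtain \<delta> where \<delta>: "\<delta> > 0" "!!x y. x \<in> qcube x0 (2 * r) ==> y \<in> qcube x0 (2 * r) ==> dist y x < \<delta> ==> dist (Qn n y) (Qn n x) < eps / 6"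
  unfolding uniformly_continuous_on_def using e by (metis divide_pos_pos zero_less_numeral)
 obtain m0 :: nat where m0: "real CARD('n) * (2 * r) / \<delta> < real m0" using reals_Archimedean2 by blast
 define m where "m = Suc m0"
 have m: "1 <= m" "0 < real m" by (auto simp: m_def)
 have m1: "real CARD('n) * (2 * r / real m) < \<delta>" proof -
  have "real CARD('n) * (2 * r) / \<delta> < real m" using m0 by (simp add: m_def)
  thus ?thesis using \<delta>(1) m(2) by (simp add: field_simps)
 qed
 have uc: "\<bar>Qn n x - Qn n y\<bar> <= eps / 6" if "x \<in> qcube x0 (2 * r)" "y \<in> qcube x0 (2 * r)" "!!j. \<bar>x $ j - y $ j\<bar> <= 2 * r / real m" for x y
 proof -
  have "norm (x - y) <= (\<Sum>j\<in>UNIV. \<bar>(x - y) $ j\<bar>)" by (rule norm_le_l1_cart)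
  also have "... <= (\<Sum>j\<in>(UNIV :: 'n set). 2 * r / real m)" using that(3) by (intro sum_mono) simp
  also have "... = real CARD('n) * (2 * r / real m)" by simp
  finally have "dist x y < \<delta>" using m1 by (simp add: dist_norm)
  from \<delta>(2)[OF that(2,1) this] show ?thesis by (simp add: dist_real_def)
 qed
 obtain i \<kappa> where i: "i ~= l" "\<kappa> \<in> {1, -1}" and many: "m * m <= 8 * CARD('n) * card {(s, t). s < m \<and> t < m \<and> good r \<rho> eps n m i \<kappa> s t}"
  using many_good[OF m(1) bc[OF m(1)]] by blast
 define G where "G = {(s, t). s < m \<and> t < m \<and> good r \<rho> eps n m i \<kappa> s t}"
 have fG: "finite G" by (rule finite_subset[of _ "{..<m} \<times> {..<m}"]) (auto simp: G_def)
 let ?a = "r / (2 * real m) * (2 * \<rho> / real m)"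
 let ?K = "(16 * w * real d / eps) ^ pe"
 have K0: "0 <= ?K" using w e by simp
 have "\<forall>p\<in>G. \<exists>B. B \<in> sets borel \<and> B \<subseteq> {x. cellA r m i \<kappa> (fst p) x \<and> cellB \<rho> m (snd p) x} \<and> B \<subseteq> icube x0 (3 * r) \<and>
  (2 * w) ^ d * ?a <= 2 * measure lborel {x \<in> B. Qn n x < eps} + ?K * (LBINT x. indicator B x * Y x ^ pe)"
 proof
  fix p assume "p \<in> G"
  hence p: "fst p < m" "snd p < m" "good r \<rho> eps n m i \<kappa> (fst p) (snd p)" by (auto simp: G_def)
  show "\<exists>B. B \<in> sets borel \<and> B \<subseteq> {x. cellA r m i \<kappa> (fst p) x \<and> cellB \<rho> m (snd p) x} \<and> B \<subseteq> icube x0 (3 * r) \<and>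
  (2 * w) ^ d * ?a <= 2 * measure lborel {x \<in> B. Qn n x < eps} + ?K * (LBINT x. indicator B x * Y x ^ pe)"
   by (rule cell_box[OF r rh e w i p(1,2) d uc p(3)])
 qed
 then obtain B where B: "!!p. p \<in> G ==> B p \<in> sets borel" "!!p. p \<in> G ==> B p \<subseteq> {x. cellA r m i \<kappa> (fst p) x \<and> cellB \<rho> m (snd p) x}"
  "!!p. p \<in> G ==> B p \<subseteq> icube x0 (3 * r)"
  "!!p. p \<in> G ==> (2 * w) ^ d * ?a <= 2 * measure lborel {x \<in> B p. Qn n x < eps} + ?K * (LBINT x. indicator (B p) x * Y x ^ pe)"
  unfolding bchoice_iff by blast
 have disj: "p = p'" if "p \<in> G" "p' \<in> G" "x \<in> B p" "x \<in> B p'" for p p' x proof -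
  have 1: "cellA r m i \<kappa> (fst p) x" "cellB \<rho> m (snd p) x" "cellA r m i \<kappa> (fst p') x" "cellB \<rho> m (snd p') x"
   using B(2)[OF that(1)] B(2)[OF that(2)] that(3,4) by auto
  have "0 < r / (2 * real m)" "0 < 2 * \<rho> / real m" using r rh m by auto
  hence "fst p = fst p'" "snd p = snd p'" using 1 unfolding cellA_def cellB_def by (blast intro: grid_disjoint)+
  thus ?thesis by (rule prod_eqI)
 qed
 define S where "S = {x \<in> icube x0 (3 * r). Qn n x < eps}"
 have cU: "icube x0 (3 * r) \<subseteq> U" by (rule cube_subset_U) (use r in linarith)
 have Sm: "S \<in> sets borel" unfolding S_def by (rule Qn_low_meas[OF _ cU]) simp
 have Sfin: "emeasure lborel S < \<infinity>"
  using emeasure_mono[of S "icube x0 (3 * r)" lborel] cube_finite[of "3 * r"] by (auto simp: S_def le_less_trans)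
 have s1: "(\<Sum>p\<in>G. measure lborel {x \<in> B p. Qn n x < eps}) <= measure lborel S" proof -
  have "measure lborel {x \<in> B p. Qn n x < eps} = (LBINT x. indicator (B p) x * indicator S x)" if "p \<in> G" for p proof -
   have "{x \<in> B p. Qn n x < eps} = B p \<inter> S" using B(3)[OF that] by (auto simp: S_def)
   thus ?thesis by (simp add: indicator_inter_arith[symmetric])
  qed
  hence "(\<Sum>p\<in>G. measure lborel {x \<in> B p. Qn n x < eps}) = (\<Sum>p\<in>G. LBINT x. indicator (B p) x * indicator S x)" by simp
  also have "... <= (LBINT x. indicator UNIV x * indicator S x)"
   by (rule sum_integral_disjoint_le[OF fG _ _ _ _ _ disj]) (use B(1) Sm Sfin in auto)
  finally show ?thesis by simp
 qed
 have s2: "(\<Sum>p\<in>G. LBINT x. indicator (B p) x * Y x ^ pe) <= (LBINT x. indicator U x * Y x ^ pe)" 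
  by (rule sum_integral_disjoint_le[OF fG _ order_trans[OF B(3) cU] Y_pow_nonneg Y_int _ disj]) (use B(1) meas(4) in auto)
 have a0: "0 <= ?a" using r rh m by simp
 have "r * \<rho> / (8 * real CARD('n)) * (2 * w) ^ d <= real (card G) * ((2 * w) ^ d * ?a)" proof -
  have "real m * real m <= 8 * real CARD('n) * real (card G)"
   using many[folded G_def] by (metis of_nat_le_iff of_nat_mult of_nat_numeral)
  hence "real m * real m / (8 * real CARD('n)) <= real (card G)" by (simp add: field_simps)
  hence "real m * real m / (8 * real CARD('n)) * ((2 * w) ^ d * ?a) <= real (card G) * ((2 * w) ^ d * ?a)"
   by (rule mult_right_mono[OF _ mult_nonneg_nonneg[OF zero_le_power a0]]) (use w in auto)
  moreover have "real m * real m / (8 * real CARD('n)) * ((2 * w) ^ d * ?a) = r * \<rho> / (8 * real CARD('n)) * (2 * w) ^ d"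
   using m by simp
  ultimately show ?thesis by (simp only:)
 qed
 also have "... = (\<Sum>p\<in>G. (2 * w) ^ d * ?a)" by simp
 also have "... <= (\<Sum>p\<in>G. 2 * measure lborel {x \<in> B p. Qn n x < eps} + ?K * (LBINT x. indicator (B p) x * Y x ^ pe))"
  by (rule sum_mono[OF B(4)])
 also have "... = 2 * (\<Sum>p\<in>G. measure lborel {x \<in> B p. Qn n x < eps}) + ?K * (\<Sum>p\<in>G. LBINT x. indicator (B p) x * Y x ^ pe)"
  by (simp only: sum.distrib sum_distrib_left)
 also have "... <= 2 * measure lborel S + ?K * (LBINT x. indicator U x * Y x ^ pe)"
  by (rule add_mono[OF mult_left_mono[OF s1] mult_left_mono[OF s2 K0]]) simp
 finally show ?thesis unfolding S_def .
qed

text \<open>Where Qn < eps, either Q < 2 eps or the point is \<open>far\<close>, and the measure of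
  \<open>far\<close> tends to 0 with growing n.\<close>

lemma cell_limit:
 assumes r: "0 < r" "20 * r <= R" and rh: "0 < \<rho>" "\<rho> <= r" and e: "0 < eps" and w: "0 < w" "w <= r" and d: "0 < d" and c1: "0 < c1"
  and rad: "!!a b. x0 $ l - \<rho> <= a ==> a <= b ==> b <= x0 $ l + \<rho> ==> c1 * (b - a) <= measure lborel (strip Q x0 l r (eps / 8) a b)"
 shows "r * \<rho> / (8 * real CARD('n)) * (2 * w) ^ d <= 2 * measure lborel (sub (3 * r) (2 * eps))
  + (16 * w * real d / eps) ^ pe * (LBINT x. indicator U x * Y x ^ pe)" (is "?X <= 2 * ?m + ?Z") proof -
 have rR: "r < R" using r by linarith
 obtain n0 where n0: "!!n m. n \<ge> n0 ==> 1 <= m ==> 2 * card {t. t < m \<and> bad r \<rho> eps n m t} <= m"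
  using bad_count[OF r(1) rR rh e c1 rad] by blast
 have farU: "far eps n \<subseteq> U" for n by (auto simp: far_def)
 have ff: "emeasure lborel (far eps n) < \<infinity>" for n
  using le_less_trans[OF emeasure_mono[OF farU, of lborel] cube_finite[of R]] by simp
 have bnd: "?X <= 2 * (?m + (LBINT x. indicator (far eps n) x * Y x ^ pe)) + ?Z" if n: "n \<ge> n0" for n proof -
  have cU: "icube x0 (3 * r) \<subseteq> U" by (rule cube_subset_U) (use r in linarith)
  have "measure lborel {x \<in> icube x0 (3 * r). Qn n x < eps} <= measure lborel (sub (3 * r) (2 * eps) \<union> far eps n)"
  proof (rule measure_mono_fmeasurable)
   show "{x \<in> icube x0 (3 * r). Qn n x < eps} \<subseteq> sub (3 * r) (2 * eps) \<union> far eps n"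
    using cU by (auto simp: sub_def far_def)
   show "sub (3 * r) (2 * eps) \<union> far eps n \<in> fmeasurable lborel"
    using sub_finite ff by (intro fmeasurable.Un) (auto simp: fmeasurable_def)
  qed (use Qn_low_meas[OF _ cU] in simp)
  also have "... <= ?m + measure lborel (far eps n)" by (rule measure_Un_le) auto
  also have "measure lborel (far eps n) = (LBINT x. indicator (far eps n) x)" by simp
  also have "... <= (LBINT x. indicator (far eps n) x * Y x ^ pe)" using ff Y_ge_1 one_le_power
   by (intro integral_mono Y_sub_int farU integrable_real_indicator) (auto simp: indicator_def)
  finally have le: "measure lborel {x \<in> icube x0 (3 * r). Qn n x < eps} <= ?m + (LBINT x. indicator (far eps n) x * Y x ^ pe)"
   by simp
  have "?X <= 2 * measure lborel {x \<in> icube x0 (3 * r). Qn n x < eps} + ?Z"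
   by (rule sum_cells[OF r rh e w d]) (rule n0[OF n])
  also have "... <= 2 * (?m + (LBINT x. indicator (far eps n) x * Y x ^ pe)) + ?Z"
   by (rule add_right_mono[OF mult_left_mono[OF le]]) simp
  finally show ?thesis .
 qed
 have "(%n. 2 * (?m + (LBINT x. indicator (far eps n) x * Y x ^ pe)) + ?Z) \<longlonglongrightarrow> 2 * (?m + 0) + ?Z"
  by (intro tendsto_intros far_tendsto_0 e)
 from LIMSEQ_le_const[OF this] bnd show ?thesis by auto
qed

text \<open>Good cells force (2 w)^d to be at most the measure of a sublevel set plus a multiple of
  (w/\<eta>)^pe. With w^d equal to K \<eta>^(d+1) D, the first term is a fixed fraction of the left
  side, and the second is \<eta>^(d+1) D times a multiple of D^d, which is too small once D is
  small.\<close>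

lemma radial_contradiction:
 assumes r: "0 < r" "20 * r <= R" and rh: "0 < \<rho>" "\<rho> <= r"
  and rad: "!!eps. 0 < eps ==> \<exists>c1>0. \<forall>a b. x0 $ l - \<rho> <= a --> a <= b --> b <= x0 $ l + \<rho> --> c1 * (b - a) <= measure lborel (strip Q x0 l r eps a b)"
 shows False proof -
 have r6: "0 < 6 * r" "6 * r < R" using r by auto
 define C where "C = 8 / c * Ac (6 * r)"
 have C: "C > 0" using c_pos Ac_pos[OF r6(1)] by (simp add: C_def)
 have sb: "measure lborel (sub (3 * r) (\<eta> / 2)) <= C * \<eta> ^ (d + 1) * D (6 * r) \<eta>" if "\<eta> > 0" for \<eta>
  using sublevel_bound[OF r6 that] by (simp add: C_def)
 \<comment> \<open>A strip of positive measure lies in the sublevel set, so D cannot vanish; this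
   makes the width w chosen below positive.\<close>
 have pos: "0 < D (6 * r) \<eta>" if eta: "0 < \<eta>" for \<eta> proof -
  obtain c1 where c1: "c1 > 0" "!!a b. x0 $ l - \<rho> <= a ==> a <= b ==> b <= x0 $ l + \<rho> ==> c1 * (b - a) <= measure lborel (strip Q x0 l r (\<eta> / 2) a b)"
   using rad[of "\<eta> / 2"] eta by auto
  let ?S = "strip Q x0 l r (\<eta> / 2) (x0 $ l - \<rho>) (x0 $ l + \<rho>)"
  have "0 < c1 * ((x0 $ l + \<rho>) - (x0 $ l - \<rho>))" using c1(1) rh by simp
  also have "... <= measure lborel ?S" by (rule c1(2)) (use rh in auto)
  also have "... <= measure lborel (sub (3 * r) (\<eta> / 2))" proof (rule measure_mono_fmeasurable)
   have "?S \<subseteq> qcube x0 r" by (rule strip_subset) (use r rh in auto)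
   moreover have "qcube x0 r \<subseteq> icube x0 (3 * r)" using r(1) by (auto simp: icube_def qcube_def intro: le_less_trans)
   moreover have "?S \<subseteq> {x. Q x < \<eta> / 2}" by (auto simp: strip_def)
   ultimately show "?S \<subseteq> sub (3 * r) (\<eta> / 2)" unfolding sub_def by blast
   show "?S \<in> sets lborel" using strip_borel[OF meas(1)] by simp
   show "sub (3 * r) (\<eta> / 2) \<in> fmeasurable lborel" using sub_finite by (auto simp: fmeasurable_def)
  qed
  also note sb[OF eta]
  finally show ?thesis by (rule zero_less_mult_pos) (use C eta in simp)
 qed
 show False proof (cases "d = 0")
  case True
  \<comment> \<open>For d = 0 the factor Y^d is 1, so at this \<eta> the set \<open>large\<close> is
    empty and D = 0.\<close>
  define \<eta> where "\<eta> = c / (2 * Kc (6 * r))"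
  have "0 < \<eta>" using c_pos Kc_pos[OF r6(1)] by (simp add: \<eta>_def)
  moreover have "large (6 * r) \<eta> = {}" unfolding large_def \<eta>_def using Kc_pos[OF r6(1)] True by auto
  ultimately show False using pos[of \<eta>] unfolding D_def by simp
 next
  case False
  hence d: "0 < d" by simp
  define YU where "YU = (LBINT x. indicator U x * Y x ^ pe)"
  have YU0: "0 <= YU" unfolding YU_def by (intro Bochner_Integration.integral_nonneg mult_nonneg_nonneg Y_pow_nonneg) auto
  define \<kappa> where "\<kappa> = r * \<rho> / (8 * real CARD('n))"
  have k0: "0 < \<kappa>" using r rh by (simp add: \<kappa>_def)
  \<comment> \<open>The cell estimate is used with \<eta>/4, because its doubled threshold is then
    the \<eta>/2 of the sublevel estimate.\<close>
  have key: "\<kappa> * (2 * w) ^ d <= 2 * (C * \<eta> ^ (d + 1) * D (6 * r) \<eta>) + (64 * w * real d / \<eta>) ^ pe * YU"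
   if eta: "0 < \<eta>" and w: "0 < w" "w <= r" for \<eta> w proof -
   obtain c1 where c1: "c1 > 0" "!!a b. x0 $ l - \<rho> <= a ==> a <= b ==> b <= x0 $ l + \<rho> ==> c1 * (b - a) <= measure lborel (strip Q x0 l r (\<eta> / 4 / 8) a b)"
    using rad[of "\<eta> / 4 / 8"] eta by auto
   have e4: "0 < \<eta> / 4" using eta by simp
   have "\<kappa> * (2 * w) ^ d <= 2 * measure lborel (sub (3 * r) (2 * (\<eta> / 4))) + (16 * w * real d / (\<eta> / 4)) ^ pe * YU"
    unfolding \<kappa>_def YU_def by (rule cell_limit[OF r rh e4 w d c1])
   moreover have "2 * (\<eta> / 4) = \<eta> / 2" by simp
   moreover have "16 * w * real d / (\<eta> / 4) = 64 * w * real d / \<eta>" by simp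
   ultimately show ?thesis using sb[OF eta] by (simp only:)
  qed
  \<comment> \<open>Makes \<kappa> w^d equal to 4 C \<eta>^(d+1) Dv, twice the term that stems from
    the sublevel set.\<close>
  define K where "K = 4 * C / \<kappa>"
  have K: "0 < K" using C k0 by (simp add: K_def)
  define L where "L = (64 * real d) ^ pe * YU * K ^ (d + 1)"
  have L: "0 <= L" using YU0 K by (simp add: L_def)
  \<comment> \<open>The three bounds on \<open>Dv\<close> give Dv <= 1, L Dv <= C and w <=
    r.\<close>
  define e where "e = min (min 1 (C / (L + 1))) (r ^ d / K)"
  have e: "0 < e" using C L K r by (simp add: e_def)
  obtain \<eta> where eta: "0 < \<eta>" "\<eta> <= 1" and De': "D (6 * r) \<eta> < e" using D_tendsto_0[OF r6(1) e] by blast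
  define Dv where "Dv = D (6 * r) \<eta>"
  have De: "Dv < e" and D0: "0 < Dv" unfolding Dv_def by (rule De', rule pos[OF eta(1)])
  define w where "w = root d (K * \<eta> ^ (d + 1) * Dv)"
  have w0: "0 < w" using K eta D0 d by (simp add: w_def)
  have wd: "w ^ d = K * \<eta> ^ (d + 1) * Dv" unfolding w_def using K eta D0 d by (intro real_root_pow_pos2) auto
  have "w ^ d <= r ^ d" proof -
   have "\<eta> ^ (d + 1) <= 1" using eta by (intro power_le_one) auto
   hence "K * \<eta> ^ (d + 1) * Dv <= K * 1 * Dv" using K D0 by (intro mult_right_mono mult_left_mono) auto
   also have "... <= K * 1 * (r ^ d / K)" by (rule mult_left_mono) (use De K in \<open>auto simp: e_def\<close>)
   also have "... = r ^ d" using K by simp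
   finally show ?thesis unfolding wd .
  qed
  hence wr: "w <= r" using power_le_imp_le_base[of w "d - 1" r] d r by simp
  let ?X = "\<eta> ^ (d + 1) * Dv"
  have X: "0 < ?X" using eta D0 by simp
  have pe: "pe = d * (d + 1)" using d by (cases d) (auto simp: pe_def)
  have "(64 * w * real d / \<eta>) ^ pe * YU = (64 * real d) ^ pe * YU * ((w ^ d) ^ (d + 1) / \<eta> ^ pe)" proof -
   have "64 * w * real d / \<eta> = (64 * real d) * (w / \<eta>)" by simp
   hence "(64 * w * real d / \<eta>) ^ pe = (64 * real d) ^ pe * (w ^ pe / \<eta> ^ pe)"
    by (simp only: power_mult_distrib power_divide)
   moreover have "w ^ pe = (w ^ d) ^ (d + 1)" unfolding pe power_mult ..
   ultimately show ?thesis by (simp only: mult_ac)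
  qed
  also have "(w ^ d) ^ (d + 1) / \<eta> ^ pe = K ^ (d + 1) * (Dv ^ d * ?X)" proof -
   \<comment> \<open>The exponent balance at the critical value: (d + 1)^2 = d (d + 1) + (d + 1), so
     exactly \<eta>^(d+1) survives the division by \<eta>^pe.\<close>
   have 1: "(\<eta> ^ (d + 1)) ^ (d + 1) = \<eta> ^ pe * \<eta> ^ (d + 1)"
    unfolding pe power_mult[symmetric] power_add[symmetric] by (simp add: algebra_simps)
   have "(w ^ d) ^ (d + 1) = K ^ (d + 1) * (\<eta> ^ pe * \<eta> ^ (d + 1)) * (Dv ^ d * Dv)" unfolding wd power_mult_distrib 1 by simp
   also have "... = \<eta> ^ pe * (K ^ (d + 1) * (Dv ^ d * ?X))" by (simp only: mult_ac)
   finally show ?thesis using eta(1) by simp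
  qed
  finally have "(64 * w * real d / \<eta>) ^ pe * YU = L * Dv ^ d * ?X" by (simp only: L_def mult_ac)
  with key[OF eta(1) w0 wr] have ke: "\<kappa> * (2 * w) ^ d <= 2 * (C * \<eta> ^ (d + 1) * Dv) + L * Dv ^ d * ?X"
   unfolding Dv_def by (simp only:)
  have "\<kappa> * w ^ d <= \<kappa> * (2 * w) ^ d" using k0 w0 by (intro mult_left_mono power_mono) auto
  also note ke
  also have "\<kappa> * w ^ d = (4 * C) * ?X" unfolding wd K_def using k0 by simp
  also have "2 * (C * \<eta> ^ (d + 1) * Dv) + L * Dv ^ d * ?X = (2 * C + L * Dv ^ d) * ?X" by (simp add: algebra_simps)
  finally have "4 * C <= 2 * C + L * Dv ^ d" using X by (simp only: mult_le_cancel_right_pos)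
  moreover have "L * Dv ^ d <= C" proof -
   have "Dv <= 1" using De by (simp add: e_def)
   hence "Dv ^ d <= Dv ^ 1" using d D0 by (intro power_decreasing) auto
   hence "L * Dv ^ d <= L * Dv" using L by (intro mult_left_mono) auto
   also have "... <= (L + 1) * Dv" using D0 by (simp add: algebra_simps)
   also have "... <= (L + 1) * (C / (L + 1))" by (rule mult_left_mono) (use De L in \<open>auto simp: e_def\<close>)
   also have "... = C" using L by simp
   finally show ?thesis .
  qed
  ultimately show False using C by linarith
 qed
qed

end

subsection \<open>The strong maximum principle for a homogeneous solution\<close>

text \<open>Column l has its only nonzero entry in row l, so the other entries of row l do not
  affect the determinant.\<close>

lemma det_row_irrelevant:
 fixes M :: "real ^ 'n ^ 'n"
 assumes "!!i. i ~= l ==> M $ i $ l = 0"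
 shows "det M = det (\<chi> i. if i = l then M $ l $ l *s axis l 1 else M $ i)" proof -
 have "M = (\<chi> i. if i = l then M $ l $ l *s axis l 1 + (M $ l - M $ l $ l *s axis l 1) else M $ i)" by (simp add: vec_eq_iff)
 hence "det M = det (\<chi> i. if i = l then M $ l $ l *s axis l 1 + (M $ l - M $ l $ l *s axis l 1) else M $ i)" by (rule arg_cong)
 also have "... = det (\<chi> i. if i = l then M $ l $ l *s axis l 1 else M $ i) + det (\<chi> i. if i = l then M $ l - M $ l $ l *s axis l 1 else M $ i)"
  by (rule det_row_add)
 also have "det (\<chi> i. if i = l then M $ l - M $ l $ l *s axis l 1 else M $ i) = 0"
  by (rule det_zero_column(1)[of l]) (simp add: column_def vec_eq_iff assms axis_def)
 finally show ?thesis by simp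
qed

lemma fraction_cancel: "c ~= 0 ==> - w / c * (c * (p * (c * h / a)) / b) = - (w * (p * (c * h))) / (a * b)" for w :: real
 by simp

text \<open>\<open>A\<close> stands for D^2 w. The relation \<open>phi\<close> says that the
  rank-one part is precisely the correction that makes \<open>A\<close> annihilate x. Cramer's rule
  with the vector x then links the minors of \<open>A\<close> to det \<open>H\<close> through a
  bordered matrix with the gradient in row l.\<close>

lemma jacobian_formula:
 fixes H A :: "real ^ 'n ^ 'n" and D x e :: "real ^ 'n"
 assumes kl: "k ~= l" and xl: "x $ l ~= 0" and a1: "\<alpha> ~= 1" and au: "\<alpha> * u ~= 0"
  and A: "!!i j. A $ i $ j = \<phi>0 * H $ i $ j + \<phi>1 * D $ i * D $ j"
  and H1: "!!j. (\<Sum>i\<in>UNIV. x $ i * H $ i $ j) = (\<alpha> - 1) * D $ j"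
  and H2: "!!i. (\<Sum>j\<in>UNIV. x $ j * H $ i $ j) = (\<alpha> - 1) * D $ i"
  and D: "(\<Sum>j\<in>UNIV. x $ j * D $ j) = \<alpha> * u" and phi: "\<phi>0 * (\<alpha> - 1) + \<phi>1 * (\<alpha> * u) = 0"
 shows "jdet k l (%b. - (\<Sum>i\<in>UNIV. e $ i * A $ i $ b)) (%a b. A $ a $ b)
  = (e $ k * x $ l - e $ l * x $ k) * x $ l * \<phi>0 ^ (CARD('n) - 1) * det H / (\<alpha> * u * (1 - \<alpha>))" proof -
 have xA: "(\<Sum>i\<in>UNIV. x $ i * A $ i $ j) = 0" for j proof -
  have "(\<Sum>i\<in>UNIV. x $ i * A $ i $ j) = \<phi>0 * (\<Sum>i\<in>UNIV. x $ i * H $ i $ j) + \<phi>1 * D $ j * (\<Sum>i\<in>UNIV. x $ i * D $ i)"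
   by (simp add: A sum_distrib_left sum.distrib algebra_simps)
  also have "... = D $ j * (\<phi>0 * (\<alpha> - 1) + \<phi>1 * (\<alpha> * u))" unfolding H1 D by (simp add: algebra_simps)
  finally show ?thesis unfolding phi by simp
 qed
 have Ax: "(\<Sum>j\<in>UNIV. A $ i $ j * x $ j) = 0" for i proof -
  have "(\<Sum>j\<in>UNIV. A $ i $ j * x $ j) = \<phi>0 * (\<Sum>j\<in>UNIV. x $ j * H $ i $ j) + \<phi>1 * D $ i * (\<Sum>j\<in>UNIV. x $ j * D $ j)"
   by (simp add: A sum_distrib_left sum.distrib algebra_simps)
  also have "... = D $ i * (\<phi>0 * (\<alpha> - 1) + \<phi>1 * (\<alpha> * u))" unfolding H2 D by (simp add: algebra_simps)
  finally show ?thesis unfolding phi by simp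
 qed
 define HD :: "real ^ 'n ^ 'n" where "HD = (\<chi> i. if i = l then D else row i H)"
 define C :: "real ^ 'n ^ 'n" where "C = (\<chi> i. if i = l then D else row i A)"
 define F :: "real ^ 'n ^ 'n" where "F = (\<chi> i. if i = l then axis l 1 else row i A)"
 \<comment> \<open>The x-weighted sum of the rows of \<open>H\<close> is (\<alpha> - 1) D, by
   Euler's identity for the gradient.\<close>
 have s1: "x $ l * det H = (\<alpha> - 1) * det HD" proof -
  have "x $ l * det H = det (\<chi> i. if i = l then sum (%i. x $ i *s row i H) UNIV else row i H)"
   by (rule cramer_lemma_transpose[symmetric])
  also have "sum (%i. x $ i *s row i H) UNIV = (\<alpha> - 1) *s D" using H1 by (simp add: vec_eq_iff row_def left_diff_distrib)
  also have "det (\<chi> i. if i = l then (\<alpha> - 1) *s D else row i H) = (\<alpha> - 1) * det HD"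
   unfolding HD_def by (rule det_row_mul)
  finally show ?thesis .
 qed
 \<comment> \<open>Up to multiples of row l, which is D in both matrices, the rows of
   \<open>A\<close> are \<phi>0 times those of \<open>H\<close>; the matrix \<open>E\<close>
   performs these row operations.\<close>
 have s2: "det C = \<phi>0 ^ (CARD('n) - 1) * det HD" proof -
  define \<Delta> :: "real ^ 'n ^ 'n" where "\<Delta> = (\<chi> i j. if i = j then if i = l then 1 else \<phi>0 else 0)"
  define v :: "real ^ 'n" where "v = (\<chi> i. if i = l then 1 else \<phi>1 * D $ i)"
  define E :: "real ^ 'n ^ 'n" where "E = (\<chi> i j. if j = l then v $ i else \<Delta> $ i $ j)"
  have dD: "det \<Delta> = \<phi>0 ^ (CARD('n) - 1)" proof -
   have "det \<Delta> = (\<Prod>i\<in>UNIV. \<Delta> $ i $ i)" by (rule det_diagonal) (simp add: \<Delta>_def)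
   also have "... = (\<Prod>i\<in>UNIV - {l}. \<phi>0)" by (subst prod.remove[of _ l]) (auto simp: \<Delta>_def)
   finally show ?thesis by (simp add: card_Diff_singleton_if)
  qed
  have dE: "det E = \<phi>0 ^ (CARD('n) - 1)" proof -
   have "det (transpose E) = det (\<chi> i. if i = l then v else row i \<Delta>)"
    by (rule arg_cong[where f=det]) (auto simp: E_def transpose_def vec_eq_iff row_def \<Delta>_def)
   also have "... = det (\<chi> i. if i = l then axis l 1 + (v - axis l 1) else row i \<Delta>)"
    by (rule arg_cong[where f=det]) (auto simp: vec_eq_iff)
   also have "... = det (\<chi> i. if i = l then axis l 1 else row i \<Delta>) + det (\<chi> i. if i = l then v - axis l 1 else row i \<Delta>)"
    by (rule det_row_add)
   also have "det (\<chi> i. if i = l then v - axis l 1 else row i \<Delta>) = 0"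
    by (rule det_zero_column(1)[of l]) (simp add: column_def vec_eq_iff v_def row_def \<Delta>_def)
   also have "(\<chi> i. if i = l then axis l 1 else row i \<Delta>) = \<Delta>" by (auto simp: vec_eq_iff row_def \<Delta>_def axis_def)
   finally show ?thesis using dD by (simp add: det_transpose)
  qed
  have "C = E ** HD" proof -
   have "(\<Sum>m\<in>UNIV. E $ i $ m * HD $ m $ j) = C $ i $ j" for i j proof -
    have "(\<Sum>m\<in>UNIV. E $ i $ m * HD $ m $ j) = v $ i * D $ j + (\<Sum>m\<in>UNIV - {l}. \<Delta> $ i $ m * H $ m $ j)"
     by (subst sum.remove[of _ l]) (auto simp: E_def HD_def row_def)
    also have "(\<Sum>m\<in>UNIV - {l}. \<Delta> $ i $ m * H $ m $ j) = (if i = l then 0 else \<phi>0 * H $ i $ j)"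
    proof (cases "i = l")
     case False
     hence "(\<Sum>m\<in>UNIV - {l}. \<Delta> $ i $ m * H $ m $ j) = (\<Sum>m\<in>{i}. \<Delta> $ i $ m * H $ m $ j)"
      by (intro sum.mono_neutral_right) (auto simp: \<Delta>_def)
     thus ?thesis using False by (simp add: \<Delta>_def)
    qed (auto intro!: sum.neutral simp: \<Delta>_def)
    finally show ?thesis by (simp add: C_def v_def row_def A)
   qed
   thus ?thesis by (simp add: vec_eq_iff matrix_matrix_mult_def)
  qed
  thus ?thesis by (simp add: det_mul dE)
 qed
 define N :: "real ^ 'n ^ 'n" where "N = (\<chi> i. if i = l then axis l 1 else if i = l then 0 else (\<chi> j. if j = l then 0 else A $ i $ j))"
 \<comment> \<open>Dually, the columns of \<open>C\<close> weighted by x sum to \<alpha> u times the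
   unit vector l, since A x = 0 and D . x = \<alpha> u.\<close>
 have s3: "x $ l * det C = \<alpha> * u * det N" proof -
  let ?M = "(\<chi> i j. if j = l then (C *v x) $ i else C $ i $ j) :: real ^ 'n ^ 'n"
  have Cx: "(C *v x) $ i = (if i = l then \<alpha> * u else 0)" for i proof -
   have "(C *v x) $ i = (\<Sum>j\<in>UNIV. C $ i $ j * x $ j)" by (simp only: matrix_vector_mult_def vec_lambda_beta)
   also have "... = (if i = l then \<alpha> * u else 0)" proof (cases "i = l")
    case True
    thus ?thesis using D by (simp add: C_def mult.commute)
   next
    case False
    hence "(\<Sum>j\<in>UNIV. C $ i $ j * x $ j) = (\<Sum>j\<in>UNIV. A $ i $ j * x $ j)" by (simp add: C_def row_def)
    thus ?thesis using Ax False by simp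
   qed
   finally show ?thesis .
  qed
  have "x $ l * det C = det ?M" by (rule cramer_lemma[symmetric])
  also have "... = det (\<chi> i. if i = l then ?M $ l $ l *s axis l 1 else ?M $ i)" by (rule det_row_irrelevant) (simp add: Cx)
  also have "... = ?M $ l $ l * det (\<chi> i. if i = l then axis l 1 else ?M $ i)" by (rule det_row_mul)
  also have "?M $ l $ l = \<alpha> * u" by (simp add: Cx)
  also have "(\<chi> i. if i = l then axis l 1 else ?M $ i) = N" proof -
   have "C $ i $ j = A $ i $ j" if "i ~= l" for i j using that by (simp add: C_def row_def)
   thus ?thesis by (auto simp: N_def vec_eq_iff Cx)
  qed
  finally show ?thesis .
 qed
 have s4: "det F = det N" proof -
  let ?M = "(\<chi> i j. if j = l then (F *v x) $ i else F $ i $ j) :: real ^ 'n ^ 'n"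
  have Fx: "(F *v x) $ i = (if i = l then x $ l else 0)" for i proof (cases "i = l")
   case True
   have "(\<Sum>j\<in>UNIV. axis l 1 $ j * x $ j) = (\<Sum>j\<in>UNIV. if j = l then x $ j else 0)"
    by (rule sum.cong) (auto simp: axis_def)
   hence "(\<Sum>j\<in>UNIV. F $ i $ j * x $ j) = x $ l" using True by (simp add: F_def)
   thus ?thesis using True by (simp only: matrix_vector_mult_def vec_lambda_beta simp_thms if_True)
  next
   case False
   hence "(\<Sum>j\<in>UNIV. F $ i $ j * x $ j) = (\<Sum>j\<in>UNIV. A $ i $ j * x $ j)" by (simp add: F_def row_def)
   thus ?thesis using False Ax by (simp only: matrix_vector_mult_def vec_lambda_beta if_False)
  qed
  have "x $ l * det F = det ?M" by (rule cramer_lemma[symmetric])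
  also have "... = det (\<chi> i. if i = l then ?M $ l $ l *s axis l 1 else ?M $ i)" by (rule det_row_irrelevant) (simp add: Fx)
  also have "... = ?M $ l $ l * det (\<chi> i. if i = l then axis l 1 else ?M $ i)" by (rule det_row_mul)
  also have "?M $ l $ l = x $ l" by (simp add: Fx)
  also have "(\<chi> i. if i = l then axis l 1 else ?M $ i) = N" proof -
   have "F $ i $ j = A $ i $ j" if "i ~= l" for i j using that by (simp add: F_def row_def)
   thus ?thesis by (auto simp: N_def vec_eq_iff Fx)
  qed
  finally show ?thesis using xl by simp
 qed
 define y :: "real ^ 'n" where "y = (\<chi> i. - (e $ i - e $ l * x $ i / x $ l))"
 have yl: "y $ l = 0" using xl by (simp add: y_def)
 have "jdet k l (%b. - (\<Sum>i\<in>UNIV. e $ i * A $ i $ b)) (%a b. A $ a $ b)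
  = det (\<chi> i. if i = k then sum (%i. y $ i *s row i F) UNIV else row i F)" unfolding jdet_def
 proof (rule arg_cong[where f=det])
  have "sum (%i. y $ i *s row i F) UNIV $ b = - (\<Sum>i\<in>UNIV. e $ i * A $ i $ b)" for b proof -
   have "sum (%i. y $ i *s row i F) UNIV $ b = (\<Sum>i\<in>UNIV. y $ i * F $ i $ b)" by (simp add: row_def)
   also have "... = (\<Sum>i\<in>UNIV. y $ i * A $ i $ b)" by (rule sum.cong) (auto simp: F_def row_def yl)
   also have "... = - (\<Sum>i\<in>UNIV. e $ i * A $ i $ b) + e $ l / x $ l * (\<Sum>i\<in>UNIV. x $ i * A $ i $ b)"
    unfolding sum_distrib_left sum_negf[symmetric] sum.distrib[symmetric] by (rule sum.cong) (auto simp: y_def algebra_simps)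
   finally show ?thesis unfolding xA by simp
  qed
  thus "(\<chi> a b. if a = k then - (\<Sum>i\<in>UNIV. e $ i * A $ i $ b) else if a = l then if b = l then 1 else 0 else A $ a $ b) =
   (\<chi> i. if i = k then sum (%i. y $ i *s row i F) UNIV else row i F)"
   using kl by (auto simp: vec_eq_iff F_def row_def axis_def)
 qed
 also have "... = y $ k * det F" by (rule cramer_lemma_transpose)
 finally have J: "jdet k l (%b. - (\<Sum>i\<in>UNIV. e $ i * A $ i $ b)) (%a b. A $ a $ b) = y $ k * det N" unfolding s4 .
 have "det HD = x $ l * det H / (\<alpha> - 1)" using s1 a1 by (simp add: field_simps)
 hence "det N = x $ l * (\<phi>0 ^ (CARD('n) - 1) * (x $ l * det H / (\<alpha> - 1))) / (\<alpha> * u)"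
  using s3 au unfolding s2 by (simp add: field_simps)
 moreover have "y $ k = - (e $ k * x $ l - e $ l * x $ k) / x $ l" using xl by (simp add: y_def field_simps)
 ultimately have "y $ k * det N = - (e $ k * x $ l - e $ l * x $ k) / x $ l * (x $ l * (\<phi>0 ^ (CARD('n) - 1) * (x $ l * det H / (\<alpha> - 1))) / (\<alpha> * u))" by simp
 also have "... = - ((e $ k * x $ l - e $ l * x $ k) * (\<phi>0 ^ (CARD('n) - 1) * (x $ l * det H))) / ((\<alpha> - 1) * (\<alpha> * u))"
  by (rule fraction_cancel[OF xl])
 also have "(\<alpha> - 1) * (\<alpha> * u) = - (\<alpha> * u * (1 - \<alpha>))" by (simp add: algebra_simps)
 finally show ?thesis unfolding J by (simp add: mult_ac)
qed

text \<open>Fubini for the pairs (t, x) with x in the small sublevel set E and a <= t x_l <= b. For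
  fixed x the admissible t form an interval of length (b - a)/|x_l|; for fixed t the point t x lies
  in the strip for almost every such x, since Q is constant along rays.\<close>

lemma radial_strip:
 fixes Q :: "real ^ 'n::finite => real"
 assumes r: "0 < r" and sub: "qcube x0 r \<subseteq> U" and xl: "x0 $ l ~= 0" and hom: "hom_AE U 0 Q"
  and Qm [measurable]: "Q \<in> Borel"
  and pos: "!!eps s. 0 < eps ==> 0 < s ==> emeasure lborel {x \<in> qcube x0 s. Q x < eps} ~= 0"
 shows "\<exists>\<rho>>0. \<rho> <= r \<and> (\<forall>eps>0. \<exists>c1>0. \<forall>a b. x0 $ l - \<rho> <= a --> a <= b --> b <= x0 $ l + \<rho> -->
  c1 * (b - a) <= measure lborel (strip Q x0 l r eps a b))"
proof -
 define z where "z = \<bar>x0 $ l\<bar>"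
 have z: "0 < z" using xl by (simp add: z_def)
 define B where "B = norm x0 + 1"
 have B: "0 < B" "!!j. \<bar>x0 $ j\<bar> + 1 <= B" using component_le_norm_cart[of x0] by (auto simp: B_def add_nonneg_pos)
 \<comment> \<open>With these bounds every admissible t is within 4 \<rho> / z <= 1/2 of 1, and t x
   stays within r/2 of x0 in each coordinate.\<close>
 define \<rho> where "\<rho> = Min {1, r / 4, z / 8, r * z / (16 * B)}"
 have rho: "0 < \<rho>" "\<rho> <= 1" "\<rho> <= r / 4" "\<rho> <= z / 8" "\<rho> <= r * z / (16 * B)"
  using r z B by (auto simp: \<rho>_def)
 have t_near: "\<bar>t - 1\<bar> <= 4 * \<rho> / z" if t: "x0 $ l - \<rho> <= t * y" "t * y <= x0 $ l + \<rho>" and y: "\<bar>y - x0 $ l\<bar> <= \<rho>" for t y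
 proof -
  have "z / 2 <= \<bar>y\<bar>" using y rho z by (simp add: z_def)
  have "\<bar>t * y - y\<bar> <= 2 * \<rho>" using t y by linarith
  hence "\<bar>t - 1\<bar> * \<bar>y\<bar> <= 2 * \<rho>" by (simp add: abs_mult[symmetric] algebra_simps)
  moreover have "\<bar>t - 1\<bar> * (z / 2) <= \<bar>t - 1\<bar> * \<bar>y\<bar>" using \<open>z / 2 <= \<bar>y\<bar>\<close> by (intro mult_left_mono) auto
  ultimately have "\<bar>t - 1\<bar> * (z / 2) <= 2 * \<rho>" by linarith
  thus ?thesis using z by (simp add: field_simps)
 qed
 have t_half: "\<bar>t - 1\<bar> <= 1 / 2" if "\<bar>t - 1\<bar> <= 4 * \<rho> / z" for t proof -
  have "4 * \<rho> / z <= 1 / 2" using rho z by (simp add: field_simps)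
  thus ?thesis using that by linarith
 qed
 have box: "\<bar>t * x $ j - x0 $ j\<bar> <= r / 2" if t: "\<bar>t - 1\<bar> <= 4 * \<rho> / z" and x: "\<bar>x $ j - x0 $ j\<bar> <= \<rho>" for t and x :: "real ^ 'n" and j
 proof -
  have "\<bar>x $ j\<bar> <= B" using x B(2)[of j] rho by linarith
  hence "\<bar>t - 1\<bar> * \<bar>x $ j\<bar> <= 4 * \<rho> / z * B" using t by (intro mult_mono) (use rho z in auto)
  also have "... <= r / 4" using rho(5) z B(1) by (simp add: field_simps)
  finally have "\<bar>t * x $ j - x $ j\<bar> <= r / 4" by (simp add: abs_mult[symmetric] algebra_simps)
  thus ?thesis using x rho by linarith
 qed
 show ?thesis proof (rule exI[of _ \<rho>], intro conjI allI impI)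
  show "0 < \<rho>" "\<rho> <= r" using rho r by auto
  fix eps :: real assume e: "0 < eps"
  define E where "E = {x \<in> qcube x0 \<rho>. Q x < eps}"
  have Em [measurable]: "E \<in> sets borel" proof -
   have "E = qcube x0 \<rho> \<inter> {x \<in> space borel. Q x < eps}" by (auto simp: E_def)
   thus ?thesis by simp
  qed
  have Ef: "emeasure lborel E < \<infinity>"
   using emeasure_mono[of E "qcube x0 \<rho>" lborel] emeasure_qcube(1)[of x0 \<rho>] by (auto simp: E_def le_less_trans)
  have mE: "0 < measure lborel E"
   using pos[OF e rho(1)] Ef unfolding E_def[symmetric] by (simp add: measure_def enn2real_positive_iff zero_less_iff_neq_zero)
  have "\<rho> <= r" using rho r by linarith
  hence EU: "E \<subseteq> U" using qcube_mono[of \<rho> r x0] sub by (auto simp: E_def)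
  \<comment> \<open>On E the modulus of x_l is at most 2 z, and dilation by t >= 1/2 shrinks volumes
    by at most 2^n.\<close>
  define c1 where "c1 = measure lborel E / (2 * z * 2 ^ CARD('n))"
  show "\<exists>c1>0. \<forall>a b. x0 $ l - \<rho> <= a --> a <= b --> b <= x0 $ l + \<rho> -->
   c1 * (b - a) <= measure lborel (strip Q x0 l r eps a b)"
  proof (intro exI[of _ c1] conjI allI impI)
   show "0 < c1" using mE z by (simp add: c1_def)
   fix a b assume ab: "x0 $ l - \<rho> <= a" "a <= b" "b <= x0 $ l + \<rho>"
   define S where "S = strip Q x0 l r eps a b"
   have Sm [measurable]: "S \<in> sets borel" unfolding S_def by (rule strip_borel[OF Qm])
   have SU: "S \<subseteq> qcube x0 r" unfolding S_def by (rule strip_subset) (use ab rho r in auto)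
   have Sf: "emeasure lborel S < \<infinity>" using emeasure_mono[OF SU, of lborel] emeasure_qcube(1)[of x0 r] by (auto simp: le_less_trans)
   define g where "g = (%t x. indicator E x * (indicator {t. a <= t * x $ l \<and> t * x $ l <= b} t :: ennreal))"
   have gm: "case_prod g \<in> borel_measurable (lborel \<Otimes>\<^sub>M lborel)" proof -
    have "case_prod g = (%p. indicator E (snd p) * indicator {p. a <= fst p * snd p $ l \<and> fst p * snd p $ l <= b} p)"
     by (auto simp: g_def indicator_def fun_eq_iff)
    moreover have "{p :: real \<times> (real ^ 'n). a <= fst p * snd p $ l \<and> fst p * snd p $ l <= b} \<in> sets (borel \<Otimes>\<^sub>M borel)"
    proof -
     have "(%p :: real \<times> (real ^ 'n). fst p * snd p $ l) \<in> borel_measurable (borel \<Otimes>\<^sub>M borel)"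
      unfolding borel_prod by (intro borel_measurable_continuous_onI continuous_intros)
     note [measurable] = this
     have "{p \<in> space (borel \<Otimes>\<^sub>M borel). a <= fst p * (snd p :: real ^ 'n) $ l \<and> fst p * snd p $ l <= b} \<in> sets (borel \<Otimes>\<^sub>M borel)"
      by measurable
     thus ?thesis by (simp add: space_pair_measure)
    qed
    ultimately show ?thesis by (simp cong: measurable_cong_sets sets_pair_measure_cong)
   qed
   have low: "ennreal ((b - a) / (2 * z)) * indicator E x <= (\<integral>\<^sup>+t. g t x \<partial>lborel)" for x
   proof (cases "x \<in> E")
    case True
    let ?y = "x $ l"
    have y: "\<bar>?y - x0 $ l\<bar> <= \<rho>" using True by (auto simp: E_def qcube_def)
    have yz: "z / 2 <= \<bar>?y\<bar>" "\<bar>?y\<bar> <= 2 * z" using y rho z by (auto simp: z_def)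
    have y0: "?y ~= 0" using yz z by auto
    have m: "(b - a) / (2 * z) <= (b - a) / \<bar>?y\<bar>" using yz y0 ab by (intro divide_left_mono) auto
    obtain p q where pq: "p <= q" "q - p = (b - a) / \<bar>?y\<bar>" "{p..q} \<subseteq> {t. a <= t * ?y \<and> t * ?y <= b}"
    proof (cases "?y > 0")
     case True
     show thesis proof (rule that[of "a / ?y" "b / ?y"])
      show "a / ?y <= b / ?y" using True ab(2) by (intro divide_right_mono) auto
      show "b / ?y - a / ?y = (b - a) / \<bar>?y\<bar>" using True by (simp add: diff_divide_distrib)
      show "{a / ?y..b / ?y} \<subseteq> {t. a <= t * ?y \<and> t * ?y <= b}"
       using True by (auto simp: pos_divide_le_eq pos_le_divide_eq)
     qed
    next
     case False
     hence n: "?y < 0" using y0 by simp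
     show thesis proof (rule that[of "b / ?y" "a / ?y"])
      show "b / ?y <= a / ?y" using n ab(2) by (intro divide_right_mono_neg) auto
      show "a / ?y - b / ?y = (b - a) / \<bar>?y\<bar>" using n by (simp add: diff_divide_distrib)
      show "{b / ?y..a / ?y} \<subseteq> {t. a <= t * ?y \<and> t * ?y <= b}"
       using n by (auto simp: neg_divide_le_eq neg_le_divide_eq)
     qed
    qed
    have "ennreal ((b - a) / \<bar>?y\<bar>) = emeasure lborel {p..q}" using pq by simp
    also have "... <= emeasure lborel {t. a <= t * ?y \<and> t * ?y <= b}" proof (rule emeasure_mono[OF pq(3)])
     have "{t. a <= t * ?y \<and> t * ?y <= b} = {t \<in> space borel. a <= t * ?y \<and> t * ?y <= b}" by simp
     thus "{t. a <= t * ?y \<and> t * ?y <= b} \<in> sets lborel" by simp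
    qed
    also have "... = (\<integral>\<^sup>+t. g t x \<partial>lborel)" using True
     by (simp add: g_def indicator_def[abs_def] nn_integral_indicator[symmetric])
    finally have "ennreal ((b - a) / \<bar>?y\<bar>) <= (\<integral>\<^sup>+t. g t x \<partial>lborel)" .
    thus ?thesis using True order_trans[OF ennreal_leI[OF m]] by simp
   qed simp
   have up: "(\<integral>\<^sup>+x. g t x \<partial>lborel) <= indicator {1/2 .. 3/2} t * (ennreal (2 ^ CARD('n)) * emeasure lborel S)" for t
   proof (cases "\<bar>t - 1\<bar> <= 4 * \<rho> / z")
    case True
    have t: "1 / 2 <= t" "t <= 3 / 2" "0 < t" using t_half[OF True] by linarith+
    have "AE x in lborel. x \<in> U \<and> t *\<^sub>R x \<in> U --> Q (t *\<^sub>R x) = t powr 0 * Q x"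
     using hom t unfolding hom_AE_def by blast
    hence "AE x in lborel. g t x <= indicator S (0 + t *\<^sub>R x)" proof eventually_elim
     case (elim x)
     show ?case proof (cases "x \<in> E \<and> a <= t * x $ l \<and> t * x $ l <= b")
      case T2: True
      hence xj: "\<bar>x $ j - x0 $ j\<bar> <= \<rho>" for j by (auto simp: E_def qcube_def)
      have bx: "\<bar>(t *\<^sub>R x) $ j - x0 $ j\<bar> <= r / 2" for j using box[OF True xj] by simp
      have "t *\<^sub>R x \<in> qcube x0 r" unfolding qcube_def proof (rule CollectI, rule allI)
       fix j show "\<bar>(t *\<^sub>R x) $ j - x0 $ j\<bar> <= r" using bx[of j] r by linarith
      qed
      hence "Q (t *\<^sub>R x) = Q x" using elim T2 EU sub t by auto
      hence "t *\<^sub>R x \<in> S" using T2 bx by (auto simp: S_def strip_def E_def)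
      thus ?thesis by (simp add: g_def indicator_def)
     qed (auto simp: g_def)
    qed
    hence "(\<integral>\<^sup>+x. g t x \<partial>lborel) <= (\<integral>\<^sup>+x. indicator S (0 + t *\<^sub>R x) \<partial>lborel)" by (rule nn_integral_mono_AE)
    also have "... = 1 * (\<integral>\<^sup>+x. indicator S (0 + t *\<^sub>R x) \<partial>lborel)" by simp
    also have "... <= ennreal (2 ^ CARD('n)) * ennreal (\<bar>t\<bar> ^ CARD('n)) * (\<integral>\<^sup>+x. indicator S (0 + t *\<^sub>R x) \<partial>lborel)"
    proof (rule mult_right_mono)
     have "1 ^ CARD('n) <= (2 * \<bar>t\<bar>) ^ CARD('n)" using t by (intro power_mono) auto
     hence "ennreal 1 <= ennreal (2 ^ CARD('n) * \<bar>t\<bar> ^ CARD('n))" by (intro ennreal_leI) (simp add: power_mult_distrib)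
     thus "1 <= ennreal (2 ^ CARD('n)) * ennreal (\<bar>t\<bar> ^ CARD('n))" by (simp add: ennreal_mult[symmetric])
    qed simp
    also have "... = ennreal (2 ^ CARD('n)) * (\<integral>\<^sup>+x. indicator S x \<partial>lborel)"
     using nn_integral_lborel_affine[of "indicator S" t 0] t by (simp add: mult.assoc)
    finally show ?thesis using t by simp
   next
    case False
    have "g t x = 0" for x proof (rule ccontr)
     assume "g t x ~= 0"
     hence x: "x \<in> E" "a <= t * x $ l" "t * x $ l <= b" by (auto simp: g_def indicator_def split: if_splits)
     have "\<bar>x $ l - x0 $ l\<bar> <= \<rho>" using x(1) by (auto simp: E_def qcube_def)
     thus False using t_near[of t "x $ l"] x ab False by linarith
    qed
    thus ?thesis by simp
   qed
   have "ennreal ((b - a) / (2 * z)) * emeasure lborel E = (\<integral>\<^sup>+x. ennreal ((b - a) / (2 * z)) * indicator E x \<partial>lborel)"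
    by (rule nn_integral_cmult_indicator[symmetric]) simp
   also have "... <= (\<integral>\<^sup>+x. \<integral>\<^sup>+t. g t x \<partial>lborel \<partial>lborel)" by (intro nn_integral_mono low)
   also have "... = (\<integral>\<^sup>+t. \<integral>\<^sup>+x. g t x \<partial>lborel \<partial>lborel)"
    by (rule lborel_pair.Fubini'[OF gm])
   also have "... <= (\<integral>\<^sup>+t. indicator {1/2 .. 3/2 :: real} t * (ennreal (2 ^ CARD('n)) * emeasure lborel S) \<partial>lborel)"
    by (intro nn_integral_mono up)
   also have "... = ennreal (2 ^ CARD('n)) * emeasure lborel S" by (simp add: nn_integral_multc)
   finally have fin: "ennreal ((b - a) / (2 * z)) * emeasure lborel E <= ennreal (2 ^ CARD('n)) * emeasure lborel S" .
   have "emeasure lborel E = ennreal (measure lborel E)" "emeasure lborel S = ennreal (measure lborel S)"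
    using Ef Sf by (auto intro!: emeasure_eq_ennreal_measure)
   moreover have "0 <= (b - a) / (2 * z)" using ab z by simp
   ultimately have "ennreal ((b - a) / (2 * z) * measure lborel E) <= ennreal (2 ^ CARD('n) * measure lborel S)"
    using fin by (simp only: ennreal_mult measure_nonneg zero_le_power zero_le_numeral)
   hence "(b - a) / (2 * z) * measure lborel E <= 2 ^ CARD('n) * measure lborel S" by (subst (asm) ennreal_le_iff) auto
   hence "c1 * (b - a) <= measure lborel S" using z by (simp add: c1_def field_simps)
   thus "c1 * (b - a) <= measure lborel (strip Q x0 l r eps a b)"
    unfolding S_def .
  qed
 qed
qed

lemma loc_int_subset: "loc_int U f ==> V \<subseteq> U ==> loc_int V f" unfolding loc_int_def by blast

lemma wder_subset: "wder U i f g ==> V \<subseteq> U ==> wder V i f g" unfolding wder_def box_test_def by blast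

lemma hom_AE_subset:
 assumes "hom_AE U \<gamma> f" "V \<subseteq> U"
 shows "hom_AE V \<gamma> f" unfolding hom_AE_def proof (intro allI impI)
 fix t :: real assume "t > 0"
 hence "AE x in lborel. x \<in> U \<and> t *\<^sub>R x \<in> U --> f (t *\<^sub>R x) = t powr \<gamma> * f x"
  using assms(1) unfolding hom_AE_def by blast
 thus "AE x in lborel. x \<in> V \<and> t *\<^sub>R x \<in> V --> f (t *\<^sub>R x) = t powr \<gamma> * f x"
  by eventually_elim (use assms(2) in blast)
qed

lemma powr_between:
 fixes y :: real
 assumes "0 < m" "m <= y" "y <= M"
 shows "y powr s <= m powr s + M powr s" "min (m powr s) (M powr s) <= y powr s" proof -
 show "y powr s <= m powr s + M powr s" proof (cases "0 <= s")
  case True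
  hence "y powr s <= M powr s" using assms by (intro powr_mono2) auto
  thus ?thesis using powr_ge_zero[of m s] by linarith
 next
  case False
  hence "y powr s <= m powr s" using assms by (intro powr_mono2') auto
  thus ?thesis using powr_ge_zero[of M s] by linarith
 qed
 show "min (m powr s) (M powr s) <= y powr s" proof (cases "0 <= s")
  case True
  hence "m powr s <= y powr s" using assms by (intro powr_mono2) auto
  thus ?thesis by linarith
 next
  case False
  hence "M powr s <= y powr s" using assms by (intro powr_mono2') auto
  thus ?thesis by linarith
 qed
qed

lemma has_partial_powr:
 assumes "0 < f x" "has_partial f f' i x"
 shows "has_partial (%x. f x powr s) (s * f x powr (s - 1) * f') i x" proof -
 have "DERIV (%y. y powr s) (f x) :> s * f x powr (s - 1)" by (rule has_real_derivative_powr[OF assms(1)])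
 from has_partial_chain[OF this assms(2)] show ?thesis .
qed

text \<open>If the conclusion fails, then in every cube around x0 the set where Q < eps has positive
  measure for every eps; dilation makes it a strip, and \<open>radial_contradiction\<close> applies.
  The condition on k and l says that e is not parallel to x0 and keeps the geometric factor of the
  Jacobian away from 0.\<close>

lemma strict_improvement_coords:
 fixes x0 e :: "real ^ 'n::finite" and u :: "real ^ 'n => real"
 assumes V: "open V" "x0 \<in> V" and alpha: "0 < \<alpha>" "\<alpha> < 1" and beta: "\<beta> = 1 / \<alpha>"
  and u: "loc_int V u" "continuous_on V u" "!!x. x \<in> V ==> 0 < u x"
  and D: "!!i. loc_int V (D i)" and H: "!!i j. loc_int V (H i j)"
  and pe: "pe = max 1 ((CARD('n) - 2) * (CARD('n) - 2 + 1))"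
  and Hp: "!!i j. loc_int V (%x. \<bar>H i j x\<bar> ^ pe)"
  and wu: "!!i. wder V i u (D i)" and wD: "!!i j. wder V j (D i) (H i j)"
  and bD: "!!i. AE x\<in>V in lborel. \<bar>D i x\<bar> <= L"
  and hom: "hom_AE V \<alpha> u"
  and det: "\<bar>\<sigma>\<bar> = 1" "!!K. compact K ==> K \<subseteq> V ==> \<exists>c>0. AE x\<in>K in lborel. c <= \<sigma> * det (\<chi> i j. H i j x)"
  and Qnn: "AE x\<in>V in lborel. \<beta> * u x powr (\<beta> - 1) * (\<Sum>i\<in>UNIV. e $ i * D i x) <= hh"
  and kl: "e $ k * x0 $ l ~= e $ l * x0 $ k" and xl: "x0 $ l ~= 0"
 shows "\<exists>\<delta>>0. \<exists>s>0. AE x\<in>qcube x0 s in lborel. \<beta> * u x powr (\<beta> - 1) * (\<Sum>i\<in>UNIV. e $ i * D i x) <= hh - \<delta>"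
proof (rule ccontr)
 assume neg: "\<not> ?thesis"
 have b1: "1 < \<beta>" "0 < \<beta>" using alpha by (auto simp: beta)
 define f where "f = (%x :: real ^ 'n. (e $ k * x $ l - e $ l * x $ k) * x $ l)"
 have fx0: "f x0 ~= 0" using kl xl by (simp add: f_def)
 define \<tau> where "\<tau> = sgn (f x0)"
 have tau: "\<bar>\<tau>\<bar> = 1" "\<tau> * f x0 = \<bar>f x0\<bar>" using fx0 by (auto simp: \<tau>_def sgn_if)
 define c0 where "c0 = \<bar>f x0\<bar> / 2"
 have c0: "0 < c0" using fx0 by (simp add: c0_def)
 define m0 where "m0 = u x0 / 2"
 define M0 where "M0 = 2 * u x0"
 have mM: "0 < m0" "0 < M0" using u(3)[OF V(2)] by (auto simp: m0_def M0_def)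
 \<comment> \<open>On W the geometric factor has a fixed sign and a positive lower bound, and
   \<open>u\<close> lies between positive constants, so all powers of \<open>u\<close> are
   controlled.\<close>
 define W where "W = {x \<in> V. c0 < \<tau> * f x} \<inter> (V \<inter> u -` {m0<..<M0})"
 have oW: "open W" proof -
  have "open {x. c0 < \<tau> * f x}" unfolding f_def by (intro open_Collect_less continuous_intros)
  hence "open (V \<inter> {x. c0 < \<tau> * f x})" using V(1) by blast
  moreover have "open (V \<inter> u -` {m0<..<M0})" by (rule continuous_open_preimage[OF u(2) V(1)]) simp
  moreover have "W = (V \<inter> {x. c0 < \<tau> * f x}) \<inter> (V \<inter> u -` {m0<..<M0})" by (auto simp: W_def)
  ultimately show ?thesis by auto
 qed
 have x0W: "x0 \<in> W" using V(2) c0 u(3)[OF V(2)] tau by (auto simp: W_def c0_def m0_def M0_def)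
 have WV: "W \<subseteq> V" by (auto simp: W_def)
 obtain R2 where R2: "R2 > 0" "qcube x0 R2 \<subseteq> W" using exists_qcube[OF oW x0W] by blast
 define R where "R = R2 / 2"
 have R: "R > 0" "qcube x0 (2 * R) \<subseteq> W" using R2 by (auto simp: R_def)
 have RW: "qcube x0 R \<subseteq> W" using qcube_mono[of R "2 * R" x0] R by auto
 have iR: "icube x0 R \<subseteq> qcube x0 R" by (auto simp: icube_def qcube_def intro: less_imp_le)
 have bW: "m0 <= u x" "u x <= M0" "0 < u x" "c0 <= \<tau> * f x" if "x \<in> W" for x using that mM by (auto simp: W_def)
 note sW [intro] = loc_int_subset[OF _ WV] wder_subset[OF _ WV]
 have bu: "AE x\<in>W in lborel. m0 <= u x \<and> u x <= M0" using bW by (intro AE_I2) auto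
 have bDW: "AE x\<in>W in lborel. \<bar>D i x\<bar> <= L" for i using bD[of i] by eventually_elim (use WV in blast)
 have homW: "hom_AE W \<alpha> u" by (rule hom_AE_subset[OF hom WV])
 have uW: "loc_int W u" and DW: "!!i. loc_int W (D i)" and HW: "!!i j. loc_int W (H i j)"
  and HpW: "!!i j. loc_int W (%x. \<bar>H i j x\<bar> ^ pe)" and wuW: "!!i. wder W i u (D i)" and wDW: "!!i j. wder W j (D i) (H i j)"
  using u(1) D H Hp wu wD by (blast intro: sW)+
 have homD: "hom_AE W (\<alpha> - 1) (D i)" for i by (rule hom_AE_deriv[OF oW uW DW wuW homW])
 have pe0: "0 < pe" by (simp add: pe)
 obtain un un1 un2 un3 Z where
  d1: "!!n x i. DERIV (%t. un n (x + t *\<^sub>R axis i 1)) 0 :> un1 n i x"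
  and d2: "!!n x i j. DERIV (%t. un1 n i (x + t *\<^sub>R axis j 1)) 0 :> un2 n i j x"
  and d3: "!!n x i j k. DERIV (%t. un2 n i j (x + t *\<^sub>R axis k 1)) 0 :> un3 n i j k x"
  and s2: "!!n i j. un2 n i j = un2 n j i" and s3: "!!n i j k. un3 n i j k = un3 n i k j"
  and c0n: "!!n. continuous_on UNIV (un n)" and c1n: "!!n i. continuous_on UNIV (un1 n i)"
  and c2n: "!!n i j. continuous_on UNIV (un2 n i j)" and c3n: "!!n i j k. continuous_on UNIV (un3 n i j k)"
  and un_b: "!!n x. x \<in> qcube x0 R ==> m0 <= un n x \<and> un n x <= M0"
  and un1_b: "!!n i x. x \<in> qcube x0 R ==> \<bar>un1 n i x\<bar> <= L"
  and l0: "AE x\<in>qcube x0 R in lborel. (%n. un n x) \<longlonglongrightarrow> u x"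
  and l1: "!!i. AE x\<in>qcube x0 R in lborel. (%n. un1 n i x) \<longlonglongrightarrow> D i x"
  and l2: "!!i j. AE x\<in>qcube x0 R in lborel. (%n. un2 n i j x) \<longlonglongrightarrow> H i j x"
  and Zi: "integrable lborel Z" and Z0: "!!x. Z x \<ge> 0"
  and Zb: "AE x\<in>qcube x0 R in lborel. (\<forall>n i j. \<bar>un2 n i j x\<bar> ^ pe <= Z x)"
  by (rule mollified_sequence[OF R(1) pe0 R(2) uW DW HW HpW wuW wDW bu bDW]) blast
 define Q where "Q = (%x. hh - \<beta> * u x powr (\<beta> - 1) * (\<Sum>i\<in>UNIV. e $ i * D i x))"
 define pd where "pd = (%j m x. \<beta> * u x powr (\<beta> - 1) * H j m x + \<beta> * (\<beta> - 1) * u x powr (\<beta> - 2) * (D j x * D m x))"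
 define q where "q = (%b x. - (\<Sum>i\<in>UNIV. e $ i * pd i b x))"
 define Qn where "Qn = (%n x. hh - (\<Sum>i\<in>UNIV. e $ i * (\<beta> * un n x powr (\<beta> - 1) * un1 n i x)))"
 define dP where "dP = (%n j m x. \<beta> * un n x powr (\<beta> - 1) * un2 n j m x + \<beta> * (\<beta> - 1) * un n x powr (\<beta> - 2) * (un1 n j x * un1 n m x))"
 define dQ where "dQ = (%n b x. - (\<Sum>i\<in>UNIV. e $ i * dP n i b x))"
 define ddP where "ddP = (%n j m i x. \<beta> * (\<beta> - 1) * un n x powr (\<beta> - 2) * (un1 n i x * un2 n j m x + un1 n m x * un2 n j i x + un1 n j x * un2 n m i x)
  + \<beta> * un n x powr (\<beta> - 1) * un3 n j m i x + \<beta> * (\<beta> - 1) * (\<beta> - 2) * un n x powr (\<beta> - 3) * (un1 n i x * un1 n j x * un1 n m x))"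
 have unpos: "0 < un n x" if "x \<in> qcube x0 R" for n x using un_b[OF that, of n] mM by linarith
 have pn: "has_partial (un n) (un1 n i x) i x" for n i x using d1 by (simp add: has_partial_def)
 have pn1: "has_partial (un1 n i) (un2 n i j x) j x" for n i j x using d2 by (simp add: has_partial_def)
 have pn2: "has_partial (un2 n i j) (un3 n i j k x) k x" for n i j k x using d3 by (simp add: has_partial_def)
 have cmul: "has_partial (%x. c * g x) (c * g') i x" if "has_partial g g' i x" for c g g' i and x :: "real ^ 'n"
  using has_partial_mult[OF has_partial_const[of c] that] by simp
 have padd: "has_partial (%x. g x + h x) (g' + h') i x" if "has_partial g g' i x" "has_partial h h' i x" for g g' h h' i and x :: "real ^ 'n"
  using that unfolding has_partial_def by (rule DERIV_add)
 have ppow: "has_partial (%x. un n x powr s) (s * un n x powr (s - 1) * un1 n i x) i x" if "x \<in> qcube x0 R" for n s i x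
  by (rule has_partial_powr[OF unpos[OF that] pn])
 have D1: "has_partial (%x. \<beta> * un n x powr (\<beta> - 1) * un1 n j x) (dP n j m x) m x" if x: "x \<in> qcube x0 R" for n j m x
 proof -
  have "has_partial (%x. \<beta> * un n x powr (\<beta> - 1) * un1 n j x)
   (\<beta> * ((\<beta> - 1) * un n x powr (\<beta> - 1 - 1) * un1 n m x) * un1 n j x + \<beta> * un n x powr (\<beta> - 1) * un2 n j m x) m x"
   by (rule has_partial_mult[OF cmul[OF ppow[OF x]] pn1])
  moreover have "\<beta> - 1 - 1 = \<beta> - 2" by simp
  ultimately show ?thesis by (simp only: dP_def) (simp add: algebra_simps)
 qed
 have D2: "has_partial (dP n j m) (ddP n j m i x) i x" if x: "x \<in> qcube x0 R" for n j m i x proof -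
  have "has_partial (dP n j m)
   ((\<beta> * ((\<beta> - 1) * un n x powr (\<beta> - 1 - 1) * un1 n i x) * un2 n j m x + \<beta> * un n x powr (\<beta> - 1) * un3 n j m i x)
   + (\<beta> * (\<beta> - 1) * ((\<beta> - 2) * un n x powr (\<beta> - 2 - 1) * un1 n i x) * (un1 n j x * un1 n m x)
    + \<beta> * (\<beta> - 1) * un n x powr (\<beta> - 2) * (un2 n j i x * un1 n m x + un1 n j x * un2 n m i x))) i x"
   unfolding dP_def by (intro padd has_partial_mult cmul ppow[OF x] pn1 pn2)
  moreover have "\<beta> - 1 - 1 = \<beta> - 2" "\<beta> - 2 - 1 = \<beta> - 3" by simp_all
  ultimately show ?thesis by (simp only: ddP_def) (simp add: algebra_simps)
 qed
 have D3: "has_partial (Qn n) (dQ n b x) b x" if x: "x \<in> qcube x0 R" for n b x proof -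
  have "has_partial (Qn n) (0 - (\<Sum>i\<in>UNIV. e $ i * dP n i b x)) b x"
   unfolding Qn_def by (intro has_partial_diff has_partial_const has_partial_sum cmul D1[OF x])
  thus ?thesis by (simp add: dQ_def)
 qed
 have sub: "continuous_on (icube x0 R) g" if "continuous_on UNIV g" for g :: "real ^ 'n => real"
  by (rule continuous_on_subset[OF that]) simp
 have cpw: "continuous_on (icube x0 R) (%x. un n x powr s)" for n s
 proof (intro continuous_on_powr sub c0n continuous_on_const ballI)
  fix x assume "x \<in> icube x0 R"
  thus "un n x ~= 0" using unpos[of x n] iR by (auto simp: subset_iff)
 qed
 have C1: "continuous_on (icube x0 R) (dP n j m)" for n j m
  unfolding dP_def by (intro continuous_on_add continuous_on_mult continuous_on_const cpw sub c1n c2n)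
 have C2: "continuous_on (icube x0 R) (ddP n j m i)" for n j m i
  unfolding ddP_def by (intro continuous_on_add continuous_on_mult continuous_on_const cpw sub c1n c2n c3n)
 have C3: "continuous_on (icube x0 R) (Qn n)" for n
  unfolding Qn_def by (intro continuous_on_diff continuous_on_sum continuous_on_mult continuous_on_const cpw sub c1n)
 have C4: "continuous_on (icube x0 R) (dQ n b)" for n b
  unfolding dQ_def by (intro continuous_on_minus continuous_on_sum continuous_on_mult continuous_on_const C1)
 define S where "S = (\<Sum>i\<in>UNIV. \<bar>e $ i\<bar>)"
 have S0: "0 <= S" by (auto simp: S_def intro: sum_nonneg)
 define K1 where "K1 = m0 powr (\<beta> - 1) + M0 powr (\<beta> - 1)"
 define K2 where "K2 = m0 powr (\<beta> - 2) + M0 powr (\<beta> - 2)"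
 have K: "0 <= K1" "0 <= K2" by (auto simp: K1_def K2_def)
 have pw1: "un n x powr (\<beta> - 1) <= K1" and pw2: "un n x powr (\<beta> - 2) <= K2" if "x \<in> qcube x0 R" for n x
  using powr_between(1)[OF mM(1)] un_b[OF that, of n] unfolding K1_def K2_def by blast+
 define M where "M = \<bar>hh\<bar> + S * (\<beta> * K1 * \<bar>L\<bar>)"
 have QM: "\<bar>Qn n x\<bar> <= M" if x: "x \<in> qcube x0 R" for n x proof -
  have t: "\<bar>\<beta> * un n x powr (\<beta> - 1) * un1 n i x\<bar> <= \<beta> * K1 * \<bar>L\<bar>" for i
   unfolding abs_mult using pw1[OF x, of n] un1_b[OF x, of n i] b1 K by (intro mult_mono) auto
  have "\<bar>\<Sum>i\<in>UNIV. e $ i * (\<beta> * un n x powr (\<beta> - 1) * un1 n i x)\<bar> <= (\<Sum>i\<in>UNIV. \<bar>e $ i\<bar> * (\<beta> * K1 * \<bar>L\<bar>))"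
   using t by (intro order_trans[OF sum_abs] sum_mono) (subst abs_mult, intro mult_left_mono, auto)
  also have "... = S * (\<beta> * K1 * \<bar>L\<bar>)" by (simp add: S_def sum_distrib_right)
  finally show ?thesis by (simp add: Qn_def M_def)
 qed
 define Cy where "Cy = (1 + S) * (1 + \<beta> * K1 + \<beta> * (\<beta> - 1) * K2 * L\<^sup>2)"
 define Cb where "Cb = 1 + \<beta> * K1 + \<beta> * (\<beta> - 1) * K2 * L\<^sup>2"
 have Cb1: "1 <= Cb" using b1 K by (simp add: Cb_def add_nonneg_nonneg)
 have Cy1: "1 <= Cy" and Cb_le: "Cb <= Cy" and SCb: "S * Cb <= Cy"
  using S0 Cb1 mult_mono[of 1 "1 + S" 1 Cb] unfolding Cy_def Cb_def[symmetric] by (auto simp: algebra_simps)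
 \<comment> \<open>The root of \<open>Z\<close> dominates the mollified second derivatives for all
   n, and Y^pe is at most a multiple of 1 + Z, hence integrable on the cube.\<close>
 define Y where "Y = (%x. Cy * (1 + root pe (Z x)))"
 have rt0: "0 <= root pe (Z x)" for x by (rule real_root_ge_zero[OF Z0])
 have dPb: "\<bar>dP n j m x\<bar> <= Cb * (1 + root pe (Z x))" if x: "x \<in> qcube x0 R" and zb: "\<forall>n i j. \<bar>un2 n i j x\<bar> ^ pe <= Z x" for n j m x
 proof -
  have "root pe (\<bar>un2 n j m x\<bar> ^ pe) <= root pe (Z x)" using zb pe0 by (intro real_root_le_mono) auto
  hence r: "\<bar>un2 n j m x\<bar> <= root pe (Z x)" using pe0 by (simp add: real_root_power_cancel)
  have 1: "\<bar>\<beta> * un n x powr (\<beta> - 1) * un2 n j m x\<bar> <= \<beta> * K1 * root pe (Z x)"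
   unfolding abs_mult using pw1[OF x, of n] r b1 K by (intro mult_mono) auto
  have "\<bar>un1 n j x\<bar> * \<bar>un1 n m x\<bar> <= L * L" using un1_b[OF x, of n j] un1_b[OF x, of n m] by (intro mult_mono[of _ L _ L]) auto
  hence 2: "\<bar>\<beta> * (\<beta> - 1) * un n x powr (\<beta> - 2) * (un1 n j x * un1 n m x)\<bar> <= \<beta> * (\<beta> - 1) * K2 * L\<^sup>2"
  proof -
   have p: "0 <= \<beta> * (\<beta> - 1)" using b1 by simp
   have "\<bar>\<beta> * (\<beta> - 1) * un n x powr (\<beta> - 2) * (un1 n j x * un1 n m x)\<bar> = \<beta> * (\<beta> - 1) * un n x powr (\<beta> - 2) * (\<bar>un1 n j x\<bar> * \<bar>un1 n m x\<bar>)"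
    using b1 by (simp add: abs_mult)
   also have "... <= \<beta> * (\<beta> - 1) * K2 * (L * L)"
    by (rule mult_mono[OF mult_left_mono[OF pw2[OF x, of n] p] \<open>\<bar>un1 n j x\<bar> * \<bar>un1 n m x\<bar> <= L * L\<close> mult_nonneg_nonneg[OF p K(2)]]) simp
   finally show ?thesis by (simp only: power2_eq_square)
  qed
  have a: "0 <= \<beta> * (\<beta> - 1) * K2 * L\<^sup>2" using b1 K by simp
  have b: "0 <= \<beta> * K1" using b1 K by simp
  have "\<bar>dP n j m x\<bar> <= \<beta> * K1 * root pe (Z x) + \<beta> * (\<beta> - 1) * K2 * L\<^sup>2"
   unfolding dP_def using 1 2 by linarith
  also have "... <= Cb * root pe (Z x) + Cb" proof (rule add_mono)
   show "\<beta> * K1 * root pe (Z x) <= Cb * root pe (Z x)" using a by (intro mult_right_mono rt0) (simp add: Cb_def)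
   show "\<beta> * (\<beta> - 1) * K2 * L\<^sup>2 <= Cb" using b by (simp add: Cb_def)
  qed
  finally show ?thesis by (simp add: algebra_simps)
 qed
 have dom2: "\<bar>dP n j m x\<bar> <= Y x" if "x \<in> qcube x0 R" "\<forall>n i j. \<bar>un2 n i j x\<bar> ^ pe <= Z x" for n j m x
 proof -
  have "Cb * (1 + root pe (Z x)) <= Y x" unfolding Y_def using Cb_le rt0[of x] by (intro mult_right_mono) auto
  thus ?thesis using dPb[OF that, of n j m] by linarith
 qed
 have dom1: "\<bar>dQ n b x\<bar> <= Y x" if "x \<in> qcube x0 R" "\<forall>n i j. \<bar>un2 n i j x\<bar> ^ pe <= Z x" for n b x
 proof -
  have "\<bar>dQ n b x\<bar> <= (\<Sum>i\<in>UNIV. \<bar>e $ i * dP n i b x\<bar>)" unfolding dQ_def abs_minus_cancel by (rule sum_abs)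
  also have "... <= (\<Sum>i\<in>UNIV. \<bar>e $ i\<bar> * (Cb * (1 + root pe (Z x))))"
   unfolding abs_mult using dPb[OF that] by (intro sum_mono mult_left_mono) auto
  also have "... = (S * Cb) * (1 + root pe (Z x))" by (simp add: S_def sum_distrib_right mult.assoc)
  also have "... <= Y x" unfolding Y_def using SCb rt0[of x] by (intro mult_right_mono) auto
  finally show ?thesis .
 qed
 have [measurable]: "u \<in> Borel" "!!i. D i \<in> Borel" "!!i j. H i j \<in> Borel"
  using u(1) D H by (auto simp: loc_int_def)
 have Zm [measurable]: "Z \<in> Borel" using borel_measurable_integrable[OF Zi] by simp
 have Ym: "Y \<in> Borel" proof -
  have "root pe \<in> Borel" by (intro borel_measurable_continuous_onI continuous_intros)
  from measurable_compose[OF Zm this] have [measurable]: "(%x. root pe (Z x)) \<in> Borel" .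
  show ?thesis unfolding Y_def by measurable
 qed
 have Y1: "1 <= Y x" for x unfolding Y_def using mult_mono[of 1 Cy 1 "1 + root pe (Z x)"] Cy1 rt0[of x] by simp
 have Yi: "integrable lborel (%x. indicator (icube x0 R) x * Y x ^ pe)" proof (rule Bochner_Integration.integrable_bound)
  let ?g = "%x. Cy ^ pe * 2 ^ pe * (indicator (qcube x0 R) x + Z x)"
  show "integrable lborel ?g"
   by (intro integrable_mult_right Bochner_Integration.integrable_add Zi integrable_real_indicator) (use emeasure_qcube in auto)
  show "(%x. indicator (icube x0 R) x * Y x ^ pe) \<in> borel_measurable lborel" using Ym by measurable
  show "AE x in lborel. norm (indicator (icube x0 R) x * Y x ^ pe) <= norm (?g x)" proof (rule AE_I2)
   fix x
   have g0: "0 <= ?g x" using Cy1 Z0[of x] by (intro mult_nonneg_nonneg) auto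
   show "norm (indicator (icube x0 R) x * Y x ^ pe) <= norm (?g x)" proof (cases "x \<in> icube x0 R")
    case True
    have "(1 + root pe (Z x)) ^ pe <= (2 * max 1 (root pe (Z x))) ^ pe" using rt0[of x] by (intro power_mono) auto
    also have "... = 2 ^ pe * max 1 (root pe (Z x)) ^ pe" by (simp add: power_mult_distrib)
    also have "max 1 (root pe (Z x)) ^ pe <= 1 + Z x" using Z0[of x] pe0 by (auto simp: max_def)
    finally have "(1 + root pe (Z x)) ^ pe <= 2 ^ pe * (1 + Z x)" by simp
    hence "Cy ^ pe * (1 + root pe (Z x)) ^ pe <= Cy ^ pe * (2 ^ pe * (1 + Z x))" using Cy1 by (intro mult_left_mono) auto
    hence "Y x ^ pe <= ?g x" using True iR by (auto simp: Y_def power_mult_distrib mult.assoc)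
    moreover have "0 <= Y x ^ pe" using Y1[of x] by simp
    ultimately show ?thesis using True by simp
   qed simp
  qed
 qed
 have upos: "0 < u x" if "x \<in> qcube x0 R" for x using bW(3) RW that by blast
 have allAE: "AE x in lborel. \<forall>i. P i x" if "!!i. AE x in lborel. P i x" for P :: "'n => real ^ 'n => bool"
  using that by (simp add: AE_all_countable)
 have l1': "AE x in lborel. \<forall>i. x \<in> qcube x0 R --> (%n. un1 n i x) \<longlonglongrightarrow> D i x" by (rule allAE) (rule l1)
 have l2': "AE x in lborel. \<forall>i j. x \<in> qcube x0 R --> (%n. un2 n i j x) \<longlonglongrightarrow> H i j x" by (rule allAE)+ (rule l2)
 have limpw: "(%n. un n x powr s) \<longlonglongrightarrow> u x powr s" if "x \<in> qcube x0 R" "(%n. un n x) \<longlonglongrightarrow> u x" for x s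
  using upos[OF that(1)] by (intro tendsto_powr that(2) tendsto_const) auto
 have limP: "AE x\<in>icube x0 R in lborel. (\<forall>j i. (%n. dP n j i x) \<longlonglongrightarrow> pd j i x)"
  using l0 l1' l2' proof eventually_elim
  case (elim x)
  show ?case proof (intro impI allI)
   fix j i assume "x \<in> icube x0 R"
   hence x: "x \<in> qcube x0 R" using iR by blast
   show "(%n. dP n j i x) \<longlonglongrightarrow> pd j i x"
    unfolding dP_def pd_def by (intro tendsto_add tendsto_mult tendsto_const limpw[OF x]) (use elim x in blast)+
  qed
 qed
 have limdQ: "AE x\<in>icube x0 R in lborel. (\<forall>i. (%n. dQ n i x) \<longlonglongrightarrow> q i x)" using limP
 proof eventually_elim
  case (elim x)
  show ?case proof (intro impI allI)
   fix b assume x: "x \<in> icube x0 R"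
   show "(%n. dQ n b x) \<longlonglongrightarrow> q b x"
    unfolding dQ_def q_def by (intro tendsto_minus tendsto_sum tendsto_mult tendsto_const) (use elim x in blast)
  qed
 qed
 have limQ: "AE x\<in>icube x0 R in lborel. (%n. Qn n x) \<longlonglongrightarrow> Q x" using l0 l1' proof eventually_elim
  case (elim x)
  show ?case proof (intro impI)
   assume "x \<in> icube x0 R"
   hence x: "x \<in> qcube x0 R" using iR by blast
   have "(%n. Qn n x) \<longlonglongrightarrow> hh - (\<Sum>i\<in>UNIV. e $ i * (\<beta> * u x powr (\<beta> - 1) * D i x))"
    unfolding Qn_def by (intro tendsto_diff tendsto_sum tendsto_mult tendsto_const limpw[OF x]) (use elim x in blast)+
   also have "hh - (\<Sum>i\<in>UNIV. e $ i * (\<beta> * u x powr (\<beta> - 1) * D i x)) = Q x"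
    unfolding Q_def by (simp add: sum_distrib_left mult_ac)
   finally show "(%n. Qn n x) \<longlonglongrightarrow> Q x" .
  qed
 qed
 have Hsym: "AE x\<in>qcube x0 R in lborel. (\<forall>i j. H i j x = H j i x)" using l2' proof eventually_elim
  case (elim x)
  show ?case proof (intro impI allI)
   fix i j assume "x \<in> qcube x0 R"
   hence "(%n. un2 n i j x) \<longlonglongrightarrow> H i j x" "(%n. un2 n j i x) \<longlonglongrightarrow> H j i x" using elim by blast+
   moreover have "(%n. un2 n i j x) = (%n. un2 n j i x)" using s2 by metis
   ultimately show "H i j x = H j i x" using LIMSEQ_unique by metis
  qed
 qed
 obtain cH where cH: "cH > 0" "AE x\<in>qcube x0 R in lborel. cH <= \<sigma> * det (\<chi> i j. H i j x)"
  using det(2)[of "qcube x0 R"] RW WV by auto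
 have E1: "AE x\<in>W in lborel. (\<Sum>j\<in>UNIV. x $ j * D j x) = \<alpha> * u x" by (rule euler_weak[OF oW uW DW wuW homW])
 have "AE x\<in>W in lborel. (\<Sum>j\<in>UNIV. x $ j * H i j x) = (\<alpha> - 1) * D i x" for i by (rule euler_weak[OF oW DW HW wDW homD])
 hence E2: "AE x in lborel. \<forall>i. x \<in> W --> (\<Sum>j\<in>UNIV. x $ j * H i j x) = (\<alpha> - 1) * D i x" by (rule allAE)
 define \<phi>m where "\<phi>m = \<beta> * m0 powr (\<beta> - 1)"
 have phim: "0 < \<phi>m" using b1 mM by (simp add: \<phi>m_def)
 \<comment> \<open>The value of \<open>jacobian_formula\<close> with each factor replaced by its
   bound on W.\<close>
 define c where "c = c0 * (\<phi>m ^ (CARD('n) - 1) * cH) / (\<alpha> * M0 * (1 - \<alpha>))"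
 have c: "0 < c" using c0 phim cH mM alpha by (simp add: c_def)
 have jac: "AE x\<in>icube x0 R in lborel. c <= (\<tau> * \<sigma>) * jdet k l (%b. q b x) (%a b. pd a b x)"
  using Hsym cH(2) E1 E2 proof eventually_elim
  case (elim x)
  show ?case
  proof
   assume "x \<in> icube x0 R"
   hence x: "x \<in> qcube x0 R" using iR by blast
   hence xW: "x \<in> W" using RW by blast
   define \<phi>0 where "\<phi>0 = \<beta> * u x powr (\<beta> - 1)"
   define \<phi>1 where "\<phi>1 = \<beta> * (\<beta> - 1) * u x powr (\<beta> - 2)"
   let ?Hx = "(\<chi> i j. H i j x) :: real ^ 'n ^ 'n"
   let ?A = "(\<chi> i j. pd i j x) :: real ^ 'n ^ 'n"
   let ?D = "(\<chi> i. D i x) :: real ^ 'n"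
   have ux: "0 < u x" "u x <= M0" "m0 <= u x" using bW[OF xW] by auto
   have fx: "c0 <= \<tau> * f x" by (rule bW(4)[OF xW])
   hence xl': "x $ l ~= 0" using c0 by (auto simp: f_def)
   have h2: "(\<Sum>j\<in>UNIV. x $ j * H i j x) = (\<alpha> - 1) * D i x" for i using elim xW by blast
   have h1: "(\<Sum>i\<in>UNIV. x $ i * H i j x) = (\<alpha> - 1) * D j x" for j proof -
    have "(\<Sum>i\<in>UNIV. x $ i * H i j x) = (\<Sum>i\<in>UNIV. x $ i * H j i x)" using elim x by (intro sum.cong refl) metis
    thus ?thesis using h2 by simp
   qed
   \<comment> \<open>This is D^2 w x = 0 in scalar form; it holds because \<alpha> (\<beta> - 1) = 1
     - \<alpha>.\<close>
   have phi: "\<phi>0 * (\<alpha> - 1) + \<phi>1 * (\<alpha> * u x) = 0" proof -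
    have "u x powr (\<beta> - 2) * u x = u x powr (\<beta> - 1)" using powr_add[of "u x" "\<beta> - 2" 1] ux by simp
    moreover have "(\<beta> - 1) * \<alpha> = 1 - \<alpha>" using alpha by (simp add: beta field_simps)
    moreover have "\<phi>1 * (\<alpha> * u x) = \<beta> * ((\<beta> - 1) * \<alpha>) * (u x powr (\<beta> - 2) * u x)" by (simp add: \<phi>1_def)
    ultimately have "\<phi>1 * (\<alpha> * u x) = \<beta> * (1 - \<alpha>) * u x powr (\<beta> - 1)" by (simp only:)
    thus ?thesis by (simp add: \<phi>0_def algebra_simps)
   qed
   have "jdet k l (%b. - (\<Sum>i\<in>UNIV. e $ i * ?A $ i $ b)) (%a b. ?A $ a $ b)
    = (e $ k * x $ l - e $ l * x $ k) * x $ l * \<phi>0 ^ (CARD('n) - 1) * det ?Hx / (\<alpha> * u x * (1 - \<alpha>))"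
   proof (rule jacobian_formula[where ?\<phi>1.0="\<phi>1" and D="?D"])
    show "k ~= l" using kl by auto
    show "\<alpha> * u x ~= 0" "\<alpha> ~= 1" using alpha ux by auto
    show "?A $ i $ j = \<phi>0 * ?Hx $ i $ j + \<phi>1 * ?D $ i * ?D $ j" for i j by (simp add: pd_def \<phi>0_def \<phi>1_def)
    show "(\<Sum>j\<in>UNIV. x $ j * ?D $ j) = \<alpha> * u x" using elim xW by simp
   qed (use xl' phi h1 h2 in simp_all)
   hence J: "jdet k l (%b. q b x) (%a b. pd a b x) = f x * \<phi>0 ^ (CARD('n) - 1) * det ?Hx / (\<alpha> * u x * (1 - \<alpha>))"
    by (simp add: q_def f_def)
   have den: "0 < \<alpha> * u x * (1 - \<alpha>)" "\<alpha> * u x * (1 - \<alpha>) <= \<alpha> * M0 * (1 - \<alpha>)"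
    using alpha ux by (auto intro!: mult_right_mono mult_left_mono)
   have "\<phi>m <= \<phi>0" unfolding \<phi>m_def \<phi>0_def using b1 ux mM by (intro mult_left_mono powr_mono2) auto
   hence ph: "\<phi>m ^ (CARD('n) - 1) <= \<phi>0 ^ (CARD('n) - 1)" using phim by (intro power_mono) auto
   have dH: "cH <= \<sigma> * det ?Hx" using elim x by blast
   have ph0: "0 <= \<phi>m ^ (CARD('n) - 1)" using phim by simp
   have "\<phi>m ^ (CARD('n) - 1) * cH <= \<phi>0 ^ (CARD('n) - 1) * (\<sigma> * det ?Hx)"
    by (rule mult_mono[OF ph dH]) (use ph0 ph cH in auto)
   hence num: "c0 * (\<phi>m ^ (CARD('n) - 1) * cH) <= (\<tau> * f x) * (\<phi>0 ^ (CARD('n) - 1) * (\<sigma> * det ?Hx))"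
    by (rule mult_mono[OF fx]) (use fx c0 ph0 cH in auto)
   have n0: "0 <= c0 * (\<phi>m ^ (CARD('n) - 1) * cH)" using c0 ph0 cH by simp
   have "c <= (\<tau> * f x) * (\<phi>0 ^ (CARD('n) - 1) * (\<sigma> * det ?Hx)) / (\<alpha> * u x * (1 - \<alpha>))"
    unfolding c_def by (rule frac_le[OF order_trans[OF n0 num] num den])
   also have "... = (\<tau> * \<sigma>) * jdet k l (%b. q b x) (%a b. pd a b x)" unfolding J by simp
   finally show "c <= (\<tau> * \<sigma>) * jdet k l (%b. q b x) (%a b. pd a b x)" .
  qed
 qed
 have Qm: "Q \<in> Borel" unfolding Q_def by measurable
 have QU: "AE x\<in>icube x0 R in lborel. 0 <= Q x" using Qnn proof eventually_elim
  case (elim x)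
  thus ?case using iR RW WV by (auto simp: Q_def)
 qed
 have js: "jacobian_setup x0 R k l Q q pd Qn dQ dP ddP M c (\<tau> * \<sigma>) Y (CARD('n) - 2) pe" proof (rule jacobian_setup.intro)
  show "k ~= l" using kl by auto
  show "pd j i \<in> Borel" for j i unfolding pd_def by measurable
  show "q i \<in> Borel" for i unfolding q_def pd_def by measurable
  show "AE x\<in>icube x0 R in lborel. (\<forall>n i. \<bar>dQ n i x\<bar> <= Y x)"
   using Zb by eventually_elim (use iR dom1 in blast)
  show "AE x\<in>icube x0 R in lborel. (\<forall>n j i. \<bar>dP n j i x\<bar> <= Y x)"
   using Zb by eventually_elim (use iR dom2 in blast)
  show "\<bar>\<tau> * \<sigma>\<bar> = 1" using tau det by (simp add: abs_mult)
  show "ddP n j m i x = ddP n j i m x" for n j m i x unfolding ddP_def s3[of n j m i] s2[of n m i] by (simp add: algebra_simps)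
  show "0 < R" by (rule R(1))
  show "CARD('n) - 2 = CARD('n) - 2" ..
  show "pe = max 1 ((CARD('n) - 2) * (CARD('n) - 2 + 1))" by (rule pe)
  show "has_partial (Qn n) (dQ n i x) i x" if "x \<in> icube x0 R" for n i x by (rule D3) (use that iR in blast)
  show "has_partial (dP n j m) (ddP n j m i x) i x" if "x \<in> icube x0 R" for n j m i x by (rule D2) (use that iR in blast)
  show "\<bar>Qn n x\<bar> <= M" if "x \<in> icube x0 R" for n x by (rule QM) (use that iR in blast)
 qed (rule C1 C2 C3 C4 Qm Ym Y1 Yi limQ limdQ limP QU c jac)+
 have homQ: "hom_AE W 0 Q" unfolding hom_AE_def proof (intro allI impI)
  fix t :: real assume t: "t > 0"
  have "AE x in lborel. x \<in> W \<and> t *\<^sub>R x \<in> W --> D i (t *\<^sub>R x) = t powr (\<alpha> - 1) * D i x" for i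
   using homD[of i] t unfolding hom_AE_def by blast
  hence 1: "AE x in lborel. \<forall>i. x \<in> W \<and> t *\<^sub>R x \<in> W --> D i (t *\<^sub>R x) = t powr (\<alpha> - 1) * D i x" by (rule allAE)
  have 2: "AE x in lborel. x \<in> W \<and> t *\<^sub>R x \<in> W --> u (t *\<^sub>R x) = t powr \<alpha> * u x"
   using homW t unfolding hom_AE_def by blast
  show "AE x in lborel. x \<in> W \<and> t *\<^sub>R x \<in> W --> Q (t *\<^sub>R x) = t powr 0 * Q x" using 1 2
  proof eventually_elim
   case (elim x)
   show ?case
   proof
    assume x: "x \<in> W \<and> t *\<^sub>R x \<in> W"
    hence ux: "0 < u x" using bW by blast
    have e1: "u (t *\<^sub>R x) powr (\<beta> - 1) = t powr (1 - \<alpha>) * u x powr (\<beta> - 1)" proof -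
     have "\<alpha> * (\<beta> - 1) = 1 - \<alpha>" using alpha by (simp add: beta field_simps)
     thus ?thesis using elim x ux t by (simp add: powr_mult powr_powr)
    qed
    have e2: "(\<Sum>i\<in>UNIV. e $ i * D i (t *\<^sub>R x)) = t powr (\<alpha> - 1) * (\<Sum>i\<in>UNIV. e $ i * D i x)"
     using elim x by (simp add: sum_distrib_left mult_ac)
    have e3: "t powr (1 - \<alpha>) * t powr (\<alpha> - 1) = 1" using t by (simp add: powr_add[symmetric])
    have "\<beta> * u (t *\<^sub>R x) powr (\<beta> - 1) * (\<Sum>i\<in>UNIV. e $ i * D i (t *\<^sub>R x)) =
     (t powr (1 - \<alpha>) * t powr (\<alpha> - 1)) * (\<beta> * u x powr (\<beta> - 1) * (\<Sum>i\<in>UNIV. e $ i * D i x))" unfolding e1 e2 by (simp only: mult_ac)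
    also have "... = \<beta> * u x powr (\<beta> - 1) * (\<Sum>i\<in>UNIV. e $ i * D i x)" unfolding e3 by simp
    finally show "Q (t *\<^sub>R x) = t powr 0 * Q x" using t by (simp add: Q_def)
   qed
  qed
 qed
 define r where "r = R / 20"
 have r: "0 < r" "20 * r <= R" using R by (auto simp: r_def)
 have rW: "qcube x0 r \<subseteq> W" using qcube_mono[of r R x0] RW r by auto
 have pos: "emeasure lborel {x \<in> qcube x0 s. Q x < eps} ~= 0" if "0 < eps" "0 < s" for eps s
 proof
  assume z: "emeasure lborel {x \<in> qcube x0 s. Q x < eps} = 0"
  have "{x \<in> qcube x0 s. Q x < eps} = qcube x0 s \<inter> {x \<in> space borel. Q x < eps}" by auto
  hence "{x \<in> qcube x0 s. Q x < eps} \<in> sets lborel" using Qm by simp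
  with z have "AE x in lborel. x \<notin> {x \<in> qcube x0 s. Q x < eps}" by (intro AE_not_in null_setsI) auto
  hence "AE x\<in>qcube x0 s in lborel. \<beta> * u x powr (\<beta> - 1) * (\<Sum>i\<in>UNIV. e $ i * D i x) <= hh - eps"
   by eventually_elim (auto simp: Q_def)
  thus False using neg that by blast
 qed
 obtain \<rho> where rho: "0 < \<rho>" "\<rho> <= r" and rad: "!!eps. 0 < eps ==> \<exists>c1>0. \<forall>a b. x0 $ l - \<rho> <= a --> a <= b --> b <= x0 $ l + \<rho> -->
  c1 * (b - a) <= measure lborel (strip Q x0 l r eps a b)"
  using radial_strip[OF r(1) rW xl homQ Qm pos] by blast
 show False by (rule jacobian_setup.radial_contradiction[OF js r rho rad])
qed

subsection \<open>Increments of the degree-one power\<close>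

lemma mol_has_derivative:
 fixes f :: "real ^ 'n::finite => real"
 assumes f: "integrable lborel f"
 shows "DERIV (%t. mol N \<kappa> f (x + t *\<^sub>R e)) t0 :> (\<Sum>i\<in>UNIV. e $ i * mol N (\<kappa>(i := Suc (\<kappa> i))) f (x + t0 *\<^sub>R e))"
proof -
 have hp: "has_partial (mol N \<kappa> f) (mol N (\<kappa>(i := Suc (\<kappa> i))) f y) i y" for y i
  using DERIV_mol[OF f, of N \<kappa> y i 0] by (simp add: has_partial_def)
 have "(mol N \<kappa> f has_derivative (%h. \<Sum>i\<in>UNIV. mol N (\<kappa>(i := Suc (\<kappa> i))) f (x + t0 *\<^sub>R e) * h $ i)) (at (x + t0 *\<^sub>R e))"
  by (rule partials_has_derivative[OF open_UNIV UNIV_I hp mol_continuous[OF f]])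
 hence d: "(mol N \<kappa> f has_derivative (%h. \<Sum>i\<in>UNIV. mol N (\<kappa>(i := Suc (\<kappa> i))) f (x + t0 *\<^sub>R e) * h $ i)) (at (x + t0 *\<^sub>R e) within range (%t. x + t *\<^sub>R e))"
  by (rule has_derivative_at_withinI)
 have "((%t. x + t *\<^sub>R e) has_vector_derivative e) (at t0)" by (auto intro!: derivative_eq_intros)
 from vector_derivative_diff_chain_within[OF this d]
 show ?thesis unfolding has_real_derivative_iff_has_vector_derivative o_def by (simp add: mult.commute)
qed

lemma mol_sum:
 fixes f :: "'n => real ^ 'n::finite => real"
 assumes "!!i. integrable lborel (f i)"
 shows "(\<Sum>i\<in>UNIV. e i * mol N \<kappa> (f i) x) = mol N \<kappa> (%z. \<Sum>i\<in>UNIV. e i * f i z) x" proof -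
 have i: "integrable lborel (%z. e i * (f i z * ker N \<kappa> (x - z)))" for i
  by (intro integrable_mult_right mol_integrable assms)
 have "mol N \<kappa> (%z. \<Sum>i\<in>UNIV. e i * f i z) x = (LBINT z. (\<Sum>i\<in>UNIV. e i * (f i z * ker N \<kappa> (x - z))))"
  unfolding mol_def by (simp add: sum_distrib_right mult.assoc)
 also have "... = (\<Sum>i\<in>UNIV. e i * mol N \<kappa> (f i) x)"
  unfolding mol_def by (subst Bochner_Integration.integral_sum[OF i]) simp
 finally show ?thesis by simp
qed

lemma mol_pointwise:
 fixes u :: "real ^ 'n::finite => real"
 assumes U: "open U" "y \<in> U" and c: "continuous_on U u" and f: "integrable lborel f" and eq: "!!z. z \<in> V ==> f z = u z"
  and V: "open V" "y \<in> V" and e: "0 < eps"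
 shows "\<exists>N0>0. \<forall>N\<ge>N0. \<bar>mol0 N f y - u y\<bar> <= eps" proof -
 have "open (U \<inter> u -` {u y - eps<..<u y + eps})" by (rule continuous_open_preimage[OF c U(1)]) simp
 hence "open (U \<inter> u -` {u y - eps<..<u y + eps} \<inter> V)" using V(1) by blast
 moreover have "y \<in> U \<inter> u -` {u y - eps<..<u y + eps} \<inter> V" using U V e by auto
 ultimately obtain s where s: "s > 0" "qcube y s \<subseteq> U \<inter> u -` {u y - eps<..<u y + eps} \<inter> V" using exists_qcube by blast
 show ?thesis proof (intro exI[of _ "1 / s"] conjI allI impI)
  show "0 < 1 / s" using s by simp
  fix N assume N: "1 / s <= N"
  have N0: "0 < N" using less_le_trans[OF _ N] s(1) by simp
  have "1 / N <= s" using N N0 s(1) by (simp add: field_simps)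
  hence sub: "qcube y (1 / N) \<subseteq> U \<inter> u -` {u y - eps<..<u y + eps} \<inter> V" using qcube_mono s(2) by blast
  have b: "u y - eps <= f z \<and> f z <= u y + eps" if "z \<in> qcube y (1 / N)" for z proof -
   have "z \<in> U \<inter> u -` {u y - eps<..<u y + eps} \<inter> V" using that sub by blast
   thus ?thesis using eq[of z] by auto
  qed
  have "mol0 N f y <= u y + eps" by (rule mol_bounds_const(1)[OF f N0]) (use b in \<open>auto intro!: AE_I2\<close>)
  moreover have "u y - eps <= mol0 N f y" by (rule mol_bounds_const(2)[OF f N0]) (use b in \<open>auto intro!: AE_I2\<close>)
  ultimately show "\<bar>mol0 N f y - u y\<bar> <= eps" by linarith
 qed
qed

text \<open>For the mollified function the derivative bound holds everywhere on the segment and can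
  be integrated; continuity of \<open>u\<close> at the two end points allows the passage to the
  limit.\<close>

lemma local_monotone:
 fixes u :: "real ^ 'n::finite => real"
 assumes U: "open U" and u: "loc_int U u" "continuous_on U u" and D: "!!i. loc_int U (D i)" and w: "!!i. wder U i u (D i)"
  and ae: "AE x\<in>qcube x0 (2 * R) in lborel. (\<Sum>i\<in>UNIV. e $ i * D i x) <= A"
  and R: "0 < R" "qcube x0 (2 * R) \<subseteq> U" and y: "y \<in> qcube x0 R" "y + t *\<^sub>R e \<in> qcube x0 R" and t: "0 <= t"
 shows "u (y + t *\<^sub>R e) - u y <= A * t" proof -
 let ?K = "qcube x0 (2 * R)"
 have cK: "compact ?K" "?K \<subseteq> U" using R by auto
 have iu: "integrable lborel (%z. indicator ?K z * u z)" and iD: "integrable lborel (%z. indicator ?K z * D i z)" for i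
  using u(1) D cK by (auto simp: loc_int_def)
 have seg: "y + s *\<^sub>R e \<in> qcube x0 R" if "0 <= s" "s <= t" for s proof (cases "t = 0")
  case False
  have "convex (qcube x0 R)" by (simp add: qcube_eq_cbox convex_box)
  moreover have "y + s *\<^sub>R e = (1 - s / t) *\<^sub>R y + (s / t) *\<^sub>R (y + t *\<^sub>R e)"
   using False by (simp add: algebra_simps)
  ultimately show ?thesis using y that t False by (simp add: convex_def)
 qed (use that y in simp)
 have mono: "mol0 N (%z. indicator ?K z * u z) (y + t *\<^sub>R e) - mol0 N (%z. indicator ?K z * u z) y <= A * t" if N: "1 / R <= N" for N
 proof -
  have N0: "0 < N" using less_le_trans[OF _ N] R(1) by simp
  have N1: "1 / N <= R" using N N0 R(1) by (simp add: field_simps)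
  have sub: "qcube z (1 / N) \<subseteq> ?K" if z: "z \<in> qcube x0 R" for z
  proof
   fix x assume x: "x \<in> qcube z (1 / N)"
   have "\<bar>x $ i - x0 $ i\<bar> <= 2 * R" for i proof -
    have "\<bar>x $ i - z $ i\<bar> <= 1 / N" "\<bar>z $ i - x0 $ i\<bar> <= R" using x z by (auto simp: qcube_def)
    thus ?thesis using N1 by linarith
   qed
   thus "x \<in> ?K" by (simp add: qcube_def)
  qed
  have db: "(\<Sum>i\<in>UNIV. e $ i * mol1 N i (%z. indicator ?K z * u z) z) <= A" if z: "z \<in> qcube x0 R" for z
  proof -
   have "(\<Sum>i\<in>UNIV. e $ i * mol1 N i (%z. indicator ?K z * u z) z)
    = (\<Sum>i\<in>UNIV. e $ i * mol0 N (%z. indicator ?K z * D i z) z)"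
    by (intro sum.cong refl arg_cong2[of _ _ _ _ "(*)"] mol_wder[OF w N0 sub[OF z] cK(2)])
   also have "... = mol0 N (%z. \<Sum>i\<in>UNIV. e $ i * (indicator ?K z * D i z)) z" by (rule mol_sum[OF iD])
   also have "... <= A" proof (rule mol_bounds_const(1)[OF _ N0])
    show "integrable lborel (%z. \<Sum>i\<in>UNIV. e $ i * (indicator ?K z * D i z))"
     by (intro Bochner_Integration.integrable_sum integrable_mult_right iD)
    show "AE x\<in>qcube z (1 / N) in lborel. (\<Sum>i\<in>UNIV. e $ i * (indicator ?K x * D i x)) <= A"
     using ae by eventually_elim (use sub[OF z] in auto)
   qed
   finally show ?thesis .
  qed
  have "A * 0 - mol0 N (%z. indicator ?K z * u z) (y + 0 *\<^sub>R e) <= A * t - mol0 N (%z. indicator ?K z * u z) (y + t *\<^sub>R e)"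
  proof (rule DERIV_nonneg_imp_nondecreasing[OF t])
   fix s assume s: "0 <= s" "s <= t"
   let ?d = "\<Sum>i\<in>UNIV. e $ i * mol1 N i (%z. indicator ?K z * u z) (y + s *\<^sub>R e)"
   have "DERIV (%s. A * s - mol0 N (%z. indicator ?K z * u z) (y + s *\<^sub>R e)) s :> A * 1 - ?d"
    by (intro DERIV_diff DERIV_cmult DERIV_ident mol_has_derivative[OF iu])
   moreover have "0 <= A * 1 - ?d" using db[OF seg[OF s]] by simp
   ultimately show "\<exists>d. DERIV (%s. A * s - mol0 N (%z. indicator ?K z * u z) (y + s *\<^sub>R e)) s :> d \<and> 0 <= d" by blast
  qed
  thus ?thesis by simp
 qed
 have R3: "qcube x0 R \<subseteq> icube x0 (2 * R)" using R(1) by (auto simp: qcube_def icube_def intro: le_less_trans)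
 have iK: "icube x0 (2 * R) \<subseteq> ?K" by (auto simp: qcube_def icube_def intro: less_imp_le)
 have pw: "\<exists>N0>0. \<forall>N\<ge>N0. \<bar>mol0 N (%z. indicator ?K z * u z) z - u z\<bar> <= eps" if "z \<in> qcube x0 R" "0 < eps" for z eps
  by (rule mol_pointwise[OF U _ u(2) iu _ open_icube[of x0 "2 * R"] _ that(2)]) (use that R3 iK R in \<open>auto simp: subset_iff\<close>)
 show ?thesis proof (rule field_le_epsilon)
  fix eps :: real assume "0 < eps"
  hence e: "0 < eps / 2" by simp
  obtain N1 where N1: "N1 > 0" "!!N. N \<ge> N1 ==> \<bar>mol0 N (%z. indicator ?K z * u z) y - u y\<bar> <= eps / 2" using pw[OF y(1) e] by blast
  obtain N2 where N2: "N2 > 0" "!!N. N \<ge> N2 ==> \<bar>mol0 N (%z. indicator ?K z * u z) (y + t *\<^sub>R e) - u (y + t *\<^sub>R e)\<bar> <= eps / 2" using pw[OF y(2) e] by blast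
  let ?N = "max (1 / R) (max N1 N2)"
  have "1 / R <= ?N" "N1 <= ?N" "N2 <= ?N" by simp_all
  from mono[OF this(1)] N1(2)[OF this(2)] N2(2)[OF this(3)]
  show "u (y + t *\<^sub>R e) - u y <= A * t + eps" by linarith
 qed
qed

text \<open>The incremental bound is mollified first and differentiated at 0 from the right
  afterwards; the fundamental lemma removes the mollification.\<close>

lemma directional_bound_AE:
 fixes u g :: "real ^ 'n::finite => real"
 assumes U: "open U" and u: "loc_int U u" and D: "!!i. loc_int U (D i)" and w: "!!i. wder U i u (D i)" and g: "loc_int U g"
  and inc: "!!x t. x \<in> U ==> 0 < t ==> x + t *\<^sub>R e \<in> U ==> u (x + t *\<^sub>R e) <= u x + t * g x"
 shows "AE x\<in>U in lborel. (\<Sum>i\<in>UNIV. e $ i * D i x) <= g x" proof -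
 have f: "loc_int U (%x. g x - (\<Sum>i\<in>UNIV. e $ i * D i x))" unfolding loc_int_def proof (intro conjI allI impI)
  have [measurable]: "g \<in> Borel" "!!i. D i \<in> Borel" using g D by (auto simp: loc_int_def)
  show "(%x. g x - (\<Sum>i\<in>UNIV. e $ i * D i x)) \<in> Borel" by measurable
  fix K assume K: "compact K \<and> K \<subseteq> U"
  have "integrable lborel (%x. indicator K x * g x - (\<Sum>i\<in>UNIV. e $ i * (indicator K x * D i x)))"
   using g D K by (intro Bochner_Integration.integrable_diff Bochner_Integration.integrable_sum integrable_mult_right) (auto simp: loc_int_def)
  thus "integrable lborel (%x. indicator K x * (g x - (\<Sum>i\<in>UNIV. e $ i * D i x)))"
   by (simp add: algebra_simps sum_distrib_left)
 qed
 have "AE x\<in>U in lborel. 0 <= g x - (\<Sum>i\<in>UNIV. e $ i * D i x)" proof (rule fundamental_lemma[OF U f])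
  fix x :: "real ^ 'n" and N :: real
  assume N: "0 < N" and sub: "qcube x (1 / N) \<subseteq> U"
  obtain \<delta> K where K: "\<delta> > 0" "compact K" "K \<subseteq> U" "!!z. z \<in> qcube x (1 / N) ==> qcube z \<delta> \<subseteq> K"
   using compact_enlarge[OF compact_qcube U sub] by blast
  have qK: "qcube x (1 / N) \<subseteq> K" using K(1,4) qcube_self[of \<delta>] by (meson less_imp_le subset_iff)
  define cu where "cu = (%z. indicator K z * u z)"
  define cg where "cg = (%z. indicator K z * g z)"
  define cD where "cD = (%i z. indicator K z * D i z)"
  have iu: "integrable lborel cu" and ig: "integrable lborel cg" and iD: "integrable lborel (cD i)" for i
   using u g D K by (auto simp: loc_int_def cu_def cg_def cD_def)
  define d where "d = (\<Sum>i\<in>UNIV. e $ i * mol0 N (cD i) x)"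
  have "d = (\<Sum>i\<in>UNIV. e $ i * mol1 N i cu x)"
   unfolding d_def cD_def cu_def by (intro sum.cong refl arg_cong2[of _ _ _ _ "(*)"] mol_wder[OF w N qK K(3), symmetric])
  hence der: "DERIV (%t. mol0 N cu (x + t *\<^sub>R e)) 0 :> d"
   using mol_has_derivative[OF iu, of N "%_. 0" x e 0] by simp
  define B where "B = norm e + 1"
  have B: "0 < B" "!!i. \<bar>e $ i\<bar> <= B" using component_le_norm_cart[of e] by (auto simp: B_def add_nonneg_pos add_increasing2)
  \<comment> \<open>After a translation the increment of the mollification is the mollification of
    the increment, to which \<open>inc\<close> applies pointwise.\<close>
  have step: "mol0 N cu (x + t *\<^sub>R e) - mol0 N cu x <= t * mol0 N cg x" if t: "0 < t" "t <= \<delta> / B" for t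
  proof -
   have cum: "cu \<in> Borel" using iu by auto
   have tr: "integrable lborel (%z. cu (t *\<^sub>R e + 1 *\<^sub>R z))" by (rule integrable_lborel_affine[OF iu]) simp
   have "mol0 N cu (x + t *\<^sub>R e) = mol0 N (%z. cu (t *\<^sub>R e + 1 *\<^sub>R z)) x" proof -
    have m: "(%z. cu z * ker0 N (x + t *\<^sub>R e - z)) \<in> Borel" using cum by measurable
    show ?thesis unfolding mol_def using lborel_integral_affine[OF m, of 1 "t *\<^sub>R e"] by (simp add: algebra_simps)
   qed
   moreover have "mol0 N (%z. cu (t *\<^sub>R e + 1 *\<^sub>R z)) x <= mol0 N (%z. cu z + t * cg z) x"
   proof (rule mol_mono_AE[OF tr _ N])
    show "integrable lborel (%z. cu z + t * cg z)" by (intro Bochner_Integration.integrable_add iu integrable_mult_right ig)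
    show "AE z\<in>qcube x (1 / N) in lborel. cu (t *\<^sub>R e + 1 *\<^sub>R z) <= cu z + t * cg z" proof (rule AE_I2, rule impI)
     fix z assume z: "z \<in> qcube x (1 / N)"
     have "t * B <= \<delta>" using t B by (simp add: field_simps)
     have "z + t *\<^sub>R e \<in> qcube z \<delta>" unfolding qcube_def proof (rule CollectI, rule allI)
      fix i
      have "t * \<bar>e $ i\<bar> <= t * B" using t B by (intro mult_left_mono) auto
      hence "t * \<bar>e $ i\<bar> <= \<delta>" using \<open>t * B <= \<delta>\<close> by linarith
      thus "\<bar>(z + t *\<^sub>R e) $ i - z $ i\<bar> <= \<delta>" using t by (simp add: abs_mult)
     qed
     hence zK: "z + t *\<^sub>R e \<in> K" "z \<in> K" using K(4)[OF z] qK z by auto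
     hence "u (z + t *\<^sub>R e) <= u z + t * g z" using K(3) t by (intro inc) auto
     thus "cu (t *\<^sub>R e + 1 *\<^sub>R z) <= cu z + t * cg z" using zK by (simp add: cu_def cg_def add.commute)
    qed
   qed
   moreover have "mol0 N (%z. cu z + t * cg z) x = mol0 N cu x + t * mol0 N cg x"
   proof -
    have "(LBINT z. cu z * ker0 N (x - z) + t * (cg z * ker0 N (x - z))) = mol0 N cu x + t * mol0 N cg x"
     unfolding mol_def by (subst Bochner_Integration.integral_add) (auto intro: mol_integrable iu ig)
    thus ?thesis unfolding mol_def by (simp add: algebra_simps)
   qed
   ultimately show ?thesis by linarith
  qed
  have "d <= mol0 N cg x" proof (rule tendsto_upperbound)
   define F where "F = (%t. mol0 N cu (x + t *\<^sub>R e))"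
   have "((%t. (F (0 + t) - F 0) / t) \<longlongrightarrow> d) (at 0)"
    using der unfolding F_def[symmetric] by (rule iffD1[OF DERIV_def])
   hence "((%t. (F (0 + t) - F 0) / t) \<longlongrightarrow> d) (at_right 0)" by (rule tendsto_within_subset) simp
   moreover have "F 0 = mol0 N cu x" by (simp add: F_def)
   ultimately show "((%t. (mol0 N cu (x + t *\<^sub>R e) - mol0 N cu x) / t) \<longlongrightarrow> d) (at_right 0)"
    by (simp only: add_0 F_def)
   have "0 < \<delta> / B" using K(1) B(1) by simp
   hence "\<forall>\<^sub>F t in at_right 0. 0 < t \<and> t < \<delta> / B"
    by (auto simp: eventually_at_right_field intro!: exI[of _ "\<delta> / B"])
   thus "\<forall>\<^sub>F t in at_right 0. (mol0 N cu (x + t *\<^sub>R e) - mol0 N cu x) / t <= mol0 N cg x"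
   proof eventually_elim
    case (elim t)
    thus ?case using step[of t] by (simp add: pos_divide_le_eq mult.commute)
   qed
  qed simp
  moreover have "(LBINT z. (g z - (\<Sum>i\<in>UNIV. e $ i * D i z)) * ker0 N (x - z)) = mol0 N cg x - d"
  proof -
   have iS: "integrable lborel (%z. \<Sum>i\<in>UNIV. e $ i * cD i z)"
    by (intro Bochner_Integration.integrable_sum integrable_mult_right iD)
   have "(LBINT z. (g z - (\<Sum>i\<in>UNIV. e $ i * D i z)) * ker0 N (x - z))
    = (LBINT z. cg z * ker0 N (x - z) - (\<Sum>i\<in>UNIV. e $ i * cD i z) * ker0 N (x - z))"
   proof (rule Bochner_Integration.integral_cong[OF refl])
    fix z
    show "(g z - (\<Sum>i\<in>UNIV. e $ i * D i z)) * ker0 N (x - z) = cg z * ker0 N (x - z) - (\<Sum>i\<in>UNIV. e $ i * cD i z) * ker0 N (x - z)"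
    proof (cases "z \<in> qcube x (1 / N)")
     case True
     thus ?thesis using qK by (auto simp: cg_def cD_def left_diff_distrib)
    next
     case False
     thus ?thesis using ker_eq_0_qcube[OF N, of z x] by simp
    qed
   qed
   also have "... = mol0 N cg x - mol0 N (%z. \<Sum>i\<in>UNIV. e $ i * cD i z) x"
    unfolding mol_def by (rule Bochner_Integration.integral_diff[OF mol_integrable[OF ig] mol_integrable[OF iS]])
   also have "mol0 N (%z. \<Sum>i\<in>UNIV. e $ i * cD i z) x = d" unfolding d_def by (rule mol_sum[OF iD, symmetric])
   finally show ?thesis .
  qed
  ultimately show "0 <= (LBINT z. (g z - (\<Sum>i\<in>UNIV. e $ i * D i z)) * ker0 N (x - z))" by simp
 qed
 thus ?thesis by eventually_elim auto
qed

lemma powr_tangent: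
 fixes x y \<beta> :: real
 assumes "1 <= \<beta>" "0 < x" "0 < y"
 shows "x powr \<beta> + \<beta> * x powr (\<beta> - 1) * (y - x) <= y powr \<beta>" proof -
 define f where "f = (%s. s powr \<beta> - \<beta> * x powr (\<beta> - 1) * s)"
 have d: "DERIV f s :> \<beta> * s powr (\<beta> - 1) - \<beta> * x powr (\<beta> - 1) * 1" if "0 < s" for s
  unfolding f_def by (intro DERIV_diff DERIV_cmult DERIV_ident has_real_derivative_powr that)
 have "f x <= f y" proof (cases "x <= y")
  case True
  thus ?thesis proof (rule DERIV_nonneg_imp_nondecreasing)
   fix s assume s: "x <= s" "s <= y"
   hence "x powr (\<beta> - 1) <= s powr (\<beta> - 1)" using assms by (intro powr_mono2) auto
   hence "\<beta> * x powr (\<beta> - 1) <= \<beta> * s powr (\<beta> - 1)" using assms by (intro mult_left_mono) auto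
   thus "\<exists>d. DERIV f s :> d \<and> 0 <= d" using d[of s] s assms by (intro exI[of _ "\<beta> * s powr (\<beta> - 1) - \<beta> * x powr (\<beta> - 1) * 1"]) auto
  qed
 next
  case False
  hence "y <= x" by simp
  thus ?thesis proof (rule DERIV_nonpos_imp_nonincreasing)
   fix s assume s: "y <= s" "s <= x"
   hence "s powr (\<beta> - 1) <= x powr (\<beta> - 1)" using assms by (intro powr_mono2) auto
   hence "\<beta> * s powr (\<beta> - 1) <= \<beta> * x powr (\<beta> - 1)" using assms by (intro mult_left_mono) auto
   thus "\<exists>d. DERIV f s :> d \<and> d <= 0" using d[of s] s assms by (intro exI[of _ "\<beta> * s powr (\<beta> - 1) - \<beta> * x powr (\<beta> - 1) * 1"]) auto
  qed
 qed
 thus ?thesis by (simp add: f_def algebra_simps)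
qed

text \<open>The hypotheses in working form: \<open>D\<close> and \<open>H\<close> are Borel
  representatives of the weak derivatives, \<sigma> is the sign of the determinant, and
  \<open>u_small\<close> expresses the zero boundary values through points outside \<Omega>. Bounds
  are assumed on an annulus only, since homogeneity spreads them.\<close>

locale cone_solution =
 fixes \<Omega> :: "(real ^ 'n::finite) set" and u :: "real ^ 'n => real" and D :: "'n => real ^ 'n => real"
  and H :: "'n => 'n => real ^ 'n => real" and \<alpha> \<beta> L M \<sigma> :: real and pe :: nat
 assumes open_dom: "open \<Omega>" and cone: "!!x t. x \<in> \<Omega> ==> 0 < t ==> t *\<^sub>R x \<in> \<Omega>" and zero: "0 \<notin> \<Omega>" and nonempty: "\<Omega> ~= {}"
  and alpha: "0 < \<alpha>" "\<alpha> < 1" and beta: "\<beta> = 1 / \<alpha>"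
  and u_int: "loc_int \<Omega> u" and u_cont: "continuous_on \<Omega> u" and u_pos: "!!x. x \<in> \<Omega> ==> 0 < u x"
  and u_hom: "!!x t. x \<in> \<Omega> ==> 0 < t ==> u (t *\<^sub>R x) = t powr \<alpha> * u x"
  and u_bound: "!!x. x \<in> \<Omega> ==> 1 < norm x ==> norm x < 2 ==> u x <= M"
  and u_small: "!!z eps. z \<notin> \<Omega> ==> 0 < eps ==> \<exists>s>0. \<forall>x\<in>\<Omega>. dist x z < s --> u x < eps"
  and D_int: "!!i. loc_int \<Omega> (D i)" and H_int: "!!i j. loc_int \<Omega> (H i j)"
  and pe: "pe = max 1 ((CARD('n) - 2) * (CARD('n) - 2 + 1))"
  and Hp: "!!i j. loc_int \<Omega> (%x. \<bar>H i j x\<bar> ^ pe)"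
  and wu: "!!i. wder \<Omega> i u (D i)" and wD: "!!i j. wder \<Omega> j (D i) (H i j)"
  and D_bound: "!!i. AE x in lborel. x \<in> \<Omega> \<and> 1 < norm x \<and> norm x < 2 --> \<bar>D i x\<bar> <= L"
  and sigma: "\<bar>\<sigma>\<bar> = 1" and det: "!!K. compact K ==> K \<subseteq> \<Omega> ==> \<exists>c>0. AE x\<in>K in lborel. c <= \<sigma> * det (\<chi> i j. H i j x)"
begin

lemma beta_gt_1: "1 < \<beta>" using alpha by (simp add: beta)

lemma alpha_beta: "\<alpha> * \<beta> = 1" "\<beta> * \<alpha> = 1" using alpha by (simp_all add: beta)

definition w :: "real ^ 'n => real" where "w x = (if x \<in> \<Omega> then u x powr \<beta> else 0)"

text \<open>The derivative of \<open>w\<close> in direction \<open>e\<close>, by the chain rule from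
  the weak gradient of \<open>u\<close>.\<close>

definition G :: "real ^ 'n => real ^ 'n => real" where
 "G e x = \<beta> * u x powr (\<beta> - 1) * (\<Sum>i\<in>UNIV. e $ i * D i x)"

lemma w_nonneg: "0 <= w x" by (simp add: w_def)

lemma w_pos: "x \<in> \<Omega> ==> 0 < w x" using u_pos[of x] by (simp add: w_def)

lemma cone_iff: "0 < t ==> t *\<^sub>R x \<in> \<Omega> \<longleftrightarrow> x \<in> \<Omega>"
 using cone[of x t] cone[of "t *\<^sub>R x" "1 / t"] by auto

lemma w_scale: "0 < t ==> w (t *\<^sub>R x) = t * w x"
 using u_hom[of x t] u_pos[of x] alpha_beta by (simp add: w_def cone_iff powr_mult powr_powr)

lemma powr_inverse: "0 < y ==> y powr (\<beta> - 1) * y powr (1 - \<beta>) = 1" by (simp add: powr_add[symmetric])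

lemma G_iff: "x \<in> \<Omega> ==> G e x <= h \<longleftrightarrow> (\<Sum>i\<in>UNIV. e $ i * D i x) <= h * (\<alpha> * u x powr (1 - \<beta>))"
proof -
 assume x: "x \<in> \<Omega>"
 let ?S = "\<Sum>i\<in>UNIV. e $ i * D i x" and ?c = "\<beta> * u x powr (\<beta> - 1)" and ?c' = "\<alpha> * u x powr (1 - \<beta>)"
 have c: "0 < ?c" using beta_gt_1 u_pos[OF x] by simp
 have "?c * ?c' = (\<beta> * \<alpha>) * (u x powr (\<beta> - 1) * u x powr (1 - \<beta>))" by simp
 hence cc: "?c * ?c' = 1" unfolding alpha_beta powr_inverse[OF u_pos[OF x]] by simp
 have "G e x <= h \<longleftrightarrow> ?c * ?S <= ?c * (h * ?c')"
  unfolding G_def by (simp only: mult.left_commute[of ?c h] cc mult_1_right)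
 also have "... \<longleftrightarrow> ?S <= h * ?c'" using c by (simp only: mult_le_cancel_left_pos)
 finally show ?thesis .
qed

text \<open>The power \<beta> is convex, so an increment of \<open>w\<close> dominates its
  linearisation in \<open>u\<close>; this carries the bound over to increments of
  \<open>u\<close>.\<close>

lemma increment_AE:
 assumes "!!x t. 0 < t ==> w (x + t *\<^sub>R e) <= w x + t * h"
 shows "AE x\<in>\<Omega> in lborel. G e x <= h" proof -
 have "AE x\<in>\<Omega> in lborel. (\<Sum>i\<in>UNIV. e $ i * D i x) <= h * (\<alpha> * u x powr (1 - \<beta>))"
 proof (rule directional_bound_AE[OF open_dom u_int D_int wu])
  have [measurable]: "u \<in> Borel" using u_int by (simp add: loc_int_def)
  show "loc_int \<Omega> (%x. h * (\<alpha> * u x powr (1 - \<beta>)))" unfolding loc_int_def proof (intro conjI allI impI)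
   show "(%x. h * (\<alpha> * u x powr (1 - \<beta>))) \<in> Borel" by measurable
   fix K assume K: "compact K \<and> K \<subseteq> \<Omega>"
   have "continuous_on K (%x. h * (\<alpha> * u x powr (1 - \<beta>)))"
    using K u_pos by (intro continuous_intros continuous_on_subset[OF u_cont]) force+
   thus "integrable lborel (%x. indicator K x * (h * (\<alpha> * u x powr (1 - \<beta>))))"
    using borel_integrable_compact[of K "%x. h * (\<alpha> * u x powr (1 - \<beta>))"] K by simp
  qed
  fix x t assume x: "x \<in> \<Omega>" "0 < t" "x + t *\<^sub>R e \<in> \<Omega>"
  let ?y = "x + t *\<^sub>R e"
  have "u x powr \<beta> + \<beta> * u x powr (\<beta> - 1) * (u ?y - u x) <= u ?y powr \<beta>"
   by (rule powr_tangent) (use beta_gt_1 u_pos x in auto)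
  also have "... <= u x powr \<beta> + t * h" using assms[OF x(2), of x] x by (simp add: w_def)
  finally have "\<beta> * u x powr (\<beta> - 1) * (u ?y - u x) <= t * h" by simp
  hence "(\<alpha> * u x powr (1 - \<beta>)) * (\<beta> * u x powr (\<beta> - 1) * (u ?y - u x)) <= (\<alpha> * u x powr (1 - \<beta>)) * (t * h)"
   by (rule mult_left_mono) (use alpha in simp)
  moreover have "(\<alpha> * u x powr (1 - \<beta>)) * (\<beta> * u x powr (\<beta> - 1) * (u ?y - u x)) = (\<beta> * \<alpha>) * (u x powr (\<beta> - 1) * u x powr (1 - \<beta>)) * (u ?y - u x)"
   by (simp only: mult_ac)
  ultimately have "u ?y - u x <= (\<alpha> * u x powr (1 - \<beta>)) * (t * h)"
   unfolding alpha_beta powr_inverse[OF u_pos[OF x(1)]] by simp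
  also have "... = t * (h * (\<alpha> * u x powr (1 - \<beta>)))" by (simp only: mult_ac)
  finally show "u ?y <= u x + t * (h * (\<alpha> * u x powr (1 - \<beta>)))" by simp
 qed
 thus ?thesis by eventually_elim (simp add: G_iff)
qed

text \<open>On a cube where \<open>u\<close> stays within a factor \<kappa> of its central value,
  linearising the power at varying points costs at most the factor \<kappa>^(2 (\<beta> -
  1)).\<close>

lemma local_increment:
 assumes x1: "x1 \<in> \<Omega>" and s: "0 < s" and ae: "AE x in lborel. x \<in> qcube x1 s \<and> x \<in> \<Omega> --> G e x <= h" and h: "0 <= h" and eta: "0 < \<eta>"
 shows "\<exists>r>0. \<forall>y t. y \<in> qcube x1 r --> y + t *\<^sub>R e \<in> qcube x1 r --> 0 <= t --> w (y + t *\<^sub>R e) - w y <= (h + \<eta>) * t"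
proof -
 define \<eta>' where "\<eta>' = \<eta> / (h + 1)"
 have eta': "0 < \<eta>'" "h * (1 + \<eta>') <= h + \<eta>" using h eta by (auto simp: \<eta>'_def field_simps)
 \<comment> \<open>Chosen so that the total loss \<kappa>^(2 (\<beta> - 1)) is 1 + \<eta>'.\<close>
 define \<kappa> where "\<kappa> = (1 + \<eta>') powr (1 / (2 * (\<beta> - 1)))"
 have k: "1 < \<kappa>" unfolding \<kappa>_def using eta' beta_gt_1 by (intro gr_one_powr) auto
 have kk: "\<kappa> powr (\<beta> - 1) * \<kappa> powr (\<beta> - 1) = 1 + \<eta>'" proof -
  have "1 / (2 * (\<beta> - 1)) * (\<beta> - 1) = 1 / 2" using beta_gt_1 by simp
  thus ?thesis unfolding \<kappa>_def powr_powr using eta' by (simp add: powr_add[symmetric])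
 qed
 define U1 where "U1 = u x1"
 have U1: "0 < U1" using u_pos[OF x1] by (simp add: U1_def)
 have "U1 < \<kappa> * U1" "U1 / \<kappa> < U1" using k U1 by (auto simp: field_simps)
 moreover have "open (\<Omega> \<inter> u -` {U1 / \<kappa> <..< \<kappa> * U1})" by (rule continuous_open_preimage[OF u_cont open_dom]) simp
 ultimately obtain r0 where r0: "r0 > 0" "qcube x1 r0 \<subseteq> \<Omega> \<inter> u -` {U1 / \<kappa> <..< \<kappa> * U1}"
  using exists_qcube[of "\<Omega> \<inter> u -` {U1 / \<kappa> <..< \<kappa> * U1}" x1] x1 by (auto simp: U1_def)
 define r where "r = min r0 s / 2"
 have r: "0 < r" "2 * r <= r0" "2 * r <= s" "r <= r0" using r0 s by (auto simp: r_def)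
 have sub: "qcube x1 (2 * r) \<subseteq> \<Omega> \<inter> u -` {U1 / \<kappa> <..< \<kappa> * U1}" "qcube x1 (2 * r) \<subseteq> qcube x1 s"
  by (rule order_trans[OF qcube_mono[OF r(2)] r0(2)], rule qcube_mono[OF r(3)])
 have sub1: "qcube x1 r \<subseteq> qcube x1 (2 * r)" using r by (intro qcube_mono) simp
 define A where "A = h * (\<alpha> * (U1 / \<kappa>) powr (1 - \<beta>))"
 have A0: "0 <= A" using h alpha by (simp add: A_def)
 have aeA: "AE x\<in>qcube x1 (2 * r) in lborel. (\<Sum>i\<in>UNIV. e $ i * D i x) <= A" using ae proof eventually_elim
  case (elim x)
  show ?case
  proof
   assume x: "x \<in> qcube x1 (2 * r)"
   hence xO: "x \<in> \<Omega>" "U1 / \<kappa> < u x" using sub by auto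
   have "(\<Sum>i\<in>UNIV. e $ i * D i x) <= h * (\<alpha> * u x powr (1 - \<beta>))" using elim x sub(2) xO G_iff[OF xO(1)] by blast
   also have "... <= A" unfolding A_def using h alpha xO U1 k beta_gt_1 by (intro mult_left_mono powr_mono2') auto
   finally show "(\<Sum>i\<in>UNIV. e $ i * D i x) <= A" .
  qed
 qed
 show ?thesis proof (intro exI[of _ r] conjI allI impI r(1))
  fix y t assume y: "y \<in> qcube x1 r" "y + t *\<^sub>R e \<in> qcube x1 r" and t: "0 <= t"
  let ?y = "y + t *\<^sub>R e"
  have yO: "y \<in> \<Omega>" "?y \<in> \<Omega>" "u ?y < \<kappa> * U1" using y sub1 sub(1) by auto
  have inc: "u ?y - u y <= A * t" by (rule local_monotone[OF open_dom u_int u_cont D_int wu aeA r(1) _ y t]) (use sub(1) in blast)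
  have "u ?y powr \<beta> + \<beta> * u ?y powr (\<beta> - 1) * (u y - u ?y) <= u y powr \<beta>"
   by (rule powr_tangent) (use beta_gt_1 u_pos yO in auto)
  hence "w ?y - w y <= \<beta> * u ?y powr (\<beta> - 1) * (u ?y - u y)" using yO by (simp add: w_def algebra_simps)
  also have "... <= \<beta> * u ?y powr (\<beta> - 1) * (A * t)" by (rule mult_left_mono[OF inc]) (use beta_gt_1 in simp)
  also have "... <= \<beta> * (\<kappa> * U1) powr (\<beta> - 1) * (A * t)"
   using A0 t beta_gt_1 yO u_pos[OF yO(2)] by (intro mult_right_mono mult_left_mono powr_mono2) auto
  also have "... = (\<beta> * \<alpha>) * (h * t) * ((\<kappa> * U1) powr (\<beta> - 1) * (U1 / \<kappa>) powr (1 - \<beta>))" by (simp add: A_def mult_ac)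
  also have "(\<kappa> * U1) powr (\<beta> - 1) * (U1 / \<kappa>) powr (1 - \<beta>) = 1 + \<eta>'" proof -
   have "(U1 / \<kappa>) powr (1 - \<beta>) = U1 powr (1 - \<beta>) * \<kappa> powr (\<beta> - 1)"
    using U1 k by (simp add: powr_divide powr_diff powr_minus_divide field_simps)
   hence "(\<kappa> * U1) powr (\<beta> - 1) * (U1 / \<kappa>) powr (1 - \<beta>) = (\<kappa> powr (\<beta> - 1) * \<kappa> powr (\<beta> - 1)) * (U1 powr (\<beta> - 1) * U1 powr (1 - \<beta>))"
    using U1 k by (simp add: powr_mult)
   thus ?thesis unfolding kk powr_inverse[OF U1] by simp
  qed
  also have "(\<beta> * \<alpha>) * (h * t) * (1 + \<eta>') = (h * (1 + \<eta>')) * t" unfolding alpha_beta by simp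
  also have "... <= (h + \<eta>) * t" by (rule mult_right_mono[OF eta'(2) t])
  finally show "w ?y - w y <= (h + \<eta>) * t" .
 qed
qed

text \<open>Homogeneity spreads the bound from the annulus to all of \<Omega>, and it is integrated
  along the segment from x to x + e. If the segment meets the complement, only the part after the
  last such point counts, and \<open>w\<close> is arbitrarily small at its beginning.\<close>

lemma increment:
 assumes ae: "AE x in lborel. x \<in> \<Omega> \<and> 7/5 < norm x \<and> norm x < 8/5 --> G e x <= h" and h: "0 <= h"
 shows "w (x + e) <= w x + h" proof -
 have loc: "\<exists>r>0. \<forall>y t. y \<in> qcube x1 r --> y + t *\<^sub>R e \<in> qcube x1 r --> 0 <= t --> w (y + t *\<^sub>R e) - w y <= (h + \<eta>) * t"
  if x1: "x1 \<in> \<Omega>" and eta: "0 < \<eta>" for x1 \<eta> proof -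
  have n0: "0 < norm x1" using x1 zero by auto
  \<comment> \<open>Dilation to the norm 3/2, the middle of the annulus.\<close>
  define l where "l = (3 / 2) / norm x1"
  have l: "0 < l" using n0 by (simp add: l_def)
  have lx: "l *\<^sub>R x1 \<in> \<Omega>" "norm (l *\<^sub>R x1) = 3 / 2" using cone[OF x1 l] n0 by (auto simp: l_def)
  have "open {x :: real ^ 'n. 7/5 < norm x \<and> norm x < 8/5}" by (intro open_Collect_conj open_Collect_less continuous_intros)
  then obtain s where s: "0 < s" "qcube (l *\<^sub>R x1) s \<subseteq> {x. 7/5 < norm x \<and> norm x < 8/5}"
   using exists_qcube[of "{x :: real ^ 'n. 7/5 < norm x \<and> norm x < 8/5}" "l *\<^sub>R x1"] lx by auto
  have ae2: "AE x in lborel. x \<in> qcube (l *\<^sub>R x1) s \<and> x \<in> \<Omega> --> G e x <= h"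
   using ae by eventually_elim (use s in blast)
  obtain r where r: "0 < r" "!!y t. y \<in> qcube (l *\<^sub>R x1) r ==> y + t *\<^sub>R e \<in> qcube (l *\<^sub>R x1) r ==> 0 <= t ==> w (y + t *\<^sub>R e) - w y <= (h + \<eta>) * t"
   using local_increment[OF lx(1) s(1) ae2 h eta] by blast
  have scl: "l *\<^sub>R y \<in> qcube (l *\<^sub>R x1) r" if "y \<in> qcube x1 (r / l)" for y unfolding qcube_def
  proof (rule CollectI, rule allI)
   fix i
   have "\<bar>y $ i - x1 $ i\<bar> <= r / l" using that by (simp add: qcube_def)
   hence "l * \<bar>y $ i - x1 $ i\<bar> <= r" using l by (simp add: field_simps)
   moreover have "(l *\<^sub>R y) $ i - (l *\<^sub>R x1) $ i = l * (y $ i - x1 $ i)" by (simp add: right_diff_distrib)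
   ultimately show "\<bar>(l *\<^sub>R y) $ i - (l *\<^sub>R x1) $ i\<bar> <= r" using l by (simp add: abs_mult)
  qed
  show ?thesis proof (intro exI[of _ "r / l"] conjI allI impI)
   show "0 < r / l" using r l by simp
   fix y t assume y: "y \<in> qcube x1 (r / l)" "y + t *\<^sub>R e \<in> qcube x1 (r / l)" and t: "0 <= t"
   have e1: "l *\<^sub>R (y + t *\<^sub>R e) = l *\<^sub>R y + (l * t) *\<^sub>R e" by (simp add: scaleR_add_right)
   have "w (l *\<^sub>R y + (l * t) *\<^sub>R e) - w (l *\<^sub>R y) <= (h + \<eta>) * (l * t)"
    by (rule r(2)) (use scl[OF y(1)] scl[OF y(2)] e1 l t in auto)
   hence "l * (w (y + t *\<^sub>R e) - w y) <= l * ((h + \<eta>) * t)"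
    unfolding e1[symmetric] w_scale[OF l] by (simp add: algebra_simps)
   thus "w (y + t *\<^sub>R e) - w y <= (h + \<eta>) * t" using l by (simp only: mult_le_cancel_left_pos)
  qed
 qed
 have seg: "w (x + e) - w (x + a *\<^sub>R e) <= (h + \<eta>) * (1 - a)"
  if a: "a <= 1" and inO: "!!t. a <= t ==> t <= 1 ==> x + t *\<^sub>R e \<in> \<Omega>" and eta: "0 < \<eta>" for a \<eta>
 proof -
  \<comment> \<open>Bolzano's principle chains the local estimates, which are additive over adjacent
    intervals.\<close>
  have "w (x + 1 *\<^sub>R e) - w (x + a *\<^sub>R e) <= (h + \<eta>) * (1 - a)" using a proof (induction rule: Bolzano)
   case (trans p q r)
   have "(h + \<eta>) * (r - p) = (h + \<eta>) * (q - p) + (h + \<eta>) * (r - q)" by (simp add: algebra_simps)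
   thus ?case using trans by linarith
  next
   case (local t)
   obtain r where r: "0 < r" "!!y s. y \<in> qcube (x + t *\<^sub>R e) r ==> y + s *\<^sub>R e \<in> qcube (x + t *\<^sub>R e) r ==> 0 <= s ==> w (y + s *\<^sub>R e) - w y <= (h + \<eta>) * s"
    using loc[OF inO[OF local] eta] by blast
   define B where "B = norm e + 1"
   have B: "0 < B" "!!i. \<bar>e $ i\<bar> <= B" using component_le_norm_cart[of e] by (auto simp: B_def add_nonneg_pos add_increasing2)
   have near: "x + p *\<^sub>R e \<in> qcube (x + t *\<^sub>R e) r" if "\<bar>p - t\<bar> < r / B" for p unfolding qcube_def
   proof (rule CollectI, rule allI)
    fix i
    have "(x + p *\<^sub>R e) $ i - (x + t *\<^sub>R e) $ i = (p - t) * e $ i" by (simp add: left_diff_distrib)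
    hence "\<bar>(x + p *\<^sub>R e) $ i - (x + t *\<^sub>R e) $ i\<bar> = \<bar>p - t\<bar> * \<bar>e $ i\<bar>" by (simp add: abs_mult)
    also have "... <= (r / B) * B" using that B by (intro mult_mono) auto
    also have "... = r" using B by simp
    finally show "\<bar>(x + p *\<^sub>R e) $ i - (x + t *\<^sub>R e) $ i\<bar> <= r" .
   qed
   show ?case proof (intro exI[of _ "r / B"] conjI allI impI)
    show "0 < r / B" using r B by simp
    fix p q assume pq: "p <= t \<and> t <= q \<and> q - p < r / B"
    have eq: "x + p *\<^sub>R e + (q - p) *\<^sub>R e = x + q *\<^sub>R e" by (simp add: algebra_simps)
    have pq1: "x + p *\<^sub>R e \<in> qcube (x + t *\<^sub>R e) r" "x + q *\<^sub>R e \<in> qcube (x + t *\<^sub>R e) r" using pq by (auto intro!: near)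
    show "w (x + q *\<^sub>R e) - w (x + p *\<^sub>R e) <= (h + \<eta>) * (q - p)"
     using r(2)[OF pq1(1), of "q - p", unfolded eq, OF pq1(2)] pq by auto
   qed
  qed
  thus ?thesis by simp
 qed
 show ?thesis proof (rule field_le_epsilon)
  fix eps :: real assume e: "0 < eps"
  define \<eta> where "\<eta> = eps / 2"
  have eta: "0 < \<eta>" using e by (simp add: \<eta>_def)
  define T where "T = {0..1} \<inter> (%t. x + t *\<^sub>R e) -` (- \<Omega>)"
  have cT: "compact T" proof -
   have "closed ((%t. x + t *\<^sub>R e) -` (- \<Omega>))" using open_dom by (intro closed_vimage continuous_intros) auto
   thus ?thesis unfolding T_def by (intro compact_Int_closed) auto
  qed
  show "w (x + e) <= w x + h + eps" proof (cases "x + e \<in> \<Omega>")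
   case False
   thus ?thesis using w_nonneg[of x] h e by (simp add: w_def)
  next
   case xe: True
   show ?thesis proof (cases "T = {}")
    case True
    hence "w (x + e) - w (x + 0 *\<^sub>R e) <= (h + \<eta>) * (1 - 0)" by (intro seg eta) (auto simp: T_def)
    thus ?thesis using e by (simp add: \<eta>_def)
   next
    case False
    then obtain t0 where t0: "t0 \<in> T" "!!t. t \<in> T ==> t <= t0" using compact_attains_sup[OF cT] by blast
    have t01: "0 <= t0" "t0 < 1" "x + t0 *\<^sub>R e \<notin> \<Omega>" using t0(1) xe by (auto simp: T_def less_le)
    \<comment> \<open>\<open>u\<close> below this value means that \<open>w\<close> is below
      \<eta>.\<close>
    define eps' where "eps' = \<eta> powr (1 / \<beta>)"
    have e': "0 < eps'" using eta by (simp add: eps'_def)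
    obtain s where s: "0 < s" "!!y. y \<in> \<Omega> ==> dist y (x + t0 *\<^sub>R e) < s ==> u y < eps'" using u_small[OF t01(3) e'] by blast
    have n1: "0 < norm e + 1" by (simp add: add_nonneg_pos)
    define S where "S = s / (2 * (norm e + 1))"
    have S0: "0 < S" using s(1) n1 by (simp add: S_def)
    define a where "a = t0 + min ((1 - t0) / 2) S"
    have a: "t0 < a" "a < 1" "a - t0 <= S" using S0 t01 by (auto simp: a_def min_def field_simps)
    have inO: "x + t *\<^sub>R e \<in> \<Omega>" if "a <= t" "t <= 1" for t proof (rule ccontr)
     assume "x + t *\<^sub>R e \<notin> \<Omega>"
     hence "t \<in> T" using that a t01 by (auto simp: T_def)
     thus False using t0(2) that a by fastforce
    qed
    have "dist (x + a *\<^sub>R e) (x + t0 *\<^sub>R e) = (a - t0) * norm e"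
     using a by (simp add: dist_norm scaleR_diff_left[symmetric])
    also have "... <= S * norm e" by (rule mult_right_mono[OF a(3)]) simp
    also have "... < s" proof -
     have "norm e < 2 * (norm e + 1)" using norm_ge_zero[of e] unfolding distrib_left by linarith
     hence "s * norm e < s * (2 * (norm e + 1))" using s(1) by (rule mult_strict_left_mono)
     thus ?thesis using n1 unfolding S_def by (simp add: divide_less_eq)
    qed
    finally have "u (x + a *\<^sub>R e) < eps'" using inO[of a] a s(2) by simp
    hence "w (x + a *\<^sub>R e) <= eps' powr \<beta>"
     using inO[of a] a u_pos[of "x + a *\<^sub>R e"] beta_gt_1 by (simp add: w_def powr_mono2)
    also have "... = \<eta>" using beta_gt_1 eta by (simp add: eps'_def powr_powr)
    finally have wa: "w (x + a *\<^sub>R e) <= \<eta>" .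
    have "w (x + e) - w (x + a *\<^sub>R e) <= (h + \<eta>) * (1 - a)" by (rule seg[OF _ inO eta]) (use a in auto)
    also have "... <= (h + \<eta>) * 1" using a t01 h eta by (intro mult_left_mono) auto
    finally show ?thesis using wa w_nonneg[of x] by (simp add: \<eta>_def)
   qed
  qed
 qed
qed

end

lemma half_cancel: "b ~= 0 ==> c ~= 0 ==> b * (h / (2 * b * c)) * c = h / 2" for b c h :: real
 by simp

section \<open>Strict improvement near every point of an annulus, and subadditivity\<close>

context cone_solution
begin

lemma annulus_open: "open {x :: real ^ 'n. a < norm x \<and> norm x < b}" by (intro open_Collect_conj open_Collect_less continuous_intros)

lemma sum_D_bound:
 assumes "!!i. \<bar>D i x\<bar> <= \<bar>L\<bar>"
 shows "\<bar>\<Sum>i\<in>UNIV. v $ i * D i x\<bar> <= (\<Sum>i\<in>UNIV. \<bar>v $ i\<bar>) * \<bar>L\<bar>" proof -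
 have "\<bar>\<Sum>i\<in>UNIV. v $ i * D i x\<bar> <= (\<Sum>i\<in>UNIV. \<bar>v $ i\<bar> * \<bar>L\<bar>)"
  using assms by (intro order_trans[OF sum_abs] sum_mono) (subst abs_mult, intro mult_left_mono, auto)
 thus ?thesis by (simp add: sum_distrib_right)
qed

lemma D_all: "AE x in lborel. x \<in> \<Omega> \<and> 1 < norm x \<and> norm x < 2 --> (\<forall>i. \<bar>D i x\<bar> <= \<bar>L\<bar>)"
proof -
 have "AE x in lborel. \<forall>i. x \<in> \<Omega> \<and> 1 < norm x \<and> norm x < 2 --> \<bar>D i x\<bar> <= L"
  unfolding AE_all_countable using D_bound by blast
 thus ?thesis proof eventually_elim
  case (elim x)
  thus ?case by (metis abs_ge_self order_trans)
 qed
qed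

lemma near_annulus:
 assumes z: "7/5 <= norm z" "norm z <= 8/5"
 shows "\<exists>s>0. \<forall>x. dist x z < s --> 1 < norm x \<and> norm x < 2"
proof (intro exI[of _ "1/5"] conjI allI impI)
 fix x assume "dist x z < 1/5"
 hence "norm (x - z) < 1/5" by (simp add: dist_norm)
 thus "1 < norm x" "norm x < 2" using z norm_triangle_ineq2[of x z] norm_triangle_ineq2[of z x] by (auto simp: norm_minus_commute)
qed simp

lemma qcube_near: "0 < s ==> \<exists>r>0. \<forall>x\<in>qcube z r. dist x z < (s :: real)" for z :: "real ^ 'n"
 using exists_qcube[of "ball z s" z] by (auto simp: subset_iff dist_commute)

text \<open>Only points of \<Omega> not parallel to e need the strong maximum principle. At points
  outside \<Omega> the factor u^(\<beta>-1) makes \<open>G\<close> small, and at parallel points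
  Euler's identity gives the sign.\<close>

lemma local_strict:
 assumes e: "e \<notin> \<Omega>" and h: "0 < h" and ae: "AE x\<in>\<Omega> in lborel. G e x <= h" and z: "7/5 <= norm z" "norm z <= 8/5"
 shows "\<exists>\<delta>>0. \<exists>s>0. AE x\<in>qcube z s in lborel. x \<in> \<Omega> --> G e x <= h - \<delta>"
proof -
 obtain s0 where s0: "0 < s0" "!!x. dist x z < s0 ==> 1 < norm x \<and> norm x < 2" using near_annulus[OF z] by blast
 define E where "E = (\<Sum>i\<in>UNIV. \<bar>e $ i\<bar>) * \<bar>L\<bar>"
 have E0: "0 <= E" by (auto simp: E_def intro!: mult_nonneg_nonneg sum_nonneg)
 have b0: "0 < \<beta>" "0 < \<beta> - 1" using beta_gt_1 by auto
 show ?thesis proof (cases "z \<in> \<Omega>")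
  case zO: False
  \<comment> \<open>Makes \<beta> eps^(\<beta>-1) (E + 1) equal to h/2, where E bounds the modulus
    of e . grad u on the annulus.\<close>
  define eps where "eps = (h / (2 * \<beta> * (E + 1))) powr (1 / (\<beta> - 1))"
  have q: "0 < h / (2 * \<beta> * (E + 1))" using h b0 E0 by simp
  have eps: "0 < eps" unfolding eps_def powr_gt_zero using q by (rule less_imp_neq[symmetric])
  have epsb: "eps powr (\<beta> - 1) = h / (2 * \<beta> * (E + 1))" proof -
   have "1 / (\<beta> - 1) * (\<beta> - 1) = 1" using b0 by simp
   thus ?thesis unfolding eps_def powr_powr by (simp only: powr_one[OF less_imp_le[OF q]])
  qed
  obtain s1 where s1: "0 < s1" "!!x. x \<in> \<Omega> ==> dist x z < s1 ==> u x < eps" using u_small[OF zO eps] by blast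
  obtain r where r: "0 < r" "!!x. x \<in> qcube z r ==> dist x z < min s0 s1" using qcube_near[of "min s0 s1" z] s0 s1 by auto
  have "AE x\<in>qcube z r in lborel. x \<in> \<Omega> --> G e x <= h - h / 2" using D_all proof eventually_elim
   case (elim x)
   show ?case proof (intro impI)
    assume x: "x \<in> qcube z r" "x \<in> \<Omega>"
    have nx: "1 < norm x \<and> norm x < 2" using s0(2)[of x] r(2)[OF x(1)] by auto
    have ux: "0 < u x" "u x < eps" using u_pos[OF x(2)] s1(2)[OF x(2)] r(2)[OF x(1)] by auto
    have "\<bar>\<Sum>i\<in>UNIV. e $ i * D i x\<bar> <= E" unfolding E_def by (rule sum_D_bound) (use elim x nx in blast)
    hence S: "(\<Sum>i\<in>UNIV. e $ i * D i x) <= E + 1" by linarith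
    have "G e x <= \<beta> * u x powr (\<beta> - 1) * (E + 1)" unfolding G_def by (rule mult_left_mono[OF S]) (use b0 in simp)
    also have "... <= \<beta> * eps powr (\<beta> - 1) * (E + 1)" using ux b0 E0 by (intro mult_right_mono mult_left_mono powr_mono2) auto
    also have "... = h / 2" unfolding epsb by (rule half_cancel) (use b0 E0 in linarith)+
    finally show "G e x <= h - h / 2" by simp
   qed
  qed
  thus ?thesis using h r(1) half_gt_zero[OF h] by blast
 next
  case zO: True
  have z0: "z ~= 0" using zO zero by auto
  then obtain l where l: "z $ l ~= 0" by (auto simp: vec_eq_iff)
  show ?thesis proof (cases "\<exists>k. e $ k * z $ l ~= e $ l * z $ k")
   case True
   then obtain k where k: "e $ k * z $ l ~= e $ l * z $ k" by blast
   define V where "V = \<Omega> \<inter> {x. 1 < norm x \<and> norm x < 2}"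
   have V: "open V" "z \<in> V" "V \<subseteq> \<Omega>" using annulus_open open_dom zO s0 by (auto simp: V_def)
   have hom: "hom_AE V \<alpha> u" unfolding hom_AE_def using u_hom V(3) by (auto intro!: AE_I2)
   have bD: "AE x\<in>V in lborel. \<bar>D i x\<bar> <= \<bar>L\<bar>" for i using D_all by eventually_elim (auto simp: V_def)
   have Q: "AE x\<in>V in lborel. \<beta> * u x powr (\<beta> - 1) * (\<Sum>i\<in>UNIV. e $ i * D i x) <= h"
    using ae by eventually_elim (auto simp: V_def G_def)
   have uV: "continuous_on V u" "!!x. x \<in> V ==> 0 < u x" using continuous_on_subset[OF u_cont V(3)] u_pos V(3) by auto
   have detV: "\<exists>c>0. AE x\<in>K in lborel. c <= \<sigma> * det (\<chi> i j. H i j x)" if "compact K" "K \<subseteq> V" for K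
    using det[of K] that V(3) by blast
   have "\<exists>\<delta>>0. \<exists>s>0. AE x\<in>qcube z s in lborel. \<beta> * u x powr (\<beta> - 1) * (\<Sum>i\<in>UNIV. e $ i * D i x) <= h - \<delta>"
    by (rule strict_improvement_coords[OF V(1,2) alpha beta loc_int_subset[OF u_int V(3)] uV
     loc_int_subset[OF D_int V(3)] loc_int_subset[OF H_int V(3)] pe loc_int_subset[OF Hp V(3)]
     wder_subset[OF wu V(3)] wder_subset[OF wD V(3)] bD hom sigma detV Q k l])
   then obtain \<delta> s where ds: "0 < \<delta>" "0 < s" and "AE x\<in>qcube z s in lborel. \<beta> * u x powr (\<beta> - 1) * (\<Sum>i\<in>UNIV. e $ i * D i x) <= h - \<delta>" by blast
   hence "AE x\<in>qcube z s in lborel. x \<in> \<Omega> --> G e x <= h - \<delta>"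
    by (auto simp: G_def elim: AE_mp)
   thus ?thesis using ds by blast
  next
   case False
   define c where "c = e $ l / z $ l"
   have ec: "e $ i = c * z $ i" for i using False l by (simp add: c_def field_simps)
   have "e = c *\<^sub>R z" using ec by (simp add: vec_eq_iff)
   \<comment> \<open>A positive multiple of z would lie in the cone, but e does not; hence e . grad
     u is nonpositive up to an error proportional to the distance from z.\<close>
   hence c0: "c <= 0" using cone[OF zO, of c] e by (meson not_le)
   define W where "W = \<beta> * \<bar>M\<bar> powr (\<beta> - 1) * (\<bar>c\<bar> * \<bar>L\<bar>) * real CARD('n)"
   have W0: "0 <= W" using b0 by (simp add: W_def)
   obtain r0 where r0: "0 < r0" "!!x. x \<in> qcube z r0 ==> dist x z < s0" using qcube_near[OF s0(1), of z] by blast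
   define r where "r = min r0 (h / (2 * (W + 1)))"
   have r: "0 < r" "r <= r0" "r * (W + 1) <= h / 2" proof -
    show "0 < r" "r <= r0" using r0 h W0 by (auto simp: r_def)
    have "r * (W + 1) <= h / (2 * (W + 1)) * (W + 1)" using W0 by (intro mult_right_mono) (auto simp: r_def)
    also have "... = h / 2" proof -
     have "W + 1 ~= 0" using W0 by linarith
     from half_cancel[OF _ this, of 1 h] show ?thesis by (simp only: mult_1 mult_1_right one_neq_zero not_False_eq_True)
    qed
    finally show "r * (W + 1) <= h / 2" .
   qed
   have hom: "hom_AE \<Omega> \<alpha> u" unfolding hom_AE_def using u_hom by (auto intro!: AE_I2)
   have euler: "AE x\<in>\<Omega> in lborel. (\<Sum>j\<in>UNIV. x $ j * D j x) = \<alpha> * u x"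
    by (rule euler_weak[OF open_dom u_int D_int wu hom])
   have "AE x\<in>qcube z r in lborel. x \<in> \<Omega> --> G e x <= h - h / 2" using D_all euler proof eventually_elim
    case (elim x)
    show ?case proof (intro impI)
     assume x: "x \<in> qcube z r" "x \<in> \<Omega>"
     hence xr0: "x \<in> qcube z r0" using qcube_mono[OF r(2)] by blast
     have nx: "1 < norm x \<and> norm x < 2" by (rule s0(2)[OF r0(2)[OF xr0]])
     have ux: "0 < u x" "u x <= \<bar>M\<bar>" using u_pos[OF x(2)] u_bound[of x] x(2) nx by auto
     have Db: "\<bar>D i x\<bar> <= \<bar>L\<bar>" for i using elim x nx by blast
     have eul: "(\<Sum>j\<in>UNIV. x $ j * D j x) = \<alpha> * u x" using elim x by blast
     have "(\<Sum>i\<in>UNIV. e $ i * D i x) = c * (\<Sum>j\<in>UNIV. x $ j * D j x) + (\<Sum>i\<in>UNIV. c * (z $ i - x $ i) * D i x)"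
      by (simp add: ec sum_distrib_left sum.distrib[symmetric] algebra_simps)
     also have "... <= 0 + (\<Sum>i\<in>(UNIV :: 'n set). r * (\<bar>c\<bar> * \<bar>L\<bar>))" proof (rule add_mono)
      have "c * (\<alpha> * u x) <= 0" using c0 alpha ux by (simp add: mult_nonpos_nonneg)
      thus "c * (\<Sum>j\<in>UNIV. x $ j * D j x) <= 0" unfolding eul .
      show "(\<Sum>i\<in>UNIV. c * (z $ i - x $ i) * D i x) <= (\<Sum>i\<in>(UNIV :: 'n set). r * (\<bar>c\<bar> * \<bar>L\<bar>))"
      proof (rule sum_mono)
       fix i
       have "\<bar>z $ i - x $ i\<bar> <= r" using x(1) by (auto simp: qcube_def abs_minus_commute)
       hence "\<bar>c\<bar> * \<bar>z $ i - x $ i\<bar> * \<bar>D i x\<bar> <= \<bar>c\<bar> * r * \<bar>L\<bar>"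
        using Db[of i] r(1) by (intro mult_mono) auto
       hence "\<bar>c * (z $ i - x $ i) * D i x\<bar> <= r * (\<bar>c\<bar> * \<bar>L\<bar>)" by (simp add: abs_mult mult_ac)
       thus "c * (z $ i - x $ i) * D i x <= r * (\<bar>c\<bar> * \<bar>L\<bar>)" by linarith
      qed
     qed
     finally have S: "(\<Sum>i\<in>UNIV. e $ i * D i x) <= real CARD('n) * (r * (\<bar>c\<bar> * \<bar>L\<bar>))" by simp
     have p0: "0 <= real CARD('n) * (r * (\<bar>c\<bar> * \<bar>L\<bar>))" using r(1) by simp
     have "G e x <= \<beta> * u x powr (\<beta> - 1) * (real CARD('n) * (r * (\<bar>c\<bar> * \<bar>L\<bar>)))" unfolding G_def by (rule mult_left_mono[OF S]) (use b0 in simp)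
     also have "... <= \<beta> * \<bar>M\<bar> powr (\<beta> - 1) * (real CARD('n) * (r * (\<bar>c\<bar> * \<bar>L\<bar>)))"
      using ux b0 by (intro mult_right_mono[OF _ p0] mult_left_mono powr_mono2) auto
     also have "... = r * W" by (simp add: W_def mult_ac)
     also have "... <= r * (W + 1)" using r(1) by simp
     also note r(3)
     finally show "G e x <= h - h / 2" by simp
    qed
   qed
   thus ?thesis using r(1) half_gt_zero[OF h] by blast
  qed
 qed
qed

lemma subadditive:
 assumes e: "e \<notin> \<Omega>"
 shows "w (x + e) <= w x" proof -
 define HH where "HH = {h. 0 <= h \<and> (\<forall>x. w (x + e) <= w x + h)}"
 \<comment> \<open>An a priori constant from the gradient bound; it shows that the set of admissible
   constants is nonempty.\<close>
 define h0 where "h0 = \<beta> * \<bar>M\<bar> powr (\<beta> - 1) * ((\<Sum>i\<in>UNIV. \<bar>e $ i\<bar>) * \<bar>L\<bar>)"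
 have b0: "0 < \<beta>" "0 < \<beta> - 1" using beta_gt_1 by auto
 have s0: "0 <= (\<Sum>i\<in>UNIV. \<bar>e $ i\<bar>) * \<bar>L\<bar>" by (intro mult_nonneg_nonneg sum_nonneg) auto
 have h00: "0 <= h0" unfolding h0_def using b0 s0 by (intro mult_nonneg_nonneg) auto
 have "AE x in lborel. x \<in> \<Omega> \<and> 7/5 < norm x \<and> norm x < 8/5 --> G e x <= h0" using D_all
 proof eventually_elim
  case (elim x)
  show ?case
  proof
   assume x: "x \<in> \<Omega> \<and> 7/5 < norm x \<and> norm x < 8/5"
   hence nx: "1 < norm x \<and> norm x < 2" by auto
   have ux: "0 < u x" "u x <= \<bar>M\<bar>" using u_pos[of x] u_bound[of x] x nx by auto
   have "\<bar>\<Sum>i\<in>UNIV. e $ i * D i x\<bar> <= (\<Sum>i\<in>UNIV. \<bar>e $ i\<bar>) * \<bar>L\<bar>" by (rule sum_D_bound) (use elim x nx in blast)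
   hence "(\<Sum>i\<in>UNIV. e $ i * D i x) <= (\<Sum>i\<in>UNIV. \<bar>e $ i\<bar>) * \<bar>L\<bar>" by linarith
   hence "G e x <= \<beta> * u x powr (\<beta> - 1) * ((\<Sum>i\<in>UNIV. \<bar>e $ i\<bar>) * \<bar>L\<bar>)" unfolding G_def by (rule mult_left_mono) (use b0 in simp)
   also have "... <= h0" unfolding h0_def using ux b0 by (intro mult_right_mono[OF _ s0] mult_left_mono powr_mono2) auto
   finally show "G e x <= h0" .
  qed
 qed
 hence "h0 \<in> HH" using increment[OF _ h00] h00 by (auto simp: HH_def)
 hence ne: "HH ~= {}" by blast
 have bb: "bdd_below HH" by (rule bdd_belowI[of _ 0]) (simp add: HH_def)
 define h where "h = Inf HH"
 have h0': "0 <= h" unfolding h_def by (rule cInf_greatest[OF ne]) (simp add: HH_def)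
 have hin: "w (x + e) <= w x + h" for x proof -
  have "w (x + e) - w x <= h" unfolding h_def proof (rule cInf_greatest[OF ne])
   fix h' assume "h' \<in> HH"
   hence "w (x + e) <= w x + h'" by (simp add: HH_def)
   thus "w (x + e) - w x <= h'" by simp
  qed
  thus ?thesis by simp
 qed
 have "h = 0" proof (rule ccontr)
  assume "h ~= 0"
  hence h: "0 < h" using h0' by simp
  \<comment> \<open>Degree one turns the increment bound for e into one for all positive multiples
    of e, which is what an almost everywhere derivative bound needs.\<close>
  have "w (x + t *\<^sub>R e) <= w x + t * h" if t: "0 < t" for x t proof -
   have "x + t *\<^sub>R e = t *\<^sub>R ((1 / t) *\<^sub>R x + e)" using t by (simp add: scaleR_add_right)
   hence "w (x + t *\<^sub>R e) = t * w ((1 / t) *\<^sub>R x + e)" using w_scale[OF t] by simp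
   also have "... <= t * (w ((1 / t) *\<^sub>R x) + h)" using hin t by (intro mult_left_mono) auto
   also have "... = w x + t * h" using t by (simp add: w_scale algebra_simps)
   finally show ?thesis .
  qed
  hence ae: "AE x\<in>\<Omega> in lborel. G e x <= h" by (rule increment_AE)
  \<comment> \<open>A closed annulus inside 1 < norm < 2, where the gradient bound holds; being
    compact, it needs only finitely many local improvements.\<close>
  define S where "S = {z :: real ^ 'n. 7/5 <= norm z \<and> norm z <= 8/5}"
  have "\<forall>z\<in>S. \<exists>\<delta> s. 0 < \<delta> \<and> 0 < s \<and> (AE x\<in>qcube z s in lborel. x \<in> \<Omega> --> G e x <= h - \<delta>)"
  proof
   fix z assume "z \<in> S"
   hence "7/5 <= norm z" "norm z <= 8/5" by (auto simp: S_def)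
   from local_strict[OF e h ae this] show "\<exists>\<delta> s. 0 < \<delta> \<and> 0 < s \<and> (AE x\<in>qcube z s in lborel. x \<in> \<Omega> --> G e x <= h - \<delta>)"
    by blast
  qed
  then obtain \<delta> s where ds: "!!z. z \<in> S ==> 0 < \<delta> z" "!!z. z \<in> S ==> 0 < s z"
   "!!z. z \<in> S ==> AE x\<in>qcube z (s z) in lborel. x \<in> \<Omega> --> G e x <= h - \<delta> z"
   unfolding bchoice_iff by blast
  have cS: "compact S" proof -
   have "bounded S" by (rule boundedI[of _ "8/5"]) (simp add: S_def)
   moreover have "closed S" unfolding S_def by (intro closed_Collect_conj closed_Collect_le continuous_intros)
   ultimately show ?thesis by (simp add: compact_eq_bounded_closed)
  qed
  have Scov: "S \<subseteq> (\<Union>z\<in>S. icube z (s z))"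
  proof
   fix z assume z: "z \<in> S"
   hence "z \<in> icube z (s z)" using ds(2)[OF z] by (simp add: icube_def)
   thus "z \<in> (\<Union>z\<in>S. icube z (s z))" using z by blast
  qed
  obtain F where F: "F \<subseteq> S" "finite F" "S \<subseteq> (\<Union>z\<in>F. icube z (s z))"
   by (rule compactE_image[OF cS open_icube Scov])
  define d where "d = Min (insert h (\<delta> ` F))"
  have fin: "finite (insert h (\<delta> ` F))" using F by simp
  have d: "0 < d" "d <= h" "!!z. z \<in> F ==> d <= \<delta> z" proof -
   show "0 < d" unfolding d_def using fin h ds(1) F(1) by (subst Min_gr_iff) auto
   show "d <= h" "!!z. z \<in> F ==> d <= \<delta> z" unfolding d_def using fin by (auto intro!: Min_le)
  qed
  have "AE x in lborel. \<forall>z\<in>F. x \<in> qcube z (s z) --> x \<in> \<Omega> --> G e x <= h - \<delta> z"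
   using F ds(3) by (intro AE_finite_allI) auto
  hence "AE x in lborel. x \<in> \<Omega> \<and> 7/5 < norm x \<and> norm x < 8/5 --> G e x <= h - d"
  proof eventually_elim
   case (elim x)
   show ?case
   proof
    assume x: "x \<in> \<Omega> \<and> 7/5 < norm x \<and> norm x < 8/5"
    hence "x \<in> S" by (simp add: S_def)
    then obtain z where z: "z \<in> F" "x \<in> icube z (s z)" using F(3) by blast
    have "x \<in> qcube z (s z)" using z(2) by (auto simp: icube_def qcube_def intro: less_imp_le)
    hence "G e x <= h - \<delta> z" using elim z x by blast
    thus "G e x <= h - d" using d(3)[OF z(1)] by linarith
   qed
  qed
  moreover have "0 <= h - d" using d by simp
  ultimately have "h - d \<in> HH" using increment[of e "h - d"] by (auto simp: HH_def)
  hence "h <= h - d" unfolding h_def by (rule cInf_lower[OF _ bb])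
  thus False using d by simp
 qed
 thus ?thesis using hin[of x] by simp
qed

section \<open>The complement of the cone\<close>

lemma complement_add: "x \<notin> \<Omega> ==> y \<notin> \<Omega> ==> x + y \<notin> \<Omega>"
 using subadditive[of y x] w_pos[of "x + y"] by (auto simp: w_def split: if_splits)

lemma complement_scale: "x \<notin> \<Omega> ==> 0 <= c ==> c *\<^sub>R x \<notin> \<Omega>"
 using cone_iff[of c x] zero by (cases "c = 0") auto

lemma complement_convex_cone: "convex_cone (- \<Omega>)" unfolding convex_cone_def convex_def conic_def
 using zero complement_add complement_scale by blast

text \<open>Subadditivity in the directions v and -v gives v . grad u = 0 almost everywhere; testing
  this against derivatives shows that v also annihilates the rows of the Hessian.\<close>

lemma no_line:
 assumes v: "v ~= 0" "v \<notin> \<Omega>" "- v \<notin> \<Omega>"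
 shows False proof -
 have G0: "AE x\<in>\<Omega> in lborel. G e x <= 0" if "e \<notin> \<Omega>" for e proof (rule increment_AE)
  fix x and t :: real assume "0 < t"
  thus "w (x + t *\<^sub>R e) <= w x + t * 0" using subadditive[of "t *\<^sub>R e" x] that cone_iff by simp
 qed
 have S: "AE x\<in>\<Omega> in lborel. (\<Sum>i\<in>UNIV. v $ i * D i x) = 0" using G0[OF v(2)] G0[OF v(3)] proof eventually_elim
  case (elim x)
  show ?case
  proof
   assume x: "x \<in> \<Omega>"
   have "(\<Sum>i\<in>UNIV. v $ i * D i x) <= 0" "(\<Sum>i\<in>UNIV. (- v) $ i * D i x) <= 0"
    using elim x G_iff[OF x, of v 0] G_iff[OF x, of "- v" 0] by simp_all
   thus "(\<Sum>i\<in>UNIV. v $ i * D i x) = 0" by (simp add: sum_negf)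
  qed
 qed
 have HS: "AE x\<in>\<Omega> in lborel. (\<Sum>i\<in>UNIV. v $ i * H i j x) = 0" for j proof (rule fundamental_lemma_eq[OF open_dom])
  have [measurable]: "!!i j. H i j \<in> Borel" using H_int by (auto simp: loc_int_def)
  show "loc_int \<Omega> (%x. \<Sum>i\<in>UNIV. v $ i * H i j x)" unfolding loc_int_def proof (intro conjI allI impI)
   show "(%x. \<Sum>i\<in>UNIV. v $ i * H i j x) \<in> Borel" by measurable
   fix K assume K: "compact K \<and> K \<subseteq> \<Omega>"
   have "integrable lborel (%x. \<Sum>i\<in>UNIV. v $ i * (indicator K x * H i j x))"
    using H_int K by (intro Bochner_Integration.integrable_sum integrable_mult_right) (auto simp: loc_int_def)
   thus "integrable lborel (%x. indicator K x * (\<Sum>i\<in>UNIV. v $ i * H i j x))"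
    by (simp add: sum_distrib_left mult.left_commute)
  qed
  show "loc_int \<Omega> (%x. 0 :: real)" by (simp add: loc_int_def)
  fix h assume h: "box_test \<Omega> h"
  let ?h' = "h(j := deriv (h j))"
  have iD: "integrable lborel (%x. D i x * ptest ?h' x)" for i by (rule loc_int_test[OF D_int]) (rule box_test_deriv[OF h])
  have iH: "integrable lborel (%x. H i j x * ptest h x)" for i by (rule loc_int_test[OF H_int h])
  have "(LBINT x. (\<Sum>i\<in>UNIV. v $ i * H i j x) * ptest h x) = (LBINT x. (\<Sum>i\<in>UNIV. v $ i * (H i j x * ptest h x)))"
   by (simp add: sum_distrib_right mult.assoc)
  also have "... = (\<Sum>i\<in>UNIV. v $ i * (LBINT x. H i j x * ptest h x))"
   by (subst Bochner_Integration.integral_sum) (auto intro: iH)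
  also have "... = - (\<Sum>i\<in>UNIV. v $ i * (LBINT x. D i x * ptest ?h' x))" using wD h unfolding wder_def by (simp add: sum_negf)
  also have "(\<Sum>i\<in>UNIV. v $ i * (LBINT x. D i x * ptest ?h' x)) = (LBINT x. (\<Sum>i\<in>UNIV. v $ i * (D i x * ptest ?h' x)))"
   by (subst Bochner_Integration.integral_sum) (auto intro: iD)
  also have "... = (\<integral>x. 0 \<partial>(lborel :: (real ^ 'n) measure))" proof (rule integral_cong_AE)
   obtain K where K: "K \<subseteq> \<Omega>" "!!x. x \<notin> K ==> ptest ?h' x = 0"
    by (rule box_test_support[OF box_test_deriv[OF h, of j]]) blast
   have [measurable]: "(%x. D i x * ptest ?h' x) \<in> borel_measurable lborel" for i using iD by auto
   show "(%x. \<Sum>i\<in>UNIV. v $ i * (D i x * ptest ?h' x)) \<in> borel_measurable lborel" by measurable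
   show "AE x in lborel. (\<Sum>i\<in>UNIV. v $ i * (D i x * ptest ?h' x)) = 0" using S proof eventually_elim
    case (elim x)
    have "(\<Sum>i\<in>UNIV. v $ i * (D i x * ptest ?h' x)) = (\<Sum>i\<in>UNIV. v $ i * D i x) * ptest ?h' x"
     by (simp add: sum_distrib_right mult.assoc)
    moreover have "x \<in> \<Omega> \<or> ptest ?h' x = 0" using K by blast
    ultimately show ?case using elim by auto
   qed
  qed simp
  finally show "(LBINT x. (\<Sum>i\<in>UNIV. v $ i * H i j x) * ptest h x) = (LBINT x. 0 * ptest h x)" by simp
 qed
 have HA: "AE x in lborel. \<forall>j. x \<in> \<Omega> --> (\<Sum>i\<in>UNIV. v $ i * H i j x) = 0"
  unfolding AE_all_countable using HS by blast
 obtain k where k: "v $ k ~= 0" using v(1) by (auto simp: vec_eq_iff)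
 have dz: "AE x\<in>\<Omega> in lborel. det (\<chi> i j. H i j x) = 0" using HA proof eventually_elim
  case (elim x)
  show ?case
  proof
   assume x: "x \<in> \<Omega>"
   let ?A = "(\<chi> i j. H i j x) :: real ^ 'n ^ 'n"
   have s0: "sum (%i. v $ i *s row i ?A) UNIV = 0" using elim x by (simp add: vec_eq_iff row_def)
   have "v $ k * det ?A = det (\<chi> i. if i = k then sum (%i. v $ i *s row i ?A) UNIV else row i ?A)"
    by (rule cramer_lemma_transpose[symmetric])
   also have "... = det (\<chi> i. if i = k then 0 else row i ?A)" unfolding s0 ..
   also have "... = 0" by (rule det_zero_row(1)[of k]) (simp add: row_def vec_eq_iff)
   finally show "det ?A = 0" using k by simp
  qed
 qed
 obtain z where z: "z \<in> \<Omega>" using nonempty by blast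
 obtain r where r: "0 < r" "qcube z r \<subseteq> \<Omega>" using exists_qcube[OF open_dom z] by blast
 obtain c where c: "0 < c" "AE x\<in>qcube z r in lborel. c <= \<sigma> * det (\<chi> i j. H i j x)"
  using det[OF compact_qcube r(2)] by blast
 \<comment> \<open>The determinant would have to be zero and bounded away from zero on the same
   cube, which would therefore be null.\<close>
 have "AE x in lborel. x \<notin> qcube z r" using c(2) dz by eventually_elim (use r(2) c(1) in auto)
 hence "emeasure lborel (qcube z r) = 0" by (subst (asm) AE_iff_measurable[of "qcube z r"]) auto
 moreover have "0 < emeasure lborel (qcube z r)" proof -
  have "box (z - (\<chi> i. r)) (z + (\<chi> i. r)) \<subseteq> qcube z r" unfolding qcube_eq_cbox by (rule box_subset_cbox)
  hence "emeasure lborel (box (z - (\<chi> i. r)) (z + (\<chi> i. r))) <= emeasure lborel (qcube z r)" by (intro emeasure_mono) auto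
  moreover have "0 < measure lborel (box (z - (\<chi> i. r)) (z + (\<chi> i. r)))"
   by (subst measure_cart_box) (use r(1) in \<open>auto intro!: prod_pos\<close>)
  ultimately show ?thesis by (auto simp: measure_def enn2real_positive_iff)
 qed
 ultimately show False by simp
qed

text \<open>In the absence of lines the complement without the origin is still convex, so the hull
  of its compact trace on the sphere misses 0. The pole e is opposite to the normal of the
  separating hyperplane.\<close>

lemma hemisphere_exists: "\<exists>e\<in>sphere 0 1. closed_hemisphere e \<subseteq> \<Omega>" proof -
 let ?C = "- \<Omega> - {0}"
 have cv: "convex ?C" unfolding convex_alt proof (intro ballI allI impI)
  fix x y and a :: real assume xy: "x \<in> ?C" "y \<in> ?C" and a: "0 <= a \<and> a <= 1"
  have xa: "(1 - a) *\<^sub>R x \<notin> \<Omega>" "a *\<^sub>R y \<notin> \<Omega>" by (rule complement_scale; use xy a in simp)+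
  have "(1 - a) *\<^sub>R x + a *\<^sub>R y ~= 0"
  proof
   assume eq: "(1 - a) *\<^sub>R x + a *\<^sub>R y = 0"
   show False proof (cases "a = 0")
    case True
    thus False using eq xy by simp
   next
    case False
    hence "- (a *\<^sub>R y) = (1 - a) *\<^sub>R x" using eq by (simp add: eq_neg_iff_add_eq_0[symmetric])
    thus False using no_line[of "a *\<^sub>R y"] xa False xy by auto
   qed
  qed
  thus "(1 - a) *\<^sub>R x + a *\<^sub>R y \<in> ?C" using complement_add[OF xa] by simp
 qed
 define S where "S = - \<Omega> \<inter> sphere 0 1"
 have "compact S" unfolding S_def using open_dom by (intro closed_Int_compact) auto
 hence cl: "closed (convex hull S)" by (intro compact_imp_closed compact_convex_hull)
 have "convex hull S \<subseteq> ?C" by (rule hull_minimal) (use cv in \<open>auto simp: S_def\<close>)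
 hence "0 \<notin> convex hull S" by blast
 then obtain a b where ab: "a ~= 0" "0 < b" "!!x. x \<in> convex hull S ==> b < a \<bullet> x"
  using separating_hyperplane_closed_0[OF convex_convex_hull cl] by blast
 define e where "e = - (1 / norm a) *\<^sub>R a"
 have e: "e \<in> sphere 0 1" using ab(1) by (simp add: e_def)
 moreover have "closed_hemisphere e \<subseteq> \<Omega>"
 proof
  fix x assume x: "x \<in> closed_hemisphere e"
  show "x \<in> \<Omega>" proof (rule ccontr)
   assume "x \<notin> \<Omega>"
   hence "x \<in> S" using x by (auto simp: S_def closed_hemisphere_def)
   hence "b < a \<bullet> x" by (intro ab(3) hull_inc)
   moreover have "0 <= - (1 / norm a) * (a \<bullet> x)" using x by (simp add: closed_hemisphere_def e_def)
   ultimately show False using ab(1,2) by (simp add: divide_le_0_iff zero_le_divide_iff)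
  qed
 qed
 ultimately show ?thesis by blast
qed

end

section \<open>From the hypotheses of the statement to the locale\<close>

lemma mem_cone_over:
 assumes "S \<subseteq> sphere 0 1"
 shows "x \<in> cone_over S \<longleftrightarrow> x ~= 0 \<and> (1 / norm x) *\<^sub>R x \<in> S"
proof
 assume "x \<in> cone_over S"
 then obtain r \<omega> where r: "r > 0" "\<omega> \<in> S" "x = r *\<^sub>R \<omega>" by (auto simp: cone_over_def)
 moreover have "norm \<omega> = 1" using r assms by auto
 ultimately show "x ~= 0 \<and> (1 / norm x) *\<^sub>R x \<in> S" by auto
next
 assume x: "x ~= 0 \<and> (1 / norm x) *\<^sub>R x \<in> S"
 hence "x = norm x *\<^sub>R ((1 / norm x) *\<^sub>R x)" "norm x > 0" by auto
 thus "x \<in> cone_over S" using x unfolding cone_over_def by blast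
qed

lemma open_cone_over:
 assumes "openin (top_of_set (sphere 0 1)) S"
 shows "open (cone_over S)" proof -
 obtain T where T: "open T" "S = sphere 0 1 \<inter> T" using assms by (auto simp: openin_open)
 have "open (- {0} \<inter> (%x. (1 / norm x) *\<^sub>R x) -` T)"
  by (rule continuous_open_preimage) (auto intro!: continuous_intros simp: T)
 moreover have "cone_over S = - {0} \<inter> (%x. (1 / norm x) *\<^sub>R x) -` T" proof (rule set_eqI)
  fix x
  have "x \<in> cone_over S \<longleftrightarrow> x ~= 0 \<and> (1 / norm x) *\<^sub>R x \<in> S" by (rule mem_cone_over) (use T in auto)
  thus "x \<in> cone_over S \<longleftrightarrow> x \<in> - {0} \<inter> (%x. (1 / norm x) *\<^sub>R x) -` T" by (auto simp: T(2))
 qed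
 ultimately show ?thesis by simp
qed

lemma loc_int_continuous:
 fixes u :: "real ^ 'n::finite => real"
 assumes "open U" "continuous_on U u"
 shows "loc_int U (%x. indicator U x * u x)" unfolding loc_int_def proof (intro conjI allI impI)
 have "(%x. indicator U x *\<^sub>R u x) \<in> Borel"
  by (rule borel_measurable_continuous_on_indicator) (use assms in auto)
 thus "(%x. indicator U x * u x) \<in> Borel" by simp
 fix K assume K: "compact K \<and> K \<subseteq> U"
 hence "integrable lborel (%x. indicator K x *\<^sub>R u x)"
  by (intro borel_integrable_compact continuous_on_subset[OF assms(2)]) auto
 moreover have "(%x. indicator K x *\<^sub>R u x) = (%x. indicator K x * (indicator U x * u x))"
  using K by (auto simp: indicator_def fun_eq_iff)
 ultimately show "integrable lborel (%x. indicator K x * (indicator U x * u x))" by simp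
qed

text \<open>For k <= p the power |f|^k is at most 1 + |f|^p, and compact sets have finite
  measure.\<close>

lemma loc_int_power:
 fixes f g :: "real ^ 'n::finite => real"
 assumes f: "loc_int U f" and g: "g \<in> Lp_loc p U" and ae: "AE x\<in>U in lborel. g x = f x" and k: "real k <= p"
 shows "loc_int U (%x. \<bar>f x\<bar> ^ k)" unfolding loc_int_def proof (intro conjI allI impI)
 have [measurable]: "f \<in> Borel" using f by (simp add: loc_int_def)
 show "(%x. \<bar>f x\<bar> ^ k) \<in> Borel" by measurable
 fix K assume K: "compact K \<and> K \<subseteq> U"
 hence [measurable]: "K \<in> sets borel" by (simp add: compact_imp_closed)
 have gi: "integrable lebesgue (%x. indicator K x *\<^sub>R \<bar>g x\<bar> powr p)"
  using g K by (auto simp: Lp_loc_def set_integrable_def)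
 have m: "(%x. indicator K x * \<bar>f x\<bar> powr p) \<in> borel_measurable lborel" by measurable
 have "AE x in lebesgue. indicator K x *\<^sub>R \<bar>g x\<bar> powr p = indicator K x * \<bar>f x\<bar> powr p"
  unfolding AE_completion_iff using ae by eventually_elim (use K in \<open>auto simp: indicator_def\<close>)
 hence "integrable lebesgue (%x. indicator K x * \<bar>f x\<bar> powr p)"
  by (rule integrable_cong_AE_imp[OF gi measurable_completion[OF m]])
 hence i: "integrable lborel (%x. indicator K x * \<bar>f x\<bar> powr p)" using integrable_completion[OF m] by simp
 have iK: "integrable lborel (indicator K :: _ => real)"
  using K emeasure_bounded_finite[of K] by (intro integrable_real_indicator) (auto simp: compact_imp_bounded)
 show "integrable lborel (%x. indicator K x * \<bar>f x\<bar> ^ k)"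
 proof (rule Bochner_Integration.integrable_bound[OF Bochner_Integration.integrable_add[OF iK i]])
  show "(%x. indicator K x * \<bar>f x\<bar> ^ k) \<in> borel_measurable lborel" by measurable
  show "AE x in lborel. norm (indicator K x * \<bar>f x\<bar> ^ k) <= norm (indicator K x + indicator K x * \<bar>f x\<bar> powr p)"
  proof (rule AE_I2)
   fix x
   have "\<bar>f x\<bar> ^ k <= 1 + \<bar>f x\<bar> powr p" proof (cases "\<bar>f x\<bar> <= 1")
    case True
    hence "\<bar>f x\<bar> ^ k <= 1" by (simp add: power_le_one)
    thus ?thesis using powr_ge_zero[of "\<bar>f x\<bar>" p] by linarith
   next
    case False
    hence "\<bar>f x\<bar> ^ k = \<bar>f x\<bar> powr real k" by (intro powr_realpow[symmetric]) auto
    also have "... <= \<bar>f x\<bar> powr p" using False k by (intro powr_mono) auto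
    finally show ?thesis by linarith
   qed
   thus "norm (indicator K x * \<bar>f x\<bar> ^ k) <= norm (indicator K x + indicator K x * \<bar>f x\<bar> powr p)"
    by (auto simp: indicator_def)
  qed
 qed
qed

theorem theorem1p1:
 fixes \<Sigma> \<Omega> :: "(real ^ 'n) set"
  and u :: "real ^ 'n => real"
  and H :: "real ^ 'n => real ^ 'n ^ 'n"
  and \<alpha> p :: real
 assumes dim: "CARD('n) \<ge> 2"
  and Sigma_domain: "openin (top_of_set (sphere 0 1)) \<Sigma>" "connected \<Sigma>" "\<Sigma> \<noteq> {}"
  and Sigma_boundary: "(top_of_set (sphere 0 1)) frontier_of \<Sigma> \<noteq> {}"
  and Omega: "\<Omega> = cone_over \<Sigma>"
  and alpha: "0 < \<alpha>" "\<alpha> < 1"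
  and u_homogeneous: "homogeneous_on \<Omega> \<alpha> u"
  and p: "p > critical_exponent CARD('n) \<or> CARD('n) \<le> 3 \<and> p = critical_exponent CARD('n)"
  and u_W2p: "u \<in> sobolev_loc 2 p \<Omega>"
  and u_W1inf: "u \<in> sobolev_inf 1 (\<Omega> \<inter> ball 0 2 - cball 0 1)"
  and u_pos: "\<forall>x\<in>\<Omega>. u x > 0"
  and u_boundary: "vanishes_on_boundary \<Omega> u"
  and hessian: "has_weak_hessian \<Omega> u H"
  and det: "locally_strictly_positive \<Omega> (\<lambda>x. det (H x)) \<or>
       locally_strictly_positive \<Omega> (\<lambda>x. - det (H x))"
 shows "convex_cone (- \<Omega>) \<and> (\<exists>e \<in> sphere 0 1. closed_hemisphere e \<subseteq> \<Sigma>)" proof -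
 have S_sub: "\<Sigma> \<subseteq> sphere 0 1" using openin_imp_subset[OF Sigma_domain(1)] .
 have mem: "x \<in> \<Omega> \<longleftrightarrow> x ~= 0 \<and> (1 / norm x) *\<^sub>R x \<in> \<Sigma>" for x unfolding Omega by (rule mem_cone_over[OF S_sub])
 have oO: "open \<Omega>" unfolding Omega by (rule open_cone_over[OF Sigma_domain(1)])
 have cone: "t *\<^sub>R x \<in> \<Omega>" if "x \<in> \<Omega>" "0 < t" for x t using that by (auto simp: mem)
 have ne: "\<Omega> ~= {}" proof -
  obtain \<omega> where w: "\<omega> \<in> \<Sigma>" using Sigma_domain(3) by blast
  hence "norm \<omega> = 1" using S_sub by auto
  hence "\<omega> \<in> \<Omega>" using w by (auto simp: mem)
  thus ?thesis by blast
 qed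
 obtain v where v: "continuous_on (closure \<Omega>) v" "!!x. x \<in> \<Omega> ==> v x = u x" "!!x. x \<in> frontier \<Omega> ==> v x = 0"
  using u_boundary unfolding vanishes_on_boundary_def by blast
 have uc: "continuous_on \<Omega> u" using continuous_on_subset[OF v(1) closure_subset] v(2) by (simp cong: continuous_on_cong)
 \<comment> \<open>Outside \<Omega> nothing is known about \<open>u\<close>; the cutoff makes it
   Borel on the whole space.\<close>
 define u0 where "u0 = (%x. indicator \<Omega> x * u x)"
 have u0: "u0 x = u x" if "x \<in> \<Omega>" for x using that by (simp add: u0_def)
 have u0_int: "loc_int \<Omega> u0" unfolding u0_def by (rule loc_int_continuous[OF oO uc])
 have u0c: "continuous_on \<Omega> u0" using uc u0 by (simp cong: continuous_on_cong)
 have ae_u: "AE x\<in>U in lborel. u x = u0 x" if "U \<subseteq> \<Omega>" for U using u0 that by (intro AE_I2) auto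
 define pe where "pe = max 1 ((CARD('n) - 2) * (CARD('n) - 2 + 1))"
 \<comment> \<open>With d = n - 2 the number d (d + 1) is (n - 1)(n - 2), so \<open>pe\<close> is
   the critical exponent; \<open>dim\<close> makes the subtraction of natural numbers
   harmless.\<close>
 have pe_p: "real pe <= p" proof -
  have "real ((CARD('n) - 2) * (CARD('n) - 2 + 1)) = (real CARD('n) - 1) * (real CARD('n) - 2)" proof -
   have "real (CARD('n) - 2) = real CARD('n) - 2" using dim by (simp add: of_nat_diff)
   thus ?thesis by (simp only: of_nat_mult of_nat_add of_nat_1) (simp add: algebra_simps)
  qed
  hence "real pe = critical_exponent CARD('n)" unfolding pe_def critical_exponent_def by (simp only: of_nat_max of_nat_1)
  thus ?thesis using p by auto
 qed
 have one: "(LBINT x. f x * ptest (h(i := deriv (h i))) x) = - (LBINT x. g' x * ptest h x)"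
  if "has_weak_deriv U [i] u g" "loc_int U g'" "AE x\<in>U in lborel. g x = g' x" "box_test U h" "open U" "U \<subseteq> \<Omega>" "f = u0"
  for U i g g' h f proof -
  have "(LBINT x. u0 x * iter_partial [i] (ptest h) x) = (- 1) ^ length [i] * (LBINT x. g' x * ptest h x)"
   by (rule weak_deriv_lborel[OF that(1) loc_int_subset[OF u0_int that(6)] ae_u[OF that(6)] that(2,3,4,5)])
  moreover have "h j \<in> sm1" for j using that(4) by (simp add: box_test_def)
  ultimately show ?thesis using that(7) by (simp add: iter_partial_1)
 qed
 have "\<exists>D. loc_int \<Omega> D \<and> wder \<Omega> i u0 D" for i proof -
  have "\<exists>g\<in>Lp_loc p \<Omega>. has_weak_deriv \<Omega> [i] u g" using u_W2p unfolding sobolev_loc_def by simp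
  then obtain g where g: "has_weak_deriv \<Omega> [i] u g" by blast
  hence "locally_integrable \<Omega> g" by (simp add: has_weak_deriv_def)
  from borel_rep[OF oO this] obtain D where D: "loc_int \<Omega> D" "AE x\<in>\<Omega> in lborel. g x = D x" by blast
  have "wder \<Omega> i u0 D" unfolding wder_def using one[OF g D _ oO] by blast
  thus ?thesis using D by blast
 qed
 then obtain D where D: "!!i. loc_int \<Omega> (D i)" "!!i. wder \<Omega> i u0 (D i)" by metis
 have two: "(LBINT x. u0 x * ptest ((h(j := deriv (h j)))(i := deriv ((h(j := deriv (h j))) i))) x) = (LBINT x. g' x * ptest h x)"
  if "has_weak_deriv \<Omega> [i, j] u g" "loc_int \<Omega> g'" "AE x\<in>\<Omega> in lborel. g x = g' x" "box_test \<Omega> h"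
  for i j g g' h proof -
  have "(LBINT x. u0 x * iter_partial [i, j] (ptest h) x) = (- 1) ^ length [i, j] * (LBINT x. g' x * ptest h x)"
   by (rule weak_deriv_lborel[OF that(1) u0_int ae_u that(2,3,4) oO]) simp
  moreover have "h k \<in> sm1" for k using that(4) by (simp add: box_test_def)
  ultimately show ?thesis by (simp add: iter_partial_2)
 qed
 \<comment> \<open>The Sobolev class supplies second derivatives with the right integrability, and
   \<open>hessian\<close> supplies the matrix whose determinant is controlled. Uniqueness of weak
   derivatives identifies the two.\<close>
 define is_hessian where "is_hessian = (%i j H'. loc_int \<Omega> H' \<and> loc_int \<Omega> (%x. \<bar>H' x\<bar> ^ pe) \<and> wder \<Omega> j (D i) H' \<and> (AE x\<in>\<Omega> in lborel. H x $ i $ j = H' x))"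
 have ex_hessian: "\<exists>H'. is_hessian i j H'" for i j proof -
  have "\<exists>g\<in>Lp_loc p \<Omega>. has_weak_deriv \<Omega> [i, j] u g" using u_W2p unfolding sobolev_loc_def by simp
  then obtain g where g: "g \<in> Lp_loc p \<Omega>" "has_weak_deriv \<Omega> [i, j] u g" by blast
  hence "locally_integrable \<Omega> g" by (simp add: has_weak_deriv_def)
  from borel_rep[OF oO this] obtain H' where H': "loc_int \<Omega> H'" "AE x\<in>\<Omega> in lborel. g x = H' x" by blast
  have wH: "has_weak_deriv \<Omega> [i, j] u (%x. H x $ i $ j)" using hessian by (simp add: has_weak_hessian_def)
  hence "locally_integrable \<Omega> (%x. H x $ i $ j)" by (simp add: has_weak_deriv_def)
  from borel_rep[OF oO this] obtain Hr where Hr: "loc_int \<Omega> Hr" "AE x\<in>\<Omega> in lborel. H x $ i $ j = Hr x" by blast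
  have "AE x\<in>\<Omega> in lborel. Hr x = H' x" proof (rule fundamental_lemma_eq[OF oO Hr(1) H'(1)])
   fix h assume h: "box_test \<Omega> h"
   show "(LBINT z. Hr z * ptest h z) = (LBINT z. H' z * ptest h z)" using two[OF wH Hr h] two[OF g(2) H' h] by simp
  qed
  hence "AE x\<in>\<Omega> in lborel. H x $ i $ j = H' x" using Hr(2) by eventually_elim auto
  moreover have "wder \<Omega> j (D i) H'" unfolding wder_def proof (intro allI impI)
   fix h assume h: "box_test \<Omega> h"
   have "(LBINT x. u0 x * ptest ((h(j := deriv (h j)))(i := deriv ((h(j := deriv (h j))) i))) x) = - (LBINT x. D i x * ptest (h(j := deriv (h j))) x)"
    using D(2)[of i] box_test_deriv[OF h, of j] unfolding wder_def by blast
   thus "(LBINT x. D i x * ptest (h(j := deriv (h j))) x) = - (LBINT x. H' x * ptest h x)" using two[OF g(2) H' h] by simp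
  qed
  ultimately show ?thesis unfolding is_hessian_def using H'(1) loc_int_power[OF H'(1) g(1) H'(2) pe_p] by blast
 qed
 define H' where "H' = (%i j. SOME K. is_hessian i j K)"
 have "is_hessian i j (H' i j)" for i j unfolding H'_def by (rule someI_ex[OF ex_hessian])
 hence H': "!!i j. loc_int \<Omega> (H' i j)" "!!i j. loc_int \<Omega> (%x. \<bar>H' i j x\<bar> ^ pe)" "!!i j. wder \<Omega> j (D i) (H' i j)"
  "!!i j. AE x\<in>\<Omega> in lborel. H x $ i $ j = H' i j x" unfolding is_hessian_def by blast+
 define A where "A = \<Omega> \<inter> ball 0 2 - cball 0 1"
 have A: "open A" "A \<subseteq> \<Omega>" unfolding A_def using oO by (auto intro!: open_Diff)
 \<comment> \<open>The derivative in the class W^{1,\<infinity>} of the annulus agrees there with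
   \<open>D i\<close>, again by uniqueness, so its bound carries over.\<close>
 have ex_bound: "\<exists>C. AE x in lborel. x \<in> \<Omega> \<and> 1 < norm x \<and> norm x < 2 --> \<bar>D i x\<bar> <= C" for i
 proof -
  have "\<exists>g\<in>Linf A. has_weak_deriv A [i] u g" using u_W1inf unfolding sobolev_inf_def A_def by simp
  then obtain g C where g: "has_weak_deriv A [i] u g" and C: "AE x in lebesgue. x \<in> A --> \<bar>g x\<bar> <= C" unfolding Linf_def by blast
  hence "locally_integrable A g" by (simp add: has_weak_deriv_def)
  from borel_rep[OF A(1) this] obtain D' where D': "loc_int A D'" "AE x\<in>A in lborel. g x = D' x" by blast
  have "AE x\<in>A in lborel. D i x = D' x" proof (rule fundamental_lemma_eq[OF A(1) loc_int_subset[OF D(1) A(2)] D'(1)])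
   fix h assume h: "box_test A h"
   have "(LBINT x. u0 x * ptest (h(i := deriv (h i))) x) = - (LBINT x. D i x * ptest h x)"
    using wder_subset[OF D(2) A(2)] h unfolding wder_def by blast
   thus "(LBINT z. D i z * ptest h z) = (LBINT z. D' z * ptest h z)" using one[OF g D' h A refl] by simp
  qed
  hence "AE x in lborel. x \<in> \<Omega> \<and> 1 < norm x \<and> norm x < 2 --> \<bar>D i x\<bar> <= C"
   using D'(2) C[unfolded AE_completion_iff] by eventually_elim (auto simp: A_def)
  thus ?thesis by blast
 qed
 have "\<forall>i. \<exists>C. AE x in lborel. x \<in> \<Omega> \<and> 1 < norm x \<and> norm x < 2 --> \<bar>D i x\<bar> <= C" using ex_bound by (rule allI)
 from choice[OF this] obtain C where
  C: "!!i. AE x in lborel. x \<in> \<Omega> \<and> 1 < norm x \<and> norm x < 2 --> \<bar>D i x\<bar> <= C i" by blast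
 define L where "L = (\<Sum>i\<in>UNIV. \<bar>C i\<bar>)"
 have CL: "C i <= L" for i unfolding L_def using member_le_sum[of i UNIV "%i. \<bar>C i\<bar>"] by (simp add: abs_le_iff)
 have DL: "AE x in lborel. x \<in> \<Omega> \<and> 1 < norm x \<and> norm x < 2 --> \<bar>D i x\<bar> <= L" for i
  using C[of i] by eventually_elim (auto intro: order_trans[OF _ CL])
 \<comment> \<open>The continuous extension \<open>v\<close> is bounded on the compact part of the
   closure of \<Omega> within norm 2.\<close>
 obtain M where M: "!!x. x \<in> closure \<Omega> \<inter> cball 0 2 ==> \<bar>v x\<bar> <= M" proof -
  have "compact (v ` (closure \<Omega> \<inter> cball 0 2))"
   by (rule compact_continuous_image[OF continuous_on_subset[OF v(1)]]) (auto intro: closed_Int_compact)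
  then obtain M where "\<forall>y\<in>v ` (closure \<Omega> \<inter> cball 0 2). norm y <= M" using compact_imp_bounded bounded_iff by metis
  thus thesis by (intro that[of M]) auto
 qed
 have small: "\<exists>s>0. \<forall>x\<in>\<Omega>. dist x z < s --> u0 x < eps" if z: "z \<notin> \<Omega>" and e: "0 < eps" for z eps
 proof (cases "z \<in> closure \<Omega>")
  case True
  hence "v z = 0" using z oO by (intro v(3)) (auto simp: frontier_def interior_open)
  moreover obtain s where "0 < s" "!!x. x \<in> closure \<Omega> ==> dist x z < s ==> dist (v x) (v z) < eps"
   using v(1) True e unfolding continuous_on_iff by blast
  ultimately show ?thesis using v(2) u0 closure_subset[of \<Omega>] by (intro exI[of _ s]) (force simp: dist_real_def)
 next
  case False
  then obtain s where "0 < s" "ball z s \<subseteq> - closure \<Omega>" using open_contains_ball[of "- closure \<Omega>"] by auto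
  thus ?thesis using closure_subset[of \<Omega>] by (intro exI[of _ s]) (auto simp: subset_iff dist_commute)
 qed
 have HA: "AE x in lborel. \<forall>i j. x \<in> \<Omega> --> H x $ i $ j = H' i j x" unfolding AE_all_countable using H'(4) by blast
 have dets: "\<exists>c>0. AE x\<in>K in lborel. c <= s * det (\<chi> i j. H' i j x)"
  if "locally_strictly_positive \<Omega> (%x. s * det (H x))" "compact K" "K \<subseteq> \<Omega>" for s K proof -
  have "\<exists>c>0. AE x in lebesgue. x \<in> K --> c <= s * det (H x)"
   using that(1)[unfolded locally_strictly_positive_def, rule_format, OF conjI[OF that(2,3)]] by (rule conjunct2)
  then obtain c where c: "0 < c" "AE x\<in>K in lborel. c <= s * det (H x)" unfolding AE_completion_iff by blast
  have "AE x\<in>K in lborel. c <= s * det (\<chi> i j. H' i j x)" using c(2) HA proof eventually_elim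
   case (elim x)
   show ?case
   proof
    assume x: "x \<in> K"
    hence "H x = (\<chi> i j. H' i j x)" using elim that(3) by (auto simp: vec_eq_iff)
    thus "c <= s * det (\<chi> i j. H' i j x)" using elim x by simp
   qed
  qed
  thus ?thesis using c(1) by blast
 qed
 obtain \<sigma> :: real where sg: "\<bar>\<sigma>\<bar> = 1" "locally_strictly_positive \<Omega> (%x. \<sigma> * det (H x))"
 proof (cases "locally_strictly_positive \<Omega> (%x. det (H x))")
  case True
  thus thesis by (intro that[of 1]) auto
 next
  case False
  thus thesis using det by (intro that[of "- 1"]) auto
 qed
 interpret cone_solution \<Omega> u0 D H' \<alpha> "1 / \<alpha>" L M \<sigma> pe
 proof
  show "u0 (t *\<^sub>R x) = t powr \<alpha> * u0 x" if "x \<in> \<Omega>" "0 < t" for x t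
   using u_homogeneous that cone[OF that] by (simp add: u0 homogeneous_on_def)
  show "u0 x <= M" if "x \<in> \<Omega>" "1 < norm x" "norm x < 2" for x
   using M[of x] that v(2) u0 closure_subset[of \<Omega>] by (auto simp: subset_iff abs_le_iff)
  show "0 \<notin> \<Omega>" by (simp add: mem)
  show "0 < u0 x" if "x \<in> \<Omega>" for x using u_pos u0 that by simp
  show "\<exists>c>0. AE x\<in>K in lborel. c <= \<sigma> * det (\<chi> i j. H' i j x)" if "compact K" "K \<subseteq> \<Omega>" for K
   by (rule dets[OF sg(2) that])
 qed (rule oO cone ne alpha refl u0_int u0c small D H' DL sg(1) pe_def | assumption)+
 obtain e where e: "e \<in> sphere 0 1" "closed_hemisphere e \<subseteq> \<Omega>" using hemisphere_exists by blast
 have "closed_hemisphere e \<subseteq> \<Sigma>"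
 proof
  fix x assume "x \<in> closed_hemisphere e"
  hence "x \<in> \<Omega>" "norm x = 1" using e(2) by (auto simp: closed_hemisphere_def)
  thus "x \<in> \<Sigma>" by (simp add: mem)
 qed
 thus ?thesis using complement_convex_cone e(1) by blast
qed

end
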